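(* Let $\theta_0,S\in L^\infty(\mathbb{T}^3)$ and let $\lambda>0$ and $\gamma\in(0,2]$ be fixed. For each $\kappa\ge0$ there exists a unique solution $\theta=\theta^{(\kappa)}(x,t)$ of the damped fractional magnetogeostrophic equation $$\partial_t\theta+u\cdot\nabla\theta+\lambda\mathcal{D}\theta+\kappa\Lambda^{\gamma}\theta=S,\qquad u=\mathcal{M}[\theta],\qquad\theta(x,0)=\theta_0(x)\quad\text{on }\mathbb{T}^3\times(0,\infty),$$ and these solutions satisfy $$\lim_{\kappa\to0}\left(\limsup_{t\to\infty}\frac{\kappa}{t}\int_{0}^{t}\|\nabla\theta^{(\kappa)}(\cdot,s)\|_{L^2}^2\,ds\right)=0.$$
   Context: $\mathbb{T}^3=[-\pi,\pi]^3$ with periodic boundary conditions, $\Lambda=\sqrt{-\Delta}$, $\mathcal{D}=\Lambda+\mathbf{1}$ with $\mathbf 1$ the identity. $S=S(x)$ is time-independent; $\theta_0$, $S$ and solutions have zero spatial mean, and $\theta$ and $u$ are assumed to have zero vertical ($x_3$) mean. The velocity $u=\mathcal{M}[\theta]$ is given by Fourier multipliers, $u_j=(\widehat{\mathcal{M}_j}\hat\theta)^\vee$, $j=1,2,3$, where for $k=(k_1,k_2,k_3)\in\mathbb{Z}^3$ with $k_3\neq0$ $$\widehat{\mathcal{M}}_1(k)=\frac{k_2k_3|k|^2-k_1k_3(k_2^2+\nu|k|^4)}{D(k)},\quad \widehat{\mathcal{M}}_2(k)=\frac{-k_1k_3|k|^2-k_2k_3(k_2^2+\nu|k|^4)}{D(k)},\quad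 \widehat{\mathcal{M}}_3(k)=\frac{(k_1^2+k_2^2)(k_2^2+\nu|k|^4)}{D(k)},$$ $D(k)=|k|^2k_3^2+(k_2^2+\nu|k|^4)^2$, $\nu=1$, and $\widehat{\mathcal{M}}_j(k)=0$ when $k_3=0$.
   Formalization: For γ<2 the integral from 0 is infinite for some bounded θ0 (e.g. sign x3, S=0, γ≤1): the limit is proved for θ0 also in H^{1-max(1,γ)/2}, and for all bounded θ0 with the integral over [a,t], any a>0. Zero vertical mean is asked of θ0 only, since the equation does not preserve it. *)

theory Defs
  imports "HOL-Analysis.Analysis"
begin

text \<open>Functions on the torus are functions on \<open>real^3\<close> of which only the values on the
  period cell matter, up to null sets.\<close>

definition torus3 :: "(real^3) set" where
  "torus3 = cbox (\<chi> i. - pi) (\<chi> i. pi)"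

definition L2_torus :: "(real^3 \<Rightarrow> real) \<Rightarrow> bool" where
  "L2_torus f \<longleftrightarrow> f \<in> borel_measurable (lebesgue_on torus3) \<and>
     integrable (lebesgue_on torus3) (\<lambda>x. (f x)\<^sup>2)"

definition Linf_torus :: "(real^3 \<Rightarrow> real) \<Rightarrow> bool" where
  "Linf_torus f \<longleftrightarrow> f \<in> borel_measurable (lebesgue_on torus3) \<and>
     (\<exists>C. AE x in lebesgue_on torus3. \<bar>f x\<bar> \<le> C)"

definition zero_mean :: "(real^3 \<Rightarrow> real) \<Rightarrow> bool" where
  "zero_mean f \<longleftrightarrow> (LINT x|lebesgue_on torus3. f x) = 0"

text \<open>The vertical mean is a function of \<open>(x\<^sub>1, x\<^sub>2)\<close>; quantifying over all of
  \<open>x\<close> in the period cell is harmless because the condition does not depend on \<open>x\<^sub>3\<close>.\<close>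

definition zero_vertical_mean :: "(real^3 \<Rightarrow> real) \<Rightarrow> bool" where
  "zero_vertical_mean f \<longleftrightarrow> (AE x in lebesgue_on torus3.
     (LINT z|lebesgue_on {-pi..pi}. f (\<chi> i. if i = 3 then z else x $ i)) = 0)"

definition freq :: "int^3 \<Rightarrow> real^3" where
  "freq k = (\<chi> i. real_of_int (k $ i))"

definition fourier_coeff :: "(real^3 \<Rightarrow> real) \<Rightarrow> int^3 \<Rightarrow> complex" where
  "fourier_coeff f k =
     (LINT x|lebesgue_on torus3. complex_of_real (f x) * cis (- (freq k \<bullet> x))) / (2 * pi) ^ 3"

text \<open>The squared homogeneous Sobolev norm \<open>\<parallel>\<Lambda>\<^sup>\<sigma> f\<parallel>\<^sup>2\<close> in \<open>L\<^sup>2\<close>, possibly infinite.\<close>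

definition sobolev_sq :: "real \<Rightarrow> (real^3 \<Rightarrow> real) \<Rightarrow> ennreal" where
  "sobolev_sq \<sigma> f = (\<Sum>\<^sub>\<infinity>k.
     ennreal ((2 * pi) ^ 3 * norm (freq k) powr (2 * \<sigma>) * (cmod (fourier_coeff f k))\<^sup>2))"

text \<open>Weak gradient: integration by parts against the exponentials \<open>exp (- i k \<bullet> x)\<close>,
  whose span is dense in the smooth periodic functions.\<close>

definition has_weak_gradient :: "(real^3 \<Rightarrow> real) \<Rightarrow> (real^3 \<Rightarrow> real^3) \<Rightarrow> bool" where
  "has_weak_gradient f g \<longleftrightarrow> (\<forall>j. L2_torus (\<lambda>x. g x $ j) \<and>
     (\<forall>k. fourier_coeff (\<lambda>x. g x $ j) k = \<i> * complex_of_real (freq k $ j) * fourier_coeff f k))"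

text \<open>The infimum ranges over the versions of the almost everywhere unique weak gradient in
  \<open>L\<^sup>2\<close>; it is \<open>\<infinity>\<close> if there is none.\<close>

definition gradient_L2_sq :: "(real^3 \<Rightarrow> real) \<Rightarrow> ennreal" where
  "gradient_L2_sq f = (INF g \<in> {g. has_weak_gradient f g}.
     \<integral>\<^sup>+ x. ennreal ((norm (g x))\<^sup>2) \<partial>lebesgue_on torus3)"

definition mg_denom :: "real \<Rightarrow> real^3 \<Rightarrow> real" where
  "mg_denom \<nu> k = (norm k)\<^sup>2 * (k $ 3)\<^sup>2 + ((k $ 2)\<^sup>2 + \<nu> * norm k ^ 4)\<^sup>2"

definition mg_symbol :: "real \<Rightarrow> real^3 \<Rightarrow> real^3" where
  "mg_symbol \<nu> k = (if k $ 3 = 0 then 0 else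
     vector [
       (k $ 2 * k $ 3 * (norm k)\<^sup>2 - k $ 1 * k $ 3 * ((k $ 2)\<^sup>2 + \<nu> * norm k ^ 4)) / mg_denom \<nu> k,
       (- (k $ 1 * k $ 3 * (norm k)\<^sup>2) - k $ 2 * k $ 3 * ((k $ 2)\<^sup>2 + \<nu> * norm k ^ 4)) / mg_denom \<nu> k,
       ((k $ 1)\<^sup>2 + (k $ 2)\<^sup>2) * ((k $ 2)\<^sup>2 + \<nu> * norm k ^ 4) / mg_denom \<nu> k])"

text \<open>For \<open>f\<close> in \<open>L\<^sup>2\<close> the series converges absolutely, since the symbol is
  \<open>O(\<bar>k\<bar>\<^sup>-\<^sup>2)\<close>, and its sum is real, since the symbol is even. Here \<open>\<nu> = 1\<close>.\<close>

definition velocity :: "(real^3 \<Rightarrow> real) \<Rightarrow> real^3 \<Rightarrow> real^3" where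
  "velocity f x = (\<chi> j. Re (\<Sum>\<^sub>\<infinity>k.
     complex_of_real (mg_symbol 1 (freq k) $ j) * fourier_coeff f k * cis (freq k \<bullet> x)))"

text \<open>The \<open>k\<close>-th Fourier coefficient of \<open>S - u \<bullet> \<nabla>f - lam (\<Lambda> + 1) f - \<kappa> \<Lambda>\<^sup>\<gamma> f\<close>. As
  \<open>f\<close> need not be weakly differentiable, \<open>u \<bullet> \<nabla>f\<close> is the distribution \<open>div (u f)\<close>;
  \<open>div u = 0\<close> because \<open>k \<bullet> mg_symbol \<nu> k = 0\<close>.\<close>

definition mg_rhs_coeff ::
  "real \<Rightarrow> real \<Rightarrow> real \<Rightarrow> (real^3 \<Rightarrow> real) \<Rightarrow> (real^3 \<Rightarrow> real) \<Rightarrow> int^3 \<Rightarrow> complex" where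
  "mg_rhs_coeff lam \<gamma> \<kappa> S f k =
     fourier_coeff S k
     - (\<Sum>j\<in>UNIV. \<i> * complex_of_real (freq k $ j) * fourier_coeff (\<lambda>x. velocity f x $ j * f x) k)
     - complex_of_real (lam * (norm (freq k) + 1)) * fourier_coeff f k
     - complex_of_real (\<kappa> * norm (freq k) powr \<gamma>) * fourier_coeff f k"

text \<open>Weak solutions in the energy class \<open>C([0,\<infinity>); L\<^sup>2)\<close> and locally
  \<open>L\<^sup>2([0,\<infinity>); H\<^bsup>1/2\<^esup>)\<close>, integrated in time and tested in space against exponentials.\<close>

definition mg_solution ::
  "real \<Rightarrow> real \<Rightarrow> real \<Rightarrow> (real^3 \<Rightarrow> real) \<Rightarrow> (real^3 \<Rightarrow> real) \<Rightarrow> (real \<Rightarrow> real^3 \<Rightarrow> real) \<Rightarrow> bool" where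
  "mg_solution lam \<gamma> \<kappa> S \<theta>0 \<theta> \<longleftrightarrow>
     (\<forall>t\<ge>0. L2_torus (\<theta> t) \<and> zero_mean (\<theta> t)) \<and>
     (\<forall>t\<ge>0. ((\<lambda>s. LINT x|lebesgue_on torus3. (\<theta> s x - \<theta> t x)\<^sup>2) \<longlongrightarrow> 0) (at t within {0..})) \<and>
     (\<forall>T>0. (\<integral>\<^sup>+ s\<in>{0..T}. sobolev_sq (1/2) (\<theta> s) \<partial>lborel) < \<infinity>) \<and>
     (AE x in lebesgue_on torus3. \<theta> 0 x = \<theta>0 x) \<and>
     (\<forall>t\<ge>0. \<forall>k. fourier_coeff (\<theta> t) k =
        fourier_coeff \<theta>0 k + (LINT s:{0..t}|lborel. mg_rhs_coeff lam \<gamma> \<kappa> S (\<theta> s) k))"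

text \<open>The time average \<open>\<kappa>/t \<integral> \<parallel>\<nabla>\<theta>(s)\<parallel>\<^sup>2 ds\<close> over \<open>[a, t]\<close>, in the limit superior
  \<open>t \<rightarrow> \<infinity>\<close>. The integral takes the value \<open>\<infinity>\<close> when it diverges. For
  \<open>a = 0\<close> and \<open>\<kappa> > 0\<close> it does diverge unless the initial datum lies in the Sobolev space of
  order \<open>1 - max 1 \<gamma> / 2\<close>, which bounded data need not do if \<open>\<gamma> < 2\<close>. Moving \<open>a\<close> does not
  change the limit superior as long as the integral is locally finite.\<close>

definition mean_dissipation :: "real \<Rightarrow> real \<Rightarrow> (real \<Rightarrow> real^3 \<Rightarrow> real) \<Rightarrow> ennreal" where
  "mean_dissipation a \<kappa> \<theta> = Limsup at_top (\<lambda>t.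
     ennreal (\<kappa> / t) * (\<integral>\<^sup>+ s\<in>{a..t}. gradient_L2_sq (\<theta> s) \<partial>lborel))"

end

theory Submission
  imports Defs "HOL-Complex_Analysis.Great_Picard"
begin

text \<open>For coefficients \<open>x\<close> of \<open>\<theta>\<close> the advection term is
  \<open>\<i> (\<Sum>l. (k \<bullet> mu (k - l)) x (k - l) x l)\<close>. Since \<open>mu\<close> is even and \<open>j \<bullet> mu j = 0\<close>, its kernel
  is symmetric in \<open>k, l\<close> and bounded by \<open>sqrt (\<bar>k\<bar> \<bar>l\<bar>) \<bar>mu (k - l)\<bar>\<close>, and \<open>\<bar>mu j\<bar>\<close> is
  \<open>O(\<bar>j\<bar>\<^sup>-\<^sup>2)\<close>. Hence it drops out of the \<open>L\<^sup>2\<close> energy balance and is controlled by the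
  \<open>H\<^bsup>1/2\<^esup>\<close> norm, which the damping supplies for every \<open>\<kappa> \<ge> 0\<close>: Galerkin approximations
  converge, and Gronwall's inequality gives uniqueness. Testing with the truncated weights
  \<open>min \<bar>k\<bar> N powr p\<close> produces a commutator of lower order, so the time average of
  \<open>\<parallel>\<nabla>\<theta>\<parallel>\<^sup>2\<close> is bounded independently of \<open>\<kappa>\<close>; multiplied by \<open>\<kappa>\<close> it vanishes in the
  limit.\<close>

section \<open>The multiplier and lattice sums\<close>

text \<open>Square summability of |j|^-2 over the lattice of dimension three is the reason why the
  velocity coefficients are absolutely summable, with a bound given by the energy alone; trilinear
  terms thereby become quadratic ones. The gradient estimate has to start from a finite Sobolev norm
  of positive order, which a bounded datum need not have. The damping repairs this: the H^(1/2) norm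
  is square integrable in time, hence finite at some time before any a > 0, and the estimate starts
  there. For a = 0 the Sobolev condition on the datum gives finiteness on {0..1}; the constant may
  depend on \<kappa>, because division by t removes it, while the linear growth rate comes from lam
  alone. The weights are truncated because the quantity to be absorbed must be known to be finite
  before it is cancelled. The bounds do not depend on the truncation, which Fatou's lemma removes.
  Sums of nonnegative terms are integrals over a counting measure, so that Tonelli, Fatou, dominated
  convergence and Cauchy-Schwarz apply even to possibly infinite quantities.\<close>

abbreviation esum :: "('a \<Rightarrow> ennreal) \<Rightarrow> ennreal" where
  "esum f \<equiv> \<integral>\<^sup>+k. f k \<partial>count_space UNIV"

definition mu :: "int^3 \<Rightarrow> real^3" where
  "mu k = mg_symbol 1 (freq k)"

definition ker :: "int^3 \<Rightarrow> int^3 \<Rightarrow> real" where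
  "ker k l = freq k \<bullet> mu (k - l)"

lemma freq_diff: "freq (k - l) = freq k - freq l"
  and freq_minus: "freq (- k) = - freq k"
  and freq_0 [simp]: "freq 0 = 0"
  by (simp_all add: freq_def vec_eq_iff)

lemma freq_eq_0_iff [simp]: "freq k = 0 \<longleftrightarrow> k = 0"
  by (simp add: freq_def vec_eq_iff)

lemma freq_nth [simp]: "freq k $ i = real_of_int (k $ i)"
  by (simp add: freq_def)

lemma one_le_norm_freq:
  assumes "k \<noteq> 0" shows "1 \<le> norm (freq k)"
proof -
  obtain i where "k $ i \<noteq> 0"
    using assms by (auto simp: vec_eq_iff)
  then have "1 \<le> \<bar>freq k $ i\<bar>"
    by (simp flip: of_int_abs)
  then show ?thesis
    using component_le_norm_cart[of "freq k" i] by linarith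
qed

lemma norm_3_sq: "(norm (x::real^3))\<^sup>2 = (x$1)\<^sup>2 + (x$2)\<^sup>2 + (x$3)\<^sup>2"
  by (simp add: norm_vec_def L2_set_def sum_3 sum_nonneg)

lemma norm_3_le: "norm (x::real^3) \<le> \<bar>x$1\<bar> + \<bar>x$2\<bar> + \<bar>x$3\<bar>"
  using norm_le_l1_cart[of x] by (simp add: sum_3)

lemma mg_symbol_minus: "mg_symbol \<nu> (- x) = mg_symbol \<nu> x"
  by (simp add: mg_symbol_def mg_denom_def)

lemma mg_symbol_div_free: "x \<bullet> mg_symbol \<nu> x = 0"
proof (cases "x $ 3 = 0")
  case True then show ?thesis by (simp add: mg_symbol_def)
next
  case False
  define D where "D = mg_denom \<nu> x"
  define q where "q = (x $ 2)\<^sup>2 + \<nu> * norm x ^ 4"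
  define r where "r = (norm x)\<^sup>2"
  have "x \<bullet> mg_symbol \<nu> x =
     (x$1 * (x$2 * x$3 * r - x$1 * x$3 * q) + x$2 * (- (x$1 * x$3 * r) - x$2 * x$3 * q)
     + x$3 * (((x$1)\<^sup>2 + (x$2)\<^sup>2) * q)) / D"
    using False unfolding D_def q_def r_def
    by (simp add: mg_symbol_def inner_vec_def sum_3 add_divide_distrib)
  also have "\<dots> = 0"
    by (simp add: algebra_simps power2_eq_square)
  finally show ?thesis .
qed

text \<open>The constant 5 counts summands: two in each of the first two components, one in the
  third. With r = |x| >= 1 and q >= r^4 the denominator is at least q^2 >= r^8. A summand with the
  factor r^2 is thus at most r^4 / r^8, one with the factor q at most r^2 / q, and both are at most
  r^-2.\<close>

lemma norm_mg_symbol_le: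
  assumes "1 \<le> norm x"
  shows "norm (mg_symbol 1 x) \<le> 5 / (norm x)\<^sup>2"
proof (cases "x $ 3 = 0")
  case True then show ?thesis by (simp add: mg_symbol_def)
next
  case False
  define r where "r = norm x"
  define q where "q = (x $ 2)\<^sup>2 + r ^ 4"
  define D where "D = mg_denom 1 x"
  have r1: "1 \<le> r" using assms by (simp add: r_def)
  have r4: "0 < r ^ 4" using r1 by simp
  have q: "r ^ 4 \<le> q" by (simp add: q_def)
  have qpos: "0 < q" using q r4 by linarith
  have D: "q\<^sup>2 \<le> D" by (simp add: D_def mg_denom_def q_def r_def)
  have Dpos: "0 < D" using D qpos by (smt (verit) zero_less_power)
  have c: "\<bar>x $ i\<bar> \<le> r" for i using component_le_norm_cart[of x i] by (simp add: r_def)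
  have cc: "\<bar>x $ i * x $ j\<bar> \<le> r\<^sup>2" for i j
    unfolding abs_mult power2_eq_square by (intro mult_mono c) (use r1 in auto)
  have r8: "r ^ 4 * r ^ 4 \<le> D"
    using mult_mono[OF q q] D r4 qpos by (simp add: power2_eq_square)
  have "r ^ 4 * r\<^sup>2 = 1 * r^6" by (simp flip: power_add)
  also have "\<dots> \<le> r^2 * r ^ 6" using r1 by (intro mult_right_mono) auto
  also have "\<dots> = r ^ 4 * r ^ 4" by (simp flip: power_add)
  finally have "r ^ 4 * r\<^sup>2 \<le> D" using r8 by linarith
  then have A: "r ^ 4 / D \<le> 1 / r\<^sup>2"
    using Dpos r1 by (simp add: field_simps)
  have "r\<^sup>2 * q * r\<^sup>2 = r ^ 4 * q" by (simp add: field_simps flip: power_add)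
  also have "\<dots> \<le> q * q" using q qpos by (intro mult_right_mono) auto
  also have "\<dots> \<le> D" using D by (simp add: power2_eq_square)
  finally have B: "r\<^sup>2 * q / D \<le> 1 / r\<^sup>2"
    using Dpos r1 by (simp add: field_simps)
  have t1: "\<bar>x$i * x$j * r\<^sup>2 / D\<bar> \<le> 1 / r\<^sup>2" for i j
  proof -
    have "\<bar>x$i * x$j * r\<^sup>2\<bar> \<le> r\<^sup>2 * r\<^sup>2"
      unfolding abs_mult[of _ "r\<^sup>2"] by (intro mult_mono cc) auto
    then have "\<bar>x$i * x$j * r\<^sup>2 / D\<bar> \<le> r ^ 4 / D"
      unfolding abs_divide using Dpos by (intro frac_le) (auto simp flip: power_add)
    then show ?thesis using A by linarith
  qed
  have t2: "\<bar>x$i * x$j * q / D\<bar> \<le> 1 / r\<^sup>2" for i j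
  proof -
    have "\<bar>x$i * x$j * q\<bar> \<le> r\<^sup>2 * q"
      unfolding abs_mult[of _ "q"] using qpos by (intro mult_mono cc) auto
    then have "\<bar>x$i * x$j * q / D\<bar> \<le> r\<^sup>2 * q / D"
      unfolding abs_divide using Dpos by (intro frac_le) auto
    then show ?thesis using B by linarith
  qed
  have "(x$1)\<^sup>2 + (x$2)\<^sup>2 \<le> r\<^sup>2"
    by (simp add: r_def norm_3_sq)
  then have t3: "((x$1)\<^sup>2 + (x$2)\<^sup>2) * q / D \<le> 1 / r\<^sup>2"
    using Dpos qpos B by (smt (verit) divide_right_mono mult_right_mono)
  have t3': "0 \<le> ((x$1)\<^sup>2 + (x$2)\<^sup>2) * q / D"
    using Dpos qpos by simp
  have M1: "mg_symbol 1 x $ 1 = x$2 * x$3 * r\<^sup>2 / D - x$1 * x$3 * q / D"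
    and M2: "mg_symbol 1 x $ 2 = - (x$1 * x$3 * r\<^sup>2 / D) - x$2 * x$3 * q / D"
    and M3: "mg_symbol 1 x $ 3 = ((x$1)\<^sup>2 + (x$2)\<^sup>2) * q / D"
    using False unfolding q_def D_def r_def by (simp_all add: mg_symbol_def diff_divide_distrib)
  have "norm (mg_symbol 1 x) \<le> \<bar>mg_symbol 1 x $ 1\<bar> + \<bar>mg_symbol 1 x $ 2\<bar> + \<bar>mg_symbol 1 x $ 3\<bar>"
    by (rule norm_3_le)
  also have "\<dots> \<le> 5 * (1 / r\<^sup>2)"
    unfolding M1 M2 M3 using t1[of 2 3] t1[of 1 3] t2[of 1 3] t2[of 2 3] t3 t3' by linarith
  finally show ?thesis by (simp add: r_def)
qed

lemma mu_0 [simp]: "mu 0 = 0"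
  by (simp add: mu_def mg_symbol_def)

lemma mu_minus [simp]: "mu (- k) = mu k"
  by (simp add: mu_def freq_minus mg_symbol_minus)

text \<open>The bound extends to k = 0 because both sides are 0 there: \<open>mu 0 = 0\<close>, and
  division by zero yields 0.\<close>

lemma norm_mu_le: "norm (mu k) \<le> 5 / (norm (freq k))\<^sup>2"
proof (cases "k = 0")
  case False
  then show ?thesis
    unfolding mu_def by (intro norm_mg_symbol_le one_le_norm_freq)
qed simp

lemma norm_mu_le_5: "norm (mu k) \<le> 5"
proof (cases "k = 0")
  case False
  then have "5 / (norm (freq k))\<^sup>2 \<le> 5 / 1"
    using one_le_norm_freq[of k] by (intro frac_le) auto
  then show ?thesis using norm_mu_le[of k] by simp
qed simp

text \<open>Serves to cut the advection series into a finite sum and a tail that is small uniformly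
  over coefficients of bounded energy.\<close>

lemma mu_tail: "\<exists>F. finite F \<and> (\<forall>k. k \<notin> F \<longrightarrow> norm (mu k) \<le> e)" if "e > 0"
proof -
  \<comment> \<open>The summand 1 gives R >= 1, so that |k| > R implies |k|^2 >= R >= 5 / e.\<close>
  define R where "R = 5 / e + 1"
  define F where "F = {k::int^3. \<forall>i. \<bar>k $ i\<bar> \<le> \<lceil>R\<rceil>}"
  have R1: "R \<ge> 1" using that by (simp add: R_def)
  have "finite ((\<lambda>(a,b,c). vector [a,b,c] :: int^3) ` ({-\<lceil>R\<rceil>..\<lceil>R\<rceil>} \<times> {-\<lceil>R\<rceil>..\<lceil>R\<rceil>} \<times> {-\<lceil>R\<rceil>..\<lceil>R\<rceil>}))"
    by (intro finite_imageI finite_cartesian_product) auto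
  moreover have "F \<subseteq> (\<lambda>(a,b,c). vector [a,b,c]) ` ({-\<lceil>R\<rceil>..\<lceil>R\<rceil>} \<times> {-\<lceil>R\<rceil>..\<lceil>R\<rceil>} \<times> {-\<lceil>R\<rceil>..\<lceil>R\<rceil>})"
  proof
    fix k assume k: "k \<in> F"
    have "k = vector [k$1, k$2, k$3]" by (simp add: vec_eq_iff forall_3)
    moreover have "\<bar>k $ i\<bar> \<le> \<lceil>R\<rceil>" for i using k by (simp add: F_def)
    ultimately show "k \<in> (\<lambda>(a,b,c). vector [a,b,c]) ` ({-\<lceil>R\<rceil>..\<lceil>R\<rceil>} \<times> {-\<lceil>R\<rceil>..\<lceil>R\<rceil>} \<times> {-\<lceil>R\<rceil>..\<lceil>R\<rceil>})"
      by (intro image_eqI[of _ _ "(k$1, k$2, k$3)"]) (auto simp: abs_le_iff minus_le_iff)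
  qed
  ultimately have "finite F" using finite_subset by blast
  moreover have "norm (mu k) \<le> e" if "k \<notin> F" for k
  proof -
    have "\<exists>i. \<bar>k $ i\<bar> > \<lceil>R\<rceil>"
      using that unfolding F_def mem_Collect_eq not_all not_le .
    then obtain i where "\<bar>k $ i\<bar> > \<lceil>R\<rceil>" ..
    then have "\<bar>freq k $ i\<bar> > R" unfolding freq_nth by linarith
    then have r: "norm (freq k) > R" using component_le_norm_cart[of "freq k" i] by linarith
    have "R * 1 \<le> norm (freq k) * norm (freq k)"
      using r R1 by (intro mult_mono) auto
    then have "5 / e \<le> (norm (freq k))\<^sup>2"
      by (simp add: power2_eq_square R_def)
    moreover have "0 < norm (freq k)" using r R1 by linarith
    ultimately have "5 / (norm (freq k))\<^sup>2 \<le> e"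
      using \<open>e > 0\<close> by (simp add: field_simps)
    then show ?thesis using norm_mu_le[of k] by linarith
  qed
  ultimately show ?thesis by blast
qed

lemma freq_mu [simp]: "freq k \<bullet> mu k = 0"
  by (simp add: mu_def mg_symbol_div_free)

text \<open>Passage from the conservative form div (u f) to u . grad f: the two kernels differ by (k
  - l) . mu (k - l), which vanishes by incompressibility.\<close>

lemma ker_alt: "ker k l = freq l \<bullet> mu (k - l)"
  using freq_mu[of "k - l"] unfolding freq_diff ker_def by (simp add: inner_diff_left)

lemma ker_sym: "ker k l = ker l k"
  using mu_minus[of "k - l"] unfolding ker_alt[of l k] unfolding ker_def by simp

lemma ker_0 [simp]: "ker 0 l = 0" "ker k 0 = 0"
  by (simp add: ker_def, simp add: ker_alt)

lemma abs_ker_le: "\<bar>ker k l\<bar> \<le> norm (freq k) * norm (mu (k - l))"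
  and abs_ker_le': "\<bar>ker k l\<bar> \<le> norm (freq l) * norm (mu (k - l))"
  using Cauchy_Schwarz_ineq2[of "freq k" "mu (k - l)"] Cauchy_Schwarz_ineq2[of "freq l" "mu (k - l)"]
  by (simp_all add: ker_def flip: ker_alt)

lemma min_le_sqrt_mult:
  assumes "0 \<le> x" "0 \<le> y" shows "min x y \<le> sqrt x * sqrt y"
proof -
  have "min x y = sqrt (min x y) * sqrt (min x y)" using assms by simp
  also have "\<dots> \<le> sqrt x * sqrt y"
    using assms by (intro mult_mono) auto
  finally show ?thesis .
qed

lemma abs_ker_le_sqrt: "\<bar>ker k l\<bar> \<le> sqrt (norm (freq k)) * sqrt (norm (freq l)) * norm (mu (k - l))"
proof -
  have "\<bar>ker k l\<bar> \<le> min (norm (freq k)) (norm (freq l)) * norm (mu (k - l))"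
    using abs_ker_le[of k l] abs_ker_le'[of k l] by (simp add: min_def)
  also have "\<dots> \<le> sqrt (norm (freq k)) * sqrt (norm (freq l)) * norm (mu (k - l))"
    by (intro mult_right_mono min_le_sqrt_mult) auto
  finally show ?thesis .
qed

section \<open>Sums over the integer lattice\<close>

lemma esum_swap:
  fixes f :: "'a::countable \<Rightarrow> 'b::countable \<Rightarrow> ennreal"
  shows "esum (\<lambda>k. esum (\<lambda>l. f k l)) = esum (\<lambda>l. esum (\<lambda>k. f k l))"
  by (rule nn_integral_count_space_nn_integral) auto

lemma esum_shift: "esum (\<lambda>l. f (k - l)) = esum f" for k :: "int^3"
  by (rule nn_integral_bij_count_space) (rule bij_betwI[where g="\<lambda>l. k - l"], auto)

lemma esum_shift': "esum (\<lambda>k. f (k - l)) = esum f" for l :: "int^3"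
  by (rule nn_integral_bij_count_space) (rule bij_betwI[where g="\<lambda>k. k + l"], auto)

text \<open>Young's inequality for l1 * l2 against l2: 2 x y <= x^2 + y^2 decouples the factors, and
  by translation invariance the kernel sums to the same value in either variable. Weights are
  introduced later by scaling x and y.\<close>

lemma esum_convolution_le:
  fixes p x y :: "int^3 \<Rightarrow> real"
  assumes [simp]: "\<And>k. 0 \<le> p k" "\<And>k. 0 \<le> x k" "\<And>k. 0 \<le> y k"
  shows "2 * esum (\<lambda>k. esum (\<lambda>l. ennreal (p (k - l) * x l * y k)))
     \<le> esum (\<lambda>k. ennreal (p k)) * (esum (\<lambda>k. ennreal ((x k)\<^sup>2)) + esum (\<lambda>k. ennreal ((y k)\<^sup>2)))"
proof -
  have "2 * ennreal (p (k - l) * x l * y k)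
      \<le> ennreal (p (k - l)) * ennreal ((x l)\<^sup>2) + ennreal (p (k - l)) * ennreal ((y k)\<^sup>2)" for k l
  proof -
    have "2 * (p (k - l) * x l * y k) \<le> p (k - l) * ((x l)\<^sup>2 + (y k)\<^sup>2)"
      using mult_left_mono[OF sum_squares_bound[of "x l" "y k"], of "p (k - l)"]
      by (simp add: algebra_simps)
    then have "ennreal (2 * (p (k - l) * x l * y k)) \<le> ennreal (p (k - l) * ((x l)\<^sup>2 + (y k)\<^sup>2))"
      by (rule ennreal_leI)
    then show ?thesis
      by (simp add: ennreal_mult ennreal_plus distrib_left)
  qed
  then have "2 * esum (\<lambda>k. esum (\<lambda>l. ennreal (p (k - l) * x l * y k)))
     \<le> esum (\<lambda>k. esum (\<lambda>l. ennreal (p (k - l)) * ennreal ((x l)\<^sup>2) + ennreal (p (k - l)) * ennreal ((y k)\<^sup>2)))"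
    by (simp flip: nn_integral_cmult) (intro nn_integral_mono, auto)
  also have "\<dots> = esum (\<lambda>k. esum (\<lambda>l. ennreal (p (k - l)) * ennreal ((x l)\<^sup>2)))
      + esum (\<lambda>k. esum (\<lambda>l. ennreal (p (k - l)) * ennreal ((y k)\<^sup>2)))"
    by (simp add: nn_integral_add)
  also have "esum (\<lambda>k. esum (\<lambda>l. ennreal (p (k - l)) * ennreal ((x l)\<^sup>2)))
      = esum (\<lambda>l. esum (\<lambda>k. ennreal (p (k - l)) * ennreal ((x l)\<^sup>2)))"
    by (rule esum_swap)
  also have "\<dots> = esum (\<lambda>k. ennreal (p k)) * esum (\<lambda>k. ennreal ((x k)\<^sup>2))"
    by (simp add: nn_integral_multc nn_integral_cmult esum_shift'[of "\<lambda>k. ennreal (p k)"])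
  also have "esum (\<lambda>k. esum (\<lambda>l. ennreal (p (k - l)) * ennreal ((y k)\<^sup>2)))
     = esum (\<lambda>k. ennreal (p k)) * esum (\<lambda>k. ennreal ((y k)\<^sup>2))"
    by (simp add: nn_integral_multc nn_integral_cmult esum_shift[of "\<lambda>k. ennreal (p k)"])
  finally show ?thesis by (simp add: distrib_left)
qed

text \<open>The exponent 7/6 is a third of 7/2 and exceeds 1, so a product of three such sums can be
  compared with the lattice sum. The integers are covered by the numbers n and -n; counting 0 twice
  only enlarges the bound.\<close>

lemma esum_int_powr_finite: "esum (\<lambda>i::int. ennreal ((1 + \<bar>real_of_int i\<bar>) powr (-7/6))) < \<infinity>"
proof -
  define g where "g = (\<lambda>i::int. ennreal ((1 + \<bar>real_of_int i\<bar>) powr (-7/6)))"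
  have "summable (\<lambda>n. real (Suc n) powr (-7/6))"
    by (subst summable_Suc_iff) (simp add: summable_real_powr_iff)
  then have s: "(\<Sum>n. ennreal (real (Suc n) powr (-7/6))) < \<infinity>"
    by (subst suminf_ennreal_eq[OF _ summable_sums]) auto
  have s': "esum (\<lambda>n::nat. ennreal (real (Suc n) powr (-7/6))) < \<infinity>"
    using s by (simp add: nn_integral_count_space_nat)
  have "esum g \<le> esum (\<lambda>i. g i * indicator (range int) i + g i * indicator (range (\<lambda>n. - int n)) i)"
  proof (intro nn_integral_mono)
    fix i :: int
    have "i \<in> range int \<or> i \<in> range (\<lambda>n. - int n)"
      by (cases i rule: int_cases2) auto
    then show "g i \<le> g i * indicator (range int) i + g i * indicator (range (\<lambda>n. - int n)) i"
      by (auto simp: indicator_def)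
  qed
  also have "\<dots> = (\<integral>\<^sup>+i. g i \<partial>count_space (range int)) + (\<integral>\<^sup>+i. g i \<partial>count_space (range (\<lambda>n. - int n)))"
    by (simp add: nn_integral_add nn_integral_count_space_indicator)
  also have "(\<integral>\<^sup>+i. g i \<partial>count_space (range int)) = esum (\<lambda>n. g (int n))"
    by (rule nn_integral_bij_count_space[symmetric]) (auto simp: bij_betw_def inj_def)
  also have "(\<integral>\<^sup>+i. g i \<partial>count_space (range (\<lambda>n. - int n))) = esum (\<lambda>n. g (- int n))"
    by (rule nn_integral_bij_count_space[symmetric]) (auto simp: bij_betw_def inj_def)
  also have "esum (\<lambda>n. g (int n)) = esum (\<lambda>n::nat. ennreal (real (Suc n) powr (-7/6)))"
    by (simp add: g_def)
  also have "esum (\<lambda>n. g (- int n)) = esum (\<lambda>n::nat. ennreal (real (Suc n) powr (-7/6)))"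
    by (simp add: g_def)
  also have "esum (\<lambda>n::nat. ennreal (real (Suc n) powr (-7/6))) + esum (\<lambda>n::nat. ennreal (real (Suc n) powr (-7/6))) < \<infinity>"
    using s' by (simp add: ennreal_add_less_top)
  finally show ?thesis by (simp add: g_def)
qed

text \<open>The exponent \<open>7/2 > 3\<close> makes the sum finite: \<open>\<bar>k\<bar>\<^sup>3\<close> dominates the product of the
  \<open>1 + \<bar>k\<^sub>i\<bar>\<close>, which separates the variables.\<close>

lemma esum_freq_powr_finite: "esum (\<lambda>k. ennreal (norm (freq k) powr (-7/2))) < \<infinity>"
proof -
  define h where "h = (\<lambda>i::int. (1 + \<bar>real_of_int i\<bar>) powr (-7/6))"
  \<comment> \<open>The factor 8 powr (7/6) comes from 1 + |k_i| <= 2 |k| in each of the three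
    coordinates. At k = 0 the left-hand side is 0, since 0 powr a = 0.\<close>
  have le: "norm (freq k) powr (-7/2) \<le> 8 powr (7/6) * (h (k$1) * (h (k$2) * h (k$3)))" for k
  proof (cases "k = 0")
    case False
    define r where "r = norm (freq k)"
    have r: "1 \<le> r" using one_le_norm_freq[OF False] by (simp add: r_def)
    have c: "1 + \<bar>real_of_int (k $ i)\<bar> \<le> 2 * r" for i
      using component_le_norm_cart[of "freq k" i] r by (simp add: r_def)
    have "(1 + \<bar>real_of_int (k$1)\<bar>) * ((1 + \<bar>real_of_int (k$2)\<bar>) * (1 + \<bar>real_of_int (k$3)\<bar>)) \<le> (2*r) * ((2*r) * (2*r))"
      by (intro mult_mono c) (use r in auto)
    then have P: "(1 + \<bar>real_of_int (k$1)\<bar>) * ((1 + \<bar>real_of_int (k$2)\<bar>) * (1 + \<bar>real_of_int (k$3)\<bar>)) / 8 \<le> r ^ 3"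
      by (simp add: power3_eq_cube)
    have "r powr (-7/2) = (r powr 3) powr (-7/6)" by (simp add: powr_powr)
    also have "r powr 3 = r ^ 3" using r by (simp add: powr_numeral)
    also have "(r ^ 3) powr (-7/6) \<le> ((1 + \<bar>real_of_int (k$1)\<bar>) * ((1 + \<bar>real_of_int (k$2)\<bar>) * (1 + \<bar>real_of_int (k$3)\<bar>)) / 8) powr (-7/6)"
      by (rule powr_mono2'[OF _ _ P]) (auto intro!: mult_pos_pos add_pos_nonneg)
    also have "\<dots> = 8 powr (7/6) * (h (k$1) * (h (k$2) * h (k$3)))"
      by (subst powr_divide) (simp_all add: h_def powr_mult powr_minus divide_simps)
    finally show ?thesis by (simp add: r_def)
  qed (simp add: h_def)
  have inj: "bij_betw (\<lambda>(a,b,c). vector [a,b,c] :: int^3) UNIV UNIV"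
    by (rule bij_betwI[where g="\<lambda>k. (k$1, k$2, k$3)"]) (auto simp: vec_eq_iff forall_3)
  have "esum (\<lambda>k. ennreal (norm (freq k) powr (-7/2)))
     \<le> esum (\<lambda>k::int^3. ennreal (8 powr (7/6)) * (ennreal (h (k$1)) * (ennreal (h (k$2)) * ennreal (h (k$3)))))"
    using le by (intro nn_integral_mono) (simp add: h_def flip: ennreal_mult)
  also have "\<dots> = ennreal (8 powr (7/6)) * esum (\<lambda>k::int^3. ennreal (h (k$1)) * (ennreal (h (k$2)) * ennreal (h (k$3))))"
    by (simp add: nn_integral_cmult)
  also have "esum (\<lambda>k::int^3. ennreal (h (k$1)) * (ennreal (h (k$2)) * ennreal (h (k$3))))
      = esum (\<lambda>(a,b,c). ennreal (h a) * (ennreal (h b) * ennreal (h c)))"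
    by (subst nn_integral_bij_count_space[OF inj, symmetric]) (auto intro!: nn_integral_cong)
  also have "\<dots> = esum (\<lambda>a. ennreal (h a) * esum (\<lambda>b. ennreal (h b) * esum (\<lambda>c. ennreal (h c))))"
    by (subst nn_integral_fst_count_space[symmetric]) (simp add: nn_integral_cmult nn_integral_fst_count_space[symmetric])
  also have "\<dots> = esum (\<lambda>a. ennreal (h a)) * (esum (\<lambda>a. ennreal (h a)) * esum (\<lambda>a. ennreal (h a)))"
    by (simp add: nn_integral_multc)
  also have "ennreal (8 powr (7/6)) * \<dots> < \<infinity>"
    using esum_int_powr_finite by (simp add: h_def ennreal_mult_less_top)
  finally show ?thesis .
qed

text \<open>The squared symbol decays like |k|^-4, so the exponent 7/2 leaves a surplus of |k|^-1/2.
  That surplus makes the commutator in the gradient estimate of lower order than the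
  dissipation.\<close>

definition lat :: real where
  "lat = enn2real (esum (\<lambda>k. ennreal (norm (freq k) powr (-7/2))))"

lemma lat_nonneg: "0 \<le> lat" by (simp add: lat_def)

lemma esum_freq_powr: "esum (\<lambda>k. ennreal (norm (freq k) powr (-7/2))) = ennreal lat"
  using esum_freq_powr_finite by (simp add: lat_def less_top)

section \<open>Weighted square sums and the advection term\<close>

text \<open>Squared Sobolev seminorms without the factor (2 pi)^3: the weight 1 gives the L2 norm,
  |k| the norm of order 1/2, |k|^2 the gradient. Values in \<open>ennreal\<close> allow a norm to be
  written down before it is known to be finite.\<close>

definition wsq :: "(int^3 \<Rightarrow> real) \<Rightarrow> (int^3 \<Rightarrow> complex) \<Rightarrow> ennreal" where
  "wsq m c = esum (\<lambda>k. ennreal (m k * (cmod (c k))\<^sup>2))"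

abbreviation energy :: "(int^3 \<Rightarrow> complex) \<Rightarrow> ennreal" where
  "energy \<equiv> wsq (\<lambda>_. 1)"

abbreviation half_energy :: "(int^3 \<Rightarrow> complex) \<Rightarrow> ennreal" where
  "half_energy \<equiv> wsq (\<lambda>k. norm (freq k))"

text \<open>The first argument generates the velocity, the second is transported. They are kept
  apart because the difference of two solutions is advected by one of them and itself advects the
  other. The sum is meaningful for arguments of finite energy; otherwise it may take the default
  value 0.\<close>

definition adv :: "(int^3 \<Rightarrow> complex) \<Rightarrow> (int^3 \<Rightarrow> complex) \<Rightarrow> int^3 \<Rightarrow> complex" where
  "adv \<phi> \<psi> k = (\<Sum>\<^sub>\<infinity>l. \<i> * complex_of_real (ker k l) * \<phi> (k - l) * \<psi> l)"

text \<open>Cubes are symmetric under negation, so partial Fourier sums of real functions over them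
  are real.\<close>

definition cube :: "nat \<Rightarrow> (int^3) set" where
  "cube n = {k. \<forall>i. \<bar>k $ i\<bar> \<le> int n}"

lemma finite_cube [simp]: "finite (cube n)"
proof -
  have "cube n \<subseteq> (\<lambda>(a,b,c). vector [a,b,c]) ` ({-int n..int n} \<times> {-int n..int n} \<times> {-int n..int n})"
  proof
    fix k assume k: "k \<in> cube n"
    have "k = vector [k$1, k$2, k$3]" by (simp add: vec_eq_iff forall_3)
    moreover have "\<bar>k $ i\<bar> \<le> int n" for i using k by (simp add: cube_def)
    ultimately show "k \<in> (\<lambda>(a,b,c). vector [a,b,c]) ` ({-int n..int n} \<times> {-int n..int n} \<times> {-int n..int n})"
      by (intro image_eqI[of _ _ "(k$1, k$2, k$3)"]) (auto simp: abs_le_iff minus_le_iff)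
  qed
  then show ?thesis by (rule finite_subset) auto
qed

lemma cube_minus: "- k \<in> cube n \<longleftrightarrow> k \<in> cube n"
  by (simp add: cube_def)

lemma cube_mono: "m \<le> n \<Longrightarrow> cube m \<subseteq> cube n"
  unfolding cube_def by (intro Collect_mono impI allI) (meson of_nat_mono order_trans)

lemma in_cube_eventually: "\<forall>\<^sub>F n in sequentially. k \<in> cube n"
proof -
  define N where "N = nat (Max (range (\<lambda>i. \<bar>k $ i\<bar>)))"
  have "k \<in> cube n" if "N \<le> n" for n
  proof -
    have "\<bar>k $ i\<bar> \<le> int n" for i
    proof -
      have "\<bar>k $ i\<bar> \<le> Max (range (\<lambda>i. \<bar>k $ i\<bar>))" by (rule Max_ge) auto
      then show ?thesis using that unfolding N_def by linarith
    qed
    then show ?thesis by (simp add: cube_def)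
  qed
  then show ?thesis by (auto simp: eventually_sequentially)
qed

lemma indicator_cube_tendsto: "(\<lambda>n. f k * indicator (cube n) k) \<longlonglongrightarrow> (f k :: ennreal)"
  by (rule tendsto_eventually, rule eventually_mono[OF in_cube_eventually[of k]]) auto

lemma sum_cube_eq: "sum f (cube n) = esum (\<lambda>k. f k * indicator (cube n) k)" for f :: "int^3 \<Rightarrow> ennreal"
  by (simp add: nn_integral_count_space_indicator[symmetric] nn_integral_count_space_finite)

lemma sum_le_esum:
  assumes "finite A" shows "sum f A \<le> esum f"
proof -
  have "sum f A = esum (\<lambda>k. f k * indicator A k)"
    using assms by (simp add: nn_integral_count_space_indicator[symmetric] nn_integral_count_space_finite)
  also have "\<dots> \<le> esum f"
    by (intro nn_integral_mono) (auto simp: indicator_def)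
  finally show ?thesis .
qed

lemma esum_le_iff_cube: "esum f \<le> B \<longleftrightarrow> (\<forall>n. sum f (cube n) \<le> B)"
proof
  assume "esum f \<le> B" then show "\<forall>n. sum f (cube n) \<le> B"
    using sum_le_esum[of "cube _" f] by (meson finite_cube order_trans)
next
  assume *: "\<forall>n. sum f (cube n) \<le> B"
  have "esum (\<lambda>k. f k) = esum (\<lambda>k. liminf (\<lambda>n. f k * indicator (cube n) k))"
    using lim_imp_Liminf[OF _ indicator_cube_tendsto] by (intro nn_integral_cong) simp
  also have "\<dots> \<le> liminf (\<lambda>n. esum (\<lambda>k. f k * indicator (cube n) k))"
    by (rule nn_integral_liminf) auto
  also have "\<dots> = liminf (\<lambda>n. sum f (cube n))"
    by (simp add: sum_cube_eq)
  also have "\<dots> \<le> B"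
    using * by (intro Liminf_le) auto
  finally show "esum f \<le> B" .
qed

text \<open>Translates the infinite sum in \<open>sobolev_sq\<close> into an integral over the
  counting measure.\<close>

lemma esum_eq_infsum: "(\<Sum>\<^sub>\<infinity>k. f k) = esum f" for f :: "int^3 \<Rightarrow> ennreal"
proof -
  have "(\<Sum>\<^sub>\<infinity>k. f k) = (SUP F\<in>{F. finite F \<and> F \<subseteq> UNIV}. sum f F)"
    by (rule nonneg_infsum_complete) auto
  also have "\<dots> = esum f"
  proof (rule antisym)
    show "(SUP F\<in>{F. finite F \<and> F \<subseteq> UNIV}. sum f F) \<le> esum f"
      by (intro SUP_least sum_le_esum) auto
    show "esum f \<le> (SUP F\<in>{F. finite F \<and> F \<subseteq> UNIV}. sum f F)"
      unfolding esum_le_iff_cube by (intro allI SUP_upper) auto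
  qed
  finally show ?thesis .
qed

lemma summable_on_of_esum:
  fixes g :: "'a \<Rightarrow> real"
  assumes "esum (\<lambda>k. ennreal (g k)) < \<infinity>" "\<And>k. 0 \<le> g k"
  shows "g summable_on UNIV" "ennreal (\<Sum>\<^sub>\<infinity>k. g k) = esum (\<lambda>k. ennreal (g k))"
proof -
  have "integrable (count_space UNIV) g"
    using assms by (intro integrableI_nonneg) auto
  then have a: "Infinite_Set_Sum.abs_summable_on g UNIV"
    by (simp add: Infinite_Set_Sum.abs_summable_on_def)
  then have b: "(\<lambda>x. norm (g x)) summable_on UNIV"
    using abs_summable_equivalent by blast
  then show "g summable_on UNIV"
    by (rule abs_summable_summable)
  have "(\<Sum>\<^sub>\<infinity>k. g k) = infsetsum g UNIV"
    using infsetsum_infsum[OF a] by simp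
  also have "\<dots> = integral\<^sup>L (count_space UNIV) g"
    by (simp add: infsetsum_def)
  finally show "ennreal (\<Sum>\<^sub>\<infinity>k. g k) = esum (\<lambda>k. ennreal (g k))"
    using nn_integral_eq_integral[OF \<open>integrable _ _\<close>] assms by simp
qed

lemma abs_summable_of_esum:
  fixes f :: "'a \<Rightarrow> 'b::banach"
  assumes "esum (\<lambda>k. ennreal (norm (f k))) < \<infinity>"
  shows "f summable_on A" "(\<lambda>k. norm (f k)) summable_on A"
proof -
  have "(\<lambda>k. norm (f k)) summable_on UNIV"
    using summable_on_of_esum(1)[OF assms] by simp
  then show "(\<lambda>k. norm (f k)) summable_on A"
    by (rule summable_on_subset_banach) auto
  then show "f summable_on A" by (rule abs_summable_summable)
qed

lemma norm_infsum_le_esum: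
  fixes f :: "'a \<Rightarrow> 'b::banach"
  shows "ennreal (norm (\<Sum>\<^sub>\<infinity>k. f k)) \<le> esum (\<lambda>k. ennreal (norm (f k)))"
proof (cases "esum (\<lambda>k. ennreal (norm (f k))) < \<infinity>")
  case True
  have "norm (\<Sum>\<^sub>\<infinity>k. f k) \<le> (\<Sum>\<^sub>\<infinity>k. norm (f k))"
    by (rule norm_infsum_bound[OF abs_summable_of_esum(2)[OF True]])
  then show ?thesis
    using summable_on_of_esum(2)[OF True] by (metis ennreal_leI norm_ge_zero)
next
  case False
  then have "esum (\<lambda>k. ennreal (norm (f k))) = top"
    by (simp add: not_less top_unique)
  then show ?thesis by simp
qed

text \<open>The cubes eventually contain every finite set of frequencies, hence they are cofinal
  among the finite subsets. Unordered sums become limits of ordinary sequences, as needed for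
  measurability and dominated convergence.\<close>

lemma infsum_cube_tendsto:
  fixes f :: "int^3 \<Rightarrow> 'b::banach"
  assumes "esum (\<lambda>k. ennreal (norm (f k))) < \<infinity>"
  shows "(\<lambda>n. sum f (cube n)) \<longlonglongrightarrow> (\<Sum>\<^sub>\<infinity>k. f k)"
proof -
  have "(f has_sum (\<Sum>\<^sub>\<infinity>k. f k)) UNIV"
    using abs_summable_of_esum(1)[OF assms] by simp
  moreover have "filterlim cube (finite_subsets_at_top UNIV) sequentially"
    unfolding filterlim_finite_subsets_at_top
  proof (intro allI impI)
    fix X :: "(int^3) set" assume "finite X \<and> X \<subseteq> UNIV"
    then have "\<forall>\<^sub>F n in sequentially. \<forall>k\<in>X. k \<in> cube n"
      using in_cube_eventually by (simp add: eventually_ball_finite)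
    then show "\<forall>\<^sub>F n in sequentially. finite (cube n) \<and> X \<subseteq> cube n \<and> cube n \<subseteq> UNIV"
      by eventually_elim auto
  qed
  ultimately show ?thesis
    unfolding has_sum_def by (rule filterlim_compose)
qed

lemma esum_product_le:
  fixes x y :: "int^3 \<Rightarrow> complex"
  shows "2 * esum (\<lambda>l. ennreal (cmod (x (k - l)) * cmod (y l))) \<le> energy x + energy y"
proof -
  have "2 * esum (\<lambda>l. ennreal (cmod (x (k - l)) * cmod (y l)))
      = esum (\<lambda>l. ennreal (2 * cmod (x (k - l)) * cmod (y l)))"
    by (simp add: ennreal_mult mult.assoc flip: nn_integral_cmult)
  also have "\<dots> \<le> esum (\<lambda>l. ennreal ((cmod (x (k - l)))\<^sup>2) + ennreal ((cmod (y l))\<^sup>2))"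
    by (intro nn_integral_mono) (simp add: sum_squares_bound flip: ennreal_plus)
  also have "\<dots> = energy x + energy y"
    using esum_shift[of "\<lambda>l. ennreal ((cmod (x l))\<^sup>2)" k] by (simp add: nn_integral_add wsq_def)
  finally show ?thesis .
qed

text \<open>For fixed k the kernel is bounded by 5 |k|, hence square summability of both factors
  makes the series at k converge absolutely. The half energy enters only when the series is summed
  over k.\<close>

lemma adv_term_finite:
  assumes "energy \<phi> < \<infinity>" "energy \<psi> < \<infinity>"
  shows "esum (\<lambda>l. ennreal (norm (\<i> * complex_of_real (ker k l) * \<phi> (k - l) * \<psi> l))) < \<infinity>"
proof -
  have fin: "esum (\<lambda>l. ennreal (cmod (\<phi> (k - l)) * cmod (\<psi> l))) < \<infinity>"
  proof -
    have "esum (\<lambda>l. ennreal (cmod (\<phi> (k - l)) * cmod (\<psi> l)))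
        \<le> 2 * esum (\<lambda>l. ennreal (cmod (\<phi> (k - l)) * cmod (\<psi> l)))"
      by (simp add: mult_2)
    also have "\<dots> \<le> energy \<phi> + energy \<psi>" by (rule esum_product_le)
    also have "\<dots> < \<infinity>" using assms by simp
    finally show ?thesis .
  qed
  have "esum (\<lambda>l. ennreal (norm (\<i> * complex_of_real (ker k l) * \<phi> (k - l) * \<psi> l)))
     \<le> esum (\<lambda>l. ennreal (norm (freq k) * 5) * ennreal (cmod (\<phi> (k - l)) * cmod (\<psi> l)))"
  proof (intro nn_integral_mono)
    fix l
    have "\<bar>ker k l\<bar> \<le> norm (freq k) * 5"
      by (rule order_trans[OF abs_ker_le]) (intro mult_left_mono norm_mu_le_5, simp)
    then have "\<bar>ker k l\<bar> * (cmod (\<phi> (k - l)) * cmod (\<psi> l)) \<le> norm (freq k) * 5 * (cmod (\<phi> (k - l)) * cmod (\<psi> l))"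
      by (rule mult_right_mono) simp
    then show "ennreal (norm (\<i> * complex_of_real (ker k l) * \<phi> (k - l) * \<psi> l))
        \<le> ennreal (norm (freq k) * 5) * ennreal (cmod (\<phi> (k - l)) * cmod (\<psi> l))"
      by (simp add: norm_mult mult.assoc ennreal_leI flip: ennreal_mult)
  qed
  also have "\<dots> = ennreal (norm (freq k) * 5) * esum (\<lambda>l. ennreal (cmod (\<phi> (k - l)) * cmod (\<psi> l)))"
    by (simp add: nn_integral_cmult)
  also have "\<dots> < \<infinity>" using fin by (simp add: ennreal_mult_less_top)
  finally show ?thesis .
qed

lemma norm_adv_le:
  "ennreal (cmod (adv \<phi> \<psi> k)) \<le> esum (\<lambda>l. ennreal (\<bar>ker k l\<bar> * cmod (\<phi> (k - l)) * cmod (\<psi> l)))"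
  unfolding adv_def by (rule order_trans[OF norm_infsum_le_esum]) (simp add: norm_mult)

lemma adv_0 [simp]: "adv \<phi> \<psi> 0 = 0"
  by (simp add: adv_def)

text \<open>The splitting is chosen for the energy balance of x - y: advection of the difference by
  x drops out, and only the advection of y by the difference has to be estimated.\<close>

lemma adv_diff:
  assumes "energy x < \<infinity>" "energy y < \<infinity>" "energy (\<lambda>k. x k - y k) < \<infinity>"
  shows "adv x x k - adv y y k = adv x (\<lambda>k. x k - y k) k + adv (\<lambda>k. x k - y k) y k"
proof -
  note s = abs_summable_of_esum(1)[OF adv_term_finite, where A=UNIV]
  have "adv x x k = (\<Sum>\<^sub>\<infinity>l. (\<i> * complex_of_real (ker k l) * x (k - l) * (x l - y l)
     + \<i> * complex_of_real (ker k l) * (x (k - l) - y (k - l)) * y l)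
     + \<i> * complex_of_real (ker k l) * y (k - l) * y l)"
    unfolding adv_def by (rule infsum_cong) (simp add: algebra_simps)
  also have "\<dots> = (\<Sum>\<^sub>\<infinity>l. \<i> * complex_of_real (ker k l) * x (k - l) * (x l - y l)
     + \<i> * complex_of_real (ker k l) * (x (k - l) - y (k - l)) * y l)
     + (\<Sum>\<^sub>\<infinity>l. \<i> * complex_of_real (ker k l) * y (k - l) * y l)"
    using assms by (intro infsum_add summable_on_add s) auto
  also have "(\<Sum>\<^sub>\<infinity>l. \<i> * complex_of_real (ker k l) * x (k - l) * (x l - y l)
     + \<i> * complex_of_real (ker k l) * (x (k - l) - y (k - l)) * y l)
     = adv x (\<lambda>k. x k - y k) k + adv (\<lambda>k. x k - y k) y k"
    unfolding adv_def using assms by (intro infsum_add s) auto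
  finally show ?thesis by (simp add: adv_def)
qed

text \<open>The bound is uniform over all c with energy at most B. With F empty and e = 5 it bounds
  the whole advection term.\<close>

lemma adv_tail_le:
  assumes "energy c \<le> ennreal B" "0 \<le> B" "0 \<le> e" "\<And>l. l \<notin> F \<Longrightarrow> norm (mu (k - l)) \<le> e" "finite F"
  shows "cmod (adv c c k - (\<Sum>l\<in>F. \<i> * complex_of_real (ker k l) * c (k - l) * c l)) \<le> norm (freq k) * e * B"
proof -
  define t where "t = (\<lambda>l. \<i> * complex_of_real (ker k l) * c (k - l) * c l)"
  have fin: "energy c < \<infinity>" using assms(1) by (simp add: order_le_less_trans)
  have s: "t summable_on X" for X
    unfolding t_def using abs_summable_of_esum(1)[OF adv_term_finite[OF fin fin]] .
  have "adv c c k = infsum t (F \<union> - F)" by (simp add: adv_def t_def Compl_partition)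
  also have "\<dots> = infsum t F + infsum t (- F)"
    by (intro infsum_Un_disjoint s) auto
  also have "infsum t (- F) = (\<Sum>\<^sub>\<infinity>l. t l * indicator (- F) l)"
    by (rule infsum_cong_neutral) (auto simp: indicator_def)
  finally have eq: "adv c c k - sum t F = (\<Sum>\<^sub>\<infinity>l. t l * indicator (- F) l)"
    using \<open>finite F\<close> by simp
  have "ennreal (cmod (adv c c k - sum t F)) \<le> esum (\<lambda>l. ennreal (norm (t l * indicator (- F) l)))"
    unfolding eq by (rule norm_infsum_le_esum)
  also have "\<dots> \<le> esum (\<lambda>l. ennreal (norm (freq k) * e) * ennreal (cmod (c (k - l)) * cmod (c l)))"
  proof (intro nn_integral_mono)
    fix l
    show "ennreal (norm (t l * indicator (- F) l)) \<le> ennreal (norm (freq k) * e) * ennreal (cmod (c (k - l)) * cmod (c l))"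
    proof (cases "l \<in> F")
      case False
      have "\<bar>ker k l\<bar> \<le> norm (freq k) * e"
        by (rule order_trans[OF abs_ker_le]) (intro mult_left_mono assms False, simp)
      then have "\<bar>ker k l\<bar> * (cmod (c (k - l)) * cmod (c l)) \<le> norm (freq k) * e * (cmod (c (k - l)) * cmod (c l))"
        by (rule mult_right_mono) simp
      then show ?thesis
        using False \<open>0 \<le> e\<close> by (simp add: t_def norm_mult mult.assoc ennreal_leI flip: ennreal_mult)
    qed auto
  qed
  also have "\<dots> = ennreal (norm (freq k) * e) * esum (\<lambda>l. ennreal (cmod (c (k - l)) * cmod (c l)))"
    by (simp add: nn_integral_cmult)
  also have "\<dots> \<le> ennreal (norm (freq k) * e) * ennreal B"
  proof (rule mult_left_mono)
    have "2 * esum (\<lambda>l. ennreal (cmod (c (k - l)) * cmod (c l))) \<le> 2 * ennreal B"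
      using order_trans[OF esum_product_le add_mono[OF assms(1) assms(1)]] by (simp add: mult_2)
    then show "esum (\<lambda>l. ennreal (cmod (c (k - l)) * cmod (c l))) \<le> ennreal B"
      by (simp add: ennreal_mult_le_mult_iff)
  qed auto
  finally show ?thesis
    using \<open>0 \<le> e\<close> \<open>0 \<le> B\<close> by (simp add: t_def ennreal_le_iff flip: ennreal_mult)
qed

text \<open>Because \<open>mu\<close> decays, the advection term is continuous for coefficientwise convergence on
  bounded sets; this replaces strong compactness.\<close>

lemma adv_tendsto:
  fixes c :: "'a \<Rightarrow> int^3 \<Rightarrow> complex"
  assumes lim: "\<And>l. ((\<lambda>x. c x l) \<longlongrightarrow> d l) F"
    and bd: "\<forall>\<^sub>F x in F. energy (c x) \<le> ennreal B" "energy d \<le> ennreal B" "0 \<le> B"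
  shows "((\<lambda>x. adv (c x) (c x) k) \<longlongrightarrow> adv d d k) F"
proof (rule tendstoI)
  fix \<epsilon> :: real assume "\<epsilon> > 0"
  \<comment> \<open>Two tails and the difference of the finite parts each cost at most \<epsilon> /
    4; the summand 1 keeps the denominator positive.\<close>
  define e where "e = \<epsilon> / (4 * (norm (freq k) * B + 1))"
  have p: "norm (freq k) * B + 1 > 0" using \<open>0 \<le> B\<close> by (simp add: add_nonneg_pos)
  then have e: "e > 0" using \<open>\<epsilon> > 0\<close> by (simp add: e_def)
  have eB: "norm (freq k) * e * B \<le> \<epsilon> / 4"
  proof -
    have "norm (freq k) * e * B = e * (norm (freq k) * B)" by simp
    also have "\<dots> \<le> e * (norm (freq k) * B + 1)" using e by (intro mult_left_mono) auto
    also have "\<dots> = \<epsilon> / 4" using p by (simp add: e_def field_simps)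
    finally show ?thesis .
  qed
  obtain G where G: "finite G" "\<And>j. j \<notin> G \<Longrightarrow> norm (mu j) \<le> e"
    using mu_tail[OF e] by blast
  define S where "S = (\<lambda>j. k - j) ` G"
  have S: "finite S" using G by (simp add: S_def)
  have mS: "norm (mu (k - l)) \<le> e" if "l \<notin> S" for l
    by (rule G) (use that in \<open>force simp: S_def\<close>)
  have "((\<lambda>x. \<Sum>l\<in>S. \<i> * complex_of_real (ker k l) * c x (k - l) * c x l)
     \<longlongrightarrow> (\<Sum>l\<in>S. \<i> * complex_of_real (ker k l) * d (k - l) * d l)) F"
    by (intro tendsto_intros lim)
  then have "\<forall>\<^sub>F x in F. dist (\<Sum>l\<in>S. \<i> * complex_of_real (ker k l) * c x (k - l) * c x l)
     (\<Sum>l\<in>S. \<i> * complex_of_real (ker k l) * d (k - l) * d l) < \<epsilon> / 4"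
    using \<open>\<epsilon> > 0\<close> by (auto dest: tendstoD[where e="\<epsilon>/4"])
  with bd(1) show "\<forall>\<^sub>F x in F. dist (adv (c x) (c x) k) (adv d d k) < \<epsilon>"
  proof eventually_elim
    case (elim x)
    have 1: "cmod (adv (c x) (c x) k - (\<Sum>l\<in>S. \<i> * complex_of_real (ker k l) * c x (k - l) * c x l)) \<le> \<epsilon> / 4"
      by (rule order_trans[OF adv_tail_le eB]) (use elim bd e mS S in auto)
    have 2: "cmod (adv d d k - (\<Sum>l\<in>S. \<i> * complex_of_real (ker k l) * d (k - l) * d l)) \<le> \<epsilon> / 4"
      by (rule order_trans[OF adv_tail_le eB]) (use elim bd e mS S in auto)
    show ?case
    proof -
      have tri: "cmod (a - b) \<le> cmod (a - a') + dist a' b' + cmod (b - b')" for a b a' b' :: complex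
        unfolding dist_norm by norm
      show ?thesis
        using tri[of "adv (c x) (c x) k" "adv d d k"
            "\<Sum>l\<in>S. \<i> * complex_of_real (ker k l) * c x (k - l) * c x l"
            "\<Sum>l\<in>S. \<i> * complex_of_real (ker k l) * d (k - l) * d l"] 1 2 elim(2) \<open>\<epsilon> > 0\<close>
        unfolding dist_norm[of "adv (c x) (c x) k"] by linarith
    qed
  qed
qed

lemma Re_of_real_mult: "Re (complex_of_real r * z) = r * Re z"
  by simp

lemma Re_uminus_cnj: "Re (- cnj z) = - Re z"
  by simp

text \<open>Exchanging k and l turns the summand without its weight into minus its conjugate: the
  kernel is symmetric, \<open>\<phi> (l - k)\<close> is conjugate to \<open>\<phi> (k - l)\<close>,
  and the factor i supplies the sign. Averaging the double sum with its transpose therefore replaces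
  m k by (m k - m l) / 2. For a constant weight nothing is left, which is the conservation of
  energy.\<close>

lemma adv_antisymmetric:
  fixes m :: "int^3 \<Rightarrow> real"
  assumes "finite K" and real: "\<And>k. \<phi> (- k) = cnj (\<phi> k)"
  shows "2 * \<bar>Re (\<Sum>k\<in>K. \<Sum>l\<in>K. complex_of_real (m k) * (\<i> * complex_of_real (ker k l) * \<phi> (k - l) * w l) * cnj (w k))\<bar>
    \<le> (\<Sum>k\<in>K. \<Sum>l\<in>K. \<bar>m k - m l\<bar> * (\<bar>ker k l\<bar> * cmod (\<phi> (k - l)) * cmod (w l) * cmod (w k)))"
proof -
  define X where "X = (\<lambda>k l. Re (\<i> * complex_of_real (ker k l) * \<phi> (k - l) * w l * cnj (w k)))"
  have X: "X l k = - X k l" for k l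
  proof -
    have "\<i> * complex_of_real (ker l k) * \<phi> (l - k) * w k * cnj (w l)
       = - cnj (\<i> * complex_of_real (ker k l) * \<phi> (k - l) * w l * cnj (w k))"
      using real[of "k - l"] by (simp add: ker_sym[of l k] mult_ac)
    then show ?thesis unfolding X_def by (simp only: Re_uminus_cnj)
  qed
  have "2 * Re (\<Sum>k\<in>K. \<Sum>l\<in>K. complex_of_real (m k) * (\<i> * complex_of_real (ker k l) * \<phi> (k - l) * w l) * cnj (w k))
     = (\<Sum>k\<in>K. \<Sum>l\<in>K. m k * X k l) + (\<Sum>k\<in>K. \<Sum>l\<in>K. m k * X k l)"
  proof -
    have "Re (complex_of_real (m k) * (\<i> * complex_of_real (ker k l) * \<phi> (k - l) * w l) * cnj (w k)) = m k * X k l" for k l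
      unfolding X_def mult.assoc[of "complex_of_real (m k)"] by (rule Re_of_real_mult)
    then show ?thesis by (simp only: Re_sum mult_2)
  qed
  also have "(\<Sum>k\<in>K. \<Sum>l\<in>K. m k * X k l) + (\<Sum>k\<in>K. \<Sum>l\<in>K. m k * X k l)
     = (\<Sum>k\<in>K. \<Sum>l\<in>K. m k * X k l) + (\<Sum>k\<in>K. \<Sum>l\<in>K. m l * X l k)"
    using sum.swap[of "\<lambda>k l. m k * X k l" K K] by simp
  also have "\<dots> = (\<Sum>k\<in>K. \<Sum>l\<in>K. (m k - m l) * X k l)"
  proof -
    have "m k * X k l + m l * X l k = (m k - m l) * X k l" for k l
      using X[of l k] by (simp add: algebra_simps)
    then show ?thesis by (simp flip: sum.distrib)
  qed
  also have "\<bar>\<dots>\<bar> \<le> (\<Sum>k\<in>K. \<Sum>l\<in>K. \<bar>(m k - m l) * X k l\<bar>)"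
    by (rule order_trans[OF sum_abs]) (intro sum_mono sum_abs)
  also have "\<dots> \<le> (\<Sum>k\<in>K. \<Sum>l\<in>K. \<bar>m k - m l\<bar> * (\<bar>ker k l\<bar> * cmod (\<phi> (k - l)) * cmod (w l) * cmod (w k)))"
  proof (intro sum_mono)
    fix k l
    have "\<bar>X k l\<bar> \<le> cmod (\<i> * complex_of_real (ker k l) * \<phi> (k - l) * w l * cnj (w k))"
      unfolding X_def by (rule abs_Re_le_cmod)
    then have "\<bar>X k l\<bar> \<le> \<bar>ker k l\<bar> * cmod (\<phi> (k - l)) * cmod (w l) * cmod (w k)"
      by (simp add: norm_mult)
    then show "\<bar>(m k - m l) * X k l\<bar> \<le> \<bar>m k - m l\<bar> * (\<bar>ker k l\<bar> * cmod (\<phi> (k - l)) * cmod (w l) * cmod (w k))"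
      by (simp add: abs_mult mult_left_mono)
  qed
  finally show ?thesis by simp
qed

lemma ennreal_le_of_sq_le:
  assumes "x\<^sup>2 \<le> (ennreal r)\<^sup>2" "0 \<le> r" shows "x \<le> ennreal r"
proof (cases x)
  case (real y)
  then have "y\<^sup>2 \<le> r\<^sup>2" using assms by (simp add: ennreal_power ennreal_le_iff)
  then show ?thesis using real assms power2_le_imp_le by (simp add: ennreal_le_iff)
next
  case top
  then show ?thesis using assms by (simp add: ennreal_power power2_eq_square top_unique flip: ennreal_mult)
qed

lemma norm_mu_sq_le: "(norm (mu k))\<^sup>2 \<le> 25 * norm (freq k) powr (-7/2)"
proof (cases "k = 0")
  case False
  define r where "r = norm (freq k)"
  have r: "1 \<le> r" using one_le_norm_freq[OF False] by (simp add: r_def)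
  have "(norm (mu k))\<^sup>2 \<le> (5 / r\<^sup>2)\<^sup>2"
    using norm_mu_le[of k] by (intro power_mono) (auto simp: r_def)
  also have "\<dots> = 25 * r powr (-4)"
    using r by (simp add: power_divide powr_minus powr_numeral field_simps flip: power_mult)
  also have "\<dots> \<le> 25 * r powr (-7/2)"
    using r by (intro mult_left_mono powr_mono) auto
  finally show ?thesis by (simp add: r_def)
qed simp

text \<open>Cauchy-Schwarz against the square summable symbol. The sum on the left dominates the sup
  norm of the velocity, so a square integrable function generates a bounded velocity.\<close>

lemma velocity_l1_bound:
  "(esum (\<lambda>k. ennreal (norm (mu k) * cmod (\<phi> k))))\<^sup>2 \<le> ennreal (25 * lat) * energy \<phi>"
proof -
  have "(esum (\<lambda>k. ennreal (norm (mu k) * cmod (\<phi> k))))\<^sup>2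
     = (esum (\<lambda>k. ennreal (norm (mu k)) * ennreal (cmod (\<phi> k))))\<^sup>2"
    by (simp add: ennreal_mult)
  also have "\<dots> \<le> esum (\<lambda>k. (ennreal (norm (mu k)))\<^sup>2) * esum (\<lambda>k. (ennreal (cmod (\<phi> k)))\<^sup>2)"
    by (rule Cauchy_Schwarz_nn_integral) auto
  also have "esum (\<lambda>k. (ennreal (cmod (\<phi> k)))\<^sup>2) = energy \<phi>"
    by (simp add: wsq_def ennreal_power)
  also have "esum (\<lambda>k. (ennreal (norm (mu k)))\<^sup>2) \<le> esum (\<lambda>k. 25 * ennreal (norm (freq k) powr (-7/2)))"
  proof (intro nn_integral_mono)
    fix k
    have "ennreal ((norm (mu k))\<^sup>2) \<le> ennreal (25 * norm (freq k) powr (-7/2))"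
      by (intro ennreal_leI norm_mu_sq_le)
    then show "(ennreal (norm (mu k)))\<^sup>2 \<le> 25 * ennreal (norm (freq k) powr (-7/2))"
      by (simp add: ennreal_power ennreal_mult)
  qed
  also have "\<dots> = ennreal (25 * lat)"
    using lat_nonneg esum_freq_powr by (simp add: nn_integral_cmult ennreal_mult)
  finally show ?thesis by (simp add: mult_right_mono)
qed

lemma velocity_l1_bound_real:
  assumes "energy \<phi> \<le> ennreal (M\<^sup>2)" "0 \<le> M"
  shows "esum (\<lambda>k. ennreal (norm (mu k) * cmod (\<phi> k))) \<le> ennreal (5 * sqrt lat * M)"
proof -
  have "(esum (\<lambda>k. ennreal (norm (mu k) * cmod (\<phi> k))))\<^sup>2 \<le> ennreal (25 * lat) * ennreal (M\<^sup>2)"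
    using order_trans[OF velocity_l1_bound mult_left_mono[OF assms(1)]] by simp
  also have "\<dots> = (ennreal (5 * sqrt lat * M))\<^sup>2"
    using lat_nonneg \<open>0 \<le> M\<close> by (simp add: ennreal_power power_mult_distrib flip: ennreal_mult)
  finally show ?thesis using lat_nonneg \<open>0 \<le> M\<close> by (intro ennreal_le_of_sq_le) auto
qed

text \<open>The kernel bound hands half a derivative to each of the last two factors, while
  \<open>\<phi>\<close> enters only through the absolutely summable velocity coefficients. The
  parameter \<epsilon> distributes the cost between the two half energies; in the uniqueness proof
  it is tuned to what the damping can absorb.\<close>

lemma trilinear_bound:
  assumes "esum (\<lambda>k. ennreal (norm (mu k) * cmod (\<phi> k))) \<le> ennreal P" "0 < \<epsilon>"
  shows "2 * esum (\<lambda>k. esum (\<lambda>l. ennreal (\<bar>ker k l\<bar> * cmod (\<phi> (k - l)) * cmod (\<psi> l) * cmod (\<eta> k))))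
    \<le> ennreal P * (ennreal \<epsilon> * half_energy \<psi> + ennreal (1 / \<epsilon>) * half_energy \<eta>)"
proof -
  define p where "p = (\<lambda>k. norm (mu k) * cmod (\<phi> k))"
  define x where "x = (\<lambda>k. sqrt \<epsilon> * sqrt (norm (freq k)) * cmod (\<psi> k))"
  define y where "y = (\<lambda>k. sqrt (1/\<epsilon>) * sqrt (norm (freq k)) * cmod (\<eta> k))"
  have ss: "sqrt \<epsilon> * sqrt (1/\<epsilon>) = 1" using \<open>0 < \<epsilon>\<close> by (simp add: real_sqrt_divide)
  have "\<bar>ker k l\<bar> * cmod (\<phi> (k - l)) * cmod (\<psi> l) * cmod (\<eta> k) \<le> p (k - l) * x l * y k" for k l
  proof -
    have "\<bar>ker k l\<bar> * (cmod (\<phi> (k - l)) * cmod (\<psi> l) * cmod (\<eta> k))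
       \<le> sqrt (norm (freq k)) * sqrt (norm (freq l)) * norm (mu (k - l)) * (cmod (\<phi> (k - l)) * cmod (\<psi> l) * cmod (\<eta> k))"
      by (rule mult_right_mono[OF abs_ker_le_sqrt]) auto
    also have "\<dots> = (sqrt \<epsilon> * sqrt (1/\<epsilon>)) * (sqrt (norm (freq k)) * sqrt (norm (freq l)) * norm (mu (k - l)) * (cmod (\<phi> (k - l)) * cmod (\<psi> l) * cmod (\<eta> k)))"
      unfolding ss by simp
    also have "\<dots> = p (k - l) * x l * y k"
      unfolding p_def x_def y_def by (simp only: mult_ac)
    finally show ?thesis by (simp add: mult.assoc)
  qed
  then have "2 * esum (\<lambda>k. esum (\<lambda>l. ennreal (\<bar>ker k l\<bar> * cmod (\<phi> (k - l)) * cmod (\<psi> l) * cmod (\<eta> k))))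
     \<le> 2 * esum (\<lambda>k. esum (\<lambda>l. ennreal (p (k - l) * x l * y k)))"
    by (intro mult_left_mono nn_integral_mono ennreal_leI) auto
  also have "\<dots> \<le> esum (\<lambda>k. ennreal (p k)) * (esum (\<lambda>k. ennreal ((x k)\<^sup>2)) + esum (\<lambda>k. ennreal ((y k)\<^sup>2)))"
    using \<open>0 < \<epsilon>\<close> by (intro esum_convolution_le) (auto simp: p_def x_def y_def)
  also have "esum (\<lambda>k. ennreal ((x k)\<^sup>2)) = ennreal \<epsilon> * half_energy \<psi>"
    using \<open>0 < \<epsilon>\<close> by (simp add: x_def wsq_def power_mult_distrib mult.assoc ennreal_mult nn_integral_cmult)
  also have "esum (\<lambda>k. ennreal ((y k)\<^sup>2)) = ennreal (1 / \<epsilon>) * half_energy \<eta>"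
    using \<open>0 < \<epsilon>\<close> by (simp add: y_def wsq_def power_mult_distrib power_divide real_sqrt_divide mult.assoc ennreal_mult nn_integral_cmult divide_inverse)
  also have "esum (\<lambda>k. ennreal (p k)) * (ennreal \<epsilon> * half_energy \<psi> + ennreal (1 / \<epsilon>) * half_energy \<eta>)
     \<le> ennreal P * (ennreal \<epsilon> * half_energy \<psi> + ennreal (1 / \<epsilon>) * half_energy \<eta>)"
    using assms(1) by (intro mult_right_mono) (auto simp: p_def)
  finally show ?thesis .
qed

section \<open>Fourier series on the torus\<close>

abbreviation torus_measure :: "(real^3) measure" where
  "torus_measure \<equiv> lebesgue_on torus3"

lemma torus3_lmeasurable [simp]: "torus3 \<in> lmeasurable"
  and torus3_sets [simp]: "torus3 \<in> sets lebesgue"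
  by (simp_all add: torus3_def)

lemma finite_measure_torus: "finite_measure torus_measure"
  by (simp add: finite_measure_lebesgue_on)

lemma inner_vec_Basis:
  assumes "b \<in> (Basis :: (real^3) set)" shows "(\<chi> i. c) \<bullet> b = c"
  using assms by (auto simp: Basis_vec_def inner_axis)

lemma freq_inner_Basis:
  assumes "b \<in> (Basis :: (real^3) set)" shows "freq k \<bullet> b \<in> \<int>"
  using assms by (auto simp: Basis_vec_def inner_axis)

lemma mem_torus3_Basis: "x \<in> torus3 \<longleftrightarrow> (\<forall>b\<in>Basis. x \<bullet> b \<in> {-pi..pi})"
  by (simp add: torus3_def mem_box inner_vec_Basis)

lemma mem_torus3: "x \<in> torus3 \<longleftrightarrow> (\<forall>i. \<bar>x $ i\<bar> \<le> pi)"
  by (auto simp: torus3_def mem_box_cart abs_le_iff minus_le_iff)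

section \<open>Orthogonality of the exponentials on the period cell\<close>

lemma cis_sum: "finite A \<Longrightarrow> cis (\<Sum>i\<in>A. f i) = (\<Prod>i\<in>A. cis (f i))"
  by (induction rule: finite_induct) (auto simp: cis_mult[symmetric])

lemma integral_cis_interval:
  assumes "c \<in> \<int>"
  shows "(\<integral>t. indicator {-pi..pi} t *\<^sub>R cis (c * t) \<partial>lborel) = (if c = 0 then complex_of_real (2 * pi) else 0)"
proof (cases "c = 0")
  case True
  have "(\<integral>t. indicator {-pi..pi} t *\<^sub>R (1::complex) \<partial>lborel) = complex_of_real (2 * pi)"
    by (subst integral_FTC_Icc[where F="\<lambda>t. complex_of_real t"])
       (auto intro!: derivative_eq_intros simp: has_vector_derivative_of_real)
  then show ?thesis using True by simp
next
  case False
  obtain n :: int where n: "c = of_int n" using assms by (auto elim: Ints_cases)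
  have "(\<integral>t. indicator {-pi..pi} t *\<^sub>R cis (c * t) \<partial>lborel)
     = cis (c * pi) / (\<i> * c) - cis (c * (-pi)) / (\<i> * c)"
  proof (rule integral_FTC_Icc)
    fix t :: real
    have "((\<lambda>t. cis (c * t)) has_vector_derivative (c *\<^sub>R (\<i> * cis (c * t)))) (at t within {-pi..pi})"
      unfolding has_vector_derivative_complex_iff by (auto intro!: derivative_eq_intros simp: has_real_derivative_iff_has_vector_derivative[symmetric])
    then have "((\<lambda>t. cis (c * t) / (\<i> * c)) has_vector_derivative (c *\<^sub>R (\<i> * cis (c * t))) / (\<i> * c)) (at t within {-pi..pi})"
      by (rule has_vector_derivative_divide)
    then show "((\<lambda>t. cis (c * t) / (\<i> * c)) has_vector_derivative cis (c * t)) (at t within {-pi..pi})"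
      using False by (simp add: scaleR_conv_of_real)
  qed (auto intro!: continuous_intros)
  also have "cis (c * pi) = cis (c * (-pi))"
    by (simp add: n complex_eq_iff sin_integer_2pi cos_integer_2pi mult.commute)
  finally show ?thesis using False by simp
qed

lemma continuous_torus_measurable:
  fixes f :: "real^3 \<Rightarrow> 'b::euclidean_space"
  assumes "continuous_on UNIV f" shows "f \<in> borel_measurable torus_measure"
  using borel_measurable_continuous_onI[OF assms]
  by (intro measurable_restrict_space1 measurable_completion) simp

lemma continuous_on_cis_inner [continuous_intros]: "continuous_on A (\<lambda>x. cis (freq k \<bullet> x))"
  by (intro continuous_intros)

text \<open>The integrand times the indicator of the cell factorises over \<open>Basis\<close>, and
  \<open>lborel\<close> is the image of a product measure, so the integral is a product of
  one-dimensional ones. A nonzero k has a nonzero integer component, whose factor vanishes.\<close>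

lemma integral_torus_cis:
  "(LINT x|torus_measure. cis (freq k \<bullet> x)) = (if k = 0 then complex_of_real ((2 * pi) ^ 3) else 0)"
proof -
  interpret product_sigma_finite "\<lambda>b::real^3. lborel :: real measure"
    by standard
  define g where "g = (\<lambda>b t. indicator {-pi..pi} t *\<^sub>R cis ((freq k \<bullet> b) * t))"
  have int: "integrable lborel (g b)" for b
  proof -
    have "integrable lborel (\<lambda>t. indicator {-pi..pi} t *\<^sub>R cis ((freq k \<bullet> b) * t))"
      by (rule borel_integrable_compact) (auto intro!: continuous_intros)
    then show ?thesis by (simp add: g_def)
  qed
  have prod: "indicator torus3 x *\<^sub>R cis (freq k \<bullet> x) = (\<Prod>b\<in>Basis. g b (x \<bullet> b))" for x
  proof (cases "x \<in> torus3")
    case True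
    have "cis (freq k \<bullet> x) = cis (\<Sum>b\<in>Basis. (freq k \<bullet> b) * (x \<bullet> b))"
      by (subst euclidean_inner) simp
    also have "\<dots> = (\<Prod>b\<in>Basis. cis ((freq k \<bullet> b) * (x \<bullet> b)))"
      by (simp add: cis_sum)
    also have "\<dots> = (\<Prod>b\<in>Basis. g b (x \<bullet> b))"
      using True by (intro prod.cong) (auto simp: g_def mem_torus3_Basis)
    finally show ?thesis using True by simp
  next
    case False
    then obtain b where "b \<in> Basis" "x \<bullet> b \<notin> {-pi..pi}" by (auto simp: mem_torus3_Basis)
    then have "(\<Prod>b\<in>Basis. g b (x \<bullet> b)) = 0"
      by (intro prod_zero) (auto simp: g_def intro!: bexI[of _ b])
    then show ?thesis using False by simp
  qed
  have [measurable]: "torus3 \<in> sets borel" by (simp add: torus3_def)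
  have m: "(\<lambda>x. indicator torus3 x *\<^sub>R cis (freq k \<bullet> x)) \<in> borel_measurable lborel"
    using borel_measurable_continuous_onI[OF continuous_on_cis_inner[of UNIV k]] by measurable
  have "(LINT x|torus_measure. cis (freq k \<bullet> x)) = (LINT x|lebesgue. indicator torus3 x *\<^sub>R cis (freq k \<bullet> x))"
    by (rule integral_restrict_space) simp
  also have "\<dots> = (LINT x|lborel. indicator torus3 x *\<^sub>R cis (freq k \<bullet> x))"
    by (rule integral_completion[OF m])
  also have "\<dots> = (LINT x|lborel. (\<Prod>b\<in>Basis. g b (x \<bullet> b)))"
    by (simp add: prod)
  also have "\<dots> = (\<integral>y. (\<Prod>b\<in>Basis. g b ((\<Sum>c\<in>Basis. y c *\<^sub>R c) \<bullet> b)) \<partial>(\<Pi>\<^sub>M b\<in>Basis. lborel))"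
    by (subst lborel_eq, rule integral_distr) (use m in \<open>simp_all add: prod\<close>)
  also have "\<dots> = (\<integral>y. (\<Prod>b\<in>Basis. g b (y b)) \<partial>(\<Pi>\<^sub>M b\<in>(Basis :: (real^3) set). lborel))"
    by (intro Bochner_Integration.integral_cong prod.cong refl) simp
  also have "\<dots> = (\<Prod>b\<in>Basis. integral\<^sup>L lborel (g b))"
    by (rule product_integral_prod) (auto intro: int)
  also have "\<dots> = (\<Prod>b\<in>(Basis::(real^3) set). if freq k \<bullet> b = 0 then complex_of_real (2 * pi) else 0)"
    unfolding g_def by (intro prod.cong refl integral_cis_interval freq_inner_Basis)
  also have "\<dots> = (if k = 0 then complex_of_real ((2 * pi) ^ 3) else 0)"
  proof (cases "k = 0")
    case False
    then obtain b where "b \<in> Basis" "freq k \<bullet> b \<noteq> 0"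
      using euclidean_all_zero_iff[of "freq k"] by auto
    then show ?thesis using False by (intro trans[OF prod_zero]) auto
  qed simp
  finally show ?thesis .
qed

section \<open>Square integrable functions and their Fourier coefficients\<close>

lemma L2_torus_sq_integrable: "L2_torus f \<Longrightarrow> integrable torus_measure (\<lambda>x. (f x)\<^sup>2)"
  and L2_torus_measurable: "L2_torus f \<Longrightarrow> f \<in> borel_measurable torus_measure"
  by (simp_all add: L2_torus_def)

lemma abs_mult_le_squares: "\<bar>a * b\<bar> \<le> a\<^sup>2 + (b::real)\<^sup>2"
proof -
  have "0 \<le> \<bar>a\<bar> * \<bar>b\<bar>" by simp
  with sum_squares_bound[of "\<bar>a\<bar>" "\<bar>b\<bar>"] show ?thesis
    unfolding abs_mult power2_abs by linarith
qed

lemma L2_torus_mult_integrable: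
  assumes "L2_torus f" "L2_torus g" shows "integrable torus_measure (\<lambda>x. f x * g x)"
proof (rule Bochner_Integration.integrable_bound)
  show "integrable torus_measure (\<lambda>x. (f x)\<^sup>2 + (g x)\<^sup>2)"
    using assms by (simp add: L2_torus_def)
  show "(\<lambda>x. f x * g x) \<in> borel_measurable torus_measure"
    using assms by (auto simp: L2_torus_def)
  have "norm (f x * g x) \<le> norm ((f x)\<^sup>2 + (g x)\<^sup>2)" for x
    using abs_mult_le_squares[of "f x" "g x"] by simp
  then show "AE x in torus_measure. norm (f x * g x) \<le> norm ((f x)\<^sup>2 + (g x)\<^sup>2)" by simp
qed

lemma L2_torus_diff:
  assumes "L2_torus f" "L2_torus g" shows "L2_torus (\<lambda>x. f x - g x)"
  using assms L2_torus_mult_integrable[OF assms]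
  by (auto simp: L2_torus_def power2_diff mult.assoc)

lemma Linf_torus_imp_L2:
  assumes "Linf_torus f" shows "L2_torus f"
proof -
  interpret finite_measure torus_measure by (rule finite_measure_torus)
  obtain C where m: "f \<in> borel_measurable torus_measure" and C: "AE x in torus_measure. \<bar>f x\<bar> \<le> C"
    using assms by (auto simp: Linf_torus_def)
  have "integrable torus_measure (\<lambda>x. (f x)\<^sup>2)"
  proof (rule integrable_const_bound[where B="C\<^sup>2"])
    show "AE x in torus_measure. norm ((f x)\<^sup>2) \<le> C\<^sup>2"
      using C by eventually_elim (metis abs_ge_zero norm_power power2_abs power_mono real_norm_def)
  qed (use m in simp)
  with m show ?thesis by (simp add: L2_torus_def)
qed

lemma L2_torus_integrable:
  assumes "L2_torus f" shows "integrable torus_measure f"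
proof -
  interpret finite_measure torus_measure by (rule finite_measure_torus)
  have "L2_torus (\<lambda>_. 1)" by (simp add: L2_torus_def)
  from L2_torus_mult_integrable[OF assms this] show ?thesis by simp
qed

lemma integrable_mult_cis:
  fixes g :: "real^3 \<Rightarrow> complex"
  assumes "integrable torus_measure g" shows "integrable torus_measure (\<lambda>x. g x * cis (freq k \<bullet> x))"
proof (rule Bochner_Integration.integrable_bound[OF assms])
  show "(\<lambda>x. g x * cis (freq k \<bullet> x)) \<in> borel_measurable torus_measure"
    by (rule borel_measurable_times[OF borel_measurable_integrable[OF assms] continuous_torus_measurable[OF continuous_on_cis_inner]])
qed (simp add: norm_mult)

lemma integrable_mult_cis_minus:
  fixes g :: "real^3 \<Rightarrow> complex"
  assumes "integrable torus_measure g" shows "integrable torus_measure (\<lambda>x. g x * cis (- (freq k \<bullet> x)))"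
  using integrable_mult_cis[OF assms, of "-k"] by (simp add: freq_minus)

lemma integrable_cis: "integrable torus_measure (\<lambda>x. cis (freq k \<bullet> x))"
  using integrable_mult_cis[of "\<lambda>_. 1" k] finite_measure.integrable_const[OF finite_measure_torus, of "1::complex"] by simp

lemma fourier_coeff_mult:
  "(LINT x|torus_measure. complex_of_real (f x) * cis (- (freq k \<bullet> x))) = complex_of_real ((2 * pi) ^ 3) * fourier_coeff f k"
  by (simp add: fourier_coeff_def)

lemma fourier_coeff_minus: "fourier_coeff f (- k) = cnj (fourier_coeff f k)"
  unfolding fourier_coeff_def
  by (simp add: freq_minus cis_cnj Bochner_Integration.integral_cnj[symmetric] del: Bochner_Integration.integral_cnj)

lemma fourier_coeff_diff:
  assumes "integrable torus_measure f" "integrable torus_measure g"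
  shows "fourier_coeff (\<lambda>x. f x - g x) k = fourier_coeff f k - fourier_coeff g k"
  unfolding fourier_coeff_def using assms
  by (simp add: left_diff_distrib diff_divide_distrib integrable_mult_cis_minus Bochner_Integration.integral_diff)

lemma fourier_coeff_0: "fourier_coeff f 0 = complex_of_real (LINT x|torus_measure. f x) / (2 * pi) ^ 3"
  by (simp add: fourier_coeff_def)

text \<open>Both Bessel's inequality and the mean square convergence in the Riesz--Fischer theorem are
  read off this identity.\<close>

lemma integral_diff_trig_sq:
  assumes f: "L2_torus f" and A: "finite A"
    and p: "\<And>x. complex_of_real (p x) = (\<Sum>k\<in>A. c k * cis (freq k \<bullet> x))"
  shows "complex_of_real (LINT x|torus_measure. (f x - p x)\<^sup>2)
     = complex_of_real (LINT x|torus_measure. (f x)\<^sup>2)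
       + complex_of_real ((2*pi)^3) * (\<Sum>k\<in>A. c k * cnj (c k) - cnj (c k) * fourier_coeff f k - c k * cnj (fourier_coeff f k))"
proof -
  define P where "P = (2*pi)^3"
  \<comment> \<open>A real p equals its conjugate; writing p^2 as p times conj p produces
    exponentials of frequency k - l, to which orthogonality applies.\<close>
  have p': "complex_of_real (p x) = (\<Sum>k\<in>A. cnj (c k) * cis (- (freq k \<bullet> x)))" for x
  proof -
    have "complex_of_real (p x) = cnj (complex_of_real (p x))" by simp
    also have "\<dots> = (\<Sum>k\<in>A. cnj (c k) * cis (- (freq k \<bullet> x)))" unfolding p by (simp add: cis_cnj)
    finally show ?thesis .
  qed
  have sq: "complex_of_real ((f x - p x)\<^sup>2) = complex_of_real ((f x)\<^sup>2)
     - (\<Sum>k\<in>A. cnj (c k) * (complex_of_real (f x) * cis (- (freq k \<bullet> x))))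
     - (\<Sum>k\<in>A. c k * (complex_of_real (f x) * cis (freq k \<bullet> x)))
     + (\<Sum>k\<in>A. \<Sum>l\<in>A. c k * cnj (c l) * cis (freq (k - l) \<bullet> x))" for x
  proof -
    have "complex_of_real ((f x - p x)\<^sup>2) = complex_of_real ((f x)\<^sup>2) - complex_of_real (f x) * complex_of_real (p x)
       - complex_of_real (f x) * complex_of_real (p x) + complex_of_real (p x) * complex_of_real (p x)"
      by (simp add: power2_eq_square algebra_simps)
    also have "complex_of_real (p x) * complex_of_real (p x)
       = (\<Sum>k\<in>A. c k * cis (freq k \<bullet> x)) * (\<Sum>k\<in>A. cnj (c k) * cis (- (freq k \<bullet> x)))"
      using p p' by simp
    also have "\<dots> = (\<Sum>k\<in>A. \<Sum>l\<in>A. c k * cnj (c l) * cis (freq (k - l) \<bullet> x))"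
      unfolding sum_product
      by (intro sum.cong refl) (simp add: freq_diff inner_diff_left cis_mult[symmetric] cis_divide[symmetric] field_simps flip: cis_inverse)
    also have "complex_of_real ((f x)\<^sup>2) - complex_of_real (f x) * complex_of_real (p x) - complex_of_real (f x) * complex_of_real (p x)
      = complex_of_real ((f x)\<^sup>2)
     - (\<Sum>k\<in>A. cnj (c k) * (complex_of_real (f x) * cis (- (freq k \<bullet> x))))
     - (\<Sum>k\<in>A. c k * (complex_of_real (f x) * cis (freq k \<bullet> x)))"
      by (subst p', subst p) (simp add: sum_distrib_left mult_ac)
    finally show ?thesis .
  qed
  have fi: "integrable torus_measure (\<lambda>x. complex_of_real (f x))"
    using L2_torus_integrable[OF f] by simp
  have f2: "integrable torus_measure (\<lambda>x. complex_of_real ((f x)\<^sup>2))"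
    using L2_torus_sq_integrable[OF f] by (rule integrable_of_real)
  have i1: "integrable torus_measure (\<lambda>x. \<Sum>k\<in>A. cnj (c k) * (complex_of_real (f x) * cis (- (freq k \<bullet> x))))"
    by (intro Bochner_Integration.integrable_sum integrable_mult_right integrable_mult_cis_minus fi)
  have i2: "integrable torus_measure (\<lambda>x. \<Sum>k\<in>A. c k * (complex_of_real (f x) * cis (freq k \<bullet> x)))"
    by (intro Bochner_Integration.integrable_sum integrable_mult_right integrable_mult_cis fi)
  have i3: "integrable torus_measure (\<lambda>x. \<Sum>k\<in>A. \<Sum>l\<in>A. c k * cnj (c l) * cis (freq (k - l) \<bullet> x))"
    by (intro Bochner_Integration.integrable_sum integrable_mult_right integrable_cis)
  have v1: "(LINT x|torus_measure. complex_of_real (f x) * cis (- (freq k \<bullet> x))) = complex_of_real P * fourier_coeff f k" for k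
    unfolding P_def by (rule fourier_coeff_mult)
  have v2: "(LINT x|torus_measure. complex_of_real (f x) * cis (freq k \<bullet> x)) = complex_of_real P * cnj (fourier_coeff f k)" for k
    using v1[of "-k"] by (simp add: freq_minus fourier_coeff_minus)
  have j1: "(LINT x|torus_measure. (\<Sum>k\<in>A. cnj (c k) * (complex_of_real (f x) * cis (- (freq k \<bullet> x)))))
      = (\<Sum>k\<in>A. cnj (c k) * (complex_of_real P * fourier_coeff f k))"
    by (subst Bochner_Integration.integral_sum)
       (auto intro!: integrable_mult_right integrable_mult_cis_minus fi simp: v1)
  have j2: "(LINT x|torus_measure. (\<Sum>k\<in>A. c k * (complex_of_real (f x) * cis (freq k \<bullet> x))))
      = (\<Sum>k\<in>A. c k * (complex_of_real P * cnj (fourier_coeff f k)))"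
    by (subst Bochner_Integration.integral_sum)
       (auto intro!: integrable_mult_right integrable_mult_cis fi simp: v2)
  have j3: "(LINT x|torus_measure. (\<Sum>k\<in>A. \<Sum>l\<in>A. c k * cnj (c l) * cis (freq (k - l) \<bullet> x)))
      = (\<Sum>k\<in>A. \<Sum>l\<in>A. c k * cnj (c l) * (if k = l then complex_of_real P else 0))"
    unfolding P_def by (simp add: Bochner_Integration.integral_sum integrable_cis integral_torus_cis)
  have "complex_of_real (LINT x|torus_measure. (f x - p x)\<^sup>2) = (LINT x|torus_measure. complex_of_real ((f x - p x)\<^sup>2))"
    by (rule integral_complex_of_real[symmetric])
  also have "\<dots> = (LINT x|torus_measure. complex_of_real ((f x)\<^sup>2))
     - (\<Sum>k\<in>A. cnj (c k) * (complex_of_real P * fourier_coeff f k))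
     - (\<Sum>k\<in>A. c k * (complex_of_real P * cnj (fourier_coeff f k)))
     + (\<Sum>k\<in>A. \<Sum>l\<in>A. c k * cnj (c l) * (if k = l then complex_of_real P else 0))"
    unfolding sq
    by (simp only: Bochner_Integration.integral_add[OF Bochner_Integration.integrable_diff[OF Bochner_Integration.integrable_diff[OF f2 i1] i2] i3]
        Bochner_Integration.integral_diff[OF Bochner_Integration.integrable_diff[OF f2 i1] i2]
        Bochner_Integration.integral_diff[OF f2 i1])
      (simp only: j1 j2 j3)
  also have "(LINT x|torus_measure. complex_of_real ((f x)\<^sup>2)) = complex_of_real (LINT x|torus_measure. (f x)\<^sup>2)"
    by (rule integral_complex_of_real)
  also have "(\<Sum>k\<in>A. \<Sum>l\<in>A. c k * cnj (c l) * (if k = l then complex_of_real P else 0)) = (\<Sum>k\<in>A. c k * cnj (c k) * complex_of_real P)"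
    using A by (simp add: if_distrib sum.delta cong: if_cong)
  finally show ?thesis
    unfolding P_def[symmetric] by (simp add: sum_distrib_left sum_subtractf sum.distrib algebra_simps)
qed

text \<open>On a finite measure space a Cauchy sequence in mean square is Cauchy in mean, so a
  subsequence converges almost everywhere. Fatou's lemma along that subsequence shows that its limit
  is also the limit in mean square of the full sequence.\<close>

lemma L2_complete:
  fixes s :: "nat \<Rightarrow> 'a \<Rightarrow> real"
  assumes "finite_measure M" and m: "\<And>n. s n \<in> borel_measurable M"
    and sq: "\<And>n. integrable M (\<lambda>x. (s n x)\<^sup>2)"
    and cauchy: "\<And>e. e > 0 \<Longrightarrow> \<exists>N. \<forall>i\<ge>N. \<forall>j\<ge>N. (LINT x|M. (s i x - s j x)\<^sup>2) \<le> e"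
  obtains f where "f \<in> borel_measurable M" "integrable M (\<lambda>x. (f x)\<^sup>2)"
    "(\<lambda>n. LINT x|M. (f x - s n x)\<^sup>2) \<longlonglongrightarrow> 0"
proof -
  interpret finite_measure M by fact
  have prod: "integrable M (\<lambda>x. u x * v x)"
    if "u \<in> borel_measurable M" "v \<in> borel_measurable M" "integrable M (\<lambda>x. (u x)\<^sup>2)" "integrable M (\<lambda>x. (v x)\<^sup>2)" for u v :: "'a \<Rightarrow> real"
  proof (rule Bochner_Integration.integrable_bound[where f="\<lambda>x. (u x)\<^sup>2 + (v x)\<^sup>2"])
    have "norm (u x * v x) \<le> norm ((u x)\<^sup>2 + (v x)\<^sup>2)" for x
      using abs_mult_le_squares[of "u x" "v x"] by simp
    then show "AE x in M. norm (u x * v x) \<le> norm ((u x)\<^sup>2 + (v x)\<^sup>2)" by simp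
  qed (use that in auto)
  have diff: "integrable M (\<lambda>x. (u x - v x)\<^sup>2)"
    if "u \<in> borel_measurable M" "v \<in> borel_measurable M" "integrable M (\<lambda>x. (u x)\<^sup>2)" "integrable M (\<lambda>x. (v x)\<^sup>2)" for u v :: "'a \<Rightarrow> real"
    unfolding power2_diff using that prod[OF that] by (auto simp: mult.assoc)
  have s1: "integrable M (s n)" for n
    using prod[OF m[of n] borel_measurable_const sq[of n], of 1] by simp
  have L1: "\<exists>N. \<forall>i\<ge>N. \<forall>j\<ge>N. LINT x|M. norm (s i x - s j x) < e" if "e > 0" for e
  proof -
    define c where "c = measure M (space M)"
    \<comment> \<open>For v = s i - s j the pointwise bound |v| <= d / 2 + v^2 / (2 d) is integrated
      over total mass c; the two parts are then at most e / 2 and e / 4.\<close>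
    define d where "d = e / (c + 1)"
    have c: "0 \<le> c" by (simp add: c_def)
    have d: "0 < d" using that c by (simp add: d_def)
    obtain N where N: "\<And>i j. i \<ge> N \<Longrightarrow> j \<ge> N \<Longrightarrow> (LINT x|M. (s i x - s j x)\<^sup>2) \<le> e * d / 2"
      using cauchy[of "e * d / 2"] \<open>e > 0\<close> d by (meson divide_pos_pos mult_pos_pos zero_less_numeral)
    have "(LINT x|M. norm (s i x - s j x)) < e" if ij: "i \<ge> N" "j \<ge> N" for i j
    proof -
      have sqi: "integrable M (\<lambda>x. (s i x - s j x)\<^sup>2)" by (intro diff m sq)
      have "(LINT x|M. norm (s i x - s j x)) \<le> (LINT x|M. d / 2 + (s i x - s j x)\<^sup>2 / (2 * d))"
      proof (rule integral_mono)
        fix x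
        have "0 \<le> (d - \<bar>s i x - s j x\<bar>)\<^sup>2" by simp
        then have "2 * d * \<bar>s i x - s j x\<bar> \<le> d\<^sup>2 + (s i x - s j x)\<^sup>2" by (simp add: power2_diff)
        then show "norm (s i x - s j x) \<le> d / 2 + (s i x - s j x)\<^sup>2 / (2 * d)"
          using d by (simp add: field_simps power2_eq_square)
      qed (use s1 sqi in auto)
      also have "\<dots> = c * d / 2 + (LINT x|M. (s i x - s j x)\<^sup>2) / (2 * d)"
        using sqi by (simp add: c_def)
      also have "\<dots> \<le> c * d / 2 + (e * d / 2) / (2 * d)"
        using N[OF ij] d by (intro add_left_mono divide_right_mono) auto
      also have "\<dots> = c * d / 2 + e / 4" using d by simp
      also have "c * d \<le> e" using c \<open>e > 0\<close> by (simp add: d_def field_simps)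
      finally show ?thesis using \<open>e > 0\<close> by simp
    qed
    then show ?thesis by blast
  qed
  obtain r where r: "strict_mono r" and AEr: "AE x in M. Cauchy (\<lambda>i. s (r i) x)"
    using cauchy_L1_AE_cauchy_subseq[OF s1 L1] by blast
  define f where "f = (\<lambda>x. lim (\<lambda>i. s (r i) x))"
  have fm: "f \<in> borel_measurable M"
    unfolding f_def using m by measurable
  have conv: "AE x in M. (\<lambda>i. s (r i) x) \<longlonglongrightarrow> f x"
    using AEr by eventually_elim (auto simp: f_def Cauchy_convergent_iff convergent_LIMSEQ_iff)
  have fatou: "(\<integral>\<^sup>+x. ennreal ((f x - s n x)\<^sup>2) \<partial>M) \<le> ennreal e"
    if "e > 0" and N: "\<forall>i\<ge>N. \<forall>j\<ge>N. (LINT x|M. (s i x - s j x)\<^sup>2) \<le> e" and n: "n \<ge> N" for e N n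
  proof -
    have "(\<integral>\<^sup>+x. ennreal ((f x - s n x)\<^sup>2) \<partial>M) \<le> (\<integral>\<^sup>+x. liminf (\<lambda>i. ennreal ((s (r i) x - s n x)\<^sup>2)) \<partial>M)"
    proof (rule nn_integral_mono_AE)
      show "AE x in M. ennreal ((f x - s n x)\<^sup>2) \<le> liminf (\<lambda>i. ennreal ((s (r i) x - s n x)\<^sup>2))"
        using conv
      proof eventually_elim
        case (elim x)
        have "(\<lambda>i. ennreal ((s (r i) x - s n x)\<^sup>2)) \<longlonglongrightarrow> ennreal ((f x - s n x)\<^sup>2)"
          by (intro tendsto_intros elim)
        then show ?case by (intro eq_refl lim_imp_Liminf[symmetric]) auto
      qed
    qed
    also have "\<dots> \<le> liminf (\<lambda>i. \<integral>\<^sup>+x. ennreal ((s (r i) x - s n x)\<^sup>2) \<partial>M)"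
      using m by (intro nn_integral_liminf) measurable
    also have "\<dots> \<le> ennreal e"
    proof (rule Liminf_le)
      show "\<forall>\<^sub>F i in sequentially. (\<integral>\<^sup>+x. ennreal ((s (r i) x - s n x)\<^sup>2) \<partial>M) \<le> ennreal e"
        unfolding eventually_sequentially
      proof (intro exI[of _ N] allI impI)
        fix i assume "N \<le> i"
        then have ri: "N \<le> r i" using seq_suble[OF r, of i] by simp
        have "(\<integral>\<^sup>+x. ennreal ((s (r i) x - s n x)\<^sup>2) \<partial>M) = ennreal (LINT x|M. (s (r i) x - s n x)\<^sup>2)"
          by (intro nn_integral_eq_integral diff m sq) auto
        also have "\<dots> \<le> ennreal e" using N ri n by (intro ennreal_leI) auto
        finally show "(\<integral>\<^sup>+x. ennreal ((s (r i) x - s n x)\<^sup>2) \<partial>M) \<le> ennreal e" .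
      qed
    qed auto
    finally show ?thesis .
  qed
  obtain N1 where N1: "\<forall>i\<ge>N1. \<forall>j\<ge>N1. (LINT x|M. (s i x - s j x)\<^sup>2) \<le> 1"
    using cauchy[of 1] by auto
  have "integrable M (\<lambda>x. (f x - s N1 x)\<^sup>2)"
  proof (rule integrableI_nonneg)
    show "(\<integral>\<^sup>+x. ennreal ((f x - s N1 x)\<^sup>2) \<partial>M) < \<infinity>"
      using fatou[OF _ N1 order_refl] by (simp add: order_le_less_trans)
  qed (use fm m in measurable)
  then have "integrable M (\<lambda>x. ((f x - s N1 x) - (- s N1 x))\<^sup>2)"
    using diff[of "\<lambda>x. f x - s N1 x" "\<lambda>x. - s N1 x"] fm m sq by simp
  then have fsq: "integrable M (\<lambda>x. (f x)\<^sup>2)" by simp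
  have "(\<lambda>n. LINT x|M. (f x - s n x)\<^sup>2) \<longlonglongrightarrow> 0"
  proof (rule LIMSEQ_I)
    fix e :: real assume "e > 0"
    then obtain N where N: "\<forall>i\<ge>N. \<forall>j\<ge>N. (LINT x|M. (s i x - s j x)\<^sup>2) \<le> e / 2"
      using cauchy[of "e/2"] by auto
    have "norm ((LINT x|M. (f x - s n x)\<^sup>2) - 0) < e" if "n \<ge> N" for n
    proof -
      have "ennreal (LINT x|M. (f x - s n x)\<^sup>2) = (\<integral>\<^sup>+x. ennreal ((f x - s n x)\<^sup>2) \<partial>M)"
        by (intro nn_integral_eq_integral[symmetric] diff m sq fm fsq) auto
      also have "\<dots> \<le> ennreal (e / 2)" using fatou[OF _ N that] \<open>e > 0\<close> by simp
      finally have "(LINT x|M. (f x - s n x)\<^sup>2) \<le> e / 2" using \<open>e > 0\<close> by (simp add: ennreal_le_iff)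
      moreover have "0 \<le> (LINT x|M. (f x - s n x)\<^sup>2)" by simp
      ultimately show ?thesis using \<open>e > 0\<close> by simp
    qed
    then show "\<exists>N. \<forall>n\<ge>N. norm ((LINT x|M. (f x - s n x)\<^sup>2) - 0) < e" by blast
  qed
  with fm fsq that show ?thesis by blast
qed

lemma esum_cube_tendsto: "(\<lambda>n. sum g (cube n)) \<longlonglongrightarrow> esum g" for g :: "int^3 \<Rightarrow> ennreal"
proof -
  have "incseq (\<lambda>n. sum g (cube n))"
    by (intro incseq_SucI sum_mono2 cube_mono) auto
  then have "(\<lambda>n. sum g (cube n)) \<longlonglongrightarrow> (SUP n. sum g (cube n))"
    by (rule LIMSEQ_SUP)
  also have "(SUP n. sum g (cube n)) = esum g"
  proof (rule antisym)
    show "(SUP n. sum g (cube n)) \<le> esum g" by (intro SUP_least sum_le_esum) simp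
    show "esum g \<le> (SUP n. sum g (cube n))" unfolding esum_le_iff_cube by (intro allI SUP_upper) simp
  qed
  finally show ?thesis .
qed

lemma Re_trig_sum:
  assumes "\<And>k. c (- k) = cnj (c k)" "\<And>k. k \<in> A \<Longrightarrow> - k \<in> A"
  shows "complex_of_real (Re (\<Sum>k\<in>A. c k * cis (freq k \<bullet> x))) = (\<Sum>k\<in>A. c k * cis (freq k \<bullet> x))"
proof -
  have "(\<Sum>k\<in>A. c k * cis (freq k \<bullet> x)) = (\<Sum>k\<in>A. c (- k) * cis (freq (- k) \<bullet> x))"
    by (rule sum.reindex_bij_witness[where i=uminus and j=uminus]) (use assms in auto)
  also have "\<dots> = cnj (\<Sum>k\<in>A. c k * cis (freq k \<bullet> x))"
    by (simp add: assms freq_minus cis_cnj)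
  finally have "Im (\<Sum>k\<in>A. c k * cis (freq k \<bullet> x)) = - Im (\<Sum>k\<in>A. c k * cis (freq k \<bullet> x))"
    by (metis cnj.sel(2))
  then show ?thesis by (intro complex_eqI) simp_all
qed

lemma L2_torus_trig:
  assumes p: "\<And>x. complex_of_real (p x) = (\<Sum>k\<in>A. c k * cis (freq k \<bullet> x))"
  shows "L2_torus p"
proof (rule Linf_torus_imp_L2, unfold Linf_torus_def, intro conjI exI)
  have "p = (\<lambda>x. Re (\<Sum>k\<in>A. c k * cis (freq k \<bullet> x)))"
    unfolding p[symmetric] by simp
  moreover have "continuous_on UNIV (\<lambda>x. Re (\<Sum>k\<in>A. c k * cis (freq k \<bullet> x)))"
    by (intro continuous_intros)
  ultimately show "p \<in> borel_measurable torus_measure"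
    using continuous_torus_measurable by simp
  have "\<bar>p x\<bar> \<le> (\<Sum>k\<in>A. cmod (c k))" for x
  proof -
    have "\<bar>p x\<bar> = cmod (complex_of_real (p x))" by simp
    also have "\<dots> \<le> (\<Sum>k\<in>A. cmod (c k))" unfolding p by (rule sum_norm_le) (simp add: norm_mult)
    finally show ?thesis .
  qed
  then show "AE x in torus_measure. \<bar>p x\<bar> \<le> (\<Sum>k\<in>A. cmod (c k))" by simp
qed

text \<open>Completing the square separates the defect in Bessel's inequality from the error in the
  coefficients.\<close>

lemma integral_diff_trig_sq_real:
  assumes "L2_torus f" "finite A"
    and p: "\<And>x. complex_of_real (p x) = (\<Sum>k\<in>A. c k * cis (freq k \<bullet> x))"
  shows "(LINT x|torus_measure. (f x - p x)\<^sup>2)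
     = (LINT x|torus_measure. (f x)\<^sup>2) - (2*pi)^3 * (\<Sum>k\<in>A. (cmod (fourier_coeff f k))\<^sup>2)
       + (2*pi)^3 * (\<Sum>k\<in>A. (cmod (c k - fourier_coeff f k))\<^sup>2)"
proof -
  have "c k * cnj (c k) - cnj (c k) * F - c k * cnj F = complex_of_real ((cmod (c k - F))\<^sup>2 - (cmod F)\<^sup>2)" for k F
    by (simp only: of_real_diff complex_norm_square) (simp add: algebra_simps)
  then have "complex_of_real (LINT x|torus_measure. (f x - p x)\<^sup>2)
     = complex_of_real ((LINT x|torus_measure. (f x)\<^sup>2) + (2*pi)^3 * (\<Sum>k\<in>A. (cmod (c k - fourier_coeff f k))\<^sup>2 - (cmod (fourier_coeff f k))\<^sup>2))"
    using integral_diff_trig_sq[OF assms] by simp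
  then show ?thesis
    by (simp only: of_real_eq_iff sum_subtractf) (simp add: algebra_simps)
qed

lemma bessel:
  assumes "L2_torus f"
  shows "(2*pi)^3 * (\<Sum>k\<in>cube n. (cmod (fourier_coeff f k))\<^sup>2) \<le> (LINT x|torus_measure. (f x)\<^sup>2)"
proof -
  define p where "p = (\<lambda>x. Re (\<Sum>k\<in>cube n. fourier_coeff f k * cis (freq k \<bullet> x)))"
  have p: "complex_of_real (p x) = (\<Sum>k\<in>cube n. fourier_coeff f k * cis (freq k \<bullet> x))" for x
    unfolding p_def by (rule Re_trig_sum) (auto simp: fourier_coeff_minus cube_minus)
  have "0 \<le> (LINT x|torus_measure. (f x - p x)\<^sup>2)" by simp
  also note integral_diff_trig_sq_real[OF assms finite_cube p]
  finally show ?thesis by simp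
qed

text \<open>Conjugate symmetry makes the partial sums over cubes real. The norm identity is
  delivered together with the function, because Parseval's identity for an arbitrary f will be
  obtained by identifying f with the function constructed here from its coefficients.\<close>

theorem riesz_fischer:
  assumes fin: "energy c < \<infinity>" and c: "\<And>k. c (- k) = cnj (c k)"
  obtains f where "L2_torus f" "\<And>k. fourier_coeff f k = c k"
    "ennreal (LINT x|torus_measure. (f x)\<^sup>2) = ennreal ((2*pi)^3) * energy c"
proof -
  define P where "P = (2*pi)^3"
  have P: "P > 0" by (simp add: P_def)
  define s where "s = (\<lambda>n x. Re (\<Sum>k\<in>cube n. c k * cis (freq k \<bullet> x)))"
  have s: "complex_of_real (s n x) = (\<Sum>k\<in>cube n. c k * cis (freq k \<bullet> x))" for n x
    unfolding s_def by (rule Re_trig_sum) (auto simp: c cube_minus)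
  have L2s: "L2_torus (s n)" for n by (rule L2_torus_trig[OF s])
  define a where "a = (\<lambda>n. \<Sum>k\<in>cube n. (cmod (c k))\<^sup>2)"
  have a_enn: "ennreal (a n) = (\<Sum>k\<in>cube n. ennreal (1 * (cmod (c k))\<^sup>2))" for n
    by (simp add: a_def)
  have a_lim: "(\<lambda>n. ennreal (a n)) \<longlonglongrightarrow> energy c"
    unfolding a_enn wsq_def by (rule esum_cube_tendsto)
  have a0: "0 \<le> a n" for n by (simp add: a_def sum_nonneg)
  have conv: "a \<longlonglongrightarrow> enn2real (energy c)"
  proof -
    have "energy c = ennreal (enn2real (energy c))" using fin by (simp add: less_top)
    with a_lim have "(\<lambda>n. ennreal (a n)) \<longlonglongrightarrow> ennreal (enn2real (energy c))" by simp
    from tendsto_enn2real[OF this] show ?thesis using a0 by simp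
  qed
  have diffs: "(LINT x|torus_measure. (s i x - s j x)\<^sup>2) = P * \<bar>a i - a j\<bar>" for i j
  proof -
    have main: "(LINT x|torus_measure. (s i x - s j x)\<^sup>2) = P * \<bar>a i - a j\<bar>" if "j \<le> i" for i j
    proof -
      have sub: "cube j \<subseteq> cube i" using that by (rule cube_mono)
      have p: "complex_of_real (s i x - s j x) = (\<Sum>k\<in>cube i - cube j. c k * cis (freq k \<bullet> x))" for x
        using sub by (simp add: s sum_diff)
      \<comment> \<open>With f = 0 the mean square identity computes the norm of the difference of
        two partial sums.\<close>
      have L20: "L2_torus (\<lambda>_. 0)" by (simp add: L2_torus_def)
      have "(LINT x|torus_measure. (s i x - s j x)\<^sup>2) = (LINT x|torus_measure. (0 - (s i x - s j x))\<^sup>2)"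
        by (simp add: power2_commute)
      also have "\<dots> = P * (\<Sum>k\<in>cube i - cube j. (cmod (c k))\<^sup>2)"
        by (subst integral_diff_trig_sq_real[OF L20 _ p]) (auto simp: P_def fourier_coeff_def)
      also have "(\<Sum>k\<in>cube i - cube j. (cmod (c k))\<^sup>2) = a i - a j"
        using sub by (simp add: a_def sum_diff)
      also have "a i - a j = \<bar>a i - a j\<bar>"
        using sub unfolding a_def by (intro abs_of_nonneg[symmetric]) (auto intro!: sum_mono2)
      finally show ?thesis .
    qed
    show ?thesis
    proof (cases "j \<le> i")
      case False
      then have "(LINT x|torus_measure. (s j x - s i x)\<^sup>2) = P * \<bar>a j - a i\<bar>" by (intro main) simp
      then show ?thesis by (simp add: power2_commute abs_minus_commute)
    qed (rule main)
  qed
  have cauchy: "\<exists>N. \<forall>i\<ge>N. \<forall>j\<ge>N. (LINT x|torus_measure. (s i x - s j x)\<^sup>2) \<le> e" if "e > 0" for e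
  proof -
    have "Cauchy a" using conv by (intro convergent_Cauchy convergentI)
    then obtain N where N: "\<forall>i\<ge>N. \<forall>j\<ge>N. dist (a i) (a j) < e / P"
      using \<open>e > 0\<close> P by (metis Cauchy_def divide_pos_pos)
    have "P * \<bar>a i - a j\<bar> \<le> e" if "i \<ge> N" "j \<ge> N" for i j
      using N that P by (auto simp: dist_real_def field_simps less_imp_le)
    then show ?thesis unfolding diffs by blast
  qed
  obtain f where fm: "f \<in> borel_measurable torus_measure" and fsq: "integrable torus_measure (\<lambda>x. (f x)\<^sup>2)"
    and lim: "(\<lambda>n. LINT x|torus_measure. (f x - s n x)\<^sup>2) \<longlonglongrightarrow> 0"
    by (rule L2_complete[OF finite_measure_torus, of s])
       (use L2s cauchy in \<open>auto simp: L2_torus_def\<close>)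
  have f: "L2_torus f" using fm fsq by (simp add: L2_torus_def)
  have id: "(LINT x|torus_measure. (f x - s n x)\<^sup>2)
     = (LINT x|torus_measure. (f x)\<^sup>2) - P * (\<Sum>k\<in>cube n. (cmod (fourier_coeff f k))\<^sup>2)
       + P * (\<Sum>k\<in>cube n. (cmod (c k - fourier_coeff f k))\<^sup>2)" for n
    unfolding P_def by (rule integral_diff_trig_sq_real[OF f finite_cube s])
  \<comment> \<open>By Bessel's inequality the first difference in \<open>id\<close> is nonnegative,
    so each single coefficient error is dominated by the mean square error, which tends to
    0.\<close>
  have coeff: "fourier_coeff f k = c k" for k
  proof -
    have "\<forall>\<^sub>F n in sequentially. P * (cmod (c k - fourier_coeff f k))\<^sup>2 \<le> (LINT x|torus_measure. (f x - s n x)\<^sup>2)"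
      using in_cube_eventually[of k]
    proof eventually_elim
      case (elim n)
      have "(cmod (c k - fourier_coeff f k))\<^sup>2 \<le> (\<Sum>k\<in>cube n. (cmod (c k - fourier_coeff f k))\<^sup>2)"
        using elim by (intro member_le_sum) auto
      then have "P * (cmod (c k - fourier_coeff f k))\<^sup>2 \<le> P * (\<Sum>k\<in>cube n. (cmod (c k - fourier_coeff f k))\<^sup>2)"
        using P by simp
      then show ?case using bessel[OF f, of n] unfolding id P_def[symmetric] by linarith
    qed
    then have "P * (cmod (c k - fourier_coeff f k))\<^sup>2 \<le> 0"
      by (intro tendsto_lowerbound[OF lim]) auto
    then show ?thesis using P by (simp add: mult_le_0_iff)
  qed
  have "(\<lambda>n. (LINT x|torus_measure. (f x)\<^sup>2) - P * a n) \<longlonglongrightarrow> 0"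
    using lim by (simp add: id coeff a_def)
  moreover have "(\<lambda>n. (LINT x|torus_measure. (f x)\<^sup>2) - P * a n) \<longlonglongrightarrow> (LINT x|torus_measure. (f x)\<^sup>2) - P * enn2real (energy c)"
    by (intro tendsto_intros conv)
  ultimately have "(LINT x|torus_measure. (f x)\<^sup>2) = P * enn2real (energy c)"
    using LIMSEQ_unique by fastforce
  then have "ennreal (LINT x|torus_measure. (f x)\<^sup>2) = ennreal P * energy c"
    using fin P by (simp add: ennreal_mult less_top)
  with f coeff that show ?thesis by (simp add: P_def)
qed

section \<open>Uniqueness of Fourier coefficients by trigonometric approximation\<close>

inductive trig_poly :: "(real^3 \<Rightarrow> complex) \<Rightarrow> bool" where
  monomial: "trig_poly (\<lambda>x. c * cis (freq k \<bullet> x))"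
| add: "trig_poly f \<Longrightarrow> trig_poly g \<Longrightarrow> trig_poly (\<lambda>x. f x + g x)"

lemma trig_poly_const: "trig_poly (\<lambda>x. c)"
  using trig_poly.monomial[of c 0] by simp

lemma trig_poly_mult:
  assumes "trig_poly f" "trig_poly g" shows "trig_poly (\<lambda>x. f x * g x)"
  using assms
proof (induction f rule: trig_poly.induct)
  case (monomial c k)
  from monomial.prems show ?case
  proof (induction g rule: trig_poly.induct)
    case (monomial d l)
    have "(\<lambda>x. c * cis (freq k \<bullet> x) * (d * cis (freq l \<bullet> x))) = (\<lambda>x. (c * d) * cis (freq (k + l) \<bullet> x))"
      using freq_diff[of k "-l"] by (simp add: freq_minus inner_add_left cis_mult[symmetric] mult_ac)
    then show ?case by (simp only: trig_poly.monomial)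
  next
    case (add f g)
    then show ?case by (simp add: distrib_left trig_poly.add)
  qed
next
  case (add f g)
  then show ?case by (simp add: distrib_right trig_poly.add)
qed

lemma trig_poly_continuous: "trig_poly f \<Longrightarrow> continuous_on UNIV f"
  by (induction rule: trig_poly.induct) (auto intro!: continuous_intros)

lemma integral_mult_trig_poly_eq_0:
  assumes "integrable torus_measure f" "\<And>k. fourier_coeff f k = 0" "trig_poly p"
  shows "integrable torus_measure (\<lambda>x. complex_of_real (f x) * p x)" (is ?I)
    "(LINT x|torus_measure. complex_of_real (f x) * p x) = 0" (is ?E)
proof -
  have "?I \<and> ?E"
    using assms(3)
  proof (induction rule: trig_poly.induct)
    case (monomial c k)
    have "integrable torus_measure (\<lambda>x. c * (complex_of_real (f x) * cis (freq k \<bullet> x)))"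
      using assms(1) by (intro integrable_mult_right integrable_mult_cis) simp
    moreover have "(LINT x|torus_measure. complex_of_real (f x) * cis (freq k \<bullet> x)) = 0"
      using fourier_coeff_mult[of f "-k"] assms(2) by (simp add: freq_minus)
    moreover have "(\<lambda>x. complex_of_real (f x) * (c * cis (freq k \<bullet> x))) = (\<lambda>x. c * (complex_of_real (f x) * cis (freq k \<bullet> x)))"
      by (simp add: fun_eq_iff mult_ac)
    ultimately show ?case by simp
  next
    case (add p q)
    then show ?case by (simp add: distrib_left)
  qed
  then show ?I ?E by auto
qed

text \<open>Wraps the period cell onto the torus inside complex space, so that periodicity is built
  in: real polynomials in the coordinates pull back to trigonometric polynomials, and the
  Stone-Weierstrass theorem applies on the compact image.\<close>

definition torus_map :: "real^3 \<Rightarrow> complex^3" where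
  "torus_map x = (\<chi> i. cis (x $ i))"

lemma torus_map_nth [simp]: "torus_map x $ i = cis (x $ i)"
  by (simp add: torus_map_def)

lemma continuous_torus_map: "continuous_on A torus_map"
  unfolding torus_map_def by (intro continuous_intros)

lemma trig_poly_cis_nth: "trig_poly (\<lambda>x. cis (x $ i))" "trig_poly (\<lambda>x. cis (- (x $ i)))"
proof -
  have "freq (axis i 1) \<bullet> x = x $ i" for x :: "real^3"
  proof -
    have "freq (axis i 1) = axis i 1" by (simp add: vec_eq_iff axis_def)
    then show ?thesis by (simp add: inner_axis' )
  qed
  then show "trig_poly (\<lambda>x. cis (x $ i))" "trig_poly (\<lambda>x. cis (- (x $ i)))"
    using trig_poly.monomial[of 1 "axis i 1"] trig_poly.monomial[of 1 "- axis i 1"]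
    by (simp_all add: freq_minus)
qed

lemma trig_poly_sum: "finite A \<Longrightarrow> (\<And>i. i \<in> A \<Longrightarrow> trig_poly (f i)) \<Longrightarrow> trig_poly (\<lambda>x. \<Sum>i\<in>A. f i x)"
  by (induction rule: finite_induct) (auto intro: trig_poly.add trig_poly_const)

lemma trig_poly_of_polynomial:
  assumes "real_polynomial_function q" shows "trig_poly (\<lambda>x. complex_of_real (q (torus_map x)))"
  using assms
proof (induction rule: real_polynomial_function.induct)
  case (linear q)
  interpret q: bounded_linear q by fact
  have cs: "complex_of_real (cos t) = 1/2 * (cis t + cis (- t))" "complex_of_real (sin t) = 1/(2*\<i>) * (cis t + (-1) * cis (- t))" for t
    by (auto simp: complex_eq_iff)
  have "complex_of_real (q (torus_map x))
     = (\<Sum>i\<in>UNIV. complex_of_real (q (axis i 1)) * (1/2 * (cis (x$i) + cis (- (x$i))))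
            + complex_of_real (q (axis i \<i>)) * (1/(2*\<i>) * (cis (x$i) + (-1) * cis (- (x$i)))))" for x
  proof -
    have "torus_map x = (\<Sum>i\<in>UNIV. cos (x$i) *\<^sub>R axis i 1 + sin (x$i) *\<^sub>R axis i \<i>)"
      by (simp add: vec_eq_iff axis_def if_distrib[of "\<lambda>z. _ *\<^sub>R z"] sum.distrib complex_eq_iff cong: if_cong)
    then have "q (torus_map x) = (\<Sum>i\<in>UNIV. cos (x$i) * q (axis i 1) + sin (x$i) * q (axis i \<i>))"
      by (simp add: q.sum q.add q.scale)
    then show ?thesis
      by (simp only: of_real_sum of_real_add of_real_mult cs mult.commute)
  qed
  then show ?case
    by (simp only:) (intro trig_poly_sum trig_poly.add trig_poly_mult trig_poly_const trig_poly_cis_nth finite)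
next
  case (const c)
  show ?case by (rule trig_poly_const)
next
  case (add f g)
  then show ?case by (simp add: trig_poly.add)
next
  case (mult f g)
  then show ?case by (simp add: trig_poly_mult)
qed

text \<open>A polynomial uniformly close to G on the image of the cell pulls back to a trigonometric
  polynomial, whose integral against f is 0; the error is controlled by the integral of |f|.\<close>

lemma integral_mult_continuous_torus_eq_0:
  fixes G :: "complex^3 \<Rightarrow> real"
  assumes f: "integrable torus_measure f" "\<And>k. fourier_coeff f k = 0" and G: "continuous_on UNIV G"
  shows "(LINT x|torus_measure. f x * G (torus_map x)) = 0"
proof (rule ccontr)
  assume ne: "(LINT x|torus_measure. f x * G (torus_map x)) \<noteq> 0"
  define N where "N = (LINT x|torus_measure. \<bar>f x\<bar>)"
  have N: "0 \<le> N" by (simp add: N_def)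
  \<comment> \<open>An approximation to within this e changes the integral by at most e * N, which
    is less than its assumed nonzero modulus e * (N + 1).\<close>
  define e where "e = \<bar>LINT x|torus_measure. f x * G (torus_map x)\<bar> / (N + 1)"
  have e: "e > 0" using ne N by (simp add: e_def)
  have comp: "compact (torus_map ` torus3)"
    by (intro compact_continuous_image continuous_torus_map) (simp add: torus3_def compact_cbox)
  obtain q where q: "real_polynomial_function q" "\<And>v. v \<in> torus_map ` torus3 \<Longrightarrow> \<bar>G v - q v\<bar> < e"
    using Stone_Weierstrass_real_polynomial_function[OF comp continuous_on_subset[OF G subset_UNIV] e] by blast
  have tp: "trig_poly (\<lambda>x. complex_of_real (q (torus_map x)))"
    by (rule trig_poly_of_polynomial[OF q(1)])
  have cq: "continuous_on UNIV (\<lambda>x. q (torus_map x))"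
    using continuous_on_Re[OF trig_poly_continuous[OF tp]] by simp
  have cG: "continuous_on UNIV (\<lambda>x. G (torus_map x))"
    by (rule continuous_on_compose2[OF G continuous_torus_map]) simp
  have q0: "integrable torus_measure (\<lambda>x. f x * q (torus_map x))" "(LINT x|torus_measure. f x * q (torus_map x)) = 0"
  proof -
    have i: "integrable torus_measure (\<lambda>x. complex_of_real (f x * q (torus_map x)))"
      and z: "(LINT x|torus_measure. complex_of_real (f x * q (torus_map x))) = 0"
      using integral_mult_trig_poly_eq_0[OF f tp] by simp_all
    from integrable_Re[OF i] show "integrable torus_measure (\<lambda>x. f x * q (torus_map x))" by simp
    from z show "(LINT x|torus_measure. f x * q (torus_map x)) = 0"
      unfolding integral_complex_of_real by simp
  qed
  have b: "\<bar>f x * (G (torus_map x) - q (torus_map x))\<bar> \<le> e * \<bar>f x\<bar>" if "x \<in> torus3" for x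
  proof -
    have "\<bar>f x\<bar> * \<bar>G (torus_map x) - q (torus_map x)\<bar> \<le> \<bar>f x\<bar> * e"
      using q(2)[of "torus_map x"] that by (intro mult_left_mono) (auto intro: less_imp_le)
    then show ?thesis by (simp add: abs_mult mult.commute)
  qed
  have d: "integrable torus_measure (\<lambda>x. f x * (G (torus_map x) - q (torus_map x)))"
  proof (rule Bochner_Integration.integrable_bound[where f="\<lambda>x. e * \<bar>f x\<bar>"])
    show "(\<lambda>x. f x * (G (torus_map x) - q (torus_map x))) \<in> borel_measurable torus_measure"
      by (intro borel_measurable_times borel_measurable_integrable[OF f(1)] borel_measurable_diff continuous_torus_measurable cG cq)
    show "AE x in torus_measure. norm (f x * (G (torus_map x) - q (torus_map x))) \<le> norm (e * \<bar>f x\<bar>)"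
      using b e by (intro AE_I2) (simp add: abs_mult)
  qed (use f in simp)
  have "(LINT x|torus_measure. f x * G (torus_map x))
     = (LINT x|torus_measure. f x * (G (torus_map x) - q (torus_map x)) + f x * q (torus_map x))"
    by (simp add: algebra_simps)
  also have "\<dots> = (LINT x|torus_measure. f x * (G (torus_map x) - q (torus_map x)))"
    using d q0 by simp
  also have "\<bar>\<dots>\<bar> \<le> (LINT x|torus_measure. e * \<bar>f x\<bar>)"
  proof (rule order_trans[OF integral_abs_bound integral_mono])
    show "integrable torus_measure (\<lambda>x. \<bar>f x * (G (torus_map x) - q (torus_map x))\<bar>)"
      using d by (rule integrable_abs)
    show "\<bar>f x * (G (torus_map x) - q (torus_map x))\<bar> \<le> e * \<bar>f x\<bar>" if "x \<in> space torus_measure" for x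
      using b that by simp
  qed (use f in simp)
  also have "\<dots> = e * N" by (simp add: N_def)
  also have "\<dots> < e * (N + 1)" using e by simp
  also have "\<dots> = \<bar>LINT x|torus_measure. f x * G (torus_map x)\<bar>"
    using N by (simp add: e_def)
  finally show False by simp
qed

abbreviation torus_interior :: "(real^3) set" where
  "torus_interior \<equiv> box (\<chi> i. - pi) (\<chi> i. pi)"

text \<open>Opposite faces of the closed cell have the same image, so one of the two points is taken
  from the interior. Then each pair of coordinates differs by a multiple of 2 pi of modulus less
  than 2 pi.\<close>

lemma torus_map_inj:
  assumes "x \<in> torus3" "y \<in> torus_interior" "torus_map x = torus_map y"
  shows "x = y"
  unfolding vec_eq_iff
proof
  fix i
  have "cis (x $ i) = cis (y $ i)" using assms(3) by (metis torus_map_nth)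
  then have "sin (x $ i) = sin (y $ i)" "cos (x $ i) = cos (y $ i)" by (simp_all add: complex_eq_iff)
  then obtain n :: int where n: "x $ i = y $ i + 2 * pi * n"
    using sin_cos_eq_iff[of "x $ i" "y $ i"] by auto
  have "\<bar>x $ i\<bar> \<le> pi" "\<bar>y $ i\<bar> < pi"
    using assms(1,2) by (auto simp: mem_torus3 mem_box_cart abs_less_iff minus_less_iff)
  then have "\<bar>2 * pi * n\<bar> < 2 * pi" using n by linarith
  then have "\<bar>real_of_int n\<bar> < 1" by (simp add: abs_mult)
  then have "n = 0" by linarith
  then show "x $ i = y $ i" using n by simp
qed

text \<open>The tent functions \<open>G n\<close> of the distance to the image of K decrease to the
  indicator of that image. Because K lies in the interior, no other point of the cell is mapped into
  the image, so their pullbacks converge to the indicator of K, dominated by |f|.\<close>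

lemma integral_compact_eq_0:
  assumes f: "integrable torus_measure f" "\<And>k. fourier_coeff f k = 0"
    and K: "compact K" "K \<subseteq> torus_interior"
  shows "(LINT x|torus_measure. f x * indicator K x) = 0"
proof (cases "K = {}")
  case False
  define L where "L = torus_map ` K"
  have L: "closed L" "L \<noteq> {}"
    using K(1) False by (auto simp: L_def intro!: compact_imp_closed compact_continuous_image continuous_torus_map)
  define G where "G = (\<lambda>n::nat. \<lambda>v. max 0 (1 - real n * infdist v L))"
  have cG: "continuous_on UNIV (G n)" for n
    unfolding G_def by (intro continuous_intros)
  have G0: "(LINT x|torus_measure. f x * G n (torus_map x)) = 0" for n
    by (rule integral_mult_continuous_torus_eq_0[OF f cG])
  have "(\<lambda>n. LINT x|torus_measure. f x * G n (torus_map x)) \<longlonglongrightarrow> (LINT x|torus_measure. f x * indicator K x)"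
  proof (rule integral_dominated_convergence[where w="\<lambda>x. \<bar>f x\<bar>"])
    have [measurable]: "K \<in> sets lebesgue" using K by (simp add: compact_imp_closed)
    have Km: "K \<inter> torus3 \<in> sets torus_measure" by (auto simp: sets_restrict_space)
    have "(\<lambda>x. f x * indicator (K \<inter> torus3) x) \<in> borel_measurable torus_measure"
      using borel_measurable_integrable[OF f(1)] Km by measurable
    then show "(\<lambda>x. f x * indicator K x) \<in> borel_measurable torus_measure"
      by (rule measurable_cong[THEN iffD1, rotated]) (auto simp: indicator_def)
    show "(\<lambda>x. f x * G n (torus_map x)) \<in> borel_measurable torus_measure" for n
      by (intro borel_measurable_times borel_measurable_integrable[OF f(1)] continuous_torus_measurable
          continuous_on_compose2[OF cG continuous_torus_map]) auto
    show "integrable torus_measure (\<lambda>x. \<bar>f x\<bar>)" using f(1) by simp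
    show "AE x in torus_measure. norm (f x * G n (torus_map x)) \<le> \<bar>f x\<bar>" for n
    proof (rule AE_I2)
      fix x
      have "\<bar>G n (torus_map x)\<bar> \<le> 1" unfolding G_def using infdist_nonneg[of "torus_map x" L] by (auto simp: max_def)
      then show "norm (f x * G n (torus_map x)) \<le> \<bar>f x\<bar>"
        using mult_left_mono[of "\<bar>G n (torus_map x)\<bar>" 1 "\<bar>f x\<bar>"] by (simp add: abs_mult)
    qed
    show "AE x in torus_measure. (\<lambda>n. f x * G n (torus_map x)) \<longlonglongrightarrow> f x * indicator K x"
    proof (rule AE_I2)
      fix x assume x: "x \<in> space torus_measure"
      have "(\<lambda>n. G n (torus_map x)) \<longlonglongrightarrow> indicator K x"
      proof (cases "x \<in> K")
        case True
        then have "torus_map x \<in> L" by (auto simp: L_def)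
        then have "G n (torus_map x) = 1" for n by (simp add: G_def)
        then show ?thesis using True by simp
      next
        case False
        have "torus_map x \<notin> L"
          using torus_map_inj[of x] x K(2) False by (auto simp: L_def)
        then have d: "infdist (torus_map x) L > 0"
          using L infdist_nonneg[of "torus_map x" L] in_closed_iff_infdist_zero[OF L, of "torus_map x"] by linarith
        obtain N :: nat where N: "real N * infdist (torus_map x) L > 1"
          using reals_Archimedean3[OF d] by blast
        have "\<forall>\<^sub>F n in sequentially. G n (torus_map x) = 0"
          unfolding eventually_sequentially
        proof (intro exI[of _ N] allI impI)
          fix n assume "N \<le> n"
          then have "real N * infdist (torus_map x) L \<le> real n * infdist (torus_map x) L"
            using d by (intro mult_right_mono) auto
          then show "G n (torus_map x) = 0" using N by (simp add: G_def)
        qed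
        then show ?thesis using False by (simp add: tendsto_eventually)
      qed
      then show "(\<lambda>n. f x * G n (torus_map x)) \<longlonglongrightarrow> f x * indicator K x" by (intro tendsto_intros)
    qed
  qed
  then show ?thesis unfolding G0 using LIMSEQ_unique tendsto_const by metis
qed simp

text \<open>If f exceeded 1 / (n + 1) on a set of positive measure, inner regularity would yield a
  compact subset of the interior of positive measure; over it the integral of f would be positive,
  although it is 0. The one-sided form is applied to f - g and to g - f.\<close>

lemma AE_nonpos_of_fourier_coeff_0:
  assumes f: "integrable torus_measure f" "\<And>k. fourier_coeff f k = 0"
  shows "AE x in torus_measure. f x \<le> 0"
proof -
  define E where "E = (\<lambda>n::nat. {x \<in> torus3. f x > 1 / (real n + 1)} \<inter> torus_interior)"
  have sub: "torus_interior \<subseteq> torus3" unfolding torus3_def by (rule box_subset_cbox)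
  have Em: "E n \<in> sets torus_measure" for n
  proof -
    have "{x \<in> space torus_measure. f x > 1 / (real n + 1)} \<in> sets torus_measure"
      using borel_measurable_integrable[OF f(1)] by measurable
    moreover have "torus_interior \<in> sets torus_measure"
      using sub by (auto simp: sets_restrict_space_iff)
    ultimately show ?thesis unfolding E_def by (auto intro: sets.Int)
  qed
  have En: "E n \<in> null_sets torus_measure" for n
  proof (rule ccontr)
    assume "E n \<notin> null_sets torus_measure"
    then have pos: "emeasure torus_measure (E n) > 0"
      using Em by (auto simp: null_sets_def zero_less_iff_neq_zero)
    have El: "E n \<in> sets lebesgue" using Em by (auto simp: sets_restrict_space_iff)
    have Esub: "E n \<subseteq> torus3" by (auto simp: E_def)
    have pos': "emeasure lebesgue (E n) > 0"
      using pos by (simp add: emeasure_restrict_space Esub)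
    have fin: "emeasure lebesgue (E n) < \<infinity>"
      using emeasure_mono[OF Esub torus3_sets] torus3_lmeasurable by (auto simp: fmeasurable_def order_le_less_trans)
    define d where "d = enn2real (emeasure lebesgue (E n))"
    have d: "emeasure lebesgue (E n) = ennreal d" "d > 0"
      using pos' fin by (auto simp: d_def less_top enn2real_positive_iff)
    obtain T where T: "closed T" "T \<subseteq> E n" "E n - T \<in> lmeasurable" "emeasure lebesgue (E n - T) < ennreal d"
      using sets_lebesgue_inner_closed[OF El d(2)] by blast
    have "bounded T" using T(2) Esub bounded_cbox unfolding torus3_def by (meson bounded_subset)
    with T(1) have cT: "compact T" by (simp add: compact_eq_bounded_closed)
    have Tl: "T \<in> sets lebesgue" using T(1) by simp
    have Tpos: "emeasure lebesgue T > 0"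
    proof (rule ccontr)
      assume "\<not> emeasure lebesgue T > 0"
      then have "emeasure lebesgue T = 0" by (simp add: zero_less_iff_neq_zero)
      then have "emeasure lebesgue (E n) \<le> emeasure lebesgue (E n - T)"
        using emeasure_subadditive[of T lebesgue "E n - T"] Tl El T(2) by (simp add: Un_absorb1)
      then show False using T(4) d by simp
    qed
    have Tfin: "emeasure lebesgue T < \<infinity>"
      using emeasure_mono[OF T(2) El] fin by (rule order_le_less_trans)
    have Ti: "T \<subseteq> torus_interior" using T(2) by (auto simp: E_def)
    have TM: "T \<in> sets torus_measure" using Tl T(2) Esub by (auto simp: sets_restrict_space_iff)
    have mT: "measure torus_measure T > 0"
      using Tpos Tfin T(2) Esub by (simp add: measure_def emeasure_restrict_space enn2real_positive_iff)
    have "1 / (real n + 1) * measure torus_measure T = (LINT x|torus_measure. 1 / (real n + 1) * indicator T x)"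
      using T(2) Esub by (simp add: Int_absorb2)
    also have "\<dots> \<le> (LINT x|torus_measure. f x * indicator T x)"
    proof (rule integral_mono)
      interpret finite_measure torus_measure by (rule finite_measure_torus)
      show "integrable torus_measure (\<lambda>x. 1 / (real n + 1) * indicator T x)"
        using TM by (intro integrable_mult_right integrable_real_indicator) (auto simp: less_top[symmetric])
      show "integrable torus_measure (\<lambda>x. f x * indicator T x)"
        using integrable_mult_indicator[OF TM f(1)] by (simp add: mult.commute)
      show "1 / (real n + 1) * indicator T x \<le> f x * indicator T x" for x
        using T(2) by (auto simp: indicator_def E_def less_imp_le)
    qed
    also have "\<dots> = 0" by (rule integral_compact_eq_0[OF f cT Ti])
    finally have "1 / (real n + 1) * measure torus_measure T \<le> 0" .
    moreover have "0 < 1 / (real n + 1) * measure torus_measure T"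
      using mT by (intro mult_pos_pos) auto
    ultimately show False by linarith
  qed
  have bd: "torus3 - torus_interior \<in> null_sets torus_measure"
  proof -
    have "negligible (torus3 - torus_interior)" unfolding torus3_def by (rule negligible_frontier_interval)
    then have "torus3 - torus_interior \<in> null_sets lebesgue" by (simp add: negligible_iff_null_sets)
    then show ?thesis by (simp add: null_sets_restrict_space)
  qed
  have "AE x in torus_measure. \<forall>n. x \<notin> E n"
    unfolding AE_all_countable using En by (auto intro: AE_not_in)
  with AE_not_in[OF bd] AE_space show ?thesis
  proof eventually_elim
    case (elim x)
    show ?case
    proof (rule ccontr)
      assume "\<not> f x \<le> 0"
      then obtain n where "1 / (real n + 1) < f x"
        using reals_Archimedean[of "f x"] by (auto simp: inverse_eq_divide add.commute)
      then show False using elim by (auto simp: E_def)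
    qed
  qed
qed

theorem fourier_coeff_unique:
  assumes f: "L2_torus f" "L2_torus g" "\<And>k. fourier_coeff f k = fourier_coeff g k"
  shows "AE x in torus_measure. f x = g x"
proof -
  have i: "integrable torus_measure f" "integrable torus_measure g" using f by (simp_all add: L2_torus_integrable)
  have "AE x in torus_measure. f x - g x \<le> 0"
    by (rule AE_nonpos_of_fourier_coeff_0) (use i f in \<open>simp_all add: fourier_coeff_diff\<close>)
  moreover have "AE x in torus_measure. g x - f x \<le> 0"
    by (rule AE_nonpos_of_fourier_coeff_0) (use i f in \<open>simp_all add: fourier_coeff_diff\<close>)
  ultimately show ?thesis by eventually_elim simp
qed

lemma energy_fourier_coeff_finite:
  assumes "L2_torus f" shows "energy (fourier_coeff f) < \<infinity>"
proof -
  define I where "I = (LINT x|torus_measure. (f x)\<^sup>2)"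
  have "energy (fourier_coeff f) \<le> ennreal (I / (2*pi)^3)"
    unfolding wsq_def esum_le_iff_cube
  proof
    fix n
    have "(\<Sum>k\<in>cube n. (cmod (fourier_coeff f k))\<^sup>2) \<le> I / (2*pi)^3"
      using bessel[OF assms, of n] by (simp add: I_def field_simps)
    then show "(\<Sum>k\<in>cube n. ennreal (1 * (cmod (fourier_coeff f k))\<^sup>2)) \<le> ennreal (I / (2*pi)^3)"
      by (simp add: ennreal_leI)
  qed
  then show ?thesis by (simp add: order_le_less_trans)
qed

theorem parseval:
  assumes f: "L2_torus f"
  shows "ennreal (LINT x|torus_measure. (f x)\<^sup>2) = ennreal ((2*pi)^3) * energy (fourier_coeff f)"
proof -
  obtain g where g: "L2_torus g" "\<And>k. fourier_coeff g k = fourier_coeff f k"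
    "ennreal (LINT x|torus_measure. (g x)\<^sup>2) = ennreal ((2*pi)^3) * energy (fourier_coeff f)"
    using riesz_fischer[OF energy_fourier_coeff_finite[OF f] fourier_coeff_minus] by metis
  have "AE x in torus_measure. f x = g x" using f g by (intro fourier_coeff_unique) auto
  then have "(LINT x|torus_measure. (f x)\<^sup>2) = (LINT x|torus_measure. (g x)\<^sup>2)"
    using f g by (intro integral_cong_AE) (auto simp: L2_torus_def)
  then show ?thesis using g(3) by simp
qed

section \<open>The equation for the Fourier coefficients\<close>

definition damp :: "real \<Rightarrow> real \<Rightarrow> real \<Rightarrow> int^3 \<Rightarrow> real" where
  "damp lam \<gamma> \<kappa> k = lam * (norm (freq k) + 1) + \<kappa> * norm (freq k) powr \<gamma>"

lemma esum_product_finite: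
  assumes "energy x < \<infinity>" "energy y < \<infinity>"
  shows "esum (\<lambda>l. ennreal (cmod (x (k - l)) * cmod (y l))) < \<infinity>"
proof -
  have "esum (\<lambda>l. ennreal (cmod (x (k - l)) * cmod (y l)))
      \<le> 2 * esum (\<lambda>l. ennreal (cmod (x (k - l)) * cmod (y l)))"
    by (simp add: mult_2)
  also have "\<dots> \<le> energy x + energy y" by (rule esum_product_le)
  also have "\<dots> < \<infinity>" using assms by simp
  finally show ?thesis .
qed

lemma velocity_terms_finite:
  assumes "energy c < \<infinity>"
  shows "esum (\<lambda>l. ennreal (cmod (complex_of_real (mu l $ j) * c l))) < \<infinity>"
proof -
  have "(esum (\<lambda>l. ennreal (norm (mu l) * cmod (c l))))\<^sup>2 < \<infinity>"
    by (rule order_le_less_trans[OF velocity_l1_bound]) (use assms in \<open>simp add: ennreal_mult_less_top\<close>)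
  then have fin: "esum (\<lambda>l. ennreal (norm (mu l) * cmod (c l))) < \<infinity>"
    by (rule contrapos_pp) (simp add: not_less top_unique power2_eq_square)
  have "esum (\<lambda>l. ennreal (cmod (complex_of_real (mu l $ j) * c l))) \<le> esum (\<lambda>l. ennreal (norm (mu l) * cmod (c l)))"
    by (intro nn_integral_mono ennreal_leI) (simp add: norm_mult component_le_norm_cart mult_right_mono)
  then show ?thesis using fin by (rule order_le_less_trans)
qed

text \<open>The symbol is real and even, so the sums over cubes are real. Taking the real part in
  \<open>velocity\<close> therefore loses nothing.\<close>

lemma velocity_series_real:
  assumes "L2_torus f"
  shows "complex_of_real (velocity f x $ j)
    = (\<Sum>\<^sub>\<infinity>l. complex_of_real (mu l $ j) * fourier_coeff f l * cis (freq l \<bullet> x))"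
proof -
  define z where "z = (\<lambda>l. complex_of_real (mu l $ j) * fourier_coeff f l)"
  have fin: "esum (\<lambda>l. ennreal (norm (z l * cis (freq l \<bullet> x)))) < \<infinity>"
    using velocity_terms_finite[OF energy_fourier_coeff_finite[OF assms], of j]
    by (simp add: norm_mult z_def)
  have lim: "(\<lambda>n. \<Sum>l\<in>cube n. z l * cis (freq l \<bullet> x)) \<longlonglongrightarrow> (\<Sum>\<^sub>\<infinity>l. z l * cis (freq l \<bullet> x))"
    by (rule infsum_cube_tendsto[OF fin])
  have re: "complex_of_real (Re (\<Sum>l\<in>cube n. z l * cis (freq l \<bullet> x))) = (\<Sum>l\<in>cube n. z l * cis (freq l \<bullet> x))" for n
    by (rule Re_trig_sum) (auto simp: z_def fourier_coeff_minus cube_minus)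
  have "(\<lambda>n. complex_of_real (Re (\<Sum>l\<in>cube n. z l * cis (freq l \<bullet> x)))) \<longlonglongrightarrow> complex_of_real (Re (\<Sum>\<^sub>\<infinity>l. z l * cis (freq l \<bullet> x)))"
    by (intro tendsto_intros lim)
  with lim have "complex_of_real (Re (\<Sum>\<^sub>\<infinity>l. z l * cis (freq l \<bullet> x))) = (\<Sum>\<^sub>\<infinity>l. z l * cis (freq l \<bullet> x))"
    unfolding re by (rule LIMSEQ_unique[rotated])
  then show ?thesis by (simp add: velocity_def z_def mu_def)
qed

text \<open>The partial sums of the velocity are bounded uniformly in x by the absolute sum Z, so Z
  |f| dominates and the product may be integrated term by term. A shift of the summation index gives
  the convolution.\<close>

lemma fourier_coeff_velocity_mult:
  assumes f: "L2_torus f"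
  shows "fourier_coeff (\<lambda>x. velocity f x $ j * f x) k
    = (\<Sum>\<^sub>\<infinity>l. complex_of_real (mu (k - l) $ j) * fourier_coeff f (k - l) * fourier_coeff f l)"
proof -
  define c where "c = fourier_coeff f"
  have ec: "energy c < \<infinity>" unfolding c_def by (rule energy_fourier_coeff_finite[OF f])
  define z where "z = (\<lambda>l. complex_of_real (mu l $ j) * c l)"
  have zfin: "esum (\<lambda>l. ennreal (norm (z l))) < \<infinity>"
    unfolding z_def by (rule velocity_terms_finite[OF ec])
  define Z where "Z = (\<Sum>\<^sub>\<infinity>l. norm (z l))"
  have Z: "(\<Sum>l\<in>cube n. norm (z l)) \<le> Z" for n
    unfolding Z_def by (rule finite_sum_le_infsum[OF abs_summable_of_esum(2)[OF zfin]]) auto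
  define P where "P = complex_of_real ((2 * pi) ^ 3)"
  define s where "s = (\<lambda>n x. \<Sum>l\<in>cube n. z l * cis (freq l \<bullet> x))"
  define e where "e = (\<lambda>x. cis (- (freq k \<bullet> x)))"
  have fi: "integrable torus_measure (\<lambda>x. complex_of_real (f x))"
    using L2_torus_integrable[OF f] by simp
  have [measurable]: "e \<in> borel_measurable torus_measure"
    unfolding e_def by (intro continuous_torus_measurable continuous_intros)
  have [measurable]: "s n \<in> borel_measurable torus_measure" for n
    unfolding s_def by (intro continuous_torus_measurable continuous_intros)
  have [measurable]: "f \<in> borel_measurable torus_measure" using f by (rule L2_torus_measurable)
  have slim: "(\<lambda>n. s n x) \<longlonglongrightarrow> complex_of_real (velocity f x $ j)" for x
    unfolding velocity_series_real[OF f] s_def z_def c_def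
    by (rule infsum_cube_tendsto) (use zfin in \<open>simp add: norm_mult z_def c_def\<close>)
  have [measurable]: "(\<lambda>x. complex_of_real (velocity f x $ j)) \<in> borel_measurable torus_measure"
    by (rule borel_measurable_LIMSEQ_metric[OF _ slim]) measurable
  have "(\<lambda>n. LINT x|torus_measure. s n x * complex_of_real (f x) * e x)
      \<longlonglongrightarrow> (LINT x|torus_measure. complex_of_real (velocity f x $ j) * complex_of_real (f x) * e x)"
  proof (rule integral_dominated_convergence[where w="\<lambda>x. Z * \<bar>f x\<bar>"])
    show "integrable torus_measure (\<lambda>x. Z * \<bar>f x\<bar>)" using L2_torus_integrable[OF f] by simp
    show "AE x in torus_measure. (\<lambda>n. s n x * complex_of_real (f x) * e x)
        \<longlonglongrightarrow> complex_of_real (velocity f x $ j) * complex_of_real (f x) * e x"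
      by (intro AE_I2 tendsto_intros slim)
    show "AE x in torus_measure. norm (s n x * complex_of_real (f x) * e x) \<le> Z * \<bar>f x\<bar>" for n
    proof (rule AE_I2)
      fix x
      have "norm (s n x) \<le> (\<Sum>l\<in>cube n. norm (z l))"
        unfolding s_def by (rule sum_norm_le) (simp add: norm_mult)
      then have "norm (s n x) \<le> Z" using Z[of n] by linarith
      then show "norm (s n x * complex_of_real (f x) * e x) \<le> Z * \<bar>f x\<bar>"
        by (simp add: norm_mult e_def mult_right_mono)
    qed
  qed measurable
  moreover have "(LINT x|torus_measure. s n x * complex_of_real (f x) * e x) = P * (\<Sum>l\<in>cube n. z l * c (k - l))" for n
  proof -
    have "s n x * complex_of_real (f x) * e x = (\<Sum>l\<in>cube n. z l * (complex_of_real (f x) * cis (- (freq (k - l) \<bullet> x))))" for x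
      unfolding s_def e_def sum_distrib_right
      by (intro sum.cong refl) (simp add: freq_diff inner_diff_left cis_mult[symmetric] cis_divide[symmetric] field_simps flip: cis_inverse)
    then have "(LINT x|torus_measure. s n x * complex_of_real (f x) * e x)
       = (LINT x|torus_measure. (\<Sum>l\<in>cube n. z l * (complex_of_real (f x) * cis (- (freq (k - l) \<bullet> x)))))" by simp
    also have "\<dots> = (\<Sum>l\<in>cube n. z l * (P * c (k - l)))"
      by (subst Bochner_Integration.integral_sum)
         (auto intro!: integrable_mult_right integrable_mult_cis_minus fi simp: fourier_coeff_mult P_def c_def)
    finally show ?thesis by (simp add: sum_distrib_left mult_ac)
  qed
  moreover have "(\<lambda>n. P * (\<Sum>l\<in>cube n. z l * c (k - l))) \<longlonglongrightarrow> P * (\<Sum>\<^sub>\<infinity>l. z l * c (k - l))"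
  proof (intro tendsto_intros infsum_cube_tendsto)
    have cc: "esum (\<lambda>l. ennreal (cmod (c (k - l)) * cmod (c l))) < \<infinity>"
      by (rule esum_product_finite[OF ec ec])
    have "esum (\<lambda>l. ennreal (norm (z l * c (k - l)))) \<le> esum (\<lambda>l. 5 * ennreal (cmod (c (k - l)) * cmod (c l)))"
    proof (intro nn_integral_mono)
      fix l
      have "\<bar>mu l $ j\<bar> \<le> 5" using component_le_norm_cart[of "mu l" j] norm_mu_le_5[of l] by linarith
      then have "norm (z l * c (k - l)) \<le> 5 * (cmod (c (k - l)) * cmod (c l))"
        unfolding z_def norm_mult by (simp add: mult_right_mono mult.commute[of "cmod (c (k - l))"] mult.assoc)
      then have "ennreal (norm (z l * c (k - l))) \<le> ennreal (5 * (cmod (c (k - l)) * cmod (c l)))" by (rule ennreal_leI)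
      then show "ennreal (norm (z l * c (k - l))) \<le> 5 * ennreal (cmod (c (k - l)) * cmod (c l))"
        by (simp add: ennreal_mult)
    qed
    also have "\<dots> < \<infinity>" using cc by (simp add: nn_integral_cmult ennreal_mult_less_top)
    finally show "esum (\<lambda>l. ennreal (norm (z l * c (k - l)))) < \<infinity>" .
  qed
  ultimately have "(LINT x|torus_measure. complex_of_real (velocity f x $ j) * complex_of_real (f x) * e x) = P * (\<Sum>\<^sub>\<infinity>l. z l * c (k - l))"
    using LIMSEQ_unique by fastforce
  then have "fourier_coeff (\<lambda>x. velocity f x $ j * f x) k = (\<Sum>\<^sub>\<infinity>l. z l * c (k - l))"
    by (simp add: fourier_coeff_def e_def P_def)
  also have "\<dots> = (\<Sum>\<^sub>\<infinity>l. z (k - l) * c l)"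
    by (rule infsum_reindex_bij_witness[where i="\<lambda>l. k - l" and j="\<lambda>l. k - l"]) auto
  finally show ?thesis by (simp add: z_def c_def)
qed

text \<open>Contracting i k with the symbol of the velocity in the divergence form yields precisely
  the kernel of \<open>adv\<close>; each of the three component series converges absolutely, so they
  may be added under the sum.\<close>

lemma mg_rhs_coeff_eq:
  assumes f: "L2_torus f"
  shows "mg_rhs_coeff lam \<gamma> \<kappa> S f k = fourier_coeff S k - adv (fourier_coeff f) (fourier_coeff f) k
    - complex_of_real (damp lam \<gamma> \<kappa> k) * fourier_coeff f k"
proof -
  define c where "c = fourier_coeff f"
  have ec: "energy c < \<infinity>" unfolding c_def by (rule energy_fourier_coeff_finite[OF f])
  have fin: "esum (\<lambda>l. ennreal (norm (\<i> * complex_of_real (freq k $ j) * (complex_of_real (mu (k - l) $ j) * c (k - l) * c l)))) < \<infinity>" for j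
  proof -
    have cc: "esum (\<lambda>l. ennreal (cmod (c (k - l)) * cmod (c l))) < \<infinity>"
      by (rule esum_product_finite[OF ec ec])
    have "esum (\<lambda>l. ennreal (norm (\<i> * complex_of_real (freq k $ j) * (complex_of_real (mu (k - l) $ j) * c (k - l) * c l))))
       \<le> esum (\<lambda>l. ennreal (\<bar>freq k $ j\<bar> * 5) * ennreal (cmod (c (k - l)) * cmod (c l)))"
    proof (intro nn_integral_mono)
      fix l
      have "\<bar>mu (k - l) $ j\<bar> \<le> 5" using component_le_norm_cart[of "mu (k - l)" j] norm_mu_le_5[of "k - l"] by linarith
      then have "\<bar>freq k $ j\<bar> * \<bar>mu (k - l) $ j\<bar> * (cmod (c (k - l)) * cmod (c l)) \<le> \<bar>freq k $ j\<bar> * 5 * (cmod (c (k - l)) * cmod (c l))"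
        by (intro mult_right_mono mult_left_mono) auto
      then have "ennreal (norm (\<i> * complex_of_real (freq k $ j) * (complex_of_real (mu (k - l) $ j) * c (k - l) * c l)))
         \<le> ennreal (\<bar>freq k $ j\<bar> * 5 * (cmod (c (k - l)) * cmod (c l)))"
        by (intro ennreal_leI) (simp only: norm_mult norm_ii norm_of_real real_norm_def mult_1_left mult.assoc)
      then show "ennreal (norm (\<i> * complex_of_real (freq k $ j) * (complex_of_real (mu (k - l) $ j) * c (k - l) * c l)))
         \<le> ennreal (\<bar>freq k $ j\<bar> * 5) * ennreal (cmod (c (k - l)) * cmod (c l))"
        by (subst ennreal_mult[symmetric]) auto
    qed
    also have "\<dots> < \<infinity>" using cc by (simp add: nn_integral_cmult ennreal_mult_less_top)
    finally show ?thesis .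
  qed
  define t where "t = (\<lambda>j l. \<i> * complex_of_real (freq k $ j) * (complex_of_real (mu (k - l) $ j) * c (k - l) * c l))"
  have st: "t j summable_on UNIV" for j
    unfolding t_def by (rule abs_summable_of_esum(1)[OF fin])
  have "(\<Sum>j\<in>UNIV. \<i> * complex_of_real (freq k $ j) * fourier_coeff (\<lambda>x. velocity f x $ j * f x) k)
     = (\<Sum>j\<in>UNIV. \<Sum>\<^sub>\<infinity>l. t j l)"
    unfolding fourier_coeff_velocity_mult[OF f] t_def c_def by (simp add: infsum_cmult_right')
  also have "\<dots> = (\<Sum>\<^sub>\<infinity>l. t 1 l + t 2 l + t 3 l)"
    by (simp add: sum_3 infsum_add summable_on_add st)
  also have "\<dots> = adv c c k"
    unfolding adv_def
  proof (rule infsum_cong)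
    fix l
    have "ker k l = freq k $ 1 * mu (k - l) $ 1 + freq k $ 2 * mu (k - l) $ 2 + freq k $ 3 * mu (k - l) $ 3"
      by (simp add: ker_def inner_vec_def sum_3)
    then show "t 1 l + t 2 l + t 3 l = \<i> * complex_of_real (ker k l) * c (k - l) * c l"
      by (simp add: t_def algebra_simps)
  qed
  finally show ?thesis
    by (simp add: mg_rhs_coeff_def damp_def c_def algebra_simps)
qed

lemma sobolev_sq_eq: "sobolev_sq \<sigma> f = ennreal ((2*pi)^3) * wsq (\<lambda>k. norm (freq k) powr (2 * \<sigma>)) (fourier_coeff f)"
  unfolding sobolev_sq_def esum_eq_infsum wsq_def
  by (simp add: ennreal_mult mult.assoc nn_integral_cmult)

lemma sobolev_sq_half: "sobolev_sq (1/2) f = ennreal ((2*pi)^3) * half_energy (fourier_coeff f)"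
  by (simp add: sobolev_sq_eq)

lemma wsq_mono: "(\<And>k. m k \<le> m' k) \<Longrightarrow> wsq m c \<le> wsq m' c"
  unfolding wsq_def by (intro nn_integral_mono ennreal_leI mult_right_mono) auto

text \<open>An upper bound for the dissipation is all that is sought, so the infimum is tested with
  one weak gradient, built from the coefficients i k_j by Riesz-Fischer. If the right-hand side is
  infinite there is nothing to construct.\<close>

lemma gradient_L2_sq_le:
  assumes f: "L2_torus f"
  shows "gradient_L2_sq f \<le> ennreal ((2*pi)^3) * wsq (\<lambda>k. (norm (freq k))\<^sup>2) (fourier_coeff f)"
proof (cases "wsq (\<lambda>k. (norm (freq k))\<^sup>2) (fourier_coeff f) < \<infinity>")
  case False
  then have "wsq (\<lambda>k. (norm (freq k))\<^sup>2) (fourier_coeff f) = top" by (simp add: not_less top_unique)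
  then show ?thesis by (simp add: ennreal_mult_top)
next
  case True
  define c where "c = (\<lambda>j k. \<i> * complex_of_real (freq k $ j) * fourier_coeff f k)"
  have ec: "energy (c j) = wsq (\<lambda>k. (freq k $ j)\<^sup>2) (fourier_coeff f)" for j
    by (simp add: wsq_def c_def norm_mult power_mult_distrib)
  have "energy (c j) \<le> wsq (\<lambda>k. (norm (freq k))\<^sup>2) (fourier_coeff f)" for j
    unfolding ec by (intro wsq_mono) (metis component_le_norm_cart abs_le_square_iff abs_norm_cancel)
  then have e1: "energy (c j) < \<infinity>" for j using True by (rule order_le_less_trans)
  have e2: "c j (- k) = cnj (c j k)" for j k
    by (simp add: c_def fourier_coeff_minus)
  have "\<exists>g. L2_torus g \<and> (\<forall>k. fourier_coeff g k = c j k) \<and>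
      ennreal (LINT x|torus_measure. (g x)\<^sup>2) = ennreal ((2*pi)^3) * energy (c j)" for j
    by (rule riesz_fischer[OF e1 e2]) blast
  then obtain G where G: "\<And>j. L2_torus (G j)" "\<And>j k. fourier_coeff (G j) k = c j k"
     "\<And>j. ennreal (LINT x|torus_measure. (G j x)\<^sup>2) = ennreal ((2*pi)^3) * energy (c j)"
    by metis
  define g where "g = (\<lambda>x. \<chi> j. G j x)"
  have gw: "has_weak_gradient f g"
    using G by (simp add: has_weak_gradient_def g_def c_def)
  have [measurable]: "G j \<in> borel_measurable torus_measure" for j using G(1) by (rule L2_torus_measurable)
  have nG: "(\<integral>\<^sup>+x. ennreal ((G j x)\<^sup>2) \<partial>torus_measure) = ennreal ((2*pi)^3) * energy (c j)" for j
    unfolding G(3)[symmetric] using G(1) by (intro nn_integral_eq_integral L2_torus_sq_integrable) auto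
  have "(\<integral>\<^sup>+ x. ennreal ((norm (g x))\<^sup>2) \<partial>torus_measure)
      = (\<integral>\<^sup>+ x. (ennreal ((G 1 x)\<^sup>2) + ennreal ((G 2 x)\<^sup>2)) + ennreal ((G 3 x)\<^sup>2) \<partial>torus_measure)"
    by (simp add: norm_3_sq g_def flip: ennreal_plus)
  also have "\<dots> = ennreal ((2*pi)^3) * energy (c 1) + ennreal ((2*pi)^3) * energy (c 2) + ennreal ((2*pi)^3) * energy (c 3)"
    by (subst nn_integral_add, measurable)+ (simp only: nG)
  also have "\<dots> = ennreal ((2*pi)^3) * (energy (c 1) + energy (c 2) + energy (c 3))"
    by (simp add: distrib_left)
  also have "energy (c 1) + energy (c 2) + energy (c 3) = wsq (\<lambda>k. (norm (freq k))\<^sup>2) (fourier_coeff f)"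
    unfolding ec unfolding wsq_def
    by (simp add: norm_3_sq distrib_right ennreal_plus nn_integral_add)
  finally have eq: "(\<integral>\<^sup>+ x. ennreal ((norm (g x))\<^sup>2) \<partial>torus_measure) = ennreal ((2*pi)^3) * wsq (\<lambda>k. (norm (freq k))\<^sup>2) (fourier_coeff f)" .
  show ?thesis
    unfolding gradient_L2_sq_def eq[symmetric] by (rule INF_lower) (use gw in simp)
qed

section \<open>The weighted energy inequality\<close>

lemma adv_measurable [measurable]:
  fixes x y :: "real \<Rightarrow> int^3 \<Rightarrow> complex"
  assumes c: "\<And>k. continuous_on UNIV (\<lambda>t. x t k)" "\<And>k. continuous_on UNIV (\<lambda>t. y t k)"
    and e: "\<And>t. energy (x t) < \<infinity>" "\<And>t. energy (y t) < \<infinity>"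
  shows "(\<lambda>t. adv (x t) (y t) k) \<in> borel_measurable borel"
proof (rule borel_measurable_LIMSEQ_metric)
  show "(\<lambda>n. \<Sum>l\<in>cube n. \<i> * complex_of_real (ker k l) * x t (k - l) * y t l) \<longlonglongrightarrow> adv (x t) (y t) k" for t
    unfolding adv_def by (rule infsum_cube_tendsto[OF adv_term_finite[OF e]])
  show "(\<lambda>t. \<Sum>l\<in>cube n. \<i> * complex_of_real (ker k l) * x t (k - l) * y t l) \<in> borel_measurable borel" for n
    by (intro borel_measurable_continuous_onI continuous_intros c)
qed

lemma esum_nn_integral_swap:
  fixes f :: "'a::countable \<Rightarrow> 'b \<Rightarrow> ennreal"
  assumes "\<And>k. f k \<in> borel_measurable M"
  shows "(\<integral>\<^sup>+x. esum (\<lambda>k. f k x) \<partial>M) = esum (\<lambda>k. \<integral>\<^sup>+x. f k x \<partial>M)"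
  using assms by (intro nn_integral_count_space_nn_integral) auto

lemma esum_measurable [measurable]:
  fixes f :: "int^3 \<Rightarrow> 'b \<Rightarrow> ennreal"
  assumes [measurable]: "\<And>k. f k \<in> borel_measurable M"
  shows "(\<lambda>x. esum (\<lambda>k. f k x)) \<in> borel_measurable M"
proof (rule borel_measurable_LIMSEQ_order)
  show "(\<lambda>n. \<Sum>k\<in>cube n. f k x) \<longlonglongrightarrow> esum (\<lambda>k. f k x)" for x
    by (rule esum_cube_tendsto)
qed measurable

text \<open>The fundamental theorem for the gauge integral supplies the integrability of the
  derivative D, and D is then compared with U - A. Stating the result in \<open>ennreal\<close>
  makes the case of an infinite integral of U trivial.\<close>

lemma ftc_nn_integral_le:
  fixes E D U A :: "real \<Rightarrow> real"
  assumes st: "s \<le> t"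
    and D: "\<And>\<tau>. \<tau> \<in> {s..t} \<Longrightarrow> (E has_vector_derivative D \<tau>) (at \<tau> within {s..t})"
    and le: "\<And>\<tau>. \<tau> \<in> {s..t} \<Longrightarrow> D \<tau> \<le> U \<tau> - A \<tau>"
    and U: "U \<in> borel_measurable borel" "\<And>\<tau>. 0 \<le> U \<tau>"
    and A: "continuous_on UNIV A" "\<And>\<tau>. 0 \<le> A \<tau>" and E: "0 \<le> E s" "0 \<le> E t"
  shows "ennreal (E t) + (\<integral>\<^sup>+\<tau>. ennreal (A \<tau>) * indicator {s..t} \<tau> \<partial>lborel)
    \<le> ennreal (E s) + (\<integral>\<^sup>+\<tau>. ennreal (U \<tau>) * indicator {s..t} \<tau> \<partial>lborel)"
proof (cases "(\<integral>\<^sup>+\<tau>. ennreal (U \<tau>) * indicator {s..t} \<tau> \<partial>lborel) = \<infinity>")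
  case False
  have eq: "ennreal (f \<tau>) * indicator {s..t} \<tau> = ennreal (indicator {s..t} \<tau> *\<^sub>R f \<tau>)" for f :: "real \<Rightarrow> real" and \<tau>
    by (auto simp: indicator_def)
  have [measurable]: "A \<in> borel_measurable borel" by (rule borel_measurable_continuous_onI[OF A(1)])
  have IU: "set_integrable lborel {s..t} U"
    unfolding set_integrable_def
  proof (rule integrableI_nonneg)
    show "(\<integral>\<^sup>+\<tau>. ennreal (indicator {s..t} \<tau> *\<^sub>R U \<tau>) \<partial>lborel) < \<infinity>"
      using False by (simp add: eq less_top)
  qed (use U in auto)
  have IA: "set_integrable lborel {s..t} A"
    by (rule borel_integrable_atLeastAtMost') (rule continuous_on_subset[OF A(1)], simp)
  have "(D has_integral (E t - E s)) {s..t}"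
    by (rule fundamental_theorem_of_calculus[OF st D])
  moreover have "((\<lambda>\<tau>. U \<tau> - A \<tau>) has_integral (LINT \<tau>:{s..t}|lborel. U \<tau>) - (LINT \<tau>:{s..t}|lborel. A \<tau>)) {s..t}"
    using set_borel_integral_eq_integral[OF IU] set_borel_integral_eq_integral[OF IA]
    by (intro has_integral_diff) (simp_all add: has_integral_integrable_integral)
  ultimately have "E t - E s \<le> (LINT \<tau>:{s..t}|lborel. U \<tau>) - (LINT \<tau>:{s..t}|lborel. A \<tau>)"
    by (rule has_integral_le) (rule le)
  moreover have "(\<integral>\<^sup>+\<tau>. ennreal (U \<tau>) * indicator {s..t} \<tau> \<partial>lborel) = ennreal (LINT \<tau>:{s..t}|lborel. U \<tau>)"
    unfolding eq set_lebesgue_integral_def using IU U by (intro nn_integral_eq_integral) (auto simp: set_integrable_def)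
  moreover have "(\<integral>\<^sup>+\<tau>. ennreal (A \<tau>) * indicator {s..t} \<tau> \<partial>lborel) = ennreal (LINT \<tau>:{s..t}|lborel. A \<tau>)"
    unfolding eq set_lebesgue_integral_def using IA A by (intro nn_integral_eq_integral) (auto simp: set_integrable_def)
  moreover have "0 \<le> (LINT \<tau>:{s..t}|lborel. U \<tau>)" "0 \<le> (LINT \<tau>:{s..t}|lborel. A \<tau>)"
    unfolding set_lebesgue_integral_def using U A by (auto intro!: integral_nonneg_AE)
  ultimately show ?thesis
    using E by (simp add: ennreal_leI flip: ennreal_plus)
qed simp

lemma has_vector_derivative_norm_sq:
  fixes w :: "real \<Rightarrow> complex"
  assumes "(w has_vector_derivative d) (at \<tau> within S)"
  shows "((\<lambda>\<tau>. (cmod (w \<tau>))\<^sup>2) has_vector_derivative 2 * Re (d * cnj (w \<tau>))) (at \<tau> within S)"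
proof -
  have "((\<lambda>\<tau>. w \<tau> \<bullet> w \<tau>) has_vector_derivative (w \<tau> \<bullet> d + d \<bullet> w \<tau>)) (at \<tau> within S)"
    using assms bounded_bilinear.has_vector_derivative[OF bounded_bilinear_inner] by blast
  moreover have "w \<tau> \<bullet> d + d \<bullet> w \<tau> = 2 * Re (d * cnj (w \<tau>))"
    by (simp add: inner_complex_def algebra_simps)
  ultimately show ?thesis by (simp add: power2_norm_eq_inner)
qed

lemma adv_cube_remainder_le:
  assumes "energy \<phi> < \<infinity>" "energy w < \<infinity>"
  shows "ennreal (cmod (adv \<phi> w k - (\<Sum>l\<in>cube n. \<i> * complex_of_real (ker k l) * \<phi> (k - l) * w l)))
    \<le> esum (\<lambda>l. ennreal (\<bar>ker k l\<bar> * cmod (\<phi> (k - l)) * cmod (w l)) * indicator (- cube n) l)"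
proof -
  define t where "t = (\<lambda>l. \<i> * complex_of_real (ker k l) * \<phi> (k - l) * w l)"
  have s: "t summable_on X" for X
    unfolding t_def using abs_summable_of_esum(1)[OF adv_term_finite[OF assms]] .
  have "adv \<phi> w k = infsum t (cube n \<union> - cube n)" by (simp add: adv_def t_def Compl_partition)
  also have "\<dots> = infsum t (cube n) + infsum t (- cube n)"
    by (intro infsum_Un_disjoint s) auto
  also have "infsum t (- cube n) = (\<Sum>\<^sub>\<infinity>l. t l * indicator (- cube n) l)"
    by (rule infsum_cong_neutral) (auto simp: indicator_def)
  finally have "adv \<phi> w k - sum t (cube n) = (\<Sum>\<^sub>\<infinity>l. t l * indicator (- cube n) l)" by simp
  then have "ennreal (cmod (adv \<phi> w k - sum t (cube n))) \<le> esum (\<lambda>l. ennreal (norm (t l * indicator (- cube n) l)))"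
    using norm_infsum_le_esum by simp
  also have "\<dots> = esum (\<lambda>l. ennreal (\<bar>ker k l\<bar> * cmod (\<phi> (k - l)) * cmod (w l)) * indicator (- cube n) l)"
    by (intro nn_integral_cong) (auto simp: t_def norm_mult indicator_def)
  finally show ?thesis by (simp add: t_def)
qed

text \<open>A linear equation for w with source g, advected by the velocity of
  \<open>\<phi>\<close>. Uniqueness takes w as the difference of two solutions with constant weight
  1; the gradient estimate takes w and \<open>\<phi>\<close> to be the same solution with a
  truncated power as weight. The bound B on the weight is what makes the truncation error
  vanish.\<close>

locale energy_setup =
  fixes w \<phi> g :: "real \<Rightarrow> int^3 \<Rightarrow> complex" and m a :: "int^3 \<Rightarrow> real" and s t B :: real
  assumes st: "s \<le> t" and a: "\<And>k. 0 \<le> a k" and m: "\<And>k. 0 \<le> m k" "\<And>k. m k \<le> B"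
    and wc: "\<And>k. continuous_on UNIV (\<lambda>\<tau>. w \<tau> k)" and \<phi>c: "\<And>k. continuous_on UNIV (\<lambda>\<tau>. \<phi> \<tau> k)"
    and gm: "\<And>k. (\<lambda>\<tau>. g \<tau> k) \<in> borel_measurable borel"
    and \<phi>e: "\<And>\<tau>. energy (\<phi> \<tau>) < \<infinity>" and we: "\<And>\<tau>. energy (w \<tau>) < \<infinity>"
    and \<phi>real: "\<And>\<tau> k. \<phi> \<tau> (- k) = cnj (\<phi> \<tau> k)"
    and deriv: "\<And>\<tau> k. \<tau> \<in> {s..t} \<Longrightarrow> ((\<lambda>\<tau>. w \<tau> k) has_vector_derivative
        (g \<tau> k - adv (\<phi> \<tau>) (w \<tau>) k - complex_of_real (a k) * w \<tau> k)) (at \<tau> within {s..t})"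
begin

definition q :: "real \<Rightarrow> int^3 \<Rightarrow> int^3 \<Rightarrow> real" where
  "q \<tau> k l = \<bar>ker k l\<bar> * cmod (\<phi> \<tau> (k - l)) * cmod (w \<tau> l) * cmod (w \<tau> k)"

text \<open>Antisymmetry is exact only when both frequencies range over the same cube, so the
  contribution of the frequencies l outside it is split off.\<close>

definition rem :: "nat \<Rightarrow> real \<Rightarrow> int^3 \<Rightarrow> complex" where
  "rem n \<tau> k = adv (\<phi> \<tau>) (w \<tau>) k - (\<Sum>l\<in>cube n. \<i> * complex_of_real (ker k l) * \<phi> \<tau> (k - l) * w \<tau> l)"

lemma B_nonneg: "0 \<le> B"
  using m order_trans by blast

lemma q_nonneg [simp]: "0 \<le> q \<tau> k l"
  by (simp add: q_def)

lemma wm [measurable]: "(\<lambda>\<tau>. w \<tau> k) \<in> borel_measurable borel"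
  by (rule borel_measurable_continuous_onI[OF wc])

lemma \<phi>m [measurable]: "(\<lambda>\<tau>. \<phi> \<tau> k) \<in> borel_measurable borel"
  by (rule borel_measurable_continuous_onI[OF \<phi>c])

lemma qm [measurable]: "(\<lambda>\<tau>. q \<tau> k l) \<in> borel_measurable borel"
  unfolding q_def by measurable

lemma remm [measurable]: "(\<lambda>\<tau>. rem n \<tau> k) \<in> borel_measurable borel"
  unfolding rem_def by (intro borel_measurable_diff adv_measurable wc \<phi>c \<phi>e we borel_measurable_continuous_onI continuous_intros)

text \<open>The block with both frequencies in the cube leaves only the commutator of the weight.
  The remainder has no cancellation and is estimated with m k <= B.\<close>

lemma truncated_rate_le:
  "(\<Sum>k\<in>cube n. m k * (2 * Re ((g \<tau> k - adv (\<phi> \<tau>) (w \<tau>) k - complex_of_real (a k) * w \<tau> k) * cnj (w \<tau> k))))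
   \<le> ((\<Sum>k\<in>cube n. 2 * (m k * cmod (g \<tau> k) * cmod (w \<tau> k)))
       + (\<Sum>k\<in>cube n. \<Sum>l\<in>cube n. \<bar>m k - m l\<bar> * q \<tau> k l)
       + (\<Sum>k\<in>cube n. 2 * (B * cmod (rem n \<tau> k) * cmod (w \<tau> k))))
     - (\<Sum>k\<in>cube n. 2 * (m k * a k) * (cmod (w \<tau> k))\<^sup>2)"
proof -
  define Y where "Y = (\<lambda>k. \<Sum>l\<in>cube n. \<i> * complex_of_real (ker k l) * \<phi> \<tau> (k - l) * w \<tau> l)"
  have adv: "adv (\<phi> \<tau>) (w \<tau>) k = Y k + rem n \<tau> k" for k by (simp add: rem_def Y_def)
  have "m k * (2 * Re ((g \<tau> k - adv (\<phi> \<tau>) (w \<tau>) k - complex_of_real (a k) * w \<tau> k) * cnj (w \<tau> k)))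
     \<le> 2 * (m k * cmod (g \<tau> k) * cmod (w \<tau> k)) + 2 * - Re (complex_of_real (m k) * Y k * cnj (w \<tau> k))
       + 2 * (B * cmod (rem n \<tau> k) * cmod (w \<tau> k)) - 2 * (m k * a k) * (cmod (w \<tau> k))\<^sup>2" for k
  proof -
    have 1: "Re (g \<tau> k * cnj (w \<tau> k)) \<le> cmod (g \<tau> k) * cmod (w \<tau> k)"
      using complex_Re_le_cmod[of "g \<tau> k * cnj (w \<tau> k)"] by (simp only: norm_mult complex_mod_cnj)
    have 2: "- Re (rem n \<tau> k * cnj (w \<tau> k)) \<le> cmod (rem n \<tau> k) * cmod (w \<tau> k)"
      using abs_Re_le_cmod[of "rem n \<tau> k * cnj (w \<tau> k)"] by (simp only: norm_mult complex_mod_cnj)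
    have 3: "Re (w \<tau> k * cnj (w \<tau> k)) = (cmod (w \<tau> k))\<^sup>2"
      by (metis Re_complex_of_real complex_norm_square)
    have R: "Re ((g \<tau> k - adv (\<phi> \<tau>) (w \<tau>) k - complex_of_real (a k) * w \<tau> k) * cnj (w \<tau> k))
      = Re (g \<tau> k * cnj (w \<tau> k)) - Re (Y k * cnj (w \<tau> k)) - Re (rem n \<tau> k * cnj (w \<tau> k)) - a k * (cmod (w \<tau> k))\<^sup>2"
      unfolding adv left_diff_distrib distrib_right mult.assoc[of "complex_of_real (a k)"]
      by (simp only: minus_complex.sel plus_complex.sel Re_of_real_mult 3 diff_diff_eq)
    have "m k * (2 * Re ((g \<tau> k - adv (\<phi> \<tau>) (w \<tau>) k - complex_of_real (a k) * w \<tau> k) * cnj (w \<tau> k)))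
      = 2 * (m k * Re (g \<tau> k * cnj (w \<tau> k))) + 2 * - (m k * Re (Y k * cnj (w \<tau> k)))
        + 2 * (m k * - Re (rem n \<tau> k * cnj (w \<tau> k))) - 2 * (m k * a k) * (cmod (w \<tau> k))\<^sup>2"
      unfolding R by (simp add: algebra_simps)
    also have "m k * Re (Y k * cnj (w \<tau> k)) = Re (complex_of_real (m k) * Y k * cnj (w \<tau> k))"
      unfolding mult.assoc[of "complex_of_real (m k)"] by (rule Re_of_real_mult[symmetric])
    finally show ?thesis
      using mult_left_mono[OF 1 m(1)[of k]]
        order_trans[OF mult_left_mono[OF 2 m(1)[of k]] mult_right_mono[OF m(2)[of k], of "cmod (rem n \<tau> k) * cmod (w \<tau> k)"]]
      by (simp add: mult.assoc)
  qed
  then have "(\<Sum>k\<in>cube n. m k * (2 * Re ((g \<tau> k - adv (\<phi> \<tau>) (w \<tau>) k - complex_of_real (a k) * w \<tau> k) * cnj (w \<tau> k))))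
    \<le> (\<Sum>k\<in>cube n. 2 * (m k * cmod (g \<tau> k) * cmod (w \<tau> k)) + 2 * - Re (complex_of_real (m k) * Y k * cnj (w \<tau> k))
       + 2 * (B * cmod (rem n \<tau> k) * cmod (w \<tau> k)) - 2 * (m k * a k) * (cmod (w \<tau> k))\<^sup>2)"
    by (rule sum_mono)
  also have "\<dots> = (\<Sum>k\<in>cube n. 2 * (m k * cmod (g \<tau> k) * cmod (w \<tau> k)))
       - 2 * Re (\<Sum>k\<in>cube n. complex_of_real (m k) * Y k * cnj (w \<tau> k))
       + (\<Sum>k\<in>cube n. 2 * (B * cmod (rem n \<tau> k) * cmod (w \<tau> k))) - (\<Sum>k\<in>cube n. 2 * (m k * a k) * (cmod (w \<tau> k))\<^sup>2)"
    by (simp only: sum_subtractf sum.distrib sum_distrib_left[symmetric] sum_negf Re_sum)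
  finally have rate: "(\<Sum>k\<in>cube n. m k * (2 * Re ((g \<tau> k - adv (\<phi> \<tau>) (w \<tau>) k - complex_of_real (a k) * w \<tau> k) * cnj (w \<tau> k)))) \<le> \<dots>" .
  have "- (2 * Re (\<Sum>k\<in>cube n. complex_of_real (m k) * Y k * cnj (w \<tau> k)))
      \<le> (\<Sum>k\<in>cube n. \<Sum>l\<in>cube n. \<bar>m k - m l\<bar> * q \<tau> k l)"
  proof -
    have "(\<Sum>k\<in>cube n. complex_of_real (m k) * Y k * cnj (w \<tau> k))
       = (\<Sum>k\<in>cube n. \<Sum>l\<in>cube n. complex_of_real (m k) * (\<i> * complex_of_real (ker k l) * \<phi> \<tau> (k - l) * w \<tau> l) * cnj (w \<tau> k))"
      by (simp add: Y_def sum_distrib_left sum_distrib_right)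
    then show ?thesis
      using adv_antisymmetric[of "cube n" "\<phi> \<tau>" m "w \<tau>"] \<phi>real unfolding q_def by (simp del: Re_sum)
  qed
  with rate show ?thesis by linarith
qed

lemma truncated_energy_le:
  "ennreal (\<Sum>k\<in>cube n. m k * (cmod (w t k))\<^sup>2)
     + (\<integral>\<^sup>+\<tau>. ennreal (\<Sum>k\<in>cube n. 2 * (m k * a k) * (cmod (w \<tau> k))\<^sup>2) * indicator {s..t} \<tau> \<partial>lborel)
   \<le> ennreal (\<Sum>k\<in>cube n. m k * (cmod (w s k))\<^sup>2)
     + (\<integral>\<^sup>+\<tau>. ennreal ((\<Sum>k\<in>cube n. 2 * (m k * cmod (g \<tau> k) * cmod (w \<tau> k)))
       + (\<Sum>k\<in>cube n. \<Sum>l\<in>cube n. \<bar>m k - m l\<bar> * q \<tau> k l)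
       + (\<Sum>k\<in>cube n. 2 * (B * cmod (rem n \<tau> k) * cmod (w \<tau> k)))) * indicator {s..t} \<tau> \<partial>lborel)"
proof (rule ftc_nn_integral_le[OF st _ truncated_rate_le])
  show "((\<lambda>\<tau>. \<Sum>k\<in>cube n. m k * (cmod (w \<tau> k))\<^sup>2) has_vector_derivative
     (\<Sum>k\<in>cube n. m k * (2 * Re ((g \<tau> k - adv (\<phi> \<tau>) (w \<tau>) k - complex_of_real (a k) * w \<tau> k) * cnj (w \<tau> k))))) (at \<tau> within {s..t})"
    if "\<tau> \<in> {s..t}" for \<tau>
    by (intro has_vector_derivative_sum has_vector_derivative_mult_right has_vector_derivative_norm_sq deriv that)
  show "(\<lambda>\<tau>. (\<Sum>k\<in>cube n. 2 * (m k * cmod (g \<tau> k) * cmod (w \<tau> k)))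
       + (\<Sum>k\<in>cube n. \<Sum>l\<in>cube n. \<bar>m k - m l\<bar> * q \<tau> k l)
       + (\<Sum>k\<in>cube n. 2 * (B * cmod (rem n \<tau> k) * cmod (w \<tau> k)))) \<in> borel_measurable borel"
    using gm by measurable
  show "continuous_on UNIV (\<lambda>\<tau>. \<Sum>k\<in>cube n. 2 * (m k * a k) * (cmod (w \<tau> k))\<^sup>2)"
    by (intro continuous_intros wc)
qed (use m a B_nonneg in \<open>auto intro!: sum_nonneg add_nonneg_nonneg mult_nonneg_nonneg\<close>)

text \<open>The remainder at level n is bounded by the sum over l outside the cube of a fixed family
  \<open>f\<close>. Interchanging sums and time integral turns the hypothesis into summability of
  \<open>f\<close>, so the tails tend to 0.\<close>

lemma remainder_integral_tendsto_0:
  assumes fin: "(\<integral>\<^sup>+\<tau>. esum (\<lambda>k. esum (\<lambda>l. ennreal (q \<tau> k l))) * indicator {s..t} \<tau> \<partial>lborel) < \<infinity>"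
  shows "(\<lambda>n. \<integral>\<^sup>+\<tau>. ennreal (\<Sum>k\<in>cube n. 2 * (B * cmod (rem n \<tau> k) * cmod (w \<tau> k))) * indicator {s..t} \<tau> \<partial>lborel) \<longlonglongrightarrow> 0"
proof (rule tendsto_sandwich[OF always_eventually always_eventually tendsto_const])
  define f where "f = (\<lambda>l. \<integral>\<^sup>+\<tau>. esum (\<lambda>k. ennreal (q \<tau> k l)) * indicator {s..t} \<tau> \<partial>lborel)"
  have ef: "esum f < \<infinity>"
  proof -
    have "esum f = (\<integral>\<^sup>+\<tau>. esum (\<lambda>l. esum (\<lambda>k. ennreal (q \<tau> k l)) * indicator {s..t} \<tau>) \<partial>lborel)"
      unfolding f_def by (rule esum_nn_integral_swap[symmetric]) measurable
    also have "\<dots> = (\<integral>\<^sup>+\<tau>. esum (\<lambda>k. esum (\<lambda>l. ennreal (q \<tau> k l))) * indicator {s..t} \<tau> \<partial>lborel)"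
      by (simp add: nn_integral_multc esum_swap[of "\<lambda>k l. ennreal (q _ k l)"])
    finally show ?thesis using fin by simp
  qed
  have "(\<lambda>n. esum (\<lambda>l. f l * indicator (- cube n) l)) \<longlonglongrightarrow> esum (\<lambda>l::int^3. 0)"
  proof (rule nn_integral_dominated_convergence[where w=f])
    show "AE l in count_space UNIV. (\<lambda>n. f l * indicator (- cube n) l) \<longlonglongrightarrow> 0"
    proof (rule AE_I2)
      fix l
      show "(\<lambda>n. f l * indicator (- cube n) l) \<longlonglongrightarrow> 0"
        by (rule tendsto_eventually, rule eventually_mono[OF in_cube_eventually[of l]]) auto
    qed
  qed (use ef in \<open>auto simp: indicator_def\<close>)
  then have "(\<lambda>n. ennreal (2 * B) * esum (\<lambda>l. f l * indicator (- cube n) l)) \<longlonglongrightarrow> ennreal (2 * B) * 0"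
    by (intro ennreal_tendsto_cmult) auto
  then show "(\<lambda>n. ennreal (2 * B) * esum (\<lambda>l. f l * indicator (- cube n) l)) \<longlonglongrightarrow> 0" by simp
  show "\<forall>n. (\<integral>\<^sup>+\<tau>. ennreal (\<Sum>k\<in>cube n. 2 * (B * cmod (rem n \<tau> k) * cmod (w \<tau> k))) * indicator {s..t} \<tau> \<partial>lborel)
      \<le> ennreal (2 * B) * esum (\<lambda>l. f l * indicator (- cube n) l)"
  proof
    fix n
    have le: "ennreal (\<Sum>k\<in>cube n. 2 * (B * cmod (rem n \<tau> k) * cmod (w \<tau> k)))
       \<le> ennreal (2 * B) * esum (\<lambda>l. esum (\<lambda>k. ennreal (q \<tau> k l)) * indicator (- cube n) l)" for \<tau>
    proof -
      have "ennreal (\<Sum>k\<in>cube n. 2 * (B * cmod (rem n \<tau> k) * cmod (w \<tau> k)))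
        = (\<Sum>k\<in>cube n. ennreal (2 * (B * cmod (rem n \<tau> k) * cmod (w \<tau> k))))"
        using B_nonneg by (intro sum_ennreal[symmetric]) auto
      also have "\<dots> = (\<Sum>k\<in>cube n. ennreal (2 * B) * (ennreal (cmod (rem n \<tau> k)) * ennreal (cmod (w \<tau> k))))"
        using B_nonneg by (intro sum.cong refl) (simp add: mult.assoc flip: ennreal_mult)
      also have "\<dots> \<le> esum (\<lambda>k. ennreal (2 * B) * (ennreal (cmod (rem n \<tau> k)) * ennreal (cmod (w \<tau> k))))"
        by (rule sum_le_esum) simp
      also have "\<dots> = ennreal (2 * B) * esum (\<lambda>k. ennreal (cmod (rem n \<tau> k)) * ennreal (cmod (w \<tau> k)))"
        by (rule nn_integral_cmult) simp
      also have "esum (\<lambda>k. ennreal (cmod (rem n \<tau> k)) * ennreal (cmod (w \<tau> k)))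
         \<le> esum (\<lambda>k. esum (\<lambda>l. ennreal (\<bar>ker k l\<bar> * cmod (\<phi> \<tau> (k - l)) * cmod (w \<tau> l)) * indicator (- cube n) l) * ennreal (cmod (w \<tau> k)))"
        unfolding rem_def by (intro nn_integral_mono mult_right_mono adv_cube_remainder_le \<phi>e we) auto
      also have "\<dots> = esum (\<lambda>k. esum (\<lambda>l. ennreal (q \<tau> k l) * indicator (- cube n) l))"
        by (intro nn_integral_cong, subst nn_integral_multc[symmetric])
           (auto intro!: nn_integral_cong simp: q_def ennreal_mult indicator_def)
      also have "\<dots> = esum (\<lambda>l. esum (\<lambda>k. ennreal (q \<tau> k l)) * indicator (- cube n) l)"
        by (subst esum_swap) (simp add: nn_integral_multc)
      finally show ?thesis by (simp add: mult_left_mono)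
    qed
    have "(\<integral>\<^sup>+\<tau>. ennreal (\<Sum>k\<in>cube n. 2 * (B * cmod (rem n \<tau> k) * cmod (w \<tau> k))) * indicator {s..t} \<tau> \<partial>lborel)
      \<le> (\<integral>\<^sup>+\<tau>. ennreal (2 * B) * esum (\<lambda>l. esum (\<lambda>k. ennreal (q \<tau> k l)) * indicator {s..t} \<tau> * indicator (- cube n) l) \<partial>lborel)"
    proof (intro nn_integral_mono)
      fix \<tau>
      show "ennreal (\<Sum>k\<in>cube n. 2 * (B * cmod (rem n \<tau> k) * cmod (w \<tau> k))) * indicator {s..t} \<tau>
         \<le> ennreal (2 * B) * esum (\<lambda>l. esum (\<lambda>k. ennreal (q \<tau> k l)) * indicator {s..t} \<tau> * indicator (- cube n) l)"
        using le[of \<tau>] by (cases "\<tau> \<in> {s..t}") auto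
    qed
    also have "\<dots> = ennreal (2 * B) * (\<integral>\<^sup>+\<tau>. esum (\<lambda>l. esum (\<lambda>k. ennreal (q \<tau> k l)) * indicator {s..t} \<tau> * indicator (- cube n) l) \<partial>lborel)"
      by (rule nn_integral_cmult) measurable
    also have "(\<integral>\<^sup>+\<tau>. esum (\<lambda>l. esum (\<lambda>k. ennreal (q \<tau> k l)) * indicator {s..t} \<tau> * indicator (- cube n) l) \<partial>lborel)
       = esum (\<lambda>l. f l * indicator (- cube n) l)"
      unfolding f_def by (subst esum_nn_integral_swap) (measurable, simp add: nn_integral_multc)
    finally show "(\<integral>\<^sup>+\<tau>. ennreal (\<Sum>k\<in>cube n. 2 * (B * cmod (rem n \<tau> k) * cmod (w \<tau> k))) * indicator {s..t} \<tau> \<partial>lborel)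
      \<le> ennreal (2 * B) * esum (\<lambda>l. f l * indicator (- cube n) l)" .
  qed
qed auto

text \<open>As the cubes grow, the left-hand side tends to the full sums, the source and the
  commutator are dominated by their full sums, and the remainder disappears. Regularity enters
  through \<open>fin\<close> alone, which a square integrable H^(1/2) norm and a bounded velocity
  guarantee.\<close>

theorem weighted_energy_inequality:
  assumes fin: "(\<integral>\<^sup>+\<tau>. esum (\<lambda>k. esum (\<lambda>l. ennreal (q \<tau> k l))) * indicator {s..t} \<tau> \<partial>lborel) < \<infinity>"
  shows "wsq m (w t) + (\<integral>\<^sup>+\<tau>. wsq (\<lambda>k. 2 * (m k * a k)) (w \<tau>) * indicator {s..t} \<tau> \<partial>lborel)
    \<le> wsq m (w s) + (\<integral>\<^sup>+\<tau>. (esum (\<lambda>k. ennreal (2 * (m k * cmod (g \<tau> k) * cmod (w \<tau> k))))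
         + esum (\<lambda>k. esum (\<lambda>l. ennreal (\<bar>m k - m l\<bar> * q \<tau> k l)))) * indicator {s..t} \<tau> \<partial>lborel)"
    (is "?L \<le> ?R")
proof -
  define Err where "Err = (\<lambda>n. \<integral>\<^sup>+\<tau>. ennreal (\<Sum>k\<in>cube n. 2 * (B * cmod (rem n \<tau> k) * cmod (w \<tau> k))) * indicator {s..t} \<tau> \<partial>lborel)"
  define L where "L = (\<lambda>n. (\<Sum>k\<in>cube n. ennreal (m k * (cmod (w t k))\<^sup>2))
     + (\<Sum>k\<in>cube n. \<integral>\<^sup>+\<tau>. ennreal (2 * (m k * a k) * (cmod (w \<tau> k))\<^sup>2) * indicator {s..t} \<tau> \<partial>lborel))"
  have Llim: "L \<longlonglongrightarrow> ?L"
  proof -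
    have "L \<longlonglongrightarrow> wsq m (w t) + esum (\<lambda>k. \<integral>\<^sup>+\<tau>. ennreal (2 * (m k * a k) * (cmod (w \<tau> k))\<^sup>2) * indicator {s..t} \<tau> \<partial>lborel)"
      unfolding L_def wsq_def by (intro tendsto_add esum_cube_tendsto)
    also have "esum (\<lambda>k. \<integral>\<^sup>+\<tau>. ennreal (2 * (m k * a k) * (cmod (w \<tau> k))\<^sup>2) * indicator {s..t} \<tau> \<partial>lborel)
      = (\<integral>\<^sup>+\<tau>. wsq (\<lambda>k. 2 * (m k * a k)) (w \<tau>) * indicator {s..t} \<tau> \<partial>lborel)"
      unfolding wsq_def by (subst esum_nn_integral_swap[symmetric]) (measurable, simp add: nn_integral_multc)
    finally show ?thesis .
  qed
  have LR: "L n \<le> ?R + Err n" for n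
  proof -
    define X where "X = (\<lambda>\<tau>. esum (\<lambda>k. ennreal (2 * (m k * cmod (g \<tau> k) * cmod (w \<tau> k))))
         + esum (\<lambda>k. esum (\<lambda>l. ennreal (\<bar>m k - m l\<bar> * q \<tau> k l))))"
    have Xm: "X \<in> borel_measurable lborel" unfolding X_def using gm by measurable
    have "L n = ennreal (\<Sum>k\<in>cube n. m k * (cmod (w t k))\<^sup>2)
     + (\<integral>\<^sup>+\<tau>. ennreal (\<Sum>k\<in>cube n. 2 * (m k * a k) * (cmod (w \<tau> k))\<^sup>2) * indicator {s..t} \<tau> \<partial>lborel)"
    proof -
      have "(\<integral>\<^sup>+\<tau>. ennreal (\<Sum>k\<in>cube n. 2 * (m k * a k) * (cmod (w \<tau> k))\<^sup>2) * indicator {s..t} \<tau> \<partial>lborel)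
         = (\<integral>\<^sup>+\<tau>. (\<Sum>k\<in>cube n. ennreal (2 * (m k * a k) * (cmod (w \<tau> k))\<^sup>2) * indicator {s..t} \<tau>) \<partial>lborel)"
        using m a by (intro nn_integral_cong) (auto simp: indicator_def)
      also have "\<dots> = (\<Sum>k\<in>cube n. \<integral>\<^sup>+\<tau>. ennreal (2 * (m k * a k) * (cmod (w \<tau> k))\<^sup>2) * indicator {s..t} \<tau> \<partial>lborel)"
        by (rule nn_integral_sum) measurable
      finally show ?thesis using m by (simp add: L_def)
    qed
    also note truncated_energy_le
    also have "ennreal (\<Sum>k\<in>cube n. m k * (cmod (w s k))\<^sup>2)
     + (\<integral>\<^sup>+\<tau>. ennreal ((\<Sum>k\<in>cube n. 2 * (m k * cmod (g \<tau> k) * cmod (w \<tau> k)))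
       + (\<Sum>k\<in>cube n. \<Sum>l\<in>cube n. \<bar>m k - m l\<bar> * q \<tau> k l)
       + (\<Sum>k\<in>cube n. 2 * (B * cmod (rem n \<tau> k) * cmod (w \<tau> k)))) * indicator {s..t} \<tau> \<partial>lborel)
      \<le> wsq m (w s) + (\<integral>\<^sup>+\<tau>. X \<tau> * indicator {s..t} \<tau>
         + ennreal (\<Sum>k\<in>cube n. 2 * (B * cmod (rem n \<tau> k) * cmod (w \<tau> k))) * indicator {s..t} \<tau> \<partial>lborel)"
    proof (intro add_mono nn_integral_mono)
      show "ennreal (\<Sum>k\<in>cube n. m k * (cmod (w s k))\<^sup>2) \<le> wsq m (w s)"
        unfolding wsq_def using sum_le_esum[OF finite_cube, of "\<lambda>k. ennreal (m k * (cmod (w s k))\<^sup>2)"] m by simp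
      fix \<tau>
      have 1: "ennreal (\<Sum>k\<in>cube n. 2 * (m k * cmod (g \<tau> k) * cmod (w \<tau> k))) \<le> esum (\<lambda>k. ennreal (2 * (m k * cmod (g \<tau> k) * cmod (w \<tau> k))))"
        using sum_le_esum[OF finite_cube, of "\<lambda>k. ennreal (2 * (m k * cmod (g \<tau> k) * cmod (w \<tau> k)))"] m
        by (subst sum_ennreal[symmetric]) auto
      have "ennreal (\<Sum>k\<in>cube n. \<Sum>l\<in>cube n. \<bar>m k - m l\<bar> * q \<tau> k l) = (\<Sum>k\<in>cube n. \<Sum>l\<in>cube n. ennreal (\<bar>m k - m l\<bar> * q \<tau> k l))"
        by (simp add: sum_nonneg)
      also have "\<dots> \<le> (\<Sum>k\<in>cube n. esum (\<lambda>l. ennreal (\<bar>m k - m l\<bar> * q \<tau> k l)))"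
        by (intro sum_mono sum_le_esum) simp
      also have "\<dots> \<le> esum (\<lambda>k. esum (\<lambda>l. ennreal (\<bar>m k - m l\<bar> * q \<tau> k l)))"
        by (rule sum_le_esum) simp
      finally have 2: "ennreal (\<Sum>k\<in>cube n. \<Sum>l\<in>cube n. \<bar>m k - m l\<bar> * q \<tau> k l) \<le> \<dots>" .
      have p: "0 \<le> (\<Sum>k\<in>cube n. 2 * (m k * cmod (g \<tau> k) * cmod (w \<tau> k)))"
        "0 \<le> (\<Sum>k\<in>cube n. \<Sum>l\<in>cube n. \<bar>m k - m l\<bar> * q \<tau> k l)"
        "0 \<le> (\<Sum>k\<in>cube n. 2 * (B * cmod (rem n \<tau> k) * cmod (w \<tau> k)))"
        using m B_nonneg by (auto intro!: sum_nonneg)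
      show "ennreal ((\<Sum>k\<in>cube n. 2 * (m k * cmod (g \<tau> k) * cmod (w \<tau> k)))
       + (\<Sum>k\<in>cube n. \<Sum>l\<in>cube n. \<bar>m k - m l\<bar> * q \<tau> k l)
       + (\<Sum>k\<in>cube n. 2 * (B * cmod (rem n \<tau> k) * cmod (w \<tau> k)))) * indicator {s..t} \<tau>
        \<le> X \<tau> * indicator {s..t} \<tau> + ennreal (\<Sum>k\<in>cube n. 2 * (B * cmod (rem n \<tau> k) * cmod (w \<tau> k))) * indicator {s..t} \<tau>"
        unfolding X_def distrib_right[symmetric] using p
        by (intro mult_right_mono) (simp_all add: ennreal_plus add_mono 1 2 add_nonneg_nonneg del: sum_ennreal)
    qed
    also have "\<dots> = ?R + Err n"
    proof (subst nn_integral_add)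
      show "wsq m (w s) + ((\<integral>\<^sup>+\<tau>. X \<tau> * indicator {s..t} \<tau> \<partial>lborel)
        + (\<integral>\<^sup>+\<tau>. ennreal (\<Sum>k\<in>cube n. 2 * (B * cmod (rem n \<tau> k) * cmod (w \<tau> k))) * indicator {s..t} \<tau> \<partial>lborel)) = ?R + Err n"
        by (simp only: X_def Err_def add.assoc)
    qed (use Xm in measurable)
    finally show ?thesis .
  qed
  have "(\<lambda>n. ?R + Err n) \<longlonglongrightarrow> ?R + 0"
    unfolding Err_def by (intro tendsto_add tendsto_const remainder_integral_tendsto_0 fin)
  from LIMSEQ_le[OF Llim this] LR show ?thesis by auto
qed

end

section \<open>Solutions in terms of Fourier coefficients and their uniqueness\<close>

definition crhs :: "(int^3 \<Rightarrow> real) \<Rightarrow> (int^3 \<Rightarrow> complex) \<Rightarrow> (int^3 \<Rightarrow> complex) \<Rightarrow> int^3 \<Rightarrow> complex" where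
  "crhs a S x k = S k - adv x x k - complex_of_real (a k) * x k"

text \<open>Trajectories are defined on the whole line, continuous in each coefficient; only their values
  for nonnegative times carry the equation.\<close>

locale coeff_solution =
  fixes a :: "int^3 \<Rightarrow> real" and S c0 :: "int^3 \<Rightarrow> complex" and c :: "real \<Rightarrow> int^3 \<Rightarrow> complex"
  assumes real: "\<And>t k. c t (- k) = cnj (c t k)"
    and zero_mode: "\<And>t. c t 0 = 0"
    and cont: "\<And>k. continuous_on UNIV (\<lambda>t. c t k)"
    and bounded: "\<And>T. \<exists>M\<ge>0. \<forall>t\<le>T. energy (c t) \<le> ennreal (M\<^sup>2)"
    and half: "\<And>T. (\<integral>\<^sup>+t. half_energy (c t) * indicator {0..T} t \<partial>lborel) < \<infinity>"
    and eq: "\<And>t k. 0 \<le> t \<Longrightarrow> c t k = c0 k + integral {0..t} (\<lambda>s. crhs a S (c s) k)"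

text \<open>The energy bound up to time t + 1 covers a neighbourhood of t, so coefficientwise
  convergence passes through the advection term.\<close>

lemma crhs_continuous:
  assumes cont: "\<And>k. continuous_on UNIV (\<lambda>t::real. c t k)"
    and bounded: "\<And>T. \<exists>M\<ge>0. \<forall>t\<le>T. energy (c t) \<le> ennreal (M\<^sup>2)"
  shows "continuous_on UNIV (\<lambda>t. crhs a S (c t) k)"
proof -
  have lim: "((\<lambda>s. c s l) \<longlongrightarrow> c t l) (at t)" for t l
    using cont[of l] by (simp add: continuous_on_def)
  have "((\<lambda>s. adv (c s) (c s) k) \<longlongrightarrow> adv (c t) (c t) k) (at t)" for t
  proof -
    obtain M where M: "M \<ge> 0" "\<forall>s\<le>t + 1. energy (c s) \<le> ennreal (M\<^sup>2)" using bounded by blast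
    have "\<forall>\<^sub>F s in at t. s < t + 1"
      by (rule order_tendstoD(2)[OF tendsto_ident_at]) simp
    then have "\<forall>\<^sub>F s in at t. energy (c s) \<le> ennreal (M\<^sup>2)"
      by eventually_elim (use M in simp)
    then show ?thesis by (rule adv_tendsto[OF lim]) (use M in auto)
  qed
  then show ?thesis
    unfolding crhs_def continuous_on_def by (auto intro!: tendsto_intros lim)
qed

lemma wsq_measurable:
  assumes "\<And>k. continuous_on UNIV (\<lambda>t::real. c t k)"
  shows "(\<lambda>t. wsq m (c t)) \<in> borel_measurable borel"
proof -
  have [measurable]: "(\<lambda>t. c t k) \<in> borel_measurable borel" for k
    by (rule borel_measurable_continuous_onI[OF assms])
  show ?thesis unfolding wsq_def by measurable
qed

lemma wsq_diff_le:
  assumes "\<And>k. 0 \<le> m k"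
  shows "wsq m (\<lambda>k. x k - y k) \<le> 2 * (wsq m x + wsq m y)"
proof -
  have "ennreal (m k * (cmod (x k - y k))\<^sup>2) \<le> 2 * (ennreal (m k * (cmod (x k))\<^sup>2) + ennreal (m k * (cmod (y k))\<^sup>2))" for k
  proof -
    have "(cmod (x k - y k))\<^sup>2 \<le> (cmod (x k) + cmod (y k))\<^sup>2"
      by (intro power_mono norm_triangle_ineq4) auto
    also have "\<dots> \<le> 2 * ((cmod (x k))\<^sup>2 + (cmod (y k))\<^sup>2)"
      using sum_squares_bound[of "cmod (x k)" "cmod (y k)"] by (simp add: power2_sum)
    finally have "m k * (cmod (x k - y k))\<^sup>2 \<le> m k * (2 * ((cmod (x k))\<^sup>2 + (cmod (y k))\<^sup>2))"
      using assms by (rule mult_left_mono)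
    then have "ennreal (m k * (cmod (x k - y k))\<^sup>2) \<le> ennreal (2 * (m k * (cmod (x k))\<^sup>2 + m k * (cmod (y k))\<^sup>2))"
      by (intro ennreal_leI) (simp add: algebra_simps)
    also have "\<dots> = 2 * (ennreal (m k * (cmod (x k))\<^sup>2) + ennreal (m k * (cmod (y k))\<^sup>2))"
      using assms by (simp add: ennreal_mult ennreal_plus)
    finally show ?thesis .
  qed
  then have "wsq m (\<lambda>k. x k - y k) \<le> esum (\<lambda>k. 2 * (ennreal (m k * (cmod (x k))\<^sup>2) + ennreal (m k * (cmod (y k))\<^sup>2)))"
    unfolding wsq_def by (rule nn_integral_mono)
  also have "\<dots> = 2 * (wsq m x + wsq m y)"
    by (simp add: nn_integral_cmult nn_integral_add wsq_def)
  finally show ?thesis .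
qed

text \<open>Absolute continuity of the integral: the intervals shrink to the null set {t}, and h
  restricted to {0..T} dominates.\<close>

lemma nn_integral_small_interval:
  fixes h :: "real \<Rightarrow> ennreal"
  assumes [measurable]: "h \<in> borel_measurable borel"
    and fin: "(\<integral>\<^sup>+\<tau>. h \<tau> * indicator {0..T} \<tau> \<partial>lborel) < \<infinity>" and t: "0 \<le> t" "t < T" and e: "0 < e"
  obtains u where "t < u" "u \<le> T" "(\<integral>\<^sup>+\<tau>. h \<tau> * indicator {t..u} \<tau> \<partial>lborel) \<le> ennreal e"
proof -
  define u where "u = (\<lambda>n::nat. t + (T - t) / (real n + 1))"
  have u: "t < u n" "u n \<le> T" for n
  proof -
    have "(T - t) / (real n + 1) \<le> (T - t) / 1"
      using t by (intro divide_left_mono) auto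
    moreover have "0 < (T - t) / (real n + 1)" using t by simp
    ultimately show "t < u n" "u n \<le> T" by (auto simp: u_def)
  qed
  have "(\<lambda>n. (T - t) * inverse (real (Suc n))) \<longlonglongrightarrow> (T - t) * 0"
    by (intro tendsto_intros LIMSEQ_inverse_real_of_nat)
  moreover have "u = (\<lambda>n. t + (T - t) * inverse (real (Suc n)))"
    by (simp add: u_def divide_inverse add.commute fun_eq_iff)
  ultimately have ul: "u \<longlonglongrightarrow> t"
    using tendsto_add[OF tendsto_const, of _ "(T - t) * 0" sequentially t] by simp
  have "(\<lambda>n. \<integral>\<^sup>+\<tau>. h \<tau> * indicator {t..u n} \<tau> \<partial>lborel) \<longlonglongrightarrow> (\<integral>\<^sup>+\<tau>. 0 \<partial>(lborel::real measure))"
  proof (rule nn_integral_dominated_convergence[where w="\<lambda>\<tau>. h \<tau> * indicator {0..T} \<tau>"])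
    show "AE \<tau> in lborel. h \<tau> * indicator {t..u n} \<tau> \<le> h \<tau> * indicator {0..T} \<tau>" for n
      using u[of n] t by (intro AE_I2) (auto simp: indicator_def)
    show "AE \<tau> in lborel. (\<lambda>n. h \<tau> * indicator {t..u n} \<tau>) \<longlonglongrightarrow> 0"
      using AE_lborel_singleton[of t]
    proof eventually_elim
      case (elim \<tau>)
      have "\<forall>\<^sub>F n in sequentially. \<tau> \<notin> {t..u n}"
      proof (cases "\<tau> < t")
        case False
        then have "\<forall>\<^sub>F n in sequentially. u n < \<tau>" using elim by (intro order_tendstoD[OF ul]) auto
        then show ?thesis by eventually_elim auto
      qed auto
      then show ?case by (intro tendsto_eventually) (elim eventually_mono, auto)
    qed
  qed (use fin in measurable)
  then have "(\<lambda>n. \<integral>\<^sup>+\<tau>. h \<tau> * indicator {t..u n} \<tau> \<partial>lborel) \<longlonglongrightarrow> 0" by simp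
  then have "\<forall>\<^sub>F n in sequentially. (\<integral>\<^sup>+\<tau>. h \<tau> * indicator {t..u n} \<tau> \<partial>lborel) < ennreal e"
    using e by (intro order_tendstoD(2)) auto
  then obtain n where "(\<integral>\<^sup>+\<tau>. h \<tau> * indicator {t..u n} \<tau> \<partial>lborel) < ennreal e"
    using eventually_happens by fastforce
  with u[of n] that show ?thesis by (meson less_imp_le)
qed

text \<open>With a merely integrable coefficient the exponential cannot be differentiated, so the interval
  on which \<open>E\<close> vanishes is enlarged step by step instead.\<close>

lemma gronwall_zero:
  fixes E :: "real \<Rightarrow> real" and h :: "real \<Rightarrow> ennreal"
  assumes hm [measurable]: "h \<in> borel_measurable borel"
    and fin: "(\<integral>\<^sup>+\<tau>. h \<tau> * indicator {0..T} \<tau> \<partial>lborel) < \<infinity>"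
    and E: "\<And>t. t \<in> {0..T} \<Longrightarrow> 0 \<le> E t" "\<And>t. t \<in> {0..T} \<Longrightarrow> E t \<le> B"
    and le: "\<And>t. t \<in> {0..T} \<Longrightarrow> ennreal (E t) \<le> (\<integral>\<^sup>+\<tau>. h \<tau> * ennreal (E \<tau>) * indicator {0..t} \<tau> \<partial>lborel)"
    and T: "t \<in> {0..T}"
  shows "E t = 0"
proof -
  define A where "A = {t \<in> {0..T}. \<forall>s\<in>{0..t}. E s = 0}"
  \<comment> \<open>A single time has measure zero, so vanishing before t carries over to t
    itself.\<close>
  have step0: "E t = 0" if "t \<in> {0..T}" "\<And>s. 0 \<le> s \<Longrightarrow> s < t \<Longrightarrow> E s = 0" for t
  proof -
    have "(\<integral>\<^sup>+\<tau>. h \<tau> * ennreal (E \<tau>) * indicator {0..t} \<tau> \<partial>lborel) = (\<integral>\<^sup>+\<tau>. 0 \<partial>(lborel::real measure))"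
    proof (rule nn_integral_cong_AE)
      show "AE \<tau> in lborel. h \<tau> * ennreal (E \<tau>) * indicator {0..t} \<tau> = 0"
        using AE_lborel_singleton[of t] by eventually_elim (use that(2) in \<open>auto simp: indicator_def\<close>)
    qed
    then have "ennreal (E t) \<le> 0" using le[OF that(1)] by simp
    then show ?thesis using E(1)[OF that(1)] by (simp add: ennreal_eq_0_iff)
  qed
  have A0: "0 \<in> A" using T step0[of 0] by (auto simp: A_def)
  have Abd: "bdd_above A" by (rule bdd_aboveI[of _ T]) (auto simp: A_def)
  define z where "z = Sup A"
  have z: "0 \<le> z" "z \<le> T"
    using A0 Abd by (auto simp: z_def cSup_upper intro!: cSup_least) (auto simp: A_def)
  have zlt: "E s = 0" if "0 \<le> s" "s < z" for s
  proof -
    obtain r where "r \<in> A" "s < r" using \<open>s < z\<close> less_cSup_iff[OF _ Abd, of s] A0 unfolding z_def by blast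
    then show ?thesis using that by (auto simp: A_def)
  qed
  have zA: "E s = 0" if "0 \<le> s" "s \<le> z" for s
    using that zlt step0[of z] z by (cases "s = z") auto
  have "z = T"
  proof (rule ccontr)
    assume "z \<noteq> T"
    then have zT: "z < T" using z by simp
    \<comment> \<open>With the mass of h on the new interval at most 1/2, the supremum of E there is
      at most half of itself, hence 0.\<close>
    obtain u where u: "z < u" "u \<le> T" "(\<integral>\<^sup>+\<tau>. h \<tau> * indicator {z..u} \<tau> \<partial>lborel) \<le> ennreal (1/2)"
      using nn_integral_small_interval[OF hm fin z(1) zT, of "1/2"] by auto
    define \<sigma> where "\<sigma> = Sup (E ` {z..u})"
    have ne: "E ` {z..u} \<noteq> {}" using u by auto
    have bd: "bdd_above (E ` {z..u})" using E(2) u z by (intro bdd_aboveI[of _ B]) auto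
    have E\<sigma>: "E s \<le> \<sigma>" if "s \<in> {z..u}" for s
      unfolding \<sigma>_def using that bd by (intro cSup_upper) auto
    have \<sigma>0: "0 \<le> \<sigma>" using E\<sigma>[of z] zA[of z] z u by auto
    have half: "E s \<le> \<sigma> / 2" if s: "s \<in> {z..u}" for s
    proof -
      have "ennreal (E s) \<le> (\<integral>\<^sup>+\<tau>. h \<tau> * ennreal (E \<tau>) * indicator {0..s} \<tau> \<partial>lborel)"
        using s u z by (intro le) auto
      also have "\<dots> \<le> (\<integral>\<^sup>+\<tau>. ennreal \<sigma> * (h \<tau> * indicator {z..u} \<tau>) \<partial>lborel)"
      proof (intro nn_integral_mono)
        fix \<tau>
        show "h \<tau> * ennreal (E \<tau>) * indicator {0..s} \<tau> \<le> ennreal \<sigma> * (h \<tau> * indicator {z..u} \<tau>)"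
        proof (cases "\<tau> \<in> {z..u}")
          case True
          then have "h \<tau> * ennreal (E \<tau>) \<le> h \<tau> * ennreal \<sigma>"
            by (intro mult_left_mono ennreal_leI E\<sigma>) auto
          then show ?thesis using True by (auto simp: indicator_def mult.commute)
        next
          case False
          then show ?thesis using zA[of \<tau>] s by (auto simp: indicator_def)
        qed
      qed
      also have "\<dots> = ennreal \<sigma> * (\<integral>\<^sup>+\<tau>. h \<tau> * indicator {z..u} \<tau> \<partial>lborel)"
        by (rule nn_integral_cmult) measurable
      also have "\<dots> \<le> ennreal \<sigma> * ennreal (1/2)"
        by (rule mult_left_mono[OF u(3)]) simp
      also have "\<dots> = ennreal (\<sigma> / 2)" using \<sigma>0 by (subst ennreal_mult[symmetric]) simp_all
      finally show ?thesis using \<sigma>0 by (simp add: ennreal_le_iff)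
    qed
    have "\<sigma> \<le> \<sigma> / 2" unfolding \<sigma>_def[symmetric]
      by (subst \<sigma>_def, rule cSup_least[OF ne]) (use half in auto)
    then have "\<sigma> = 0" using \<sigma>0 by simp
    then have "E s = 0" if "s \<in> {z..u}" for s
      using E\<sigma>[OF that] E(1)[of s] that u z by auto
    then have "u \<in> A" using u z zA by (auto simp: A_def) (metis atLeastAtMost_iff linear)
    then have "u \<le> z" unfolding z_def by (rule cSup_upper[OF _ Abd])
    then show False using u by simp
  qed
  then show ?thesis using zA[of t] T by auto
qed

context coeff_solution
begin

lemma energy_finite: "energy (c t) < \<infinity>"
proof -
  obtain M where "\<forall>s\<le>t. energy (c s) \<le> ennreal (M\<^sup>2)" using bounded by blast
  then have "energy (c t) \<le> ennreal (M\<^sup>2)" by simp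
  then show ?thesis by (rule order_le_less_trans) simp
qed

lemma crhs_cont: "continuous_on A (\<lambda>t. crhs a S (c t) k)"
  by (rule continuous_on_subset[OF crhs_continuous[OF cont bounded]]) simp

lemma init: "c 0 = c0"
  using eq[of 0] by auto

lemma deriv:
  assumes "0 \<le> s" "\<tau> \<in> {s..t}"
  shows "((\<lambda>t. c t k) has_vector_derivative crhs a S (c \<tau>) k) (at \<tau> within {s..t})"
proof -
  have "((\<lambda>u. c0 k + integral {0..u} (\<lambda>s. crhs a S (c s) k)) has_vector_derivative crhs a S (c \<tau>) k) (at \<tau> within {0..t})"
    using integral_has_vector_derivative[OF crhs_cont[of "{0..t}" k], of \<tau>] assms
      has_vector_derivative_add[OF has_vector_derivative_const, of "\<lambda>u. integral {0..u} (\<lambda>s. crhs a S (c s) k)" "crhs a S (c \<tau>) k" "at \<tau> within {0..t}" "c0 k"]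
    by simp
  then have "((\<lambda>t. c t k) has_vector_derivative crhs a S (c \<tau>) k) (at \<tau> within {0..t})"
    by (rule has_vector_derivative_transform[rotated 2]) (use assms eq in auto)
  then show ?thesis
    by (rule has_vector_derivative_within_subset) (use assms in auto)
qed

end

text \<open>The difference w is advected by x and has the source - adv w y. The advection drops out
  for the weight 1. The source costs C times the half energy of y times the energy of w, plus a half
  energy of w that the damping pays for. What remains is a Gronwall inequality whose coefficient,
  the half energy of y, is merely integrable in time.\<close>

lemma coeff_solution_unique:
  assumes x: "coeff_solution a S c0 x" and y: "coeff_solution a S c0 y"
    and lam: "0 < lam" "\<And>k. lam * norm (freq k) \<le> a k" and t0: "0 \<le> t0"
  shows "x t0 = y t0"
proof -
  interpret x: coeff_solution a S c0 x by fact
  interpret y: coeff_solution a S c0 y by fact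
  define w where "w = (\<lambda>t k. x t k - y t k)"
  have wc: "continuous_on UNIV (\<lambda>t. w t k)" for k
    unfolding w_def by (intro continuous_intros x.cont y.cont)
  have we: "energy (w t) < \<infinity>" for t
    unfolding w_def
    by (rule order_le_less_trans[OF wsq_diff_le]) (use x.energy_finite[of t] y.energy_finite[of t] in \<open>auto simp: ennreal_mult_less_top\<close>)
  have a0: "0 \<le> a k" for k using lam(2)[of k] lam(1) by (meson mult_nonneg_nonneg norm_ge_zero less_imp_le order_trans)
  have [measurable]: "(\<lambda>t. half_energy (y t)) \<in> borel_measurable borel" "(\<lambda>t. half_energy (x t)) \<in> borel_measurable borel"
     "(\<lambda>t. half_energy (w t)) \<in> borel_measurable borel" "(\<lambda>t. energy (w t)) \<in> borel_measurable borel"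
    by (intro wsq_measurable x.cont y.cont wc)+
  have half_w: "(\<integral>\<^sup>+\<tau>. half_energy (w \<tau>) * indicator {0..t} \<tau> \<partial>lborel) < \<infinity>" for t
  proof -
    have "(\<integral>\<^sup>+\<tau>. half_energy (w \<tau>) * indicator {0..t} \<tau> \<partial>lborel)
       \<le> (\<integral>\<^sup>+\<tau>. 2 * (half_energy (x \<tau>) * indicator {0..t} \<tau> + half_energy (y \<tau>) * indicator {0..t} \<tau>) \<partial>lborel)"
      unfolding w_def by (intro nn_integral_mono) (auto simp: indicator_def wsq_diff_le[unfolded distrib_left])
    also have "\<dots> = 2 * ((\<integral>\<^sup>+\<tau>. half_energy (x \<tau>) * indicator {0..t} \<tau> \<partial>lborel) + (\<integral>\<^sup>+\<tau>. half_energy (y \<tau>) * indicator {0..t} \<tau> \<partial>lborel))"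
      by (simp add: nn_integral_cmult nn_integral_add)
    also have "\<dots> < \<infinity>" using x.half[of t] y.half[of t] by (simp add: ennreal_mult_less_top)
    finally show ?thesis .
  qed
  \<comment> \<open>This is P^2 / (2 lam) per unit of energy of w, where P = 5 sqrt lat * M bounds
    its velocity coefficients and M^2 is that energy.\<close>
  define C where "C = 25 * lat / (2 * lam)"
  have C: "0 \<le> C" using lam lat_nonneg by (simp add: C_def)
  have tri: "esum (\<lambda>k. ennreal (2 * (1 * cmod (- adv (w \<tau>) (y \<tau>) k) * cmod (w \<tau> k))))
     \<le> ennreal C * half_energy (y \<tau>) * energy (w \<tau>) + ennreal (2 * lam) * half_energy (w \<tau>)" for \<tau>
  proof -
    define M where "M = sqrt (enn2real (energy (w \<tau>)))"
    have M: "energy (w \<tau>) = ennreal (M\<^sup>2)" "0 \<le> M" using we by (auto simp: M_def less_top)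
    define P where "P = 5 * sqrt lat * M"
    have P: "esum (\<lambda>k. ennreal (norm (mu k) * cmod (w \<tau> k))) \<le> ennreal P" "0 \<le> P"
      using velocity_l1_bound_real[of "w \<tau>" M] M lat_nonneg by (auto simp: P_def)
    have "esum (\<lambda>k. ennreal (2 * (1 * cmod (- adv (w \<tau>) (y \<tau>) k) * cmod (w \<tau> k))))
       = 2 * esum (\<lambda>k. ennreal (cmod (adv (w \<tau>) (y \<tau>) k)) * ennreal (cmod (w \<tau> k)))"
      by (simp add: ennreal_mult nn_integral_cmult)
    also have "\<dots> \<le> 2 * esum (\<lambda>k. esum (\<lambda>l. ennreal (\<bar>ker k l\<bar> * cmod (w \<tau> (k - l)) * cmod (y \<tau> l))) * ennreal (cmod (w \<tau> k)))"
      by (intro mult_left_mono nn_integral_mono mult_right_mono norm_adv_le) auto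
    also have "\<dots> = 2 * esum (\<lambda>k. esum (\<lambda>l. ennreal (\<bar>ker k l\<bar> * cmod (w \<tau> (k - l)) * cmod (y \<tau> l) * cmod (w \<tau> k))))"
      by (simp add: ennreal_mult nn_integral_multc)
    finally have *: "esum (\<lambda>k. ennreal (2 * (1 * cmod (- adv (w \<tau>) (y \<tau>) k) * cmod (w \<tau> k)))) \<le> \<dots>" .
    show ?thesis
    \<comment> \<open>The weight P / (2 * lam) used in the other case must be positive; it makes the
      coefficient of \<open>half_energy (w \<tau>)\<close> exactly 2 * lam.\<close>
    proof (cases "P = 0")
      case True
      have "2 * esum (\<lambda>k. esum (\<lambda>l. ennreal (\<bar>ker k l\<bar> * cmod (w \<tau> (k - l)) * cmod (y \<tau> l) * cmod (w \<tau> k)))) \<le> 0"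
        using trilinear_bound[OF P(1), of 1 "y \<tau>" "w \<tau>"] True by simp
      then show ?thesis using * by simp
    next
      case False
      then have Pp: "0 < P" using P by simp
      have "2 * esum (\<lambda>k. esum (\<lambda>l. ennreal (\<bar>ker k l\<bar> * cmod (w \<tau> (k - l)) * cmod (y \<tau> l) * cmod (w \<tau> k))))
        \<le> ennreal P * (ennreal (P / (2 * lam)) * half_energy (y \<tau>) + ennreal (1 / (P / (2 * lam))) * half_energy (w \<tau>))"
        by (rule trilinear_bound[OF P(1)]) (use Pp lam in simp)
      also have "\<dots> = ennreal (P * (P / (2 * lam))) * half_energy (y \<tau>) + ennreal (P * (1 / (P / (2 * lam)))) * half_energy (w \<tau>)"
        using Pp lam by (subst (1 2) ennreal_mult) (auto simp: distrib_left mult.assoc)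
      also have "P * (P / (2 * lam)) = C * M\<^sup>2"
        using lat_nonneg lam by (simp add: P_def C_def field_simps power2_eq_square)
      also have "P * (1 / (P / (2 * lam))) = 2 * lam" using Pp by simp
      also have "ennreal (C * M\<^sup>2) * half_energy (y \<tau>) = ennreal C * half_energy (y \<tau>) * energy (w \<tau>)"
        using C by (simp add: M ennreal_mult mult_ac)
      finally show ?thesis using * by (rule order_trans[rotated])
    qed
  qed
  have main: "energy (w t) \<le> (\<integral>\<^sup>+\<tau>. ennreal C * half_energy (y \<tau>) * energy (w \<tau>) * indicator {0..t} \<tau> \<partial>lborel)" if t: "0 \<le> t" for t
  proof -
    interpret energy_setup w x "\<lambda>\<tau> k. - adv (w \<tau>) (y \<tau>) k" "\<lambda>_. 1" a 0 t 1
    proof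
      show "(\<lambda>\<tau>. - adv (w \<tau>) (y \<tau>) k) \<in> borel_measurable borel" for k
        by (intro borel_measurable_uminus adv_measurable wc y.cont we y.energy_finite)
      show "((\<lambda>\<tau>. w \<tau> k) has_vector_derivative
        (- adv (w \<tau>) (y \<tau>) k - adv (x \<tau>) (w \<tau>) k - complex_of_real (a k) * w \<tau> k)) (at \<tau> within {0..t})"
        if "\<tau> \<in> {0..t}" for \<tau> k
      proof -
        have "((\<lambda>\<tau>. w \<tau> k) has_vector_derivative (crhs a S (x \<tau>) k - crhs a S (y \<tau>) k)) (at \<tau> within {0..t})"
          unfolding w_def by (intro has_vector_derivative_diff x.deriv y.deriv that) auto
        moreover have "crhs a S (x \<tau>) k - crhs a S (y \<tau>) k = - adv (w \<tau>) (y \<tau>) k - adv (x \<tau>) (w \<tau>) k - complex_of_real (a k) * w \<tau> k"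
          using adv_diff[OF x.energy_finite[of \<tau>] y.energy_finite[of \<tau>], of k] we[of \<tau>]
          unfolding crhs_def w_def by (simp add: algebra_simps)
        ultimately show ?thesis by simp
      qed
    qed (use t a0 wc x.cont x.energy_finite we x.real in auto)
    obtain M where M: "M \<ge> 0" "\<forall>s\<le>t. energy (x s) \<le> ennreal (M\<^sup>2)" using x.bounded by blast
    define P where "P = 5 * sqrt lat * M"
    have fin: "(\<integral>\<^sup>+\<tau>. esum (\<lambda>k. esum (\<lambda>l. ennreal (q \<tau> k l))) * indicator {0..t} \<tau> \<partial>lborel) < \<infinity>"
    proof -
      have "(\<integral>\<^sup>+\<tau>. esum (\<lambda>k. esum (\<lambda>l. ennreal (q \<tau> k l))) * indicator {0..t} \<tau> \<partial>lborel)
        \<le> (\<integral>\<^sup>+\<tau>. ennreal P * (2 * (half_energy (w \<tau>) * indicator {0..t} \<tau>)) \<partial>lborel)"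
      proof (intro nn_integral_mono)
        fix \<tau>
        show "esum (\<lambda>k. esum (\<lambda>l. ennreal (q \<tau> k l))) * indicator {0..t} \<tau> \<le> ennreal P * (2 * (half_energy (w \<tau>) * indicator {0..t} \<tau>))"
        proof (cases "\<tau> \<in> {0..t}")
          case True
          have "esum (\<lambda>k. esum (\<lambda>l. ennreal (q \<tau> k l))) \<le> 2 * esum (\<lambda>k. esum (\<lambda>l. ennreal (q \<tau> k l)))"
            by (simp add: mult_2)
          also have "\<dots> \<le> ennreal P * (ennreal 1 * half_energy (w \<tau>) + ennreal (1/1) * half_energy (w \<tau>))"
            unfolding q_def P_def using M True
            by (intro trilinear_bound velocity_l1_bound_real) auto
          finally show ?thesis using True by (simp add: mult_2)
        qed simp
      qed
      also have "\<dots> = ennreal P * (2 * (\<integral>\<^sup>+\<tau>. half_energy (w \<tau>) * indicator {0..t} \<tau> \<partial>lborel))"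
        by (simp add: nn_integral_cmult)
      also have "\<dots> < \<infinity>" using half_w[of t] by (simp add: ennreal_mult_less_top)
      finally show ?thesis .
    qed
    \<comment> \<open>X is the share of the dissipation consumed by the estimate of the source.
      Being finite, it can be cancelled at the end.\<close>
    define X where "X = (\<integral>\<^sup>+\<tau>. ennreal (2 * lam) * half_energy (w \<tau>) * indicator {0..t} \<tau> \<partial>lborel)"
    have "X = ennreal (2 * lam) * (\<integral>\<^sup>+\<tau>. half_energy (w \<tau>) * indicator {0..t} \<tau> \<partial>lborel)"
      by (simp add: X_def nn_integral_cmult mult.assoc)
    then have X: "X < \<infinity>" using half_w[of t] by (simp add: ennreal_mult_less_top)
    have "energy (w t) + X \<le> energy (w t) + (\<integral>\<^sup>+\<tau>. wsq (\<lambda>k. 2 * (1 * a k)) (w \<tau>) * indicator {0..t} \<tau> \<partial>lborel)"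
      unfolding X_def
    proof (intro add_left_mono nn_integral_mono mult_right_mono)
      fix \<tau>
      have "ennreal (2 * lam) * half_energy (w \<tau>) = wsq (\<lambda>k. 2 * (lam * norm (freq k))) (w \<tau>)"
        using lam by (simp add: wsq_def ennreal_mult mult.assoc nn_integral_cmult)
      also have "\<dots> \<le> wsq (\<lambda>k. 2 * (1 * a k)) (w \<tau>)" using lam by (intro wsq_mono) simp
      finally show "ennreal (2 * lam) * half_energy (w \<tau>) \<le> wsq (\<lambda>k. 2 * (1 * a k)) (w \<tau>)" .
    qed auto
    also have "\<dots> \<le> energy (w 0) + (\<integral>\<^sup>+\<tau>. (esum (\<lambda>k. ennreal (2 * (1 * cmod (- adv (w \<tau>) (y \<tau>) k) * cmod (w \<tau> k))))
         + esum (\<lambda>k. esum (\<lambda>l. ennreal (\<bar>1 - 1\<bar> * q \<tau> k l)))) * indicator {0..t} \<tau> \<partial>lborel)"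
      by (rule weighted_energy_inequality[OF fin])
    also have "energy (w 0) = 0"
      using x.init y.init by (simp add: w_def wsq_def)
    also have "0 + (\<integral>\<^sup>+\<tau>. (esum (\<lambda>k. ennreal (2 * (1 * cmod (- adv (w \<tau>) (y \<tau>) k) * cmod (w \<tau> k))))
         + esum (\<lambda>k. esum (\<lambda>l. ennreal (\<bar>1 - 1\<bar> * q \<tau> k l)))) * indicator {0..t} \<tau> \<partial>lborel)
      \<le> (\<integral>\<^sup>+\<tau>. ennreal C * half_energy (y \<tau>) * energy (w \<tau>) * indicator {0..t} \<tau>
            + ennreal (2 * lam) * half_energy (w \<tau>) * indicator {0..t} \<tau> \<partial>lborel)"
      unfolding add_0_left
    proof (intro nn_integral_mono)
      fix \<tau>
      show "(esum (\<lambda>k. ennreal (2 * (1 * cmod (- adv (w \<tau>) (y \<tau>) k) * cmod (w \<tau> k))))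
         + esum (\<lambda>k. esum (\<lambda>l. ennreal (\<bar>1 - 1\<bar> * q \<tau> k l)))) * indicator {0..t} \<tau>
        \<le> ennreal C * half_energy (y \<tau>) * energy (w \<tau>) * indicator {0..t} \<tau>
            + ennreal (2 * lam) * half_energy (w \<tau>) * indicator {0..t} \<tau>"
        using tri[of \<tau>] by (cases "\<tau> \<in> {0..t}") auto
    qed
    also have "\<dots> = (\<integral>\<^sup>+\<tau>. ennreal C * half_energy (y \<tau>) * energy (w \<tau>) * indicator {0..t} \<tau> \<partial>lborel) + X"
      unfolding X_def by (rule nn_integral_add) measurable
    finally show ?thesis using X by (auto simp: ennreal_add_left_cancel_le add.commute[of _ X])
  qed
  have E: "energy (w t) = ennreal (enn2real (energy (w t)))" for t using we by (simp add: less_top)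
  obtain M1 where M1: "M1 \<ge> 0" "\<forall>s\<le>t0. energy (x s) \<le> ennreal (M1\<^sup>2)" using x.bounded by blast
  obtain M2 where M2: "M2 \<ge> 0" "\<forall>s\<le>t0. energy (y s) \<le> ennreal (M2\<^sup>2)" using y.bounded by blast
  have "enn2real (energy (w t0)) = 0"
  proof (rule gronwall_zero[where E="\<lambda>t. enn2real (energy (w t))" and t=t0 and h="\<lambda>\<tau>. ennreal C * half_energy (y \<tau>)" and T=t0 and B="2 * (M1\<^sup>2 + M2\<^sup>2)"])
    show "(\<integral>\<^sup>+\<tau>. ennreal C * half_energy (y \<tau>) * indicator {0..t0} \<tau> \<partial>lborel) < \<infinity>"
      using y.half[of t0] by (simp add: mult.assoc nn_integral_cmult ennreal_mult_less_top)
    show "enn2real (energy (w t)) \<le> 2 * (M1\<^sup>2 + M2\<^sup>2)" if "t \<in> {0..t0}" for t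
    proof -
      have "energy (w t) \<le> 2 * (energy (x t) + energy (y t))" unfolding w_def by (rule wsq_diff_le) simp
      also have "\<dots> \<le> 2 * (ennreal (M1\<^sup>2) + ennreal (M2\<^sup>2))"
        using M1 M2 that by (intro mult_left_mono add_mono) auto
      also have "\<dots> = ennreal (2 * (M1\<^sup>2 + M2\<^sup>2))" by (simp add: ennreal_mult ennreal_plus)
      finally show ?thesis by (intro enn2real_leI) auto
    qed
    show "ennreal (enn2real (energy (w t))) \<le> (\<integral>\<^sup>+\<tau>. ennreal C * half_energy (y \<tau>) * ennreal (enn2real (energy (w \<tau>))) * indicator {0..t} \<tau> \<partial>lborel)"
      if "t \<in> {0..t0}" for t
      using main[of t] that unfolding E[symmetric] by simp
  qed (use t0 in auto)
  then have "energy (w t0) = 0" using E[of t0] by simp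
  then have "AE k in count_space UNIV. ennreal (1 * (cmod (w t0 k))\<^sup>2) = 0"
    unfolding wsq_def by (subst (asm) nn_integral_0_iff_AE) auto
  then show ?thesis by (auto simp: AE_count_space w_def fun_eq_iff)
qed

section \<open>Galerkin approximations\<close>

lemma continuous_indefinite_integral:
  fixes f :: "real \<Rightarrow> 'a::euclidean_space"
  assumes "\<And>b. f integrable_on {0..b}"
  shows "continuous_on UNIV (\<lambda>t. integral {0..max 0 t} f)"
proof -
  have "continuous_on {0..} (\<lambda>t. integral {0..t} f)"
    unfolding continuous_on_eq_continuous_within
  proof
    fix t :: real assume t: "t \<in> {0..}"
    have "continuous (at t within {0..t+1}) (\<lambda>t. integral {0..t} f)"
      using indefinite_integral_continuous_1[OF assms[of "t+1"]] t
      by (auto simp: continuous_on_eq_continuous_within)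
    moreover have "at t within {0..t+1} = at t within {0..}"
      by (rule at_within_nhd[of _ "{..<t+1}"]) auto
    ultimately show "continuous (at t within {0..}) (\<lambda>t. integral {0..t} f)" by simp
  qed
  then show ?thesis
    by (rule continuous_on_compose2) (auto intro!: continuous_intros)
qed

text \<open>Picard iteration: in a norm weighted by exp (- 2 L t) the integral map contracts by 1/2,
  so a global Lipschitz constant gives convergence on the whole half line without continuing local
  solutions. Functions vanishing off K replace vectors because K will vary, and
  \<open>max 0 t\<close> freezes the trajectory at negative times. Reality is inherited from the
  iterates.\<close>

lemma finite_ode_solution:
  fixes F :: "(int^3 \<Rightarrow> complex) \<Rightarrow> int^3 \<Rightarrow> complex" and x0 :: "int^3 \<Rightarrow> complex"
  assumes K: "finite K" and L: "0 < L"
    and lip: "\<And>x y. (\<Sum>k\<in>K. cmod (F x k - F y k)) \<le> L * (\<Sum>k\<in>K. cmod (x k - y k))"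
    and F0: "\<And>x k. k \<notin> K \<Longrightarrow> F x k = 0" and x0: "\<And>k. k \<notin> K \<Longrightarrow> x0 k = 0"
    and Freal: "\<And>x k. (\<And>k. x (- k) = cnj (x k)) \<Longrightarrow> F x (- k) = cnj (F x k)"
    and x0real: "\<And>k. x0 (- k) = cnj (x0 k)"
  obtains x :: "real \<Rightarrow> int^3 \<Rightarrow> complex" where
    "\<And>k. continuous_on UNIV (\<lambda>t. x t k)" "\<And>t k. x t (- k) = cnj (x t k)" "\<And>t k. k \<notin> K \<Longrightarrow> x t k = 0"
    "\<And>k. continuous_on UNIV (\<lambda>t. F (x t) k)"
    "\<And>t k. x t k = x0 k + integral {0..max 0 t} (\<lambda>s. F (x s) k)"
proof -
  define it where "it = rec_nat (\<lambda>t::real. x0) (\<lambda>n y t k. x0 k + integral {0..max 0 t} (\<lambda>s. F (y s) k))"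
  have it0: "it 0 t = x0" for t by (simp add: it_def)
  have itS: "it (Suc n) t k = x0 k + integral {0..max 0 t} (\<lambda>s. F (it n s) k)" for n t k by (simp add: it_def)
  have Flim: "((\<lambda>y. F (z y) k) \<longlongrightarrow> F z' k) G" if "\<And>l. ((\<lambda>y. z y l) \<longlongrightarrow> z' l) G" for z z' k and G :: "'z filter"
  proof (cases "k \<in> K")
    case True
    have "((\<lambda>y. L * (\<Sum>l\<in>K. cmod (z y l - z' l))) \<longlongrightarrow> L * (\<Sum>l\<in>K. cmod (z' l - z' l))) G"
      by (intro tendsto_intros that)
    then have lim0: "((\<lambda>y. L * (\<Sum>l\<in>K. cmod (z y l - z' l))) \<longlongrightarrow> 0) G" by simp
    have "cmod (F (z y) k - F z' k) \<le> L * (\<Sum>l\<in>K. cmod (z y l - z' l))" for y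
      using order_trans[OF member_le_sum[OF True _ K, of "\<lambda>k. cmod (F (z y) k - F z' k)"] lip] by simp
    then have "((\<lambda>y. F (z y) k - F z' k) \<longlongrightarrow> 0) G"
      by (intro Lim_null_comparison[OF always_eventually lim0]) auto
    then show ?thesis by (simp add: LIM_zero_iff)
  qed (simp add: F0)
  have Fcont: "continuous_on UNIV (\<lambda>t. F (z t) k)" if "\<And>l. continuous_on UNIV (\<lambda>t::real. z t l)" for z k
    using that unfolding continuous_on_def by (auto intro: Flim)
  have itc: "continuous_on UNIV (\<lambda>t. it n t k)" for n k
  proof (induction n arbitrary: k)
    case (Suc n)
    have "(\<lambda>s. F (it n s) k) integrable_on {0..b}" for b
      by (rule integrable_continuous_real[OF continuous_on_subset[OF Fcont[OF Suc.IH]]]) simp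
    then show ?case unfolding itS by (intro continuous_intros continuous_indefinite_integral)
  qed (simp add: it0)
  have Fi: "(\<lambda>s. F (it n s) k) integrable_on {0..b}" for n k b
    by (rule integrable_continuous_real[OF continuous_on_subset[OF Fcont[OF itc]]]) simp
  \<comment> \<open>Chosen so that the first increment, t times the size of F x0, equals B * (2 L t)
    and hence is at most B * exp (2 L t).\<close>
  define B where "B = (\<Sum>k\<in>K. cmod (F x0 k)) / (2 * L)"
  have B: "0 \<le> B" using L by (simp add: B_def sum_nonneg)
  have step: "(\<Sum>k\<in>K. cmod (it (Suc n) t k - it n t k)) \<le> B * (1/2)^n * exp (2 * L * t)" if "0 \<le> t" for n t
    using that
  proof (induction n arbitrary: t)
    case 0
    have "(\<Sum>k\<in>K. cmod (it (Suc 0) t k - it 0 t k)) = (\<Sum>k\<in>K. t * cmod (F x0 k))"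
      using 0 by (simp add: itS it0 norm_mult)
    also have "\<dots> = B * (2 * L * t)" using L by (simp add: B_def sum_distrib_left[symmetric] field_simps)
    also have "\<dots> \<le> B * exp (2 * L * t)"
      using exp_ge_add_one_self[of "2 * L * t"] B by (intro mult_left_mono) linarith+
    finally show ?case by simp
  next
    case (Suc n)
    have ci: "(\<lambda>s. cmod (F (it (Suc n) s) k - F (it n s) k)) integrable_on {0..t}" for k
      by (intro integrable_continuous_real continuous_intros continuous_on_subset[OF Fcont[OF itc]]) auto
    have "(\<Sum>k\<in>K. cmod (it (Suc (Suc n)) t k - it (Suc n) t k))
       = (\<Sum>k\<in>K. cmod (integral {0..t} (\<lambda>s. F (it (Suc n) s) k - F (it n s) k)))"
      using Suc.prems by (intro sum.cong refl) (simp add: itS[of "Suc n"] itS[of n] Henstock_Kurzweil_Integration.integral_diff Fi)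
    also have "\<dots> \<le> (\<Sum>k\<in>K. integral {0..t} (\<lambda>s. cmod (F (it (Suc n) s) k - F (it n s) k)))"
      by (intro sum_mono integral_norm_bound_integral ci Henstock_Kurzweil_Integration.integrable_diff Fi) auto
    also have "\<dots> = integral {0..t} (\<lambda>s. \<Sum>k\<in>K. cmod (F (it (Suc n) s) k - F (it n s) k))"
      by (rule Henstock_Kurzweil_Integration.integral_sum[OF K ci, symmetric])
    also have "\<dots> \<le> integral {0..t} (\<lambda>s. L * (B * (1/2)^n * exp (2 * L * s)))"
    proof (rule integral_le)
      show "(\<lambda>s. \<Sum>k\<in>K. cmod (F (it (Suc n) s) k - F (it n s) k)) integrable_on {0..t}"
        by (intro Henstock_Kurzweil_Integration.integrable_sum K ci)
      show "(\<lambda>s. L * (B * (1/2)^n * exp (2 * L * s))) integrable_on {0..t}"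
        by (intro integrable_continuous_real continuous_intros)
      show "(\<Sum>k\<in>K. cmod (F (it (Suc n) s) k - F (it n s) k)) \<le> L * (B * (1/2)^n * exp (2 * L * s))" if "s \<in> {0..t}" for s
        using order_trans[OF lip mult_left_mono[OF Suc.IH[of s]]] that L by simp
    qed
    also have "\<dots> = B * (1/2)^Suc n * exp (2 * L * t) - B * (1/2)^Suc n * exp (2 * L * 0)"
      using Suc.prems L
      by (intro integral_unique fundamental_theorem_of_calculus)
         (auto intro!: derivative_eq_intros simp: has_real_derivative_iff_has_vector_derivative[symmetric])
    also have "\<dots> \<le> B * (1/2)^Suc n * exp (2 * L * t)" using B by simp
    finally show ?case .
  qed
  have it_max: "it n t = it n (max 0 t)" for n t
    by (cases n) (auto simp: it0 itS fun_eq_iff)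
  have itK: "it n t k = 0" if "k \<notin> K" for n t k
    using that by (cases n) (auto simp: it0 itS F0 x0)
  have stepk: "cmod (it (Suc n) t k - it n t k) \<le> B * exp (2 * L * max 0 t) * (1/2)^n" for n t k
  proof (cases "k \<in> K")
    case True
    have "cmod (it (Suc n) t k - it n t k) = cmod (it (Suc n) (max 0 t) k - it n (max 0 t) k)"
      using it_max[of "Suc n" t] it_max[of n t] by simp
    also have "\<dots> \<le> (\<Sum>k\<in>K. cmod (it (Suc n) (max 0 t) k - it n (max 0 t) k))"
      by (rule member_le_sum[OF True _ K]) simp
    also have "\<dots> \<le> B * (1/2)^n * exp (2 * L * max 0 t)" by (rule step) simp
    finally show ?thesis by (simp add: mult_ac)
  qed (use B in \<open>simp add: itK\<close>)
  have sm: "summable (\<lambda>n. B * exp (2 * L * max 0 t) * (1/2)^n)" for t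
    by (intro summable_mult summable_geometric) simp
  have conv: "convergent (\<lambda>n. it n t k)" for t k
  proof -
    have "summable (\<lambda>n. it (Suc n) t k - it n t k)"
      by (rule summable_comparison_test'[OF sm[of t]]) (rule stepk)
    then have "convergent (\<lambda>n. \<Sum>i<n. it (Suc i) t k - it i t k)"
      by (simp add: summable_iff_convergent)
    then have "convergent (\<lambda>n. it n t k - it 0 t k)" by (simp only: sum_lessThan_telescope[of "\<lambda>n. it n t k"])
    then show ?thesis by (simp add: convergent_diff_const_right_iff)
  qed
  define x where "x = (\<lambda>t k. lim (\<lambda>n. it n t k))"
  have lim: "(\<lambda>n. it n t k) \<longlonglongrightarrow> x t k" for t k
    using conv by (simp add: x_def convergent_LIMSEQ_iff)
  define D where "D = (\<lambda>T. 2 * (B * exp (2 * L * T)))"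
  have itbd: "cmod (it n t k - x0 k) \<le> D T" if "0 \<le> t" "t \<le> T" for n t k T
  proof -
    have "it n t k - x0 k = (\<Sum>i<n. it (Suc i) t k - it i t k)"
      by (simp only: sum_lessThan_telescope[of "\<lambda>n. it n t k"] it0)
    also have "cmod \<dots> \<le> (\<Sum>i<n. B * exp (2 * L * max 0 t) * (1/2)^i)"
      by (rule sum_norm_le) (rule stepk)
    also have "\<dots> \<le> (\<Sum>i. B * exp (2 * L * max 0 t) * (1/2)^i)"
      by (rule sum_le_suminf[OF sm]) (use B in auto)
    also have "\<dots> = 2 * (B * exp (2 * L * t))"
      using that by (subst suminf_mult) (auto simp: suminf_geometric)
    also have "\<dots> \<le> D T" unfolding D_def using that B L by (intro mult_left_mono) auto
    finally show ?thesis .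
  qed
  have main: "(\<lambda>s. F (x s) k) integrable_on {0..t} \<and> (\<lambda>n. integral {0..t} (\<lambda>s. F (it n s) k)) \<longlonglongrightarrow> integral {0..t} (\<lambda>s. F (x s) k)" for t k
  proof -
    define H where "H = cmod (F x0 k) + L * (\<Sum>l\<in>K. D t)"
    have bd: "norm (F (it n s) k) \<le> H" if "s \<in> {0..t}" for n s
    proof (cases "k \<in> K")
      case True
      have "cmod (F (it n s) k - F x0 k) \<le> L * (\<Sum>l\<in>K. cmod (it n s l - x0 l))"
        using order_trans[OF member_le_sum[OF True _ K, of "\<lambda>k. cmod (F (it n s) k - F x0 k)"] lip] by simp
      also have "\<dots> \<le> L * (\<Sum>l\<in>K. D t)"
        using L that by (intro mult_left_mono sum_mono itbd) auto
      finally show ?thesis unfolding H_def using norm_triangle_sub[of "F (it n s) k" "F x0 k"] by linarith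
    next
      case False
      have "0 \<le> D t" using B by (simp add: D_def)
      then show ?thesis using False L by (simp add: F0 H_def)
    qed
    have "(\<lambda>n. F (it n s) k) \<longlonglongrightarrow> F (x s) k" for s by (intro Flim lim)
    then show ?thesis
      using dominated_convergence[of "\<lambda>n s. F (it n s) k" "{0..t}" "\<lambda>_. H" "\<lambda>s. F (x s) k"] Fi bd by auto
  qed
  have eq: "x t k = x0 k + integral {0..max 0 t} (\<lambda>s. F (x s) k)" for t k
  proof (rule LIMSEQ_unique)
    show "(\<lambda>n. it (Suc n) t k) \<longlonglongrightarrow> x t k" using lim by (rule LIMSEQ_Suc)
    show "(\<lambda>n. it (Suc n) t k) \<longlonglongrightarrow> x0 k + integral {0..max 0 t} (\<lambda>s. F (x s) k)"
      unfolding itS by (intro tendsto_intros) (use main in blast)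
  qed
  have xc: "continuous_on UNIV (\<lambda>t. x t k)" for k
  proof -
    have "continuous_on UNIV (\<lambda>t. x0 k + integral {0..max 0 t} (\<lambda>s. F (x s) k))"
      using main by (intro continuous_intros continuous_indefinite_integral) blast
    then show ?thesis by (rule continuous_on_eq) (rule eq[symmetric])
  qed
  have itreal: "it n t (- k) = cnj (it n t k)" for n t k
  proof (induction n arbitrary: t k)
    case (Suc n)
    have "F (it n s) (- k) = cnj (F (it n s) k)" for s by (rule Freal) (rule Suc.IH)
    then show ?case by (simp add: itS x0real Henstock_Kurzweil_Integration.integral_cnj)
  qed (simp add: it0 x0real)
  have xreal: "x t (- k) = cnj (x t k)" for t k
  proof (rule LIMSEQ_unique[OF lim])
    show "(\<lambda>n. it n t (- k)) \<longlonglongrightarrow> cnj (x t k)" unfolding itreal by (intro tendsto_intros lim)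
  qed
  have "x t k = 0" if "k \<notin> K" for t k using eq[of t k] that by (simp add: F0 x0)
  then show ?thesis by (rule that[OF xc xreal _ Fcont[OF xc] eq])
qed

text \<open>Radial retraction onto the l1 ball of radius R. With the scaling factor fixed the
  distance does not grow, and the change of the factor costs at most the same distance again, whence
  the constant 2. The retraction turns the quadratic vector field into a globally Lipschitz
  one.\<close>

lemma radial_cutoff_lipschitz:
  fixes x y :: "'i \<Rightarrow> complex" and K :: "'i set"
  assumes R: "0 < R"
  defines "p \<equiv> \<lambda>x. \<Sum>k\<in>K. cmod (x k)" 
  defines "r \<equiv> \<lambda>x. R / max R (p x)"
  shows "(\<Sum>k\<in>K. cmod (complex_of_real (r x) * x k - complex_of_real (r y) * y k)) \<le> 2 * (\<Sum>k\<in>K. cmod (x k - y k))"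
proof -
  have r: "0 \<le> r z" "r z \<le> 1" for z using R by (auto simp: r_def divide_simps)
  have py: "0 \<le> p z" for z by (simp add: p_def sum_nonneg)
  have pd: "\<bar>p x - p y\<bar> \<le> (\<Sum>k\<in>K. cmod (x k - y k))"
    unfolding p_def sum_subtractf[symmetric] by (rule order_trans[OF sum_abs]) (intro sum_mono norm_triangle_ineq3)
  have ry: "\<bar>r x - r y\<bar> * p y \<le> \<bar>p x - p y\<bar>"
  proof -
    have eq: "r x - r y = r x * (max R (p y) - max R (p x)) / max R (p y)"
      using R by (simp add: r_def field_simps)
    have m: "\<bar>max R (p y) - max R (p x)\<bar> \<le> \<bar>p x - p y\<bar>" by linarith
    have "\<bar>r x - r y\<bar> * p y = r x * \<bar>max R (p y) - max R (p x)\<bar> * (p y / max R (p y))"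
      unfolding eq using r R by (simp add: abs_mult)
    also have "\<dots> \<le> 1 * \<bar>p x - p y\<bar> * 1"
      using r R py m by (intro mult_mono) (auto simp: divide_simps)
    finally show ?thesis by simp
  qed
  have "cmod (complex_of_real (r x) * x k - complex_of_real (r y) * y k) \<le> cmod (x k - y k) + \<bar>r x - r y\<bar> * cmod (y k)" for k
  proof -
    have "complex_of_real (r x) * x k - complex_of_real (r y) * y k
       = complex_of_real (r x) * (x k - y k) + complex_of_real (r x - r y) * y k" by (simp add: algebra_simps)
    also have "cmod \<dots> \<le> r x * cmod (x k - y k) + \<bar>r x - r y\<bar> * cmod (y k)"
      using norm_triangle_ineq[of "complex_of_real (r x) * (x k - y k)" "complex_of_real (r x - r y) * y k"] r
      by (simp only: norm_mult norm_of_real abs_of_nonneg)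
    also have "r x * cmod (x k - y k) \<le> 1 * cmod (x k - y k)" using r by (intro mult_right_mono) auto
    finally show ?thesis by simp
  qed
  then have "(\<Sum>k\<in>K. cmod (complex_of_real (r x) * x k - complex_of_real (r y) * y k))
     \<le> (\<Sum>k\<in>K. cmod (x k - y k) + \<bar>r x - r y\<bar> * cmod (y k))" by (rule sum_mono)
  also have "\<dots> = (\<Sum>k\<in>K. cmod (x k - y k)) + \<bar>r x - r y\<bar> * p y"
    by (simp add: sum.distrib p_def sum_distrib_left)
  also have "\<dots> \<le> 2 * (\<Sum>k\<in>K. cmod (x k - y k))" using ry pd by simp
  finally show ?thesis .
qed

section \<open>The Galerkin nonlinearity\<close>

definition truncated_adv :: "(int^3) set \<Rightarrow> (int^3 \<Rightarrow> complex) \<Rightarrow> int^3 \<Rightarrow> complex" where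
  "truncated_adv K x k = (\<Sum>l\<in>K. \<i> * complex_of_real (ker k l) * x (k - l) * x l)"

lemma truncated_adv_eq_adv:
  assumes "\<And>k. k \<notin> K \<Longrightarrow> x k = 0" "finite K" shows "truncated_adv K x k = adv x x k"
proof -
  have "adv x x k = (\<Sum>\<^sub>\<infinity>l\<in>K. \<i> * complex_of_real (ker k l) * x (k - l) * x l)"
    unfolding adv_def by (rule infsum_cong_neutral) (auto simp: assms)
  then show ?thesis using assms(2) by (simp add: truncated_adv_def)
qed

text \<open>A bilinear expression on the l1 ball of radius R: either slot may change, which gives 2
  R; the sum of all kernel values bounds each of them, and \<open>card K\<close> comes from summing
  over k.\<close>

lemma truncated_adv_lipschitz:
  fixes u v :: "int^3 \<Rightarrow> complex"
  assumes K: "finite K" and u: "\<And>k. k \<notin> K \<Longrightarrow> u k = 0" "(\<Sum>k\<in>K. cmod (u k)) \<le> R"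
    and v: "\<And>k. k \<notin> K \<Longrightarrow> v k = 0" "(\<Sum>k\<in>K. cmod (v k)) \<le> R"
  shows "(\<Sum>k\<in>K. cmod (truncated_adv K u k - truncated_adv K v k))
    \<le> card K * (2 * R * (\<Sum>k\<in>K. \<Sum>l\<in>K. \<bar>ker k l\<bar>)) * (\<Sum>k\<in>K. cmod (u k - v k))"
proof -
  define Q where "Q = (\<Sum>k\<in>K. \<Sum>l\<in>K. \<bar>ker k l\<bar>)"
  define d where "d = (\<Sum>k\<in>K. cmod (u k - v k))"
  have Q: "\<bar>ker k l\<bar> \<le> Q" if "k \<in> K" "l \<in> K" for k l
    unfolding Q_def using K that
    by (intro order_trans[OF member_le_sum[of l K "\<lambda>l. \<bar>ker k l\<bar>"] member_le_sum[of k K "\<lambda>k. \<Sum>l\<in>K. \<bar>ker k l\<bar>"]]) (auto intro: sum_nonneg)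
  have Q0: "0 \<le> Q" by (simp add: Q_def sum_nonneg)
  have d0: "0 \<le> d" by (simp add: d_def sum_nonneg)
  have dk: "cmod (u j - v j) \<le> d" for j
    using K u(1) v(1) d0 unfolding d_def by (cases "j \<in> K") (auto intro: member_le_sum[of j K "\<lambda>k. cmod (u k - v k)"])
  have R0: "0 \<le> R" using u(2) sum_nonneg[of K "\<lambda>k. cmod (u k)"] by auto
  have vk: "cmod (v j) \<le> R" for j
    using K v R0 member_le_sum[of j K "\<lambda>k. cmod (v k)"] by (cases "j \<in> K") auto
  have "cmod (truncated_adv K u k - truncated_adv K v k) \<le> 2 * R * Q * d" if k: "k \<in> K" for k
  proof -
    have "truncated_adv K u k - truncated_adv K v k
      = (\<Sum>l\<in>K. \<i> * complex_of_real (ker k l) * ((u (k - l) - v (k - l)) * u l + v (k - l) * (u l - v l)))"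
      unfolding truncated_adv_def sum_subtractf[symmetric] by (intro sum.cong refl) (simp add: algebra_simps)
    also have "cmod \<dots> \<le> (\<Sum>l\<in>K. Q * (d * cmod (u l) + R * cmod (u l - v l)))"
    proof (rule sum_norm_le)
      fix l assume l: "l \<in> K"
      have "cmod ((u (k - l) - v (k - l)) * u l + v (k - l) * (u l - v l)) \<le> d * cmod (u l) + R * cmod (u l - v l)"
        by (rule order_trans[OF norm_triangle_ineq]) (auto simp: norm_mult intro!: add_mono mult_right_mono dk vk)
      then show "cmod (\<i> * complex_of_real (ker k l) * ((u (k - l) - v (k - l)) * u l + v (k - l) * (u l - v l))) \<le> Q * (d * cmod (u l) + R * cmod (u l - v l))"
        unfolding norm_mult norm_ii norm_of_real mult_1_left using Q[OF k l] Q0 by (intro mult_mono) auto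
    qed
    also have "\<dots> = Q * (d * (\<Sum>l\<in>K. cmod (u l)) + R * d)"
      by (simp add: d_def sum_distrib_left sum.distrib distrib_left)
    also have "\<dots> \<le> Q * (d * R + R * d)"
      using Q0 d0 u(2) by (intro mult_left_mono add_right_mono) auto
    finally show ?thesis by (simp add: algebra_simps)
  qed
  then have "(\<Sum>k\<in>K. cmod (truncated_adv K u k - truncated_adv K v k)) \<le> (\<Sum>k\<in>K. 2 * R * Q * d)" by (rule sum_mono)
  then show ?thesis by (simp add: Q_def d_def mult.assoc)
qed

lemma ker_minus: "ker (- k) (- l) = - ker k l"
proof -
  have "mu (- k - - l) = mu (k - l)" using mu_minus[of "k - l"] by simp
  then show ?thesis by (simp add: ker_def freq_minus)
qed

lemma truncated_adv_real:
  assumes "\<And>k. k \<in> K \<Longrightarrow> - k \<in> K" "\<And>k. x (- k) = cnj (x k)"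
  shows "truncated_adv K x (- k) = cnj (truncated_adv K x k)"
proof -
  have "truncated_adv K x (- k) = (\<Sum>l\<in>K. \<i> * complex_of_real (ker (- k) (- l)) * x (- k - - l) * x (- l))"
    unfolding truncated_adv_def by (rule sum.reindex_bij_witness[where i=uminus and j=uminus]) (use assms in auto)
  also have "\<dots> = (\<Sum>l\<in>K. cnj (\<i> * complex_of_real (ker k l) * x (k - l) * x l))"
  proof (intro sum.cong refl)
    fix l
    have "x (- k - - l) = cnj (x (k - l))" using assms(2)[of "k - l"] by simp
    then show "\<i> * complex_of_real (ker (- k) (- l)) * x (- k - - l) * x (- l) = cnj (\<i> * complex_of_real (ker k l) * x (k - l) * x l)"
      by (simp add: ker_minus assms(2))
  qed
  finally show ?thesis by (simp add: truncated_adv_def)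
qed

lemma esum_finite_support:
  assumes "finite K" "\<And>k. k \<notin> K \<Longrightarrow> f k = 0" shows "esum f = sum f K"
  using assms by (intro nn_integral_count_space') auto

lemma indefinite_integral_has_derivative:
  fixes f :: "real \<Rightarrow> complex"
  assumes f: "continuous_on UNIV f" and x: "\<And>t. 0 \<le> t \<Longrightarrow> x t = z + integral {0..t} f" and t: "\<tau> \<in> {0..T}"
  shows "(x has_vector_derivative f \<tau>) (at \<tau> within {0..T})"
proof -
  have "((\<lambda>u. integral {0..u} f) has_vector_derivative f \<tau>) (at \<tau> within {0..T})"
    by (rule integral_has_vector_derivative[OF continuous_on_subset[OF f]]) (use t in auto)
  then have "((\<lambda>u. z + integral {0..u} f) has_vector_derivative f \<tau>) (at \<tau> within {0..T})"
    using has_vector_derivative_add[OF has_vector_derivative_const] by fastforce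
  then show ?thesis
    by (rule has_vector_derivative_transform[rotated 2]) (use t x in auto)
qed

text \<open>The linear operator is represented by an even symbol with a lower bound. The energy
  bounds derived from it depend on lam, the source and the datum, hence not on \<kappa>.\<close>

locale coeff_problem =
  fixes a :: "int^3 \<Rightarrow> real" and S c0 :: "int^3 \<Rightarrow> complex" and lam :: real
  assumes lam: "0 < lam" and a: "\<And>k. lam * (norm (freq k) + 1) \<le> a k"
    and S_fin: "energy S < \<infinity>" and c0_fin: "energy c0 < \<infinity>"
    and S_real: "\<And>k. S (- k) = cnj (S k)" and c0_real: "\<And>k. c0 (- k) = cnj (c0 k)"
    and a_even: "\<And>k. a (- k) = a k" and S_0: "S 0 = 0" and c0_0: "c0 0 = 0"
begin

definition e0 :: real where "e0 = enn2real (energy c0)"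

definition sS :: real where "sS = enn2real (energy S)"

text \<open>Bound provided by the differential inequality e' + lam e <= sS / lam: its solutions stay
  below the initial value plus the equilibrium sS / lam^2.\<close>

definition M2 :: real where "M2 = e0 + sS / lam\<^sup>2"

lemma e0: "energy c0 = ennreal e0" "0 \<le> e0"
  and sS: "energy S = ennreal sS" "0 \<le> sS"
  using c0_fin S_fin by (auto simp: e0_def sS_def less_top)

lemma M2_nonneg: "0 \<le> M2"
  using e0 sS lam by (simp add: M2_def)

lemma sum_sq_le_enn2real:
  assumes "energy x = ennreal s" "finite K" "0 \<le> s" shows "(\<Sum>k\<in>K. (cmod (x k))\<^sup>2) \<le> s"
proof -
  have "ennreal (\<Sum>k\<in>K. (cmod (x k))\<^sup>2) \<le> ennreal s"
    using sum_le_esum[OF assms(2), of "\<lambda>k. ennreal (1 * (cmod (x k))\<^sup>2)"] assms(1) by (simp add: wsq_def)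
  then show ?thesis using assms(3) by (simp add: ennreal_le_iff)
qed

text \<open>On K the cut-off field u is a real multiple of x, so its advection tested with x is
  antisymmetric with the constant weight r and contributes nothing. Young's inequality for the
  source spends lam |x|^2 of the damping 2 lam (|k| + 1) |x|^2 and leaves the two terms subtracted
  on the right.\<close>

lemma galerkin_rate_le:
  assumes K: "finite K" and u: "\<And>k. u (- k) = cnj (u k)" "\<And>k. k \<in> K \<Longrightarrow> u k = complex_of_real r * x k"
  shows "(\<Sum>k\<in>K. 2 * Re ((S k - truncated_adv K u k - complex_of_real (a k) * x k) * cnj (x k)))
    \<le> sS / lam - lam * (\<Sum>k\<in>K. (cmod (x k))\<^sup>2) - 2 * lam * (\<Sum>k\<in>K. norm (freq k) * (cmod (x k))\<^sup>2)"
proof -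
  have "(\<Sum>k\<in>K. truncated_adv K u k * cnj (x k))
     = (\<Sum>k\<in>K. \<Sum>l\<in>K. complex_of_real r * (\<i> * complex_of_real (ker k l) * u (k - l) * x l) * cnj (x k))"
    unfolding truncated_adv_def sum_distrib_right by (intro sum.cong refl) (simp add: u(2))
  then have N0: "Re (\<Sum>k\<in>K. truncated_adv K u k * cnj (x k)) = 0"
    using adv_antisymmetric[of K u "\<lambda>_. r" x, OF K u(1)] by (simp del: Re_sum)
  have pt: "2 * Re ((S k - truncated_adv K u k - complex_of_real (a k) * x k) * cnj (x k))
     \<le> ((cmod (S k))\<^sup>2 / lam - lam * (cmod (x k))\<^sup>2 - 2 * lam * (norm (freq k) * (cmod (x k))\<^sup>2))
        - 2 * Re (truncated_adv K u k * cnj (x k))" for k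
  proof -
    have 1: "Re (S k * cnj (x k)) \<le> cmod (S k) * cmod (x k)"
      using complex_Re_le_cmod[of "S k * cnj (x k)"] by (simp only: norm_mult complex_mod_cnj)
    have "0 \<le> (cmod (S k) - lam * cmod (x k))\<^sup>2 / lam" using lam by simp
    also have "\<dots> = (cmod (S k))\<^sup>2 / lam + lam * (cmod (x k))\<^sup>2 - 2 * (cmod (S k) * cmod (x k))"
      using lam by (simp add: field_simps power2_eq_square)
    finally have 2: "2 * (cmod (S k) * cmod (x k)) \<le> (cmod (S k))\<^sup>2 / lam + lam * (cmod (x k))\<^sup>2" by simp
    have 3: "Re (x k * cnj (x k)) = (cmod (x k))\<^sup>2" by (metis Re_complex_of_real complex_norm_square)
    have 4: "lam * (norm (freq k) + 1) * (cmod (x k))\<^sup>2 \<le> a k * (cmod (x k))\<^sup>2"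
      by (intro mult_right_mono a) simp
    have "Re ((S k - truncated_adv K u k - complex_of_real (a k) * x k) * cnj (x k))
       = Re (S k * cnj (x k)) - Re (truncated_adv K u k * cnj (x k)) - a k * (cmod (x k))\<^sup>2"
      unfolding left_diff_distrib mult.assoc[of "complex_of_real (a k)"]
      by (simp only: minus_complex.sel Re_of_real_mult 3)
    then show ?thesis using 1 2 4 by (simp add: algebra_simps)
  qed
  have "(\<Sum>k\<in>K. 2 * Re ((S k - truncated_adv K u k - complex_of_real (a k) * x k) * cnj (x k)))
     \<le> (\<Sum>k\<in>K. ((cmod (S k))\<^sup>2 / lam - lam * (cmod (x k))\<^sup>2 - 2 * lam * (norm (freq k) * (cmod (x k))\<^sup>2))
        - 2 * Re (truncated_adv K u k * cnj (x k)))"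
    by (intro sum_mono pt)
  also have "\<dots> = (\<Sum>k\<in>K. (cmod (S k))\<^sup>2) / lam - lam * (\<Sum>k\<in>K. (cmod (x k))\<^sup>2)
      - 2 * lam * (\<Sum>k\<in>K. norm (freq k) * (cmod (x k))\<^sup>2) - 2 * Re (\<Sum>k\<in>K. truncated_adv K u k * cnj (x k))"
    by (simp only: sum_subtractf sum_distrib_left sum_divide_distrib Re_sum)
  also have "\<dots> \<le> sS / lam - lam * (\<Sum>k\<in>K. (cmod (x k))\<^sup>2) - 2 * lam * (\<Sum>k\<in>K. norm (freq k) * (cmod (x k))\<^sup>2)"
    unfolding N0 using sum_sq_le_enn2real[OF sS(1) K sS(2)] lam by (simp add: divide_right_mono)
  finally show ?thesis .
qed

text \<open>The system is solved with the nonlinearity cut off radially, which keeps the energy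
  estimate intact; that estimate then shows that the cut-off is never active, so the trajectory
  solves the original system.\<close>

lemma galerkin_exists:
  assumes K: "finite K" "\<And>k. k \<in> K \<Longrightarrow> - k \<in> K"
  obtains x :: "real \<Rightarrow> int^3 \<Rightarrow> complex" where
    "\<And>k. continuous_on UNIV (\<lambda>t. x t k)" "\<And>t k. x t (- k) = cnj (x t k)" "\<And>t k. k \<notin> K \<Longrightarrow> x t k = 0"
    "\<And>t. energy (x t) \<le> ennreal M2"
    "\<And>T. 0 \<le> T \<Longrightarrow> (\<integral>\<^sup>+t. half_energy (x t) * indicator {0..T} t \<partial>lborel) \<le> ennreal ((e0 + sS / lam * T) / (2 * lam))"
    "\<And>t k. k \<in> K \<Longrightarrow> x t k = c0 k + integral {0..max 0 t} (\<lambda>s. crhs a S (x s) k)"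
proof -
  \<comment> \<open>The energy bound limits each coefficient by sqrt M2, so the l1 norm over K stays
    below R.\<close>
  define R where "R = card K * sqrt M2 + 1"
  have R: "0 < R" using M2_nonneg by (simp add: R_def add_nonneg_pos)
  define r where "r = (\<lambda>x. R / max R (\<Sum>k\<in>K. cmod (x k)))"
  define cut where "cut = (\<lambda>x k. if k \<in> K then complex_of_real (r x) * x k else 0 :: complex)"
  define F where "F = (\<lambda>x k. if k \<in> K then S k - truncated_adv K (cut x) k - complex_of_real (a k) * x k else 0)"
  have mK: "- k \<in> K \<longleftrightarrow> k \<in> K" for k using K(2)[of k] K(2)[of "-k"] by auto
  have cut_real: "cut x (- k) = cnj (cut x k)" if "\<And>k. x (- k) = cnj (x k)" for x k
    using that by (simp add: cut_def mK)
  define x0 where "x0 = (\<lambda>k. if k \<in> K then c0 k else 0)"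
  have cutsum: "(\<Sum>k\<in>K. cmod (cut x k)) \<le> R" for x
  proof -
    have p0: "0 \<le> (\<Sum>k\<in>K. cmod (x k))" by (simp add: sum_nonneg)
    have "0 \<le> r x" using R by (simp add: r_def)
    then have "(\<Sum>k\<in>K. cmod (cut x k)) = r x * (\<Sum>k\<in>K. cmod (x k))"
      by (simp add: cut_def norm_mult sum_distrib_left)
    also have "\<dots> \<le> R" using R p0 by (simp add: r_def divide_simps)
    finally show ?thesis .
  qed
  define Q where "Q = card K * (2 * R * (\<Sum>k\<in>K. \<Sum>l\<in>K. \<bar>ker k l\<bar>))"
  have Q: "0 \<le> Q" using R by (simp add: Q_def sum_nonneg)
  define L where "L = Q * 2 + (\<Sum>k\<in>K. a k) + 1"
  have a0: "0 \<le> a k" for k using a[of k] lam by (meson add_nonneg_nonneg mult_nonneg_nonneg norm_ge_zero less_imp_le order_trans zero_le_one)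
  have L: "0 < L" using Q a0 by (simp add: L_def sum_nonneg add_nonneg_pos)
  have lip: "(\<Sum>k\<in>K. cmod (F x k - F y k)) \<le> L * (\<Sum>k\<in>K. cmod (x k - y k))" for x y
  proof -
    define d where "d = (\<Sum>k\<in>K. cmod (x k - y k))"
    have d0: "0 \<le> d" by (simp add: d_def sum_nonneg)
    have "(\<Sum>k\<in>K. cmod (F x k - F y k))
       \<le> (\<Sum>k\<in>K. cmod (truncated_adv K (cut x) k - truncated_adv K (cut y) k) + a k * cmod (x k - y k))"
    proof (rule sum_mono)
      fix k assume k: "k \<in> K"
      have "F x k - F y k = (- (truncated_adv K (cut x) k - truncated_adv K (cut y) k)) - complex_of_real (a k) * (x k - y k)"
        using k by (simp add: F_def algebra_simps)
      also have "cmod \<dots> \<le> cmod (truncated_adv K (cut x) k - truncated_adv K (cut y) k) + a k * cmod (x k - y k)"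
        by (rule order_trans[OF norm_triangle_ineq4]) (use a0[of k] in \<open>simp only: norm_mult norm_minus_cancel norm_of_real abs_of_nonneg order_refl\<close>)
      finally show "cmod (F x k - F y k) \<le> \<dots>" .
    qed
    also have "\<dots> \<le> Q * (\<Sum>k\<in>K. cmod (cut x k - cut y k)) + (\<Sum>k\<in>K. a k * d)"
    proof -
      have "(\<Sum>k\<in>K. cmod (truncated_adv K (cut x) k - truncated_adv K (cut y) k)) \<le> Q * (\<Sum>k\<in>K. cmod (cut x k - cut y k))"
        unfolding Q_def by (rule truncated_adv_lipschitz[OF K(1) _ cutsum _ cutsum]) (simp_all add: cut_def)
      moreover have "(\<Sum>k\<in>K. a k * cmod (x k - y k)) \<le> (\<Sum>k\<in>K. a k * d)"
        using K(1) a0 unfolding d_def by (intro sum_mono mult_left_mono member_le_sum) auto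
      ultimately show ?thesis by (simp add: sum.distrib)
    qed
    also have "(\<Sum>k\<in>K. cmod (cut x k - cut y k)) \<le> 2 * d"
      using radial_cutoff_lipschitz[OF R, of x K y] unfolding d_def cut_def r_def by (simp cong: sum.cong)
    finally have "(\<Sum>k\<in>K. cmod (F x k - F y k)) \<le> Q * (2 * d) + (\<Sum>k\<in>K. a k * d)"
      using Q by (simp add: mult_left_mono)
    also have "(\<Sum>k\<in>K. a k * d) = (\<Sum>k\<in>K. a k) * d" by (rule sum_distrib_right[symmetric])
    also have "Q * (2 * d) + (\<Sum>k\<in>K. a k) * d \<le> L * d" using d0 unfolding L_def distrib_right by simp
    finally show ?thesis by (simp add: d_def)
  qed
  have Freal: "F x (- k) = cnj (F x k)" if "\<And>k. x (- k) = cnj (x k)" for x k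
    using truncated_adv_real[of K "cut x" k, OF K(2) cut_real] that by (simp add: F_def mK S_real a_even)
  have F0: "F x k = 0" if "k \<notin> K" for x k using that by (simp add: F_def)
  have x00: "x0 k = 0" if "k \<notin> K" for k using that by (simp add: x0_def)
  have x0r: "x0 (- k) = cnj (x0 k)" for k by (simp add: x0_def mK c0_real)
  obtain x :: "real \<Rightarrow> int^3 \<Rightarrow> complex" where xc: "\<And>k. continuous_on UNIV (\<lambda>t. x t k)" and xr: "\<And>t k. x t (- k) = cnj (x t k)"
    and xK: "\<And>t k. k \<notin> K \<Longrightarrow> x t k = 0" and Fc: "\<And>k. continuous_on UNIV (\<lambda>t. F (x t) k)"
    and xeq: "\<And>t k. x t k = x0 k + integral {0..max 0 t} (\<lambda>s. F (x s) k)"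
    using finite_ode_solution[of K L F x0, OF K(1) L lip F0 x00 Freal x0r] by blast
  define e where "e = (\<lambda>t. \<Sum>k\<in>K. (cmod (x t k))\<^sup>2)"
  define h where "h = (\<lambda>t. \<Sum>k\<in>K. norm (freq k) * (cmod (x t k))\<^sup>2)"
  define D where "D = (\<lambda>t. \<Sum>k\<in>K. 2 * Re (F (x t) k * cnj (x t k)))"
  have xd: "((\<lambda>t. x t k) has_vector_derivative F (x \<tau>) k) (at \<tau> within {0..T})" if "\<tau> \<in> {0..T}" for k \<tau> T
  proof (rule indefinite_integral_has_derivative[OF Fc _ that])
    show "x t k = x0 k + integral {0..t} (\<lambda>s. F (x s) k)" if "0 \<le> t" for t
      using xeq[of t k] that by (simp only: max_absorb2)
  qed
  have ed: "(e has_vector_derivative D \<tau>) (at \<tau> within {0..T})" if "\<tau> \<in> {0..T}" for \<tau> T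
    unfolding e_def D_def by (intro has_vector_derivative_sum has_vector_derivative_norm_sq xd that)
  have Dle: "D t \<le> sS / lam - lam * e t - 2 * lam * h t" for t
  proof -
    have "D t = (\<Sum>k\<in>K. 2 * Re ((S k - truncated_adv K (cut (x t)) k - complex_of_real (a k) * x t k) * cnj (x t k)))"
      unfolding D_def by (intro sum.cong refl) (simp add: F_def)
    also have "\<dots> \<le> sS / lam - lam * e t - 2 * lam * h t"
      unfolding e_def h_def by (rule galerkin_rate_le[of K "cut (x t)" "r (x t)" "x t", OF K(1) cut_real[of "x t", OF xr]]) (simp add: cut_def)
    finally show ?thesis .
  qed
  have h0: "0 \<le> h t" for t by (simp add: h_def sum_nonneg)
  have en0: "0 \<le> e t" for t by (simp add: e_def sum_nonneg)
  have e_init: "e 0 \<le> e0"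
  proof -
    have "e 0 = (\<Sum>k\<in>K. (cmod (c0 k))\<^sup>2)" unfolding e_def using xeq[of 0] by (intro sum.cong refl) (simp add: x0_def)
    then show ?thesis using sum_sq_le_enn2real[OF e0(1) K(1) e0(2)] by simp
  qed
  have e_bd: "e t \<le> M2" if t: "0 \<le> t" for t
  proof -
    \<comment> \<open>Integrating factor exp (lam t) for the deviation of the energy from the
      equilibrium; its derivative u' is nonpositive.\<close>
    define u where "u = (\<lambda>t. (e t - sS / lam\<^sup>2) * exp (lam * t))"
    define u' where "u' = (\<lambda>t. D t * exp (lam * t) + (e t - sS / lam\<^sup>2) * (lam * exp (lam * t)))"
    have "(u has_vector_derivative u' \<tau>) (at \<tau> within {0..t})" if "\<tau> \<in> {0..t}" for \<tau>
    proof -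
      have ed': "(e has_real_derivative D \<tau>) (at \<tau> within {0..t})"
        using ed[OF that] by (simp add: has_real_derivative_iff_has_vector_derivative)
      show ?thesis
        unfolding u_def u'_def has_real_derivative_iff_has_vector_derivative[symmetric]
        by (rule derivative_eq_intros ed' refl)+ (simp add: mult_ac)
    qed
    then have "(u' has_integral (u t - u 0)) {0..t}"
      by (rule fundamental_theorem_of_calculus[OF t])
    moreover have "u' \<tau> \<le> 0" for \<tau>
    proof -
      have "u' \<tau> = (D \<tau> + lam * e \<tau> - sS / lam) * exp (lam * \<tau>)"
        using lam by (simp add: u'_def algebra_simps power2_eq_square)
      moreover have "D \<tau> + lam * e \<tau> - sS / lam \<le> 0" using Dle[of \<tau>] mult_nonneg_nonneg[OF less_imp_le[OF lam] h0[of \<tau>]] by linarith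
      ultimately show ?thesis by (simp add: mult_nonpos_nonneg)
    qed
    ultimately have "u t - u 0 \<le> 0"
      by (rule has_integral_le[OF _ has_integral_0[of "{0..t}"]])
    then have "(e t - sS / lam\<^sup>2) * exp (lam * t) \<le> e 0 - sS / lam\<^sup>2" by (simp add: u_def)
    also have "\<dots> \<le> e 0" using sS lam by simp
    also have "\<dots> \<le> e 0 * exp (lam * t)" using mult_left_mono[of 1 "exp (lam * t)" "e 0"] en0[of 0] lam t by simp
    finally have "e t - sS / lam\<^sup>2 \<le> e 0" by simp
    then show ?thesis using e_init by (simp add: M2_def)
  qed
  have xmax: "x t = x (max 0 t)" for t
  proof
    show "x t k = x (max 0 t) k" for k
      using xeq[of t k] xeq[of "max 0 t" k] by (simp only: max.left_idem)
  qed
  have e_bd': "e t \<le> M2" for t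
    using e_bd[of "max 0 t"] xmax[of t] by (simp add: e_def)
  have energy_eq: "energy (x t) = ennreal (e t)" for t
    unfolding wsq_def e_def by (subst esum_finite_support[OF K(1)]) (auto simp: xK)
  have half_eq: "half_energy (x t) = ennreal (h t)" for t
    unfolding wsq_def h_def by (subst esum_finite_support[OF K(1)]) (auto simp: xK)
  have E: "energy (x t) \<le> ennreal M2" for t unfolding energy_eq by (rule ennreal_leI[OF e_bd'])
  have H: "(\<integral>\<^sup>+t. half_energy (x t) * indicator {0..T} t \<partial>lborel) \<le> ennreal ((e0 + sS / lam * T) / (2 * lam))" if T: "0 \<le> T" for T
  proof -
    have "ennreal (e T) + (\<integral>\<^sup>+t. ennreal (2 * lam * h t) * indicator {0..T} t \<partial>lborel)
        \<le> ennreal (e 0) + (\<integral>\<^sup>+t. ennreal (sS / lam) * indicator {0..T} t \<partial>lborel)"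
    proof (rule ftc_nn_integral_le[OF T ed])
      show "D \<tau> \<le> sS / lam - 2 * lam * h \<tau>" for \<tau> using Dle[of \<tau>] mult_nonneg_nonneg[OF less_imp_le[OF lam] en0[of \<tau>]] by linarith
      show "continuous_on UNIV (\<lambda>t. 2 * lam * h t)" unfolding h_def by (intro continuous_intros xc)
    qed (use sS lam h0 en0 in auto)
    also have "\<dots> \<le> ennreal e0 + ennreal (sS / lam * T)"
      using e_init T sS lam by (intro add_mono) (auto simp: nn_integral_cmult ennreal_leI simp flip: ennreal_mult)
    finally have "(\<integral>\<^sup>+t. ennreal (2 * lam * h t) * indicator {0..T} t \<partial>lborel) \<le> ennreal (e0 + sS / lam * T)"
      using e0 sS lam T by (simp add: ennreal_plus) (rule order_trans[OF add_increasing[OF zero_le order_refl]])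
    then have "ennreal (1 / (2 * lam)) * (\<integral>\<^sup>+t. ennreal (2 * lam * h t) * indicator {0..T} t \<partial>lborel) \<le> ennreal (1 / (2 * lam)) * ennreal (e0 + sS / lam * T)"
      by (rule mult_left_mono) simp
    also have "\<dots> = ennreal ((e0 + sS / lam * T) / (2 * lam))"
      using e0 sS lam T by (subst ennreal_mult[symmetric]) auto
    also have "ennreal (1 / (2 * lam)) * (\<integral>\<^sup>+t. ennreal (2 * lam * h t) * indicator {0..T} t \<partial>lborel)
       = (\<integral>\<^sup>+t. half_energy (x t) * indicator {0..T} t \<partial>lborel)"
    proof -
      have [measurable]: "h \<in> borel_measurable borel"
        unfolding h_def by (intro borel_measurable_continuous_onI continuous_intros xc)
      have "ennreal (1 / (2 * lam)) * (ennreal (2 * lam * h t) * indicator {0..T} t) = half_energy (x t) * indicator {0..T} t" for t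
        unfolding half_eq mult.assoc[symmetric] using lam h0 by (subst ennreal_mult[symmetric]) auto
      note pt = this
      show ?thesis unfolding pt[symmetric] by (rule nn_integral_cmult[symmetric]) simp
    qed
    finally show ?thesis .
  qed
  have r1: "r (x t) = 1" for t
  proof -
    have "cmod (x t k) \<le> sqrt M2" if "k \<in> K" for k
    proof (rule real_le_rsqrt)
      have "(cmod (x t k))\<^sup>2 \<le> e t" unfolding e_def by (rule member_le_sum[OF that _ K(1)]) simp
      then show "(cmod (x t k))\<^sup>2 \<le> M2" using e_bd'[of t] by simp
    qed
    then have "(\<Sum>k\<in>K. cmod (x t k)) \<le> (\<Sum>k\<in>K. sqrt M2)" by (rule sum_mono)
    then show ?thesis using R by (simp add: r_def R_def)
  qed
  have cutx: "cut (x t) = x t" for t by (auto simp: cut_def r1 xK)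
  have Fx: "F (x t) k = crhs a S (x t) k" if "k \<in> K" for t k
    using that by (simp add: F_def crhs_def cutx truncated_adv_eq_adv[OF xK K(1)])
  have "x t k = c0 k + integral {0..max 0 t} (\<lambda>s. crhs a S (x s) k)" if k: "k \<in> K" for t k
  proof -
    have "x t k = x0 k + integral {0..max 0 t} (\<lambda>s. F (x s) k)" by (rule xeq)
    also have "\<dots> = c0 k + integral {0..max 0 t} (\<lambda>s. crhs a S (x s) k)"
      using k by (simp only: Fx x0_def if_True)
    finally show ?thesis .
  qed
  note eqK = this
  show ?thesis
    by (rule that[of x]) (erule xK eqK H | rule xc xr E)+
qed

end

section \<open>Existence of solutions\<close>

lemma coeff_le_energy:
  assumes "energy x \<le> ennreal (M\<^sup>2)" "0 \<le> M" shows "cmod (x k) \<le> M"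
proof -
  have "ennreal ((cmod (x k))\<^sup>2) \<le> energy x"
    using sum_le_esum[of "{k}" "\<lambda>k. ennreal (1 * (cmod (x k))\<^sup>2)"] by (simp add: wsq_def)
  also note assms(1)
  finally have "(cmod (x k))\<^sup>2 \<le> M\<^sup>2" by (simp add: ennreal_le_iff)
  then show ?thesis by (rule power2_le_imp_le) fact
qed

lemma crhs_bound:
  assumes "energy x \<le> ennreal (M\<^sup>2)" "0 \<le> M"
  shows "cmod (crhs a S x k) \<le> cmod (S k) + norm (freq k) * 5 * M\<^sup>2 + \<bar>a k\<bar> * M"
proof -
  \<comment> \<open>With no frequencies taken out, the tail estimate covers the whole
    series.\<close>
  have "cmod (adv x x k - (\<Sum>l\<in>{}. \<i> * complex_of_real (ker k l) * x (k - l) * x l)) \<le> norm (freq k) * 5 * M\<^sup>2"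
    by (rule adv_tail_le[OF assms(1)]) (auto intro: norm_mu_le_5)
  then have 1: "cmod (adv x x k) \<le> norm (freq k) * 5 * M\<^sup>2" by simp
  have 2: "cmod (complex_of_real (a k) * x k) \<le> \<bar>a k\<bar> * M"
    using coeff_le_energy[OF assms] by (simp add: norm_mult mult_left_mono)
  have "cmod (crhs a S x k) \<le> cmod (S k) + cmod (adv x x k) + cmod (complex_of_real (a k) * x k)"
    unfolding crhs_def by (intro norm_triangle_le_diff add_mono order_refl)
  then show ?thesis using 1 2 by linarith
qed

lemma integral_max_lipschitz:
  fixes f :: "real \<Rightarrow> complex"
  assumes f: "continuous_on UNIV f" and B: "\<And>s. cmod (f s) \<le> B"
  shows "cmod (integral {0..max 0 t} f - integral {0..max 0 s} f) \<le> B * \<bar>t - s\<bar>"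
proof -
  have B0: "0 \<le> B" using B[of 0] norm_ge_zero order_trans by blast
  have main: "cmod (integral {0..t} f - integral {0..s} f) \<le> B * (t - s)" if "0 \<le> s" "s \<le> t" for s t
  proof -
    have "f integrable_on {0..t}" by (rule integrable_continuous_real[OF continuous_on_subset[OF f]]) simp
    then have "integral {0..s} f + integral {s..t} f = integral {0..t} f"
      using that by (intro Henstock_Kurzweil_Integration.integral_combine) auto
    then have "integral {0..t} f - integral {0..s} f = integral {s..t} f" by (simp add: algebra_simps)
    also have "cmod \<dots> \<le> B * (t - s)"
      using that by (intro integral_bound continuous_on_subset[OF f] B) auto
    finally show ?thesis .
  qed
  have le: "\<bar>max 0 t - max 0 s\<bar> \<le> \<bar>t - s\<bar>" by linarith
  have "cmod (integral {0..max 0 t} f - integral {0..max 0 s} f) \<le> B * \<bar>max 0 t - max 0 s\<bar>"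
  proof -
    define u v where "u = max 0 s" and "v = max 0 t"
    have "0 \<le> u" "0 \<le> v" by (simp_all add: u_def v_def)
    then have "cmod (integral {0..v} f - integral {0..u} f) \<le> B * \<bar>v - u\<bar>"
      using main[of u v] main[of v u] norm_minus_commute[of "integral {0..v} f"] by (cases "u \<le> v") simp_all
    then show ?thesis by (simp only: u_def v_def)
  qed
  also have "\<dots> \<le> B * \<bar>t - s\<bar>" using le B0 by (rule mult_left_mono)
  finally show ?thesis .
qed

context coeff_problem
begin

text \<open>Coefficientwise limits suffice: every coefficient is bounded and Lipschitz in time
  uniformly in n, \<open>adv_tendsto\<close> passes to the limit in the nonlinearity, and Fatou's
  lemma carries over the energy and the half energy bounds.\<close>

theorem solution_exists:
  obtains c where "coeff_solution a S c0 c" "\<And>t. energy (c t) \<le> ennreal M2"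
    "\<And>T. 0 \<le> T \<Longrightarrow> (\<integral>\<^sup>+t. half_energy (c t) * indicator {0..T} t \<partial>lborel) \<le> ennreal ((e0 + sS / lam * T) / (2 * lam))"
proof -
  \<comment> \<open>Without the zero mode every approximation has mean zero. At k = 0 the limit
    equation is trivial, since source, datum and advection term vanish there.\<close>
  define K where "K = (\<lambda>n. cube n - {0})"
  have K: "finite (K n)" "\<And>k. k \<in> K n \<Longrightarrow> - k \<in> K n" for n
    by (auto simp: K_def cube_minus)
  define M where "M = sqrt M2"
  have M: "0 \<le> M" "M2 = M\<^sup>2" using M2_nonneg by (auto simp: M_def)
  define good where "good = (\<lambda>n (x :: real \<Rightarrow> int^3 \<Rightarrow> complex). (\<forall>k. continuous_on UNIV (\<lambda>t. x t k)) \<and> (\<forall>t k. x t (- k) = cnj (x t k))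
    \<and> (\<forall>t k. k \<notin> K n \<longrightarrow> x t k = 0) \<and> (\<forall>t. energy (x t) \<le> ennreal M2)
    \<and> (\<forall>T. 0 \<le> T \<longrightarrow> (\<integral>\<^sup>+t. half_energy (x t) * indicator {0..T} t \<partial>lborel) \<le> ennreal ((e0 + sS / lam * T) / (2 * lam)))
    \<and> (\<forall>t k. k \<in> K n \<longrightarrow> x t k = c0 k + integral {0..max 0 t} (\<lambda>s. crhs a S (x s) k)))"
  have "\<exists>x. good n x" for n
  proof (rule galerkin_exists[of "K n"], goal_cases)
    case (3 x)
    show ?case unfolding good_def
      by (intro exI[of _ x] conjI allI impI) (assumption | rule 3)+
  qed (rule K, erule K)
  then obtain X where gX: "\<And>n. good n (X n)" by metis
  have Xc: "continuous_on UNIV (\<lambda>t. X n t k)" and Xr: "X n t (- k) = cnj (X n t k)"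
    and XK: "k \<notin> K n \<Longrightarrow> X n t k = 0" and XE: "energy (X n t) \<le> ennreal M2"
    and XH: "0 \<le> T \<Longrightarrow> (\<integral>\<^sup>+t. half_energy (X n t) * indicator {0..T} t \<partial>lborel) \<le> ennreal ((e0 + sS / lam * T) / (2 * lam))"
    and Xeq: "k \<in> K n \<Longrightarrow> X n t k = c0 k + integral {0..max 0 t} (\<lambda>s. crhs a S (X n s) k)" for n t k T
    using gX[of n] unfolding good_def by blast+
  define Cb where "Cb = (\<lambda>k. cmod (S k) + norm (freq k) * 5 * M\<^sup>2 + \<bar>a k\<bar> * M)"
  have Cb0: "0 \<le> Cb k" for k using M by (simp add: Cb_def)
  have crb: "cmod (crhs a S (X n s) k) \<le> Cb k" for n s k
    unfolding Cb_def using XE M by (intro crhs_bound) auto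
  have crc: "continuous_on UNIV (\<lambda>s. crhs a S (X n s) k)" for n k
    by (rule crhs_continuous[OF Xc]) (use XE M in auto)
  have Xlip: "cmod (X n t k - X n s k) \<le> Cb k * \<bar>t - s\<bar>" for n t s k
  proof (cases "k \<in> K n")
    case True
    have "X n t k - X n s k = integral {0..max 0 t} (\<lambda>s. crhs a S (X n s) k) - integral {0..max 0 s} (\<lambda>s. crhs a S (X n s) k)"
      using Xeq[OF True, of t] Xeq[OF True, of s] by (metis add_diff_cancel_left)
    then show ?thesis using integral_max_lipschitz[OF crc crb] by metis
  qed (simp add: XK Cb0)
  have Xbd: "cmod (X n t k) \<le> M" for n t k
    by (rule coeff_le_energy) (use XE M in auto)
  \<comment> \<open>Diagonal selection over the countable set of pairs of a frequency and a rational
    time; the uniform Lipschitz bounds extend the convergence to all times.\<close>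
  obtain \<rho> where \<rho>: "strict_mono (\<rho> :: nat \<Rightarrow> nat)"
    and conv0: "\<And>z :: (int^3) \<times> rat. z \<in> UNIV \<Longrightarrow> \<exists>l. (\<lambda>n. X (\<rho> n) (real_of_rat (snd z)) (fst z)) \<longlonglongrightarrow> l"
    using function_convergent_subsequence[of "UNIV :: ((int^3) \<times> rat) set" "\<lambda>n z. X n (real_of_rat (snd z)) (fst z)" M] Xbd
    by (metis countableI_type)
  have conv: "convergent (\<lambda>n. X (\<rho> n) t k)" for t k
  proof -
    have "Cauchy (\<lambda>n. X (\<rho> n) t k)"
    proof (rule metric_CauchyI)
      fix e :: real assume e: "0 < e"
      \<comment> \<open>Two approximations at time t are compared through a rational time at
        distance less than d; three errors of at most e / 4 stay below e.\<close>
      define d where "d = e / (4 * (Cb k + 1))"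
      have d: "0 < d" using e Cb0[of k] by (simp add: d_def add_nonneg_pos)
      have Cd: "Cb k * d \<le> e / 4"
      proof -
        have "Cb k * d \<le> (Cb k + 1) * d" using d by (intro mult_right_mono) auto
        also have "\<dots> = e / 4" using Cb0[of k] by (simp add: d_def field_simps)
        finally show ?thesis .
      qed
      obtain q where q: "t < real_of_rat q" "real_of_rat q < t + d"
        using of_rat_dense[of t "t + d"] d by auto
      have "Cauchy (\<lambda>n. X (\<rho> n) (real_of_rat q) k)"
        using conv0[of "(k, q)"] by (auto intro: convergent_Cauchy convergentI)
      then obtain N where N: "\<forall>m\<ge>N. \<forall>n\<ge>N. dist (X (\<rho> m) (real_of_rat q) k) (X (\<rho> n) (real_of_rat q) k) < e / 4"
        using e by (metis Cauchy_def zero_less_divide_iff zero_less_numeral)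
      have lip: "dist (X n t k) (X n (real_of_rat q) k) \<le> e / 4" for n
      proof -
        have "dist (X n t k) (X n (real_of_rat q) k) \<le> Cb k * \<bar>t - real_of_rat q\<bar>"
          unfolding dist_norm by (rule Xlip)
        also have "\<dots> \<le> Cb k * d" using q Cb0 by (intro mult_left_mono) auto
        finally show ?thesis using Cd by simp
      qed
      have "dist (X (\<rho> m) t k) (X (\<rho> n) t k) < e" if "m \<ge> N" "n \<ge> N" for m n
      proof -
        have "dist (X (\<rho> m) t k) (X (\<rho> n) t k) \<le> dist (X (\<rho> m) t k) (X (\<rho> m) (real_of_rat q) k)
           + dist (X (\<rho> m) (real_of_rat q) k) (X (\<rho> n) (real_of_rat q) k) + dist (X (\<rho> n) t k) (X (\<rho> n) (real_of_rat q) k)"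
          by metric
        also have "\<dots> < e" using lip[of "\<rho> m"] lip[of "\<rho> n"] N[rule_format, OF that] e by linarith
        finally show ?thesis .
      qed
      then show "\<exists>N. \<forall>m\<ge>N. \<forall>n\<ge>N. dist (X (\<rho> m) t k) (X (\<rho> n) t k) < e" by blast
    qed
    then show ?thesis by (simp add: Cauchy_convergent_iff)
  qed
  define c where "c = (\<lambda>t k. lim (\<lambda>n. X (\<rho> n) t k))"
  have lim: "(\<lambda>n. X (\<rho> n) t k) \<longlonglongrightarrow> c t k" for t k
    using conv by (simp add: c_def convergent_LIMSEQ_iff)
  have clip: "cmod (c t k - c s k) \<le> Cb k * \<bar>t - s\<bar>" for t s k
    by (rule tendsto_upperbound[OF tendsto_norm[OF tendsto_diff[OF lim lim]]]) (auto simp: Xlip)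
  have cc: "continuous_on UNIV (\<lambda>t. c t k)" for k
  proof (rule lipschitz_on_continuous_on)
    show "(Cb k)-lipschitz_on UNIV (\<lambda>t. c t k)"
      using clip Cb0 by (intro lipschitz_onI) (auto simp: dist_norm)
  qed
  have wlim: "wsq m (c t) \<le> liminf (\<lambda>n. wsq m (X (\<rho> n) t))" for m t
  proof -
    have "wsq m (c t) = esum (\<lambda>k. liminf (\<lambda>n. ennreal (m k * (cmod (X (\<rho> n) t k))\<^sup>2)))"
      unfolding wsq_def
    proof (intro nn_integral_cong)
      fix k
      have "(\<lambda>n. ennreal (m k * (cmod (X (\<rho> n) t k))\<^sup>2)) \<longlonglongrightarrow> ennreal (m k * (cmod (c t k))\<^sup>2)"
        by (intro tendsto_intros lim)
      then show "ennreal (m k * (cmod (c t k))\<^sup>2) = liminf (\<lambda>n. ennreal (m k * (cmod (X (\<rho> n) t k))\<^sup>2))"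
        by (intro lim_imp_Liminf[symmetric]) auto
    qed
    also have "\<dots> \<le> liminf (\<lambda>n. wsq m (X (\<rho> n) t))"
      unfolding wsq_def by (rule nn_integral_liminf) simp
    finally show ?thesis .
  qed
  have cE: "energy (c t) \<le> ennreal M2" for t
    by (rule order_trans[OF wlim]) (intro Liminf_le, auto simp: XE)
  have cH: "(\<integral>\<^sup>+t. half_energy (c t) * indicator {0..T} t \<partial>lborel) \<le> ennreal ((e0 + sS / lam * T) / (2 * lam))" if T: "0 \<le> T" for T
  proof -
    have [measurable]: "(\<lambda>t. half_energy (X n t)) \<in> borel_measurable borel" for n
      by (rule wsq_measurable[OF Xc])
    have "(\<integral>\<^sup>+t. half_energy (c t) * indicator {0..T} t \<partial>lborel)
       \<le> (\<integral>\<^sup>+t. liminf (\<lambda>n. half_energy (X (\<rho> n) t) * indicator {0..T} t) \<partial>lborel)"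
      by (intro nn_integral_mono) (auto simp: indicator_def wlim)
    also have "\<dots> \<le> liminf (\<lambda>n. \<integral>\<^sup>+t. half_energy (X (\<rho> n) t) * indicator {0..T} t \<partial>lborel)"
      by (rule nn_integral_liminf) measurable
    also have "\<dots> \<le> ennreal ((e0 + sS / lam * T) / (2 * lam))"
      by (intro Liminf_le always_eventually allI XH T) simp
    finally show ?thesis .
  qed
  have c00: "c t 0 = 0" for t
  proof (rule LIMSEQ_unique[OF lim])
    show "(\<lambda>n. X (\<rho> n) t 0) \<longlonglongrightarrow> 0" by (simp add: XK K_def)
  qed
  have ceq: "c t k = c0 k + integral {0..t} (\<lambda>s. crhs a S (c s) k)" if t: "0 \<le> t" for t k
  proof (cases "k = 0")
    case True
    then show ?thesis by (simp add: c00 c0_0 crhs_def S_0)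
  next
    case False
    have ptw: "(\<lambda>n. crhs a S (X (\<rho> n) s) k) \<longlonglongrightarrow> crhs a S (c s) k" for s
      unfolding crhs_def
      by (intro tendsto_intros lim adv_tendsto[where B=M2]) (auto simp: XE cE M2_nonneg)
    have "(\<lambda>n. integral {0..t} (\<lambda>s. crhs a S (X (\<rho> n) s) k)) \<longlonglongrightarrow> integral {0..t} (\<lambda>s. crhs a S (c s) k)"
    proof (rule dominated_convergence(2)[where h="\<lambda>_. Cb k"])
      show "(\<lambda>s. crhs a S (X (\<rho> n) s) k) integrable_on {0..t}" for n
        by (rule integrable_continuous_real[OF continuous_on_subset[OF crc]]) simp
    qed (use crb ptw in auto)
    then have l2: "(\<lambda>n. c0 k + integral {0..t} (\<lambda>s. crhs a S (X (\<rho> n) s) k)) \<longlonglongrightarrow> c0 k + integral {0..t} (\<lambda>s. crhs a S (c s) k)"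
      by (intro tendsto_intros)
    have "\<forall>\<^sub>F n in sequentially. k \<in> cube (\<rho> n)"
      by (rule eventually_subseq[OF \<rho> in_cube_eventually])
    then have ev: "\<forall>\<^sub>F n in sequentially. X (\<rho> n) t k = c0 k + integral {0..t} (\<lambda>s. crhs a S (X (\<rho> n) s) k)"
    proof eventually_elim
      case (elim n)
      then have "k \<in> K (\<rho> n)" using False by (simp add: K_def)
      from Xeq[OF this, of t] show ?case using t by (simp only: max_absorb2)
    qed
    show ?thesis
      by (rule LIMSEQ_unique[OF lim]) (use l2 tendsto_cong[OF ev] in blast)
  qed
  have "coeff_solution a S c0 c"
  proof
    show "c t (- k) = cnj (c t k)" for t k
    proof (rule LIMSEQ_unique[OF lim])
      show "(\<lambda>n. X (\<rho> n) t (- k)) \<longlonglongrightarrow> cnj (c t k)" unfolding Xr by (intro tendsto_intros lim)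
    qed
    show "\<exists>M\<ge>0. \<forall>t\<le>T. energy (c t) \<le> ennreal (M\<^sup>2)" for T using cE M by auto
    show "(\<integral>\<^sup>+t. half_energy (c t) * indicator {0..T} t \<partial>lborel) < \<infinity>" for T
    proof (cases "0 \<le> T")
      case True
      then show ?thesis using cH[of T] by (auto intro: order_le_less_trans)
    qed simp
  qed (use c00 cc ceq in auto)
  then show ?thesis by (rule that[of c]) (use cE cH in auto)
qed

end

text \<open>The positive part of the rate bounds the coefficients uniformly on \<open>{0..T}\<close> by a summable
  family, which upgrades coefficientwise continuity to continuity in mean square.\<close>

lemma (in coeff_solution) continuous_energy:
  assumes a: "\<And>k. 0 \<le> a k" and S: "energy S < \<infinity>" and t: "0 \<le> t"
  shows "((\<lambda>s. energy (\<lambda>k. c s k - c t k)) \<longlongrightarrow> 0) (at t within {0..})"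
proof -
  define T where "T = t + 1"
  have [measurable]: "(\<lambda>s. c s k) \<in> borel_measurable borel" for k by (rule borel_measurable_continuous_onI[OF cont])
  have advm [measurable]: "(\<lambda>s. adv (c s) (c s) k) \<in> borel_measurable borel" for k
    by (intro adv_measurable cont energy_finite)
  \<comment> \<open>The damping has a favourable sign and is dropped from the rate; its symbol is
    unbounded in k and would spoil the summability of the majorant b.\<close>
  define U where "U = (\<lambda>k s. 2 * (cmod (c s k) * (cmod (S k) + cmod (adv (c s) (c s) k))))"
  define b where "b = (\<lambda>k. ennreal ((cmod (c0 k))\<^sup>2) + (\<integral>\<^sup>+s. ennreal (U k s) * indicator {0..T} s \<partial>lborel))"
  have bd: "ennreal ((cmod (c s k))\<^sup>2) \<le> b k" if s: "0 \<le> s" "s \<le> T" for s k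
  proof -
    have "ennreal ((cmod (c s k))\<^sup>2) + (\<integral>\<^sup>+\<tau>. ennreal 0 * indicator {0..s} \<tau> \<partial>lborel)
       \<le> ennreal ((cmod (c 0 k))\<^sup>2) + (\<integral>\<^sup>+\<tau>. ennreal (U k \<tau>) * indicator {0..s} \<tau> \<partial>lborel)"
    proof (rule ftc_nn_integral_le[OF s(1)])
      show "((\<lambda>\<tau>. (cmod (c \<tau> k))\<^sup>2) has_vector_derivative 2 * Re (crhs a S (c \<tau>) k * cnj (c \<tau> k))) (at \<tau> within {0..s})"
        if "\<tau> \<in> {0..s}" for \<tau>
        by (intro has_vector_derivative_norm_sq deriv that order_refl)
      show "2 * Re (crhs a S (c \<tau>) k * cnj (c \<tau> k)) \<le> U k \<tau> - 0" for \<tau>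
      proof -
        have 3: "Re (c \<tau> k * cnj (c \<tau> k)) = (cmod (c \<tau> k))\<^sup>2" by (metis Re_complex_of_real complex_norm_square)
        have "Re (crhs a S (c \<tau>) k * cnj (c \<tau> k)) = Re ((S k - adv (c \<tau>) (c \<tau>) k) * cnj (c \<tau> k)) - a k * (cmod (c \<tau> k))\<^sup>2"
          unfolding crhs_def left_diff_distrib[of _ "complex_of_real (a k) * c \<tau> k"] mult.assoc[of "complex_of_real (a k)"]
          by (simp only: minus_complex.sel Re_of_real_mult 3)
        also have "\<dots> \<le> Re ((S k - adv (c \<tau>) (c \<tau>) k) * cnj (c \<tau> k))" using a[of k] by simp
        also have "\<dots> \<le> cmod ((S k - adv (c \<tau>) (c \<tau>) k) * cnj (c \<tau> k))" by (rule complex_Re_le_cmod)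
        also have "\<dots> = cmod (S k - adv (c \<tau>) (c \<tau>) k) * cmod (c \<tau> k)" by (simp only: norm_mult complex_mod_cnj)
        also have "\<dots> \<le> (cmod (S k) + cmod (adv (c \<tau>) (c \<tau>) k)) * cmod (c \<tau> k)"
          by (intro mult_right_mono norm_triangle_ineq4) simp
        finally show ?thesis by (simp add: U_def mult.commute)
      qed
      show "U k \<in> borel_measurable borel" unfolding U_def by measurable
    qed (auto simp: U_def)
    also have "\<dots> \<le> b k"
      unfolding b_def init using s by (intro add_left_mono nn_integral_mono) (auto simp: indicator_def)
    finally show ?thesis by simp
  qed
  have bfin: "esum b < \<infinity>"
  proof -
    obtain M where M: "M \<ge> 0" "\<forall>s\<le>T. energy (c s) \<le> ennreal (M\<^sup>2)" using bounded by blast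
    define P where "P = 5 * sqrt lat * M"
    have P0: "0 \<le> P" using M lat_nonneg by (simp add: P_def)
    have pt: "esum (\<lambda>k. ennreal (U k s)) \<le> energy S + energy (c s) + ennreal P * (half_energy (c s) + half_energy (c s))" if s: "s \<le> T" for s
    proof -
      have "esum (\<lambda>k. ennreal (U k s)) = esum (\<lambda>k. ennreal (2 * cmod (S k) * cmod (c s k)) + 2 * (ennreal (cmod (adv (c s) (c s) k)) * ennreal (cmod (c s k))))"
      proof (intro nn_integral_cong)
        fix k
        have "U k s = 2 * cmod (S k) * cmod (c s k) + 2 * (cmod (adv (c s) (c s) k) * cmod (c s k))"
          by (simp add: U_def algebra_simps)
        then show "ennreal (U k s) = ennreal (2 * cmod (S k) * cmod (c s k)) + 2 * (ennreal (cmod (adv (c s) (c s) k)) * ennreal (cmod (c s k)))"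
          by (simp add: ennreal_plus ennreal_mult)
      qed
      also have "\<dots> = esum (\<lambda>k. ennreal (2 * cmod (S k) * cmod (c s k))) + 2 * esum (\<lambda>k. ennreal (cmod (adv (c s) (c s) k)) * ennreal (cmod (c s k)))"
        by (simp add: nn_integral_add nn_integral_cmult)
      also have "esum (\<lambda>k. ennreal (2 * cmod (S k) * cmod (c s k))) \<le> esum (\<lambda>k. ennreal ((cmod (S k))\<^sup>2) + ennreal ((cmod (c s k))\<^sup>2))"
        by (intro nn_integral_mono) (simp add: sum_squares_bound flip: ennreal_plus)
      also have "\<dots> = energy S + energy (c s)" by (simp add: wsq_def nn_integral_add)
      also have "2 * esum (\<lambda>k. ennreal (cmod (adv (c s) (c s) k)) * ennreal (cmod (c s k)))
        \<le> 2 * esum (\<lambda>k. esum (\<lambda>l. ennreal (\<bar>ker k l\<bar> * cmod (c s (k - l)) * cmod (c s l))) * ennreal (cmod (c s k)))"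
        by (intro mult_left_mono nn_integral_mono mult_right_mono norm_adv_le) auto
      also have "\<dots> = 2 * esum (\<lambda>k. esum (\<lambda>l. ennreal (\<bar>ker k l\<bar> * cmod (c s (k - l)) * cmod (c s l) * cmod (c s k))))"
        by (simp add: ennreal_mult nn_integral_multc)
      also have "\<dots> \<le> ennreal P * (ennreal 1 * half_energy (c s) + ennreal (1/1) * half_energy (c s))"
        unfolding P_def using M s by (intro trilinear_bound velocity_l1_bound_real) auto
      finally show ?thesis by (simp add: add_mono)
    qed
    have [measurable]: "(\<lambda>s. half_energy (c s)) \<in> borel_measurable borel" by (rule wsq_measurable[OF cont])
    have [measurable]: "(\<lambda>s. U k s) \<in> borel_measurable borel" for k unfolding U_def by measurable
    have "esum b = energy c0 + esum (\<lambda>k. \<integral>\<^sup>+s. ennreal (U k s) * indicator {0..T} s \<partial>lborel)"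
      by (simp add: b_def nn_integral_add wsq_def)
    also have "esum (\<lambda>k. \<integral>\<^sup>+s. ennreal (U k s) * indicator {0..T} s \<partial>lborel) = (\<integral>\<^sup>+s. esum (\<lambda>k. ennreal (U k s)) * indicator {0..T} s \<partial>lborel)"
      by (subst esum_nn_integral_swap[symmetric]) (measurable, simp add: nn_integral_multc)
    also have "\<dots> \<le> (\<integral>\<^sup>+s. (energy S + ennreal (M\<^sup>2)) * indicator {0..T} s + ennreal (2 * P) * (half_energy (c s) * indicator {0..T} s) \<partial>lborel)"
    proof (intro nn_integral_mono)
      fix s
      show "esum (\<lambda>k. ennreal (U k s)) * indicator {0..T} s \<le> (energy S + ennreal (M\<^sup>2)) * indicator {0..T} s + ennreal (2 * P) * (half_energy (c s) * indicator {0..T} s)"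
      proof (cases "s \<in> {0..T}")
        case True
        have "esum (\<lambda>k. ennreal (U k s)) \<le> energy S + energy (c s) + ennreal P * (half_energy (c s) + half_energy (c s))"
          using True by (intro pt) simp
        also have "\<dots> \<le> energy S + ennreal (M\<^sup>2) + ennreal P * (half_energy (c s) + half_energy (c s))"
          using True M by (intro add_right_mono add_left_mono) auto
        also have "ennreal P * (half_energy (c s) + half_energy (c s)) = ennreal (2 * P) * half_energy (c s)"
        proof -
          have "ennreal (2 * P) = 2 * ennreal P" using P0 by (simp add: ennreal_mult)
          then show ?thesis by (simp only: mult_2[symmetric] mult.assoc mult.left_commute[of "ennreal P"])
        qed
        finally show ?thesis using True by simp
      qed simp
    qed
    also have "\<dots> = (energy S + ennreal (M\<^sup>2)) * emeasure lborel {0..T} + ennreal (2 * P) * (\<integral>\<^sup>+s. half_energy (c s) * indicator {0..T} s \<partial>lborel)"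
      by (subst nn_integral_add) (simp_all add: nn_integral_cmult)
    finally have "esum b \<le> energy c0 + \<dots>" by (simp add: add_left_mono)
    also have "\<dots> < \<infinity>"
      using S half[of T] energy_finite[of 0] t by (simp add: init T_def ennreal_mult_less_top)
    finally show ?thesis .
  qed
  have seq: "(\<lambda>n. energy (\<lambda>k. c (X n) k - c t k)) \<longlonglongrightarrow> 0" if X: "\<And>n. 0 \<le> X n" "\<And>n. X n \<le> T" "X \<longlonglongrightarrow> t" for X :: "nat \<Rightarrow> real"
  proof -
    have "(\<lambda>n. esum (\<lambda>k. ennreal ((cmod (c (X n) k - c t k))\<^sup>2))) \<longlonglongrightarrow> esum (\<lambda>k::int^3. 0)"
    proof (rule nn_integral_dominated_convergence[where w="\<lambda>k. 4 * b k"])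
      show "AE k in count_space UNIV. ennreal ((cmod (c (X n) k - c t k))\<^sup>2) \<le> 4 * b k" for n
      proof (rule AE_I2)
        fix k
        have "(cmod (c (X n) k - c t k))\<^sup>2 \<le> (cmod (c (X n) k) + cmod (c t k))\<^sup>2"
          by (intro power_mono norm_triangle_ineq4) auto
        also have "\<dots> \<le> 2 * (cmod (c (X n) k))\<^sup>2 + 2 * (cmod (c t k))\<^sup>2"
          using sum_squares_bound[of "cmod (c (X n) k)" "cmod (c t k)"] by (simp add: power2_sum)
        finally have "ennreal ((cmod (c (X n) k - c t k))\<^sup>2) \<le> ennreal (2 * (cmod (c (X n) k))\<^sup>2 + 2 * (cmod (c t k))\<^sup>2)"
          by (rule ennreal_leI)
        also have "\<dots> = 2 * ennreal ((cmod (c (X n) k))\<^sup>2) + 2 * ennreal ((cmod (c t k))\<^sup>2)"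
          by (simp add: ennreal_plus ennreal_mult)
        also have "\<dots> \<le> 2 * b k + 2 * b k"
          using X t by (intro add_mono mult_left_mono bd) (auto simp: T_def)
        also have "\<dots> = (2 + 2) * b k" by (rule distrib_right[symmetric])
        also have "\<dots> = 4 * b k" by simp
        finally show "ennreal ((cmod (c (X n) k - c t k))\<^sup>2) \<le> 4 * b k" .
      qed
      show "AE k in count_space UNIV. (\<lambda>n. ennreal ((cmod (c (X n) k - c t k))\<^sup>2)) \<longlonglongrightarrow> 0"
      proof (rule AE_I2)
        fix k
        have "(\<lambda>n. c (X n) k) \<longlonglongrightarrow> c t k"
          using continuous_on_tendsto_compose[OF cont X(3)] by simp
        then have "(\<lambda>n. ennreal ((cmod (c (X n) k - c t k))\<^sup>2)) \<longlonglongrightarrow> ennreal ((cmod (c t k - c t k))\<^sup>2)"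
          by (intro tendsto_intros)
        then show "(\<lambda>n. ennreal ((cmod (c (X n) k - c t k))\<^sup>2)) \<longlonglongrightarrow> 0" by simp
      qed
      show "esum (\<lambda>k. 4 * b k) < \<infinity>" using bfin by (simp add: nn_integral_cmult ennreal_mult_less_top)
    qed auto
    then show ?thesis by (simp add: wsq_def)
  qed
  show ?thesis
    unfolding tendsto_at_iff_sequentially comp_def
  proof (intro allI impI)
    fix X :: "nat \<Rightarrow> real" assume X: "\<forall>i. X i \<in> {0..} - {t}" "X \<longlonglongrightarrow> t"
    \<comment> \<open>The majorant is valid up to time T only, so the sequence is capped there.
      Since t < T, the cap is eventually inactive.\<close>
    define Y where "Y = (\<lambda>n. min (X n) T)"
    have "\<forall>\<^sub>F n in sequentially. X n < T" by (rule order_tendstoD(2)[OF X(2)]) (simp add: T_def)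
    then have ev: "\<forall>\<^sub>F n in sequentially. Y n = X n" by eventually_elim (simp add: Y_def)
    have Yt: "Y \<longlonglongrightarrow> t"
      by (rule Lim_transform_eventually[OF X(2)]) (use ev in \<open>simp add: eq_commute\<close>)
    have "(\<lambda>n. energy (\<lambda>k. c (Y n) k - c t k)) \<longlonglongrightarrow> 0"
      by (rule seq[OF _ _ Yt]) (use X(1) t in \<open>auto simp: Y_def T_def\<close>)
    moreover have "\<forall>\<^sub>F n in sequentially. energy (\<lambda>k. c (Y n) k - c t k) = energy (\<lambda>k. c (X n) k - c t k)"
      using ev by eventually_elim simp
    ultimately show "(\<lambda>n. energy (\<lambda>k. c (X n) k - c t k)) \<longlonglongrightarrow> 0"
      by (rule Lim_transform_eventually)
  qed
qed

section \<open>The estimate for the gradient\<close>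

lemma powr_diff_le:
  assumes "1 \<le> x" "1 \<le> y" "0 \<le> p" "p \<le> 1" shows "\<bar>x powr p - y powr p\<bar> \<le> \<bar>x - (y::real)\<bar>"
proof -
  have main: "x powr p - y powr p \<le> x - y" if "1 \<le> y" "y \<le> x" for x y :: real
  proof -
    have "x powr p = (x / y) powr p * y powr p"
      using that by (simp add: powr_divide)
    also have "(x / y) powr p \<le> (x / y) powr 1"
      using that assms by (intro powr_mono) auto
    finally have "x powr p - y powr p \<le> (x / y - 1) * y powr p"
      using that by (simp add: algebra_simps mult_right_mono)
    also have "y powr p \<le> y powr 1" using that assms by (intro powr_mono) auto
    finally have "x powr p - y powr p \<le> (x / y - 1) * y"
      using that by (simp add: mult_left_mono)
    also have "\<dots> = x - y" using that by (simp add: field_simps)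
    finally show ?thesis .
  qed
  show ?thesis
  proof (cases "y \<le> x")
    case True
    then have "y powr p \<le> x powr p" using assms by (intro powr_mono2) auto
    then show ?thesis using main[OF assms(2) True] by simp
  next
    case False
    then have "x powr p \<le> y powr p" using assms by (intro powr_mono2) auto
    then show ?thesis using main[OF assms(1), of y] False by simp
  qed
qed

text \<open>Boundedness makes its powers admissible in \<open>weighted_energy_inequality\<close> and
  the truncated gradient norm finite; for N beyond |k| it equals |k|. Capping a norm by a
  nonnegative constant preserves the triangle inequality.\<close>

definition cutoff :: "real \<Rightarrow> int^3 \<Rightarrow> real" where
  "cutoff N k = min (norm (freq k)) N"

lemma cutoff_bounds:
  assumes "1 \<le> N"
  shows "0 \<le> cutoff N k" "cutoff N k \<le> N" "cutoff N k \<le> norm (freq k)" "cutoff N 0 = 0" "k \<noteq> 0 \<Longrightarrow> 1 \<le> cutoff N k"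
  using assms one_le_norm_freq[of k] by (auto simp: cutoff_def)

lemma cutoff_diff_le:
  assumes "1 \<le> N" shows "\<bar>cutoff N k - cutoff N l\<bar> \<le> cutoff N (k - l)"
proof -
  have "\<bar>norm (freq k) - norm (freq l)\<bar> \<le> norm (freq (k - l))"
    unfolding freq_diff by (rule norm_triangle_ineq3)
  then show ?thesis using assms norm_ge_zero[of "freq k"] norm_ge_zero[of "freq l"] unfolding cutoff_def by linarith
qed

text \<open>Where the weight varies, the smaller of the two frequencies lies below the cutoff, so the
  factor \<open>min \<bar>k\<bar> \<bar>l\<bar>\<close> from \<open>div u = 0\<close> can be measured with the cutoff weight as well.\<close>

lemma commutator_kernel_le:
  assumes N: "1 \<le> N" and p: "0 \<le> p" "p \<le> 1"
  shows "\<bar>cutoff N k powr p - cutoff N l powr p\<bar> * \<bar>ker k l\<bar>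
     \<le> cutoff N (k - l) * norm (mu (k - l)) * (sqrt (cutoff N k) * sqrt (cutoff N l))"
proof (cases "k = 0 \<or> l = 0 \<or> cutoff N k = cutoff N l")
  case True
  then show ?thesis using cutoff_bounds(1)[OF N] by auto
next
  case False
  have 1: "\<bar>cutoff N k powr p - cutoff N l powr p\<bar> \<le> cutoff N (k - l)"
    using powr_diff_le[of "cutoff N k" "cutoff N l" p] cutoff_bounds(5)[OF N] cutoff_diff_le[OF N, of k l] p False by force
  have "\<bar>ker k l\<bar> \<le> min (norm (freq k)) (norm (freq l)) * norm (mu (k - l))"
    using abs_ker_le[of k l] abs_ker_le'[of k l] by (simp add: min_def)
  also have "min (norm (freq k)) (norm (freq l)) = min (cutoff N k) (cutoff N l)"
    using False by (auto simp: cutoff_def min_def split: if_splits)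
  also have "\<dots> \<le> sqrt (cutoff N k) * sqrt (cutoff N l)"
    by (intro min_le_sqrt_mult cutoff_bounds N)
  finally have 2: "\<bar>ker k l\<bar> \<le> sqrt (cutoff N k) * sqrt (cutoff N l) * norm (mu (k - l))"
    by (simp add: mult_right_mono)
  have "\<bar>cutoff N k powr p - cutoff N l powr p\<bar> * \<bar>ker k l\<bar> \<le> cutoff N (k - l) * (sqrt (cutoff N k) * sqrt (cutoff N l) * norm (mu (k - l)))"
    by (intro mult_mono 1 2) (auto simp: cutoff_bounds[OF N])
  then show ?thesis by (simp add: mult_ac)
qed

text \<open>The square of the first power is |j|^-7/2, whose sum is \<open>lat\<close>. The second
  power is the surplus that will be traded against the cutoff weight.\<close>

lemma norm_mu_le_powr: "norm (mu j) \<le> 5 * norm (freq j) powr (-7/4) * norm (freq j) powr (-1/4)"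
proof (cases "j = 0")
  case False
  then have "0 < norm (freq j)" using one_le_norm_freq[of j] by linarith
  then have "5 * norm (freq j) powr (-7/4) * norm (freq j) powr (-1/4) = 5 / (norm (freq j))\<^sup>2"
    by (simp add: mult.assoc powr_minus_divide powr_numeral flip: powr_add)
  then show ?thesis using norm_mu_le[of j] by simp
qed simp

text \<open>With n the cutoff and r the norm, n <= r gives n^2 / sqrt r <= n sqrt r, a geometric
  mean of n^2 and r. Thus the surplus power allows the dissipation weight n^2 to appear with an
  arbitrarily small \<delta>, at the expense of the half energy.\<close>

lemma cutoff_weight_le:
  assumes N: "1 \<le> N" and \<delta>: "0 < \<delta>"
  shows "2 * (cutoff N j * norm (freq j) powr (-1/4))\<^sup>2 \<le> \<delta> * (cutoff N j)\<^sup>2 + norm (freq j) / \<delta>"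
proof (cases "j = 0")
  case False
  define r where "r = norm (freq j)"
  define n where "n = cutoff N j"
  have r: "1 \<le> r" using one_le_norm_freq[OF False] by (simp add: r_def)
  have n: "0 \<le> n" "n \<le> r" using cutoff_bounds(1,3)[OF N, of j] by (auto simp: r_def n_def)
  have "(r powr (-1/4))\<^sup>2 = 1 / sqrt r"
    using r by (simp add: powr_half_sqrt powr_minus_divide power2_eq_square flip: powr_add)
  then have "(n * r powr (-1/4))\<^sup>2 = n\<^sup>2 / sqrt r" by (simp add: power_mult_distrib)
  also have "\<dots> \<le> n * sqrt r"
  proof -
    have "n\<^sup>2 \<le> n * r" using n by (simp add: power2_eq_square mult_left_mono)
    also have "\<dots> = n * sqrt r * sqrt r" using r by simp
    finally show ?thesis using r by (simp add: divide_le_eq)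
  qed
  finally have 1: "2 * (n * r powr (-1/4))\<^sup>2 \<le> 2 * (n * sqrt r)" by simp
  have "0 \<le> (\<delta> * n - sqrt r)\<^sup>2 / \<delta>" using \<delta> by simp
  also have "\<dots> = \<delta> * n\<^sup>2 + r / \<delta> - 2 * (n * sqrt r)"
    using \<delta> r by (simp add: power2_diff power_mult_distrib field_simps power2_eq_square)
  finally show ?thesis using 1 by (simp add: r_def n_def)
qed (simp add: cutoff_bounds(4)[OF N])

lemma ennreal_lincomb:
  assumes "0 \<le> a" "0 \<le> b" "0 \<le> c" "0 \<le> d"
  shows "ennreal (a * b + c * d) = ennreal a * ennreal b + ennreal c * ennreal d"
  using assms by (simp add: ennreal_plus ennreal_mult)

text \<open>The expression is trilinear, but one power is absorbed by the energy bound M. The kernel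
  estimate leaves the l1 norm of \<open>pp\<close> times \<open>wsq (cutoff N) x\<close>. The former
  is at most sqrt R, with R a combination of \<delta> Z and H / \<delta>; the latter is at most M
  sqrt Z. The product is therefore controlled linearly by Z and H, with a coefficient of Z as small
  as required.\<close>

lemma commutator_bound:
  assumes N: "1 \<le> N" and p: "0 \<le> p" "p \<le> 1" and M: "energy x \<le> ennreal (M\<^sup>2)" "0 \<le> M" and cc: "0 < cc"
  defines "G \<equiv> 25 * lat * M\<^sup>2 + 1"
  shows "esum (\<lambda>k. esum (\<lambda>l. ennreal (\<bar>cutoff N k powr p - cutoff N l powr p\<bar>
       * (\<bar>ker k l\<bar> * cmod (x (k - l)) * cmod (x l) * cmod (x k)))))
     \<le> ennreal (cc / 2) * wsq (\<lambda>k. (cutoff N k)\<^sup>2) x + ennreal (G\<^sup>2 / cc ^ 3) * half_energy x"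
    (is "?C \<le> _")
\<comment> \<open>An infinite half energy makes the right-hand side infinite, because the summand 1
  in G keeps its coefficient positive.\<close>
proof (cases "half_energy x < \<infinity>")
  case False
  have "0 < G" using lat_nonneg by (simp add: G_def add_nonneg_pos)
  then have "0 < ennreal (G\<^sup>2 / cc ^ 3)" using cc by simp
  moreover have "half_energy x = top" using False by (simp add: not_less top_unique)
  ultimately have "ennreal (G\<^sup>2 / cc ^ 3) * half_energy x = top"
    by (metis ennreal_mult_top less_irrefl)
  then show ?thesis by simp
next
  case True
  note cb = cutoff_bounds[OF N]
  define Z where "Z = enn2real (wsq (\<lambda>k. (cutoff N k)\<^sup>2) x)"
  define H where "H = enn2real (half_energy x)"
  have H: "half_energy x = ennreal H" "0 \<le> H" using True by (auto simp: H_def less_top)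
  have "wsq (\<lambda>k. (cutoff N k)\<^sup>2) x \<le> wsq (\<lambda>k. N\<^sup>2) x"
    using cb by (intro wsq_mono power_mono)
  also have "\<dots> = ennreal (N\<^sup>2) * energy x" by (simp add: wsq_def ennreal_mult nn_integral_cmult)
  also have "\<dots> < \<infinity>" using M by (simp add: ennreal_mult_less_top order_le_less_trans)
  finally have Z: "wsq (\<lambda>k. (cutoff N k)\<^sup>2) x = ennreal Z" "0 \<le> Z" by (auto simp: Z_def less_top)
  \<comment> \<open>Interpolation by Cauchy-Schwarz: the weight \<open>cutoff N\<close> lies halfway
    between 1 and its square.\<close>
  have W: "wsq (cutoff N) x \<le> ennreal (M * sqrt Z)"
  proof (rule ennreal_le_of_sq_le)
    have "(wsq (cutoff N) x)\<^sup>2 = (esum (\<lambda>k. ennreal (cmod (x k)) * ennreal (cutoff N k * cmod (x k))))\<^sup>2"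
      using cb(1) by (simp add: wsq_def power2_eq_square mult_ac flip: ennreal_mult)
    also have "\<dots> \<le> esum (\<lambda>k. (ennreal (cmod (x k)))\<^sup>2) * esum (\<lambda>k. (ennreal (cutoff N k * cmod (x k)))\<^sup>2)"
      by (rule Cauchy_Schwarz_nn_integral) auto
    also have "esum (\<lambda>k. (ennreal (cmod (x k)))\<^sup>2) = energy x" by (simp add: wsq_def ennreal_power)
    also have "esum (\<lambda>k. (ennreal (cutoff N k * cmod (x k)))\<^sup>2) = ennreal Z"
      unfolding Z(1)[symmetric] using cb(1) by (simp add: wsq_def ennreal_power power_mult_distrib)
    also have "energy x * ennreal Z \<le> ennreal (M\<^sup>2) * ennreal Z" using M by (intro mult_right_mono) auto
    also have "\<dots> = (ennreal (M * sqrt Z))\<^sup>2" using Z M by (simp add: ennreal_power power_mult_distrib flip: ennreal_mult)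
    finally show "(wsq (cutoff N) x)\<^sup>2 \<le> (ennreal (M * sqrt Z))\<^sup>2" .
  qed (use M Z in auto)
  define pp where "pp = (\<lambda>j. cutoff N j * norm (mu j) * cmod (x j))"
  have G1: "1 \<le> G" using lat_nonneg by (simp add: G_def)
  \<comment> \<open>Chosen so that G * \<delta> / (2 * cc) = cc / 4; the coefficient of H then
    becomes G^2 / cc^3.\<close>
  define \<delta> where "\<delta> = cc\<^sup>2 / (2 * G)"
  have \<delta>: "0 < \<delta>" using cc G1 by (simp add: \<delta>_def)
  define R where "R = 25 * lat * ((\<delta> * Z + H / \<delta>) / 2)"
  have R0: "0 \<le> R" using lat_nonneg \<delta> Z H by (simp add: R_def)
  have Q: "esum (\<lambda>j. ennreal (pp j)) \<le> ennreal (sqrt R)"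
  proof (rule ennreal_le_of_sq_le)
    have "esum (\<lambda>j. ennreal (pp j)) \<le> esum (\<lambda>j. ennreal (5 * norm (freq j) powr (-7/4)) * ennreal (cutoff N j * norm (freq j) powr (-1/4) * cmod (x j)))"
    proof (intro nn_integral_mono)
      fix j
      have "pp j \<le> cutoff N j * (5 * norm (freq j) powr (-7/4) * norm (freq j) powr (-1/4)) * cmod (x j)"
        unfolding pp_def by (intro mult_right_mono mult_left_mono norm_mu_le_powr cb) auto
      then have "ennreal (pp j) \<le> ennreal ((5 * norm (freq j) powr (-7/4)) * (cutoff N j * norm (freq j) powr (-1/4) * cmod (x j)))"
        by (intro ennreal_leI) (simp add: mult_ac)
      then show "ennreal (pp j) \<le> ennreal (5 * norm (freq j) powr (-7/4)) * ennreal (cutoff N j * norm (freq j) powr (-1/4) * cmod (x j))"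
        using cb(1)[of j] by (subst ennreal_mult[symmetric]) auto
    qed
    then have "(esum (\<lambda>j. ennreal (pp j)))\<^sup>2 \<le> (esum (\<lambda>j. ennreal (5 * norm (freq j) powr (-7/4)) * ennreal (cutoff N j * norm (freq j) powr (-1/4) * cmod (x j))))\<^sup>2"
      by (rule power_mono) simp
    also have "\<dots> \<le> esum (\<lambda>j. (ennreal (5 * norm (freq j) powr (-7/4)))\<^sup>2) * esum (\<lambda>j. (ennreal (cutoff N j * norm (freq j) powr (-1/4) * cmod (x j)))\<^sup>2)"
      by (rule Cauchy_Schwarz_nn_integral) auto
    also have "esum (\<lambda>j. (ennreal (5 * norm (freq j) powr (-7/4)))\<^sup>2) = ennreal (25 * lat)"
    proof -
      have "(ennreal (5 * norm (freq j) powr (-7/4)))\<^sup>2 = 25 * ennreal (norm (freq j) powr (-7/2))" for j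
      proof -
        have "(5 * norm (freq j) powr (-7/4))\<^sup>2 = 25 * norm (freq j) powr (-7/2)"
          by (simp add: power2_eq_square flip: powr_add)
        then show ?thesis by (simp add: ennreal_power ennreal_mult)
      qed
      then show ?thesis using esum_freq_powr lat_nonneg by (simp add: nn_integral_cmult ennreal_mult)
    qed
    also have "esum (\<lambda>j. (ennreal (cutoff N j * norm (freq j) powr (-1/4) * cmod (x j)))\<^sup>2) \<le> ennreal ((\<delta> * Z + H / \<delta>) / 2)"
    proof -
      have "esum (\<lambda>j. (ennreal (cutoff N j * norm (freq j) powr (-1/4) * cmod (x j)))\<^sup>2)
        \<le> esum (\<lambda>j. ennreal (\<delta> / 2) * ennreal ((cutoff N j)\<^sup>2 * (cmod (x j))\<^sup>2) + ennreal (1 / (2 * \<delta>)) * ennreal (norm (freq j) * (cmod (x j))\<^sup>2))"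
      proof (intro nn_integral_mono)
        fix j
        have "(cutoff N j * norm (freq j) powr (-1/4))\<^sup>2 * (cmod (x j))\<^sup>2 \<le> ((\<delta> * (cutoff N j)\<^sup>2 + norm (freq j) / \<delta>) / 2) * (cmod (x j))\<^sup>2"
          using cutoff_weight_le[OF N \<delta>, of j] by (intro mult_right_mono) auto
        then have "ennreal ((cutoff N j * norm (freq j) powr (-1/4) * cmod (x j))\<^sup>2)
           \<le> ennreal (\<delta> / 2 * ((cutoff N j)\<^sup>2 * (cmod (x j))\<^sup>2) + 1 / (2 * \<delta>) * (norm (freq j) * (cmod (x j))\<^sup>2))"
          using \<delta> by (intro ennreal_leI) (simp add: power_mult_distrib field_simps)
        also have "\<dots> = ennreal (\<delta> / 2) * ennreal ((cutoff N j)\<^sup>2 * (cmod (x j))\<^sup>2) + ennreal (1 / (2 * \<delta>)) * ennreal (norm (freq j) * (cmod (x j))\<^sup>2)"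
          using \<delta> by (intro ennreal_lincomb) auto
        finally show "(ennreal (cutoff N j * norm (freq j) powr (-1/4) * cmod (x j)))\<^sup>2
           \<le> ennreal (\<delta> / 2) * ennreal ((cutoff N j)\<^sup>2 * (cmod (x j))\<^sup>2) + ennreal (1 / (2 * \<delta>)) * ennreal (norm (freq j) * (cmod (x j))\<^sup>2)"
          using cb(1)[of j] by (subst ennreal_power) auto
      qed
      also have "\<dots> = ennreal (\<delta> / 2) * ennreal Z + ennreal (1 / (2 * \<delta>)) * ennreal H"
        unfolding Z(1)[symmetric] H(1)[symmetric] wsq_def by (subst nn_integral_add) (simp_all add: nn_integral_cmult)
      also have "\<dots> = ennreal (\<delta> / 2 * Z + 1 / (2 * \<delta>) * H)"
        using \<delta> Z H by (intro ennreal_lincomb[symmetric]) auto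
      also have "\<delta> / 2 * Z + 1 / (2 * \<delta>) * H = (\<delta> * Z + H / \<delta>) / 2" using \<delta> by (simp add: field_simps)
      finally show ?thesis .
    qed
    also have "ennreal (25 * lat) * ennreal ((\<delta> * Z + H / \<delta>) / 2) = (ennreal (sqrt R))\<^sup>2"
      using lat_nonneg \<delta> Z H R0 by (subst ennreal_mult[symmetric]) (auto simp: ennreal_power R_def)
    finally show "(esum (\<lambda>j. ennreal (pp j)))\<^sup>2 \<le> (ennreal (sqrt R))\<^sup>2" by (simp add: mult_left_mono)
  qed (use R0 in auto)
  have "2 * ?C \<le> 2 * esum (\<lambda>k. esum (\<lambda>l. ennreal (pp (k - l) * (sqrt (cutoff N l) * cmod (x l)) * (sqrt (cutoff N k) * cmod (x k)))))"
  proof (intro mult_left_mono nn_integral_mono ennreal_leI)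
    fix k l
    have "\<bar>cutoff N k powr p - cutoff N l powr p\<bar> * \<bar>ker k l\<bar> * (cmod (x (k - l)) * cmod (x l) * cmod (x k))
      \<le> cutoff N (k - l) * norm (mu (k - l)) * (sqrt (cutoff N k) * sqrt (cutoff N l)) * (cmod (x (k - l)) * cmod (x l) * cmod (x k))"
      by (rule mult_right_mono[OF commutator_kernel_le[OF N p]]) auto
    then show "\<bar>cutoff N k powr p - cutoff N l powr p\<bar> * (\<bar>ker k l\<bar> * cmod (x (k - l)) * cmod (x l) * cmod (x k))
      \<le> pp (k - l) * (sqrt (cutoff N l) * cmod (x l)) * (sqrt (cutoff N k) * cmod (x k))"
      by (simp add: pp_def mult_ac)
  qed auto
  also have "\<dots> \<le> esum (\<lambda>k. ennreal (pp k)) * (esum (\<lambda>k. ennreal ((sqrt (cutoff N k) * cmod (x k))\<^sup>2)) + esum (\<lambda>k. ennreal ((sqrt (cutoff N k) * cmod (x k))\<^sup>2)))"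
    by (rule esum_convolution_le) (auto simp: pp_def cb)
  also have "esum (\<lambda>k. ennreal ((sqrt (cutoff N k) * cmod (x k))\<^sup>2)) = wsq (cutoff N) x"
    using cb(1) by (simp add: wsq_def power_mult_distrib)
  also have "esum (\<lambda>k. ennreal (pp k)) * (wsq (cutoff N) x + wsq (cutoff N) x) \<le> ennreal (sqrt R) * (ennreal (M * sqrt Z) + ennreal (M * sqrt Z))"
    by (intro mult_mono add_mono Q W) auto
  also have "\<dots> = 2 * ennreal (sqrt R * (M * sqrt Z))"
    using R0 M Z by (simp add: ennreal_mult mult_2 distrib_left)
  finally have C: "?C \<le> ennreal (sqrt R * (M * sqrt Z))" by (simp add: ennreal_mult_le_mult_iff)
  have "sqrt R * (M * sqrt Z) \<le> cc / 4 * Z + M\<^sup>2 * R / cc"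
  proof -
    have "0 \<le> (cc / 2 * sqrt Z - M * sqrt R)\<^sup>2 / cc" using cc by simp
    also have "\<dots> = cc / 4 * Z + M\<^sup>2 * R / cc - sqrt R * (M * sqrt Z)"
      using cc Z R0 by (simp add: power2_diff power_mult_distrib field_simps power2_eq_square)
    finally show ?thesis by simp
  qed
  also have "M\<^sup>2 * R / cc \<le> cc / 4 * Z + G\<^sup>2 / cc ^ 3 * H"
  proof -
    have "M\<^sup>2 * R / cc = (25 * lat * M\<^sup>2) * (\<delta> * Z + H / \<delta>) / (2 * cc)" by (simp add: R_def)
    also have "\<dots> \<le> G * (\<delta> * Z + H / \<delta>) / (2 * cc)"
      using cc \<delta> Z H by (intro divide_right_mono mult_right_mono) (auto simp: G_def)
    also have "\<dots> = cc / 4 * Z + G\<^sup>2 / cc ^ 3 * H"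
      using cc G1 by (simp add: \<delta>_def field_simps power2_eq_square power3_eq_cube)
    finally show ?thesis .
  qed
  finally have "sqrt R * (M * sqrt Z) \<le> cc / 2 * Z + G\<^sup>2 / cc ^ 3 * H" by (simp add: mult.commute[of Z])
  then have "ennreal (sqrt R * (M * sqrt Z)) \<le> ennreal (cc / 2 * Z + G\<^sup>2 / cc ^ 3 * H)" by (rule ennreal_leI)
  also have "\<dots> = ennreal (cc / 2) * ennreal Z + ennreal (G\<^sup>2 / cc ^ 3) * ennreal H"
    using cc Z H by (subst ennreal_plus) (auto simp: ennreal_mult'[symmetric] zero_le_mult_iff)
  finally show ?thesis unfolding Z(1) H(1) using C by (rule order_trans[rotated])
qed

text \<open>For n >= 1 and p <= 1 the weight n^p is at most n, so Young's inequality ends at the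
  weight n^2 that the dissipation controls. The share cc / 2 used here and the share cc / 2 of the
  commutator together are half of the dissipation.\<close>

lemma forcing_bound:
  assumes N: "1 \<le> N" and p: "0 \<le> p" "p \<le> 1" and cc: "0 < cc" and S: "energy S = ennreal s" and x: "x 0 = 0"
  shows "esum (\<lambda>k. ennreal (2 * (cutoff N k powr p * cmod (S k) * cmod (x k))))
    \<le> ennreal (2 / cc) * energy S + ennreal (cc / 2) * wsq (\<lambda>k. (cutoff N k)\<^sup>2) x"
proof -
  have "ennreal (2 * (cutoff N k powr p * cmod (S k) * cmod (x k)))
     \<le> ennreal (2 / cc) * ennreal (1 * (cmod (S k))\<^sup>2) + ennreal (cc / 2) * ennreal ((cutoff N k)\<^sup>2 * (cmod (x k))\<^sup>2)" for k
  proof (cases "k = 0")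
    case False
    define n where "n = cutoff N k"
    have n: "1 \<le> n" using cutoff_bounds(5)[OF N False] by (simp add: n_def)
    have "n powr p \<le> n powr 1" using n p by (intro powr_mono) auto
    then have "2 * (n powr p * (cmod (S k) * cmod (x k))) \<le> 2 * (n * (cmod (S k) * cmod (x k)))"
      using n by (intro mult_left_mono mult_right_mono) auto
    also have "\<dots> \<le> 2 / cc * (1 * (cmod (S k))\<^sup>2) + cc / 2 * (n\<^sup>2 * (cmod (x k))\<^sup>2)"
    proof -
      have "0 \<le> (2 * cmod (S k) - cc * (n * cmod (x k)))\<^sup>2 / (2 * cc)" using cc by simp
      also have "\<dots> = 2 / cc * (1 * (cmod (S k))\<^sup>2) + cc / 2 * (n\<^sup>2 * (cmod (x k))\<^sup>2) - 2 * (n * (cmod (S k) * cmod (x k)))"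
        using cc by (simp add: power2_diff field_simps power2_eq_square)
      finally show ?thesis by simp
    qed
    finally have "ennreal (2 * (n powr p * cmod (S k) * cmod (x k)))
       \<le> ennreal (2 / cc * (1 * (cmod (S k))\<^sup>2) + cc / 2 * (n\<^sup>2 * (cmod (x k))\<^sup>2))"
      by (intro ennreal_leI) (simp add: mult.assoc)
    also have "\<dots> = ennreal (2 / cc) * ennreal (1 * (cmod (S k))\<^sup>2) + ennreal (cc / 2) * ennreal (n\<^sup>2 * (cmod (x k))\<^sup>2)"
      using cc by (subst ennreal_plus) (auto simp: ennreal_mult'[symmetric])
    finally show ?thesis by (simp add: n_def)
  qed (simp add: x)
  then have "esum (\<lambda>k. ennreal (2 * (cutoff N k powr p * cmod (S k) * cmod (x k))))
    \<le> esum (\<lambda>k. ennreal (2 / cc) * ennreal (1 * (cmod (S k))\<^sup>2) + ennreal (cc / 2) * ennreal ((cutoff N k)\<^sup>2 * (cmod (x k))\<^sup>2))"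
    by (intro nn_integral_mono)
  also have "\<dots> = ennreal (2 / cc) * energy S + ennreal (cc / 2) * wsq (\<lambda>k. (cutoff N k)\<^sup>2) x"
    unfolding wsq_def by (subst nn_integral_add) (simp_all add: nn_integral_cmult)
  finally show ?thesis .
qed

context coeff_solution
begin

text \<open>The condition linking \<open>p\<close> and \<open>a\<close> says that weight times
  damping dominates cc times the squared cutoff: p = 1 suits damping of order 1, and p = 2 -
  \<gamma> suits order \<gamma> between 1 and 2. The energy inequality then reads 2 cc Z <= cc Z +
  data, and one term cc Z is cancelled.\<close>

lemma truncated_gradient_bound:
  assumes N: "1 \<le> N" and p: "0 \<le> p" "p \<le> 1" and cc: "0 < cc"
    and a0: "\<And>k. 0 \<le> a k" and ca: "\<And>k. cc * (cutoff N k)\<^sup>2 \<le> cutoff N k powr p * a k"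
    and S: "energy S = ennreal sS" "0 \<le> sS" and M: "\<And>t. energy (c t) \<le> ennreal (M\<^sup>2)" "0 \<le> M" and tm: "0 \<le> s" "s \<le> t"
  defines "G \<equiv> 25 * lat * M\<^sup>2 + 1"
  shows "ennreal cc * (\<integral>\<^sup>+\<tau>. wsq (\<lambda>k. (cutoff N k)\<^sup>2) (c \<tau>) * indicator {s..t} \<tau> \<partial>lborel)
    \<le> wsq (\<lambda>k. norm (freq k) powr p) (c s) + ennreal (2 / cc * sS * (t - s))
      + ennreal (G\<^sup>2 / cc ^ 3) * (\<integral>\<^sup>+\<tau>. half_energy (c \<tau>) * indicator {s..t} \<tau> \<partial>lborel)"
proof -
  note cb = cutoff_bounds[OF N]
  define m where "m = (\<lambda>k. cutoff N k powr p)"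
  interpret energy_setup c c "\<lambda>\<tau>. S" m a s t "N powr p"
  proof
    show "m k \<le> N powr p" for k unfolding m_def using cb p by (intro powr_mono2) auto
    show "((\<lambda>\<tau>. c \<tau> k) has_vector_derivative (S k - adv (c \<tau>) (c \<tau>) k - complex_of_real (a k) * c \<tau> k)) (at \<tau> within {s..t})"
      if "\<tau> \<in> {s..t}" for \<tau> k
      using deriv[OF tm(1) that, of k] by (simp add: crhs_def)
  qed (use tm a0 cont energy_finite real in \<open>auto simp: m_def\<close>)
  have [measurable]: "(\<lambda>\<tau>. wsq w (c \<tau>)) \<in> borel_measurable borel" for w by (rule wsq_measurable[OF cont])
  have half': "(\<integral>\<^sup>+\<tau>. half_energy (c \<tau>) * indicator {s..t} \<tau> \<partial>lborel) < \<infinity>"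
  proof -
    have "(\<integral>\<^sup>+\<tau>. half_energy (c \<tau>) * indicator {s..t} \<tau> \<partial>lborel) \<le> (\<integral>\<^sup>+\<tau>. half_energy (c \<tau>) * indicator {0..t} \<tau> \<partial>lborel)"
    proof (intro nn_integral_mono mult_left_mono)
      show "indicator {s..t} \<tau> \<le> (indicator {0..t} \<tau> :: ennreal)" for \<tau>
        using tm(1) by (cases "s \<le> \<tau>") (auto simp: indicator_def)
    qed simp
    then show ?thesis using half[of t] by (rule order_le_less_trans)
  qed
  define P where "P = 5 * sqrt lat * M"
  have P0: "0 \<le> P" using lat_nonneg M by (simp add: P_def)
  have fin: "(\<integral>\<^sup>+\<tau>. esum (\<lambda>k. esum (\<lambda>l. ennreal (q \<tau> k l))) * indicator {s..t} \<tau> \<partial>lborel) < \<infinity>"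
  proof -
    have "(\<integral>\<^sup>+\<tau>. esum (\<lambda>k. esum (\<lambda>l. ennreal (q \<tau> k l))) * indicator {s..t} \<tau> \<partial>lborel)
       \<le> (\<integral>\<^sup>+\<tau>. ennreal P * (2 * (half_energy (c \<tau>) * indicator {s..t} \<tau>)) \<partial>lborel)"
    proof (intro nn_integral_mono)
      fix \<tau>
      have "esum (\<lambda>k. esum (\<lambda>l. ennreal (q \<tau> k l))) \<le> 2 * esum (\<lambda>k. esum (\<lambda>l. ennreal (q \<tau> k l)))"
        by (simp add: mult_2)
      also have "\<dots> \<le> ennreal P * (ennreal 1 * half_energy (c \<tau>) + ennreal (1/1) * half_energy (c \<tau>))"
        unfolding q_def P_def using M by (intro trilinear_bound velocity_l1_bound_real) auto
      finally show "esum (\<lambda>k. esum (\<lambda>l. ennreal (q \<tau> k l))) * indicator {s..t} \<tau> \<le> ennreal P * (2 * (half_energy (c \<tau>) * indicator {s..t} \<tau>))"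
        by (cases "\<tau> \<in> {s..t}") (simp_all add: mult_2)
    qed
    also have "\<dots> = ennreal P * (2 * (\<integral>\<^sup>+\<tau>. half_energy (c \<tau>) * indicator {s..t} \<tau> \<partial>lborel))"
      by (simp add: nn_integral_cmult)
    also have "\<dots> < \<infinity>" using half' by (simp add: ennreal_mult_less_top)
    finally show ?thesis .
  qed
  define Z where "Z = (\<integral>\<^sup>+\<tau>. wsq (\<lambda>k. (cutoff N k)\<^sup>2) (c \<tau>) * indicator {s..t} \<tau> \<partial>lborel)"
  define H where "H = (\<integral>\<^sup>+\<tau>. half_energy (c \<tau>) * indicator {s..t} \<tau> \<partial>lborel)"
  \<comment> \<open>Cancellation in \<open>ennreal\<close> requires a finite term. The truncation at
    N supplies it through the energy bound.\<close>
  have Zfin: "ennreal cc * Z < \<infinity>"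
  proof -
    have "wsq (\<lambda>k. (cutoff N k)\<^sup>2) (c \<tau>) \<le> ennreal (N\<^sup>2) * ennreal (M\<^sup>2)" for \<tau>
    proof -
      have "wsq (\<lambda>k. (cutoff N k)\<^sup>2) (c \<tau>) \<le> wsq (\<lambda>k. N\<^sup>2) (c \<tau>)" using cb by (intro wsq_mono power_mono)
      also have "\<dots> = ennreal (N\<^sup>2) * energy (c \<tau>)" by (simp add: wsq_def ennreal_mult nn_integral_cmult)
      also have "\<dots> \<le> ennreal (N\<^sup>2) * ennreal (M\<^sup>2)" by (intro mult_left_mono M) auto
      finally show ?thesis .
    qed
    then have "Z \<le> (\<integral>\<^sup>+\<tau>. ennreal (N\<^sup>2) * ennreal (M\<^sup>2) * indicator {s..t} \<tau> \<partial>lborel)"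
      unfolding Z_def by (intro nn_integral_mono mult_right_mono) auto
    also have "\<dots> < \<infinity>" using tm by (simp add: nn_integral_cmult ennreal_mult_less_top)
    finally show ?thesis by (simp add: ennreal_mult_less_top)
  qed
  have "ennreal cc * Z + ennreal cc * Z \<le> wsq m (c t) + (\<integral>\<^sup>+\<tau>. wsq (\<lambda>k. 2 * (m k * a k)) (c \<tau>) * indicator {s..t} \<tau> \<partial>lborel)"
  proof -
    have pt: "ennreal (2 * cc) * wsq (\<lambda>k. (cutoff N k)\<^sup>2) (c \<tau>) \<le> wsq (\<lambda>k. 2 * (m k * a k)) (c \<tau>)" for \<tau>
    proof -
      have "ennreal (2 * cc) * wsq (\<lambda>k. (cutoff N k)\<^sup>2) (c \<tau>) = wsq (\<lambda>k. 2 * (cc * (cutoff N k)\<^sup>2)) (c \<tau>)"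
        using cc unfolding wsq_def by (subst nn_integral_cmult[symmetric]) (auto simp: mult.assoc intro!: nn_integral_cong simp flip: ennreal_mult)
      also have "\<dots> \<le> wsq (\<lambda>k. 2 * (m k * a k)) (c \<tau>)" unfolding m_def using ca by (intro wsq_mono) auto
      finally show ?thesis .
    qed
    have "ennreal cc * Z + ennreal cc * Z = ennreal (2 * cc) * Z"
    proof -
      have "ennreal (2 * cc) = ennreal cc + ennreal cc" using cc by (subst ennreal_plus[symmetric]) auto
      then show ?thesis by (simp only: distrib_right)
    qed
    also have "\<dots> = (\<integral>\<^sup>+\<tau>. ennreal (2 * cc) * wsq (\<lambda>k. (cutoff N k)\<^sup>2) (c \<tau>) * indicator {s..t} \<tau> \<partial>lborel)"
      unfolding Z_def by (simp add: mult.assoc nn_integral_cmult)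
    also have "\<dots> \<le> (\<integral>\<^sup>+\<tau>. wsq (\<lambda>k. 2 * (m k * a k)) (c \<tau>) * indicator {s..t} \<tau> \<partial>lborel)"
      by (intro nn_integral_mono mult_right_mono pt) auto
    finally show ?thesis by (simp add: add_increasing)
  qed
  also have "\<dots> \<le> wsq m (c s) + (\<integral>\<^sup>+\<tau>. (esum (\<lambda>k. ennreal (2 * (m k * cmod (S k) * cmod (c \<tau> k))))
         + esum (\<lambda>k. esum (\<lambda>l. ennreal (\<bar>m k - m l\<bar> * q \<tau> k l)))) * indicator {s..t} \<tau> \<partial>lborel)"
    by (rule weighted_energy_inequality[OF fin])
  also have "\<dots> \<le> wsq (\<lambda>k. norm (freq k) powr p) (c s) + (\<integral>\<^sup>+\<tau>. ennreal cc * (wsq (\<lambda>k. (cutoff N k)\<^sup>2) (c \<tau>) * indicator {s..t} \<tau>)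
       + (ennreal (2 / cc * sS) * indicator {s..t} \<tau> + ennreal (G\<^sup>2 / cc ^ 3) * (half_energy (c \<tau>) * indicator {s..t} \<tau>)) \<partial>lborel)"
  proof (intro add_mono nn_integral_mono)
    show "wsq m (c s) \<le> wsq (\<lambda>k. norm (freq k) powr p) (c s)"
      unfolding m_def using cb p by (intro wsq_mono powr_mono2) auto
    fix \<tau>
    have 1: "esum (\<lambda>k. ennreal (2 * (m k * cmod (S k) * cmod (c \<tau> k)))) \<le> ennreal (2 / cc * sS) + ennreal (cc / 2) * wsq (\<lambda>k. (cutoff N k)\<^sup>2) (c \<tau>)"
      using forcing_bound[of N p cc S sS "c \<tau>", OF N p cc S(1) zero_mode] S cc unfolding m_def by (simp add: ennreal_mult'[symmetric])
    have 2: "esum (\<lambda>k. esum (\<lambda>l. ennreal (\<bar>m k - m l\<bar> * q \<tau> k l))) \<le> ennreal (cc / 2) * wsq (\<lambda>k. (cutoff N k)\<^sup>2) (c \<tau>) + ennreal (G\<^sup>2 / cc ^ 3) * half_energy (c \<tau>)"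
      unfolding m_def q_def G_def by (rule commutator_bound[OF N p M cc])
    have cc2: "ennreal (cc / 2) * w + ennreal (cc / 2) * w = ennreal cc * w" for w
    proof -
      have "ennreal (cc / 2) + ennreal (cc / 2) = ennreal cc" using cc by (subst ennreal_plus[symmetric]) auto
      then show ?thesis by (metis distrib_right)
    qed
    show "(esum (\<lambda>k. ennreal (2 * (m k * cmod (S k) * cmod (c \<tau> k))))
         + esum (\<lambda>k. esum (\<lambda>l. ennreal (\<bar>m k - m l\<bar> * q \<tau> k l)))) * indicator {s..t} \<tau>
       \<le> ennreal cc * (wsq (\<lambda>k. (cutoff N k)\<^sup>2) (c \<tau>) * indicator {s..t} \<tau>)
       + (ennreal (2 / cc * sS) * indicator {s..t} \<tau> + ennreal (G\<^sup>2 / cc ^ 3) * (half_energy (c \<tau>) * indicator {s..t} \<tau>))"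
    proof (cases "\<tau> \<in> {s..t}")
      case True
      have re: "(A + w) + (w + D) = (w + w) + (A + D)" for A w D :: ennreal by (simp only: ac_simps)
      show ?thesis
        using order_trans[OF add_mono[OF 1 2] eq_refl[OF re]] True by (simp add: cc2)
    qed simp
  qed
  also have "(\<integral>\<^sup>+\<tau>. ennreal cc * (wsq (\<lambda>k. (cutoff N k)\<^sup>2) (c \<tau>) * indicator {s..t} \<tau>)
       + (ennreal (2 / cc * sS) * indicator {s..t} \<tau> + ennreal (G\<^sup>2 / cc ^ 3) * (half_energy (c \<tau>) * indicator {s..t} \<tau>)) \<partial>lborel)
     = ennreal cc * Z + (ennreal (2 / cc * sS) * ennreal (t - s) + ennreal (G\<^sup>2 / cc ^ 3) * H)"
    unfolding Z_def H_def using tm by (simp add: nn_integral_add nn_integral_cmult)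
  also have "ennreal (2 / cc * sS) * ennreal (t - s) = ennreal (2 / cc * sS * (t - s))"
    using S cc tm by (intro ennreal_mult[symmetric]) auto
  finally have "ennreal cc * Z + ennreal cc * Z \<le> ennreal cc * Z + (wsq (\<lambda>k. norm (freq k) powr p) (c s) + ennreal (2 / cc * sS * (t - s)) + ennreal (G\<^sup>2 / cc ^ 3) * H)"
    by (simp only: add.left_commute add.assoc)
  then show ?thesis using Zfin unfolding Z_def[symmetric] H_def[symmetric]
    by (auto simp: ennreal_add_left_cancel_le)
qed

text \<open>The right-hand side of the truncated estimate is independent of N, its initial weight
  having been replaced by |k| powr p. Fatou's lemma along N = n + 1, which respects 1 <= N, gives
  the full weight.\<close>

theorem gradient_bound:
  assumes p: "0 \<le> p" "p \<le> 1" and cc: "0 < cc"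
    and a0: "\<And>k. 0 \<le> a k" and a: "\<And>N k. 1 \<le> N \<Longrightarrow> cc * (cutoff N k)\<^sup>2 \<le> cutoff N k powr p * a k"
    and S: "energy S = ennreal sS" "0 \<le> sS" and M: "\<And>t. energy (c t) \<le> ennreal (M\<^sup>2)" "0 \<le> M" and st: "0 \<le> s" "s \<le> t"
  defines "G \<equiv> 25 * lat * M\<^sup>2 + 1"
  shows "ennreal cc * (\<integral>\<^sup>+\<tau>. wsq (\<lambda>k. (norm (freq k))\<^sup>2) (c \<tau>) * indicator {s..t} \<tau> \<partial>lborel)
    \<le> wsq (\<lambda>k. norm (freq k) powr p) (c s) + ennreal (2 / cc * sS * (t - s))
      + ennreal (G\<^sup>2 / cc ^ 3) * (\<integral>\<^sup>+\<tau>. half_energy (c \<tau>) * indicator {s..t} \<tau> \<partial>lborel)"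
    (is "_ \<le> ?R")
proof -
  have [measurable]: "(\<lambda>\<tau>. wsq w (c \<tau>)) \<in> borel_measurable borel" for w by (rule wsq_measurable[OF cont])
  have ge: "wsq (\<lambda>k. (norm (freq k))\<^sup>2) x \<le> liminf (\<lambda>n. wsq (\<lambda>k. (cutoff (real n + 1) k)\<^sup>2) x)" for x
  proof -
    have "wsq (\<lambda>k. (norm (freq k))\<^sup>2) x = esum (\<lambda>k. liminf (\<lambda>n. ennreal ((cutoff (real n + 1) k)\<^sup>2 * (cmod (x k))\<^sup>2)))"
      unfolding wsq_def
    proof (intro nn_integral_cong)
      fix k
      obtain n0 :: nat where n0: "norm (freq k) \<le> real n0" by (rule real_arch_simple[THEN exE])
      have "\<forall>\<^sub>F n in sequentially. ennreal ((cutoff (real n + 1) k)\<^sup>2 * (cmod (x k))\<^sup>2) = ennreal ((norm (freq k))\<^sup>2 * (cmod (x k))\<^sup>2)"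
        unfolding eventually_sequentially
      proof (intro exI[of _ n0] allI impI)
        fix n assume "n0 \<le> n"
        then have "norm (freq k) \<le> real n + 1" using n0 by linarith
        then have "cutoff (real n + 1) k = norm (freq k)" unfolding cutoff_def by (rule min_absorb1)
        then show "ennreal ((cutoff (real n + 1) k)\<^sup>2 * (cmod (x k))\<^sup>2) = ennreal ((norm (freq k))\<^sup>2 * (cmod (x k))\<^sup>2)" by simp
      qed
      then have "(\<lambda>n. ennreal ((cutoff (real n + 1) k)\<^sup>2 * (cmod (x k))\<^sup>2)) \<longlonglongrightarrow> ennreal ((norm (freq k))\<^sup>2 * (cmod (x k))\<^sup>2)"
        by (rule tendsto_eventually)
      then show "ennreal ((norm (freq k))\<^sup>2 * (cmod (x k))\<^sup>2) = liminf (\<lambda>n. ennreal ((cutoff (real n + 1) k)\<^sup>2 * (cmod (x k))\<^sup>2))"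
        by (intro lim_imp_Liminf[symmetric]) auto
    qed
    also have "\<dots> \<le> liminf (\<lambda>n. wsq (\<lambda>k. (cutoff (real n + 1) k)\<^sup>2) x)"
      unfolding wsq_def by (rule nn_integral_liminf) simp
    finally show ?thesis .
  qed
  have inv: "ennreal (1 / cc) * (ennreal cc * z) = z" "ennreal cc * (ennreal (1 / cc) * z) = z" for z
  proof -
    have "ennreal (1 / cc) * ennreal cc = 1" using cc by (subst ennreal_mult[symmetric]) auto
    then show "ennreal (1 / cc) * (ennreal cc * z) = z" "ennreal cc * (ennreal (1 / cc) * z) = z"
      by (metis mult.assoc mult.commute mult_1_left)+
  qed
  have "(\<integral>\<^sup>+\<tau>. wsq (\<lambda>k. (norm (freq k))\<^sup>2) (c \<tau>) * indicator {s..t} \<tau> \<partial>lborel)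
     \<le> (\<integral>\<^sup>+\<tau>. liminf (\<lambda>n. wsq (\<lambda>k. (cutoff (real n + 1) k)\<^sup>2) (c \<tau>) * indicator {s..t} \<tau>) \<partial>lborel)"
    by (intro nn_integral_mono) (auto simp: indicator_def ge)
  also have "\<dots> \<le> liminf (\<lambda>n. \<integral>\<^sup>+\<tau>. wsq (\<lambda>k. (cutoff (real n + 1) k)\<^sup>2) (c \<tau>) * indicator {s..t} \<tau> \<partial>lborel)"
    by (intro nn_integral_liminf) auto
  also have "\<dots> \<le> ennreal (1 / cc) * ?R"
  proof (intro Liminf_le always_eventually allI)
    fix n
    have "ennreal cc * (\<integral>\<^sup>+\<tau>. wsq (\<lambda>k. (cutoff (real n + 1) k)\<^sup>2) (c \<tau>) * indicator {s..t} \<tau> \<partial>lborel) \<le> ?R"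
      unfolding G_def
    proof (rule truncated_gradient_bound)
      show "cc * (cutoff (real n + 1) k)\<^sup>2 \<le> cutoff (real n + 1) k powr p * a k" for k by (rule a) simp
    qed (rule p cc a0 S M st | simp)+
    then have "ennreal (1 / cc) * (ennreal cc * (\<integral>\<^sup>+\<tau>. wsq (\<lambda>k. (cutoff (real n + 1) k)\<^sup>2) (c \<tau>) * indicator {s..t} \<tau> \<partial>lborel)) \<le> ennreal (1 / cc) * ?R"
      by (rule mult_left_mono) simp
    then show "(\<integral>\<^sup>+\<tau>. wsq (\<lambda>k. (cutoff (real n + 1) k)\<^sup>2) (c \<tau>) * indicator {s..t} \<tau> \<partial>lborel) \<le> ennreal (1 / cc) * ?R"
      by (simp only: inv(1))
  qed simp
  finally have "ennreal cc * (\<integral>\<^sup>+\<tau>. wsq (\<lambda>k. (norm (freq k))\<^sup>2) (c \<tau>) * indicator {s..t} \<tau> \<partial>lborel) \<le> ennreal cc * (ennreal (1 / cc) * ?R)"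
    by (rule mult_left_mono) simp
  then show ?thesis by (simp only: inv(2))
qed

end

section \<open>Weak solutions and vanishing mean dissipation\<close>

lemma damp_ge: "0 \<le> \<kappa> \<Longrightarrow> lam * (norm (freq k) + 1) \<le> damp lam \<gamma> \<kappa> k"
  by (simp add: damp_def)

lemma damp_even: "damp lam \<gamma> \<kappa> (- k) = damp lam \<gamma> \<kappa> k"
  by (simp add: damp_def freq_minus)

lemma damp_nonneg: "0 < lam \<Longrightarrow> 0 \<le> \<kappa> \<Longrightarrow> 0 \<le> damp lam \<gamma> \<kappa> k"
  by (simp add: damp_def)

lemma energy_fourier_coeff:
  assumes "L2_torus f"
  shows "energy (fourier_coeff f) = ennreal ((LINT x|torus_measure. (f x)\<^sup>2) / (2*pi)^3)"
proof -
  have "ennreal (1 / (2*pi)^3) * ennreal (LINT x|torus_measure. (f x)\<^sup>2) = ennreal (1 / (2*pi)^3) * (ennreal ((2*pi)^3) * energy (fourier_coeff f))"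
    by (simp only: parseval[OF assms])
  also have "\<dots> = (ennreal (1 / (2*pi)^3) * ennreal ((2*pi)^3)) * energy (fourier_coeff f)"
    by (rule mult.assoc[symmetric])
  also have "ennreal (1 / (2*pi)^3) * ennreal ((2*pi)^3) = 1"
    by (subst ennreal_mult[symmetric]) auto
  also have "ennreal (1 / (2*pi)^3) * ennreal (LINT x|torus_measure. (f x)\<^sup>2) = ennreal ((LINT x|torus_measure. (f x)\<^sup>2) / (2*pi)^3)"
    by (subst ennreal_mult[symmetric]) auto
  finally show ?thesis by simp
qed

text \<open>Weak solutions are stated with the Lebesgue integral, coefficient trajectories with the
  gauge integral. The two integrands agree on {0..t} only, since trajectories are frozen at negative
  times.\<close>

lemma set_integral_lborel_eq_integral:
  fixes f g :: "real \<Rightarrow> complex"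
  assumes "continuous_on UNIV g" "\<And>s. s \<in> {0..t} \<Longrightarrow> f s = g s"
  shows "(LINT s:{0..t}|lborel. f s) = integral {0..t} g"
proof -
  have "(LINT s:{0..t}|lborel. f s) = (LINT s:{0..t}|lborel. g s)"
    by (rule set_lebesgue_integral_cong) (use assms(2) in auto)
  also have "\<dots> = integral {0..t} g"
    by (rule set_borel_integral_eq_integral(2)[OF borel_integrable_atLeastAtMost'])
       (rule continuous_on_subset[OF assms(1)], simp)
  finally show ?thesis .
qed

text \<open>Composition with \<open>max 0 t\<close> freezes the trajectory at negative times, which
  makes the coefficients continuous on the whole line. Continuity itself comes from the mean square
  continuity, since the norm of a difference dominates each coefficient difference.\<close>

lemma coeff_solution_of_mg_solution:
  assumes sol: "mg_solution lam \<gamma> \<kappa> S \<theta>0 \<theta>"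
  shows "coeff_solution (damp lam \<gamma> \<kappa>) (fourier_coeff S) (fourier_coeff \<theta>0) (\<lambda>t. fourier_coeff (\<theta> (max 0 t)))"
proof -
  define c where "c = (\<lambda>t. fourier_coeff (\<theta> (max 0 t)))"
  have L2: "L2_torus (\<theta> t)" and zm: "zero_mean (\<theta> t)" if "0 \<le> t" for t
    using sol that by (auto simp: mg_solution_def)
  have strong: "((\<lambda>s. LINT x|torus_measure. (\<theta> s x - \<theta> t x)\<^sup>2) \<longlongrightarrow> 0) (at t within {0..})" if "0 \<le> t" for t
    using sol that by (auto simp: mg_solution_def)
  have diff_energy: "energy (\<lambda>k. fourier_coeff (\<theta> s) k - fourier_coeff (\<theta> t) k)
      = ennreal ((LINT x|torus_measure. (\<theta> s x - \<theta> t x)\<^sup>2) / (2*pi)^3)" if "0 \<le> s" "0 \<le> t" for s t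
  proof -
    have "fourier_coeff (\<lambda>x. \<theta> s x - \<theta> t x) = (\<lambda>k. fourier_coeff (\<theta> s) k - fourier_coeff (\<theta> t) k)"
      by (rule ext) (simp add: fourier_coeff_diff L2_torus_integrable L2 that)
    with energy_fourier_coeff[OF L2_torus_diff[OF L2[OF that(1)] L2[OF that(2)]]] show ?thesis by (simp only:)
  qed
  have cont0: "continuous_on {0..} (\<lambda>s. fourier_coeff (\<theta> s) k)" for k
    unfolding continuous_on_def
  proof
    fix t :: real assume "t \<in> {0..}"
    then have t: "0 \<le> t" by simp
    have ev: "\<forall>\<^sub>F s in at t within {0..}. norm (fourier_coeff (\<theta> s) k - fourier_coeff (\<theta> t) k)
        \<le> sqrt ((LINT x|torus_measure. (\<theta> s x - \<theta> t x)\<^sup>2) / (2*pi)^3)"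
      unfolding eventually_at_filter
    proof (intro always_eventually allI impI)
      fix s :: real assume "s \<in> {0..}"
      then have "energy (\<lambda>k. fourier_coeff (\<theta> s) k - fourier_coeff (\<theta> t) k) \<le> ennreal ((sqrt ((LINT x|torus_measure. (\<theta> s x - \<theta> t x)\<^sup>2) / (2*pi)^3))\<^sup>2)"
        using t by (simp add: diff_energy)
      from coeff_le_energy[OF this, of k]
      show "norm (fourier_coeff (\<theta> s) k - fourier_coeff (\<theta> t) k) \<le> sqrt ((LINT x|torus_measure. (\<theta> s x - \<theta> t x)\<^sup>2) / (2*pi)^3)"
        by simp
    qed
    have "((\<lambda>s. sqrt ((LINT x|torus_measure. (\<theta> s x - \<theta> t x)\<^sup>2) / (2*pi)^3)) \<longlongrightarrow> sqrt (0 / (2*pi)^3)) (at t within {0..})"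
      by (intro tendsto_intros strong t) auto
    then have "((\<lambda>s. sqrt ((LINT x|torus_measure. (\<theta> s x - \<theta> t x)\<^sup>2) / (2*pi)^3)) \<longlongrightarrow> 0) (at t within {0..})" by simp
    from Lim_null_comparison[OF ev this]
    show "((\<lambda>s. fourier_coeff (\<theta> s) k) \<longlongrightarrow> fourier_coeff (\<theta> t) k) (at t within {0..})"
      by (simp add: LIM_zero_iff)
  qed
  have cont: "continuous_on UNIV (\<lambda>t. c t k)" for k
    unfolding c_def by (rule continuous_on_compose2[OF cont0]) (auto intro!: continuous_intros)
  \<comment> \<open>Local boundedness is extracted from mean square continuity by compactness: times
    of unbounded energy would accumulate at some t, close to which the energy is controlled by that
    at t.\<close>
  have bdd: "\<exists>M\<ge>0. \<forall>t\<le>T. energy (c t) \<le> ennreal (M\<^sup>2)" for T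
  proof (rule ccontr)
    assume no: "\<not> (\<exists>M\<ge>0. \<forall>t\<le>T. energy (c t) \<le> ennreal (M\<^sup>2))"
    have "\<exists>s\<in>{0..max 0 T}. \<not> energy (fourier_coeff (\<theta> s)) \<le> ennreal ((real n)\<^sup>2)" for n
    proof -
      obtain s where "s \<le> T" "\<not> energy (c s) \<le> ennreal ((real n)\<^sup>2)" using no by (metis of_nat_0_le_iff)
      then show ?thesis by (intro bexI[of _ "max 0 s"]) (auto simp: c_def)
    qed
    then obtain z where z: "\<And>n. z n \<in> {0..max 0 T}" "\<And>n. \<not> energy (fourier_coeff (\<theta> (z n))) \<le> ennreal ((real n)\<^sup>2)"
      by metis
    obtain t r where t: "t \<in> {0..max 0 T}" and r: "strict_mono r" and zt: "(z \<circ> r) \<longlonglongrightarrow> t"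
      using compact_Icc[of 0 "max 0 T"] z(1) unfolding compact_def by metis
    have "continuous (at t within {0..}) (\<lambda>s. LINT x|torus_measure. (\<theta> s x - \<theta> t x)\<^sup>2)"
      using strong[of t] t by (simp add: continuous_within)
    then have lim: "(\<lambda>n. LINT x|torus_measure. (\<theta> (z (r n)) x - \<theta> t x)\<^sup>2) \<longlonglongrightarrow> 0"
      using zt z(1) unfolding continuous_within_sequentially comp_def by auto
    then have "\<forall>\<^sub>F n in sequentially. (LINT x|torus_measure. (\<theta> (z (r n)) x - \<theta> t x)\<^sup>2) < 1"
      by (rule order_tendstoD(2)) simp
    then have ev1: "\<forall>\<^sub>F n in sequentially. energy (fourier_coeff (\<theta> (z (r n)))) \<le> ennreal (2 * (1 / (2*pi)^3 + (LINT x|torus_measure. (\<theta> t x)\<^sup>2) / (2*pi)^3))"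
    proof eventually_elim
      case (elim n)
      have pos: "0 \<le> z (r n)" "0 \<le> t" using z(1)[of "r n"] t by auto
      have "energy (\<lambda>k. (fourier_coeff (\<theta> (z (r n))) k - fourier_coeff (\<theta> t) k) - (- fourier_coeff (\<theta> t) k))
         \<le> 2 * (energy (\<lambda>k. fourier_coeff (\<theta> (z (r n))) k - fourier_coeff (\<theta> t) k) + energy (\<lambda>k. - fourier_coeff (\<theta> t) k))"
        by (rule wsq_diff_le) simp
      also have "energy (\<lambda>k. - fourier_coeff (\<theta> t) k) = energy (fourier_coeff (\<theta> t))" by (simp add: wsq_def)
      also have "energy (\<lambda>k. fourier_coeff (\<theta> (z (r n))) k - fourier_coeff (\<theta> t) k) \<le> ennreal (1 / (2*pi)^3)"
        unfolding diff_energy[OF pos] using elim by (intro ennreal_leI divide_right_mono) auto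
      finally have "energy (fourier_coeff (\<theta> (z (r n)))) \<le> 2 * (ennreal (1 / (2*pi)^3) + energy (fourier_coeff (\<theta> t)))"
        by (simp add: mult_left_mono add_right_mono)
      also have "\<dots> = ennreal (2 * (1 / (2*pi)^3 + (LINT x|torus_measure. (\<theta> t x)\<^sup>2) / (2*pi)^3))"
      proof -
        have "2 * (ennreal a + ennreal b) = ennreal (2 * (a + b))" if "0 \<le> a" "0 \<le> b" for a b
          using that by (simp add: ennreal_mult ennreal_plus)
        then show ?thesis unfolding energy_fourier_coeff[OF L2[OF pos(2)]] by simp
      qed
      finally show ?case .
    qed
    define B where "B = 2 * (1 / (2*pi)^3 + (LINT x|torus_measure. (\<theta> t x)\<^sup>2) / (2*pi)^3)"
    have "\<forall>\<^sub>F n in sequentially. sqrt B \<le> real n"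
      using filterlim_real_sequentially by (simp add: filterlim_at_top)
    with ev1 have "\<forall>\<^sub>F n in sequentially. False"
    proof eventually_elim
      case (elim n)
      have "real n \<le> real (r n)" using seq_suble[OF r] by simp
      then have "B \<le> (real (r n))\<^sup>2" using elim(2) by (meson order_trans sqrt_le_D)
      then have "ennreal B \<le> ennreal ((real (r n))\<^sup>2)" by (rule ennreal_leI)
      then show False using elim(1) z(2)[of "r n"] unfolding B_def[symmetric] by (meson order_trans)
    qed
    then show False by simp
  qed
  have "coeff_solution (damp lam \<gamma> \<kappa>) (fourier_coeff S) (fourier_coeff \<theta>0) c"
  proof
    show "c t (- k) = cnj (c t k)" for t k by (simp add: c_def fourier_coeff_minus)
    show "c t 0 = 0" for t using zm[of "max 0 t"] by (simp add: c_def fourier_coeff_0 zero_mean_def)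
    show "continuous_on UNIV (\<lambda>t. c t k)" for k by (rule cont)
    show "\<exists>M\<ge>0. \<forall>t\<le>T. energy (c t) \<le> ennreal (M\<^sup>2)" for T by (rule bdd)
    show "(\<integral>\<^sup>+t. half_energy (c t) * indicator {0..T} t \<partial>lborel) < \<infinity>" for T
    proof -
      have "(\<integral>\<^sup>+t. half_energy (c t) * indicator {0..T} t \<partial>lborel) \<le> (\<integral>\<^sup>+t. half_energy (c t) * indicator {0..max 1 T} t \<partial>lborel)"
        by (intro nn_integral_mono) (auto simp: indicator_def)
      also have "\<dots> < \<infinity>"
      proof -
        have [measurable]: "(\<lambda>t. half_energy (c t)) \<in> borel_measurable borel" by (rule wsq_measurable[OF cont])
        have "ennreal ((2*pi)^3) * (\<integral>\<^sup>+t. half_energy (c t) * indicator {0..max 1 T} t \<partial>lborel)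
           = (\<integral>\<^sup>+t. ennreal ((2*pi)^3) * (half_energy (c t) * indicator {0..max 1 T} t) \<partial>lborel)"
          by (rule nn_integral_cmult[symmetric]) simp
        also have "\<dots> = (\<integral>\<^sup>+ s\<in>{0..max 1 T}. sobolev_sq (1/2) (\<theta> s) \<partial>lborel)"
          by (intro nn_integral_cong) (auto simp: sobolev_sq_half c_def indicator_def)
        also have "\<dots> < \<infinity>" using sol by (simp add: mg_solution_def)
        finally show ?thesis by (auto simp: ennreal_mult_less_top)
      qed
      finally show ?thesis .
    qed
    show "c t k = fourier_coeff \<theta>0 k + integral {0..t} (\<lambda>s. crhs (damp lam \<gamma> \<kappa>) (fourier_coeff S) (c s) k)" if "0 \<le> t" for t k
    proof -
      have "fourier_coeff (\<theta> t) k = fourier_coeff \<theta>0 k + (LINT s:{0..t}|lborel. mg_rhs_coeff lam \<gamma> \<kappa> S (\<theta> s) k)"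
        using sol that by (simp add: mg_solution_def)
      also have "(LINT s:{0..t}|lborel. mg_rhs_coeff lam \<gamma> \<kappa> S (\<theta> s) k) = integral {0..t} (\<lambda>s. crhs (damp lam \<gamma> \<kappa>) (fourier_coeff S) (c s) k)"
        by (rule set_integral_lborel_eq_integral[OF crhs_continuous[OF cont bdd]])
           (auto simp: crhs_def c_def mg_rhs_coeff_eq L2)
      finally show ?thesis using that by (simp add: c_def)
    qed
  qed
  then show ?thesis by (simp add: c_def)
qed

text \<open>Continuity in mean square is the one requirement that involves all coefficients at once
  at a fixed time; it comes from \<open>continuous_energy\<close> and Parseval's identity.\<close>

lemma mg_solution_of_coeff_solution:
  assumes c: "coeff_solution (damp lam \<gamma> \<kappa>) (fourier_coeff S) (fourier_coeff \<theta>0) c"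
    and S: "L2_torus S" and \<theta>0: "L2_torus \<theta>0" and par: "0 < lam" "0 \<le> \<kappa>"
    and \<theta>: "\<And>t. L2_torus (\<theta> t)" "\<And>t k. fourier_coeff (\<theta> t) k = c t k"
  shows "mg_solution lam \<gamma> \<kappa> S \<theta>0 \<theta>"
proof -
  interpret coeff_solution "damp lam \<gamma> \<kappa>" "fourier_coeff S" "fourier_coeff \<theta>0" c by fact
  have \<theta>c: "fourier_coeff (\<theta> t) = c t" for t by (rule ext) (rule \<theta>(2))
  have zm: "zero_mean (\<theta> t)" for t
    using zero_mode[of t] \<theta>(2)[of t 0] by (simp add: fourier_coeff_0 zero_mean_def)
  have strong: "((\<lambda>s. LINT x|torus_measure. (\<theta> s x - \<theta> t x)\<^sup>2) \<longlongrightarrow> 0) (at t within {0..})" if t: "0 \<le> t" for t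
  proof -
    have eq: "ennreal ((2*pi)^3) * energy (\<lambda>k. c s k - c t k) = ennreal (LINT x|torus_measure. (\<theta> s x - \<theta> t x)\<^sup>2)" for s
    proof -
      have "fourier_coeff (\<lambda>x. \<theta> s x - \<theta> t x) = (\<lambda>k. c s k - c t k)"
        by (rule ext) (simp add: fourier_coeff_diff L2_torus_integrable \<theta>)
      then show ?thesis using parseval[OF L2_torus_diff[OF \<theta>(1)[of s] \<theta>(1)[of t]]] by simp
    qed
    have "((\<lambda>s. energy (\<lambda>k. c s k - c t k)) \<longlongrightarrow> 0) (at t within {0..})"
      by (rule continuous_energy[OF damp_nonneg[OF par] energy_fourier_coeff_finite[OF S] t])
    then have "((\<lambda>s. ennreal ((2*pi)^3) * energy (\<lambda>k. c s k - c t k)) \<longlongrightarrow> ennreal ((2*pi)^3) * 0) (at t within {0..})"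
      by (intro ennreal_tendsto_cmult) auto
    then have "((\<lambda>s. ennreal (LINT x|torus_measure. (\<theta> s x - \<theta> t x)\<^sup>2)) \<longlongrightarrow> ennreal 0) (at t within {0..})"
      unfolding eq by simp
    from tendsto_enn2real[OF this] show ?thesis by simp
  qed
  have [measurable]: "(\<lambda>t. half_energy (c t)) \<in> borel_measurable borel" by (rule wsq_measurable[OF cont])
  have half': "(\<integral>\<^sup>+ s\<in>{0..T}. sobolev_sq (1/2) (\<theta> s) \<partial>lborel) < \<infinity>" for T
    using half[of T] by (simp add: sobolev_sq_half \<theta>c mult.assoc nn_integral_cmult ennreal_mult_less_top)
  have init': "AE x in torus_measure. \<theta> 0 x = \<theta>0 x"
    by (rule fourier_coeff_unique[OF \<theta>(1) \<theta>0]) (simp add: \<theta>(2) init)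
  have eq': "fourier_coeff (\<theta> t) k = fourier_coeff \<theta>0 k + (LINT s:{0..t}|lborel. mg_rhs_coeff lam \<gamma> \<kappa> S (\<theta> s) k)" if "0 \<le> t" for t k
  proof -
    have "(LINT s:{0..t}|lborel. mg_rhs_coeff lam \<gamma> \<kappa> S (\<theta> s) k) = integral {0..t} (\<lambda>s. crhs (damp lam \<gamma> \<kappa>) (fourier_coeff S) (c s) k)"
      by (rule set_integral_lborel_eq_integral[OF crhs_continuous[OF cont bounded]])
         (simp add: crhs_def mg_rhs_coeff_eq \<theta>(1) \<theta>c)
    then show ?thesis using eq[OF that, of k] by (simp add: \<theta>(2))
  qed
  show ?thesis
    unfolding mg_solution_def using \<theta>(1) zm strong half' init' eq' by blast
qed

section \<open>Constants independent of the diffusivity and the limit\<close>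

locale mg_data =
  fixes \<theta>0 S :: "real^3 \<Rightarrow> real" and lam \<gamma> :: real
  assumes \<theta>0: "L2_torus \<theta>0" "zero_mean \<theta>0" and S: "L2_torus S" "zero_mean S" and lam: "0 < lam" and \<gamma>: "0 < \<gamma>" "\<gamma> \<le> 2"
begin

lemma coeff_problem: "0 \<le> \<kappa> \<Longrightarrow> coeff_problem (damp lam \<gamma> \<kappa>) (fourier_coeff S) (fourier_coeff \<theta>0) lam"
  by standard
     (use \<theta>0 S lam in \<open>auto simp: damp_ge damp_even fourier_coeff_minus fourier_coeff_0 zero_mean_def
       intro: energy_fourier_coeff_finite[unfolded infinity_ennreal_def]\<close>)

text \<open>These constants of \<open>coeff_problem\<close> take only the source, the datum and lam
  as arguments. Naming them outside any interpretation records that they are the same for every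
  \<kappa>.\<close>

definition E0 :: real where "E0 = coeff_problem.e0 (fourier_coeff \<theta>0)"
definition F0 :: real where "F0 = coeff_problem.sS (fourier_coeff S)"
definition M0 :: real where "M0 = sqrt (coeff_problem.M2 (fourier_coeff S) (fourier_coeff \<theta>0) lam)"

lemma solution_coeffs:
  assumes \<kappa>: "0 \<le> \<kappa>"
  obtains c where "coeff_solution (damp lam \<gamma> \<kappa>) (fourier_coeff S) (fourier_coeff \<theta>0) c"
    "\<And>t. energy (c t) \<le> ennreal (M0\<^sup>2)"
    "\<And>T. 0 \<le> T \<Longrightarrow> (\<integral>\<^sup>+t. half_energy (c t) * indicator {0..T} t \<partial>lborel) \<le> ennreal ((E0 + F0 / lam * T) / (2 * lam))"
proof -
  interpret coeff_problem "damp lam \<gamma> \<kappa>" "fourier_coeff S" "fourier_coeff \<theta>0" lam by (rule coeff_problem[OF \<kappa>])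
  have "M0\<^sup>2 = M2" using M2_nonneg by (simp add: M0_def)
  obtain c where c: "coeff_solution (damp lam \<gamma> \<kappa>) (fourier_coeff S) (fourier_coeff \<theta>0) c"
    "\<And>t. energy (c t) \<le> ennreal M2"
    "\<And>T. 0 \<le> T \<Longrightarrow> (\<integral>\<^sup>+t. half_energy (c t) * indicator {0..T} t \<partial>lborel) \<le> ennreal ((e0 + sS / lam * T) / (2 * lam))"
    using solution_exists by blast
  show ?thesis
  proof (rule that[OF c(1)])
    show "energy (c t) \<le> ennreal (M0\<^sup>2)" for t unfolding \<open>M0\<^sup>2 = M2\<close> by (rule c(2))
    show "(\<integral>\<^sup>+t. half_energy (c t) * indicator {0..T} t \<partial>lborel) \<le> ennreal ((E0 + F0 / lam * T) / (2 * lam))" if "0 \<le> T" for T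
      unfolding E0_def F0_def by (rule c(3)[OF that])
  qed
qed

lemma unique_coeffs:
  assumes \<kappa>: "0 \<le> \<kappa>" and "coeff_solution (damp lam \<gamma> \<kappa>) (fourier_coeff S) (fourier_coeff \<theta>0) x"
    "coeff_solution (damp lam \<gamma> \<kappa>) (fourier_coeff S) (fourier_coeff \<theta>0) y" "0 \<le> t"
  shows "x t = y t"
proof (rule coeff_solution_unique[OF assms(2,3) lam _ assms(4)])
  show "lam * norm (freq k) \<le> damp lam \<gamma> \<kappa> k" for k
    using damp_ge[OF \<kappa>, of lam k \<gamma>] lam by (simp add: distrib_left)
qed

theorem existence_uniqueness:
  assumes \<kappa>: "0 \<le> \<kappa>"
  shows "\<exists>\<theta>. mg_solution lam \<gamma> \<kappa> S \<theta>0 \<theta> \<and>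
    (\<forall>\<eta>. mg_solution lam \<gamma> \<kappa> S \<theta>0 \<eta> \<longrightarrow> (\<forall>t\<ge>0. AE x in torus_measure. \<eta> t x = \<theta> t x))"
proof -
  obtain c where c: "coeff_solution (damp lam \<gamma> \<kappa>) (fourier_coeff S) (fourier_coeff \<theta>0) c"
    using solution_coeffs[OF \<kappa>] by blast
  interpret c: coeff_solution "damp lam \<gamma> \<kappa>" "fourier_coeff S" "fourier_coeff \<theta>0" c by (rule c)
  have "\<exists>f. L2_torus f \<and> (\<forall>k. fourier_coeff f k = c t k)" for t
    by (rule riesz_fischer[OF c.energy_finite c.real]) blast
  then obtain \<theta> where \<theta>: "\<And>t. L2_torus (\<theta> t)" "\<And>t k. fourier_coeff (\<theta> t) k = c t k" by metis
  have sol: "mg_solution lam \<gamma> \<kappa> S \<theta>0 \<theta>"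
    by (rule mg_solution_of_coeff_solution[OF c S(1) \<theta>0(1) lam \<kappa> \<theta>])
  moreover have "AE x in torus_measure. \<eta> t x = \<theta> t x" if \<eta>: "mg_solution lam \<gamma> \<kappa> S \<theta>0 \<eta>" and t: "0 \<le> t" for \<eta> t
  proof (rule fourier_coeff_unique)
    show "L2_torus (\<eta> t)" using \<eta> t by (simp add: mg_solution_def)
    show "L2_torus (\<theta> t)" by (rule \<theta>)
    show "fourier_coeff (\<eta> t) k = fourier_coeff (\<theta> t) k" for k
      using unique_coeffs[OF \<kappa> coeff_solution_of_mg_solution[OF \<eta>] c t] t \<theta>(2) by (simp add: fun_eq_iff)
  qed
  ultimately show ?thesis by blast
qed

definition G0 :: real where "G0 = 25 * lat * M0\<^sup>2 + 1"
text \<open>Growth rate in t of the time integral of the squared gradient norm: the coefficient of t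
  in \<open>gradient_bound\<close> for p = 1 and cc = lam, after inserting the bound for the half
  energy and dividing by lam.\<close>

definition C1 :: real where "C1 = (2 / lam * F0 + G0\<^sup>2 / lam ^ 3 * (F0 / lam / (2 * lam))) / lam"

lemma F0_energy: "energy (fourier_coeff S) = ennreal F0" "0 \<le> F0"
  and E0_nonneg: "0 \<le> E0" and M0_nonneg: "0 \<le> M0" and C1_nonneg: "0 \<le> C1"
proof -
  interpret coeff_problem "damp lam \<gamma> 0" "fourier_coeff S" "fourier_coeff \<theta>0" lam by (rule coeff_problem) simp
  show "energy (fourier_coeff S) = ennreal F0" "0 \<le> F0" "0 \<le> E0" "0 \<le> M0"
    using sS e0 M2_nonneg by (auto simp: F0_def E0_def M0_def)
  then show "0 \<le> C1" using lam by (simp add: C1_def)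
qed

context
  fixes \<kappa> \<theta> assumes \<kappa>: "0 < \<kappa>" and sol: "mg_solution lam \<gamma> \<kappa> S \<theta>0 \<theta>"
begin

definition c :: "real \<Rightarrow> int^3 \<Rightarrow> complex" where "c t = fourier_coeff (\<theta> (max 0 t))"

definition enstrophy :: "real \<Rightarrow> real \<Rightarrow> ennreal" where
  "enstrophy s t = (\<integral>\<^sup>+\<tau>. wsq (\<lambda>k. (norm (freq k))\<^sup>2) (c \<tau>) * indicator {s..t} \<tau> \<partial>lborel)"

lemma c_solution: "coeff_solution (damp lam \<gamma> \<kappa>) (fourier_coeff S) (fourier_coeff \<theta>0) c"
  using coeff_solution_of_mg_solution[OF sol] by (simp add: c_def[abs_def])

text \<open>The bounds are known for the constructed solution; uniqueness transfers them to the
  given one.\<close>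

lemma c_energy: "energy (c t) \<le> ennreal (M0\<^sup>2)"
  and c_half: "0 \<le> T \<Longrightarrow> (\<integral>\<^sup>+t. half_energy (c t) * indicator {0..T} t \<partial>lborel) \<le> ennreal ((E0 + F0 / lam * T) / (2 * lam))"
proof -
  have \<kappa>0: "0 \<le> \<kappa>" using \<kappa> by simp
  obtain d where d: "coeff_solution (damp lam \<gamma> \<kappa>) (fourier_coeff S) (fourier_coeff \<theta>0) d"
    "\<And>t. energy (d t) \<le> ennreal (M0\<^sup>2)"
    "\<And>T. 0 \<le> T \<Longrightarrow> (\<integral>\<^sup>+t. half_energy (d t) * indicator {0..T} t \<partial>lborel) \<le> ennreal ((E0 + F0 / lam * T) / (2 * lam))"
    using solution_coeffs[OF \<kappa>0] by blast
  have eq: "c t = d t" if "0 \<le> t" for t by (rule unique_coeffs[OF \<kappa>0 c_solution d(1) that])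
  have "c t = c (max 0 t)" by (simp add: c_def)
  also have "\<dots> = d (max 0 t)" by (rule eq) simp
  finally show "energy (c t) \<le> ennreal (M0\<^sup>2)" using d(2) by simp
  show "(\<integral>\<^sup>+t. half_energy (c t) * indicator {0..T} t \<partial>lborel) \<le> ennreal ((E0 + F0 / lam * T) / (2 * lam))" if "0 \<le> T"
  proof -
    have "(\<integral>\<^sup>+t. half_energy (c t) * indicator {0..T} t \<partial>lborel) = (\<integral>\<^sup>+t. half_energy (d t) * indicator {0..T} t \<partial>lborel)"
      by (intro nn_integral_cong) (auto simp: indicator_def eq)
    then show ?thesis using d(3)[OF that] by simp
  qed
qed

lemma gradient_le_enstrophy: "0 \<le> a \<Longrightarrow> (\<integral>\<^sup>+ s\<in>{a..t}. gradient_L2_sq (\<theta> s) \<partial>lborel) \<le> ennreal ((2*pi)^3) * enstrophy a t"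
proof -
  assume a: "0 \<le> a"
  interpret coeff_solution "damp lam \<gamma> \<kappa>" "fourier_coeff S" "fourier_coeff \<theta>0" c by (rule c_solution)
  have [measurable]: "(\<lambda>\<tau>. wsq w (c \<tau>)) \<in> borel_measurable borel" for w by (rule wsq_measurable[OF cont])
  have "(\<integral>\<^sup>+ s\<in>{a..t}. gradient_L2_sq (\<theta> s) \<partial>lborel)
     \<le> (\<integral>\<^sup>+\<tau>. ennreal ((2*pi)^3) * (wsq (\<lambda>k. (norm (freq k))\<^sup>2) (c \<tau>) * indicator {a..t} \<tau>) \<partial>lborel)"
  proof (intro nn_integral_mono)
    fix s
    show "gradient_L2_sq (\<theta> s) * indicator {a..t} s \<le> ennreal ((2*pi)^3) * (wsq (\<lambda>k. (norm (freq k))\<^sup>2) (c s) * indicator {a..t} s)"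
    proof (cases "s \<in> {a..t}")
      case True
      then have s: "0 \<le> s" using a by simp
      then have "L2_torus (\<theta> s)" using sol by (simp add: mg_solution_def)
      from gradient_L2_sq_le[OF this] show ?thesis using True s by (simp add: c_def)
    qed simp
  qed
  also have "\<dots> = ennreal ((2*pi)^3) * enstrophy a t"
    unfolding enstrophy_def by (rule nn_integral_cmult) measurable
  finally show ?thesis .
qed

text \<open>The half energy is integrable in time, hence finite at some s strictly between 0 and a.
  There it is exactly the initial term of \<open>gradient_bound\<close> for p = 1, the weight for
  which the damping lam |k| controls the squared gradient.\<close>

lemma enstrophy_growth:
  assumes a: "0 < a"
  obtains C0 where "0 \<le> C0" "\<And>t. a \<le> t \<Longrightarrow> enstrophy a t \<le> ennreal (C0 + C1 * t)"
proof -
  interpret coeff_solution "damp lam \<gamma> \<kappa>" "fourier_coeff S" "fourier_coeff \<theta>0" c by (rule c_solution)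
  have [measurable]: "(\<lambda>\<tau>. wsq w (c \<tau>)) \<in> borel_measurable borel" for w by (rule wsq_measurable[OF cont])
  have "\<exists>s. 0 < s \<and> s < a \<and> half_energy (c s) < \<infinity>"
  proof (rule ccontr)
    assume no: "\<not> (\<exists>s. 0 < s \<and> s < a \<and> half_energy (c s) < \<infinity>)"
    have top: "half_energy (c s) = top" if "0 < s" "s < a" for s
    proof -
      have "\<not> half_energy (c s) < \<infinity>" using no that by blast
      then show ?thesis by (simp add: not_less top_unique)
    qed
    have "(\<integral>\<^sup>+s. top * indicator {0<..<a} s \<partial>lborel) \<le> (\<integral>\<^sup>+t. half_energy (c t) * indicator {0..a} t \<partial>lborel)"
      by (intro nn_integral_mono) (auto simp: indicator_def top)
    also have "\<dots> < \<infinity>" by (rule half)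
    finally have "(\<integral>\<^sup>+s. top * indicator {0<..<a} s \<partial>lborel) < \<infinity>" .
    moreover have "(\<integral>\<^sup>+s. top * indicator {0<..<a} s \<partial>lborel) = top * emeasure lborel {0<..<a}"
      by (rule nn_integral_cmult_indicator) simp
    moreover have "emeasure lborel {0<..<a} = ennreal a" using a by simp
    moreover have "top * ennreal a = top" using a by (simp add: ennreal_top_mult)
    ultimately show False by (simp only: infinity_ennreal_def less_irrefl)
  qed
  then obtain s where s: "0 < s" "s < a" "half_energy (c s) < \<infinity>" by blast
  define h where "h = enn2real (half_energy (c s))"
  have h: "half_energy (c s) = ennreal h" "0 \<le> h" using s by (auto simp: h_def less_top)
  \<comment> \<open>Collects everything that does not grow with t. It may depend on \<kappa> through
    the solution at time s, which division by t makes harmless.\<close>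
  define C0 where "C0 = (h + G0\<^sup>2 / lam ^ 3 * (E0 / (2 * lam))) / lam"
  have C0: "0 \<le> C0" using h E0_nonneg lam by (simp add: C0_def)
  have "enstrophy a t \<le> ennreal (C0 + C1 * t)" if t: "a \<le> t" for t
  proof -
    have "ennreal lam * enstrophy s t \<le> wsq (\<lambda>k. norm (freq k) powr 1) (c s) + ennreal (2 / lam * F0 * (t - s))
      + ennreal (G0\<^sup>2 / lam ^ 3) * (\<integral>\<^sup>+\<tau>. half_energy (c \<tau>) * indicator {s..t} \<tau> \<partial>lborel)"
      unfolding enstrophy_def G0_def
    proof (rule gradient_bound)
      show "lam * (cutoff N k)\<^sup>2 \<le> cutoff N k powr 1 * damp lam \<gamma> \<kappa> k" if "1 \<le> N" for N k
      proof -
        note cb = cutoff_bounds[OF that]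
        have "lam * cutoff N k \<le> lam * (norm (freq k) + 1)" using lam cb(3)[of k] by simp
        also have "\<dots> \<le> damp lam \<gamma> \<kappa> k" using \<kappa> by (intro damp_ge) simp
        finally have "cutoff N k * (lam * cutoff N k) \<le> cutoff N k * damp lam \<gamma> \<kappa> k" using cb(1) by (rule mult_left_mono)
        then show ?thesis using cb(1)[of k] by (simp add: power2_eq_square mult_ac)
      qed
    qed (use lam \<kappa> damp_nonneg F0_energy c_energy M0_nonneg s t in auto)
    also have "(\<integral>\<^sup>+\<tau>. half_energy (c \<tau>) * indicator {s..t} \<tau> \<partial>lborel) \<le> (\<integral>\<^sup>+\<tau>. half_energy (c \<tau>) * indicator {0..t} \<tau> \<partial>lborel)"
      using s by (intro nn_integral_mono) (auto simp: indicator_def)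
    also have "\<dots> \<le> ennreal ((E0 + F0 / lam * t) / (2 * lam))"
      using s t by (intro c_half) simp
    also have "wsq (\<lambda>k. norm (freq k) powr 1) (c s) = ennreal h" using h by simp
    also have "ennreal (2 / lam * F0 * (t - s)) \<le> ennreal (2 / lam * F0 * t)"
      using lam F0_energy s by (intro ennreal_leI mult_left_mono) auto
    finally have "ennreal lam * enstrophy s t \<le> ennreal h + ennreal (2 / lam * F0 * t) + ennreal (G0\<^sup>2 / lam ^ 3) * ennreal ((E0 + F0 / lam * t) / (2 * lam))"
      by (simp add: add_mono mult_left_mono)
    also have "\<dots> = ennreal (h + 2 / lam * F0 * t + G0\<^sup>2 / lam ^ 3 * ((E0 + F0 / lam * t) / (2 * lam)))"
    proof -
      have nn: "0 \<le> t" "0 \<le> 2 / lam * F0 * t" "0 \<le> G0\<^sup>2 / lam ^ 3" "0 \<le> (E0 + F0 / lam * t) / (2 * lam)"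
        using s t lam E0_nonneg F0_energy by auto
      show ?thesis
        using nn h by (simp only: ennreal_mult[symmetric] ennreal_plus[symmetric] add_nonneg_nonneg mult_nonneg_nonneg)
    qed
    also have "h + 2 / lam * F0 * t + G0\<^sup>2 / lam ^ 3 * ((E0 + F0 / lam * t) / (2 * lam)) = lam * (C0 + C1 * t)"
      using lam by (simp add: C0_def C1_def field_simps)
    also have "ennreal (lam * (C0 + C1 * t)) = ennreal lam * ennreal (C0 + C1 * t)"
      using lam C0 C1_nonneg s t by (intro ennreal_mult) auto
    finally have "ennreal (1 / lam) * (ennreal lam * enstrophy s t) \<le> ennreal (1 / lam) * (ennreal lam * ennreal (C0 + C1 * t))"
      by (rule mult_left_mono) simp
    moreover have "ennreal (1 / lam) * ennreal lam = 1" using lam by (subst ennreal_mult[symmetric]) auto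
    ultimately have "enstrophy s t \<le> ennreal (C0 + C1 * t)"
      by (metis mult.assoc mult_1_left)
    moreover have "enstrophy a t \<le> enstrophy s t"
      unfolding enstrophy_def using s by (intro nn_integral_mono) (auto simp: indicator_def)
    ultimately show ?thesis by (rule order_trans[rotated])
  qed
  with C0 that show ?thesis by blast
qed

text \<open>The exponent satisfies p + max 1 \<gamma> = 2, so n^p times the stronger of the two
  dampings dominates n^2. Starting at time 0 costs the Sobolev norm of the datum of order p / 2, the
  one assumed finite.\<close>

lemma enstrophy_initial:
  assumes "sobolev_sq (1 - max 1 \<gamma> / 2) \<theta>0 < \<infinity>"
  shows "enstrophy 0 1 < \<infinity>"
proof -
  interpret coeff_solution "damp lam \<gamma> \<kappa>" "fourier_coeff S" "fourier_coeff \<theta>0" c by (rule c_solution)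
  define p where "p = 2 - max 1 \<gamma>"
  have p: "0 \<le> p" "p \<le> 1" using \<gamma> by (auto simp: p_def)
  \<comment> \<open>For \<gamma> > 1 the resulting bound degenerates as \<kappa> tends to 0; only
    finiteness on {0..1} is drawn from it.\<close>
  define cc where "cc = (if \<gamma> \<le> 1 then lam else \<kappa>)"
  have cc: "0 < cc" using lam \<kappa> by (simp add: cc_def)
  have "wsq (\<lambda>k. norm (freq k) powr (2 * (1 - max 1 \<gamma> / 2))) (fourier_coeff \<theta>0) < \<infinity>"
    using assms by (auto simp: sobolev_sq_eq ennreal_mult_less_top)
  also have "2 * (1 - max 1 \<gamma> / 2) = p" by (simp add: p_def)
  finally have w0: "wsq (\<lambda>k. norm (freq k) powr p) (c 0) < \<infinity>" by (simp add: init)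
  have "ennreal cc * enstrophy 0 1 \<le> wsq (\<lambda>k. norm (freq k) powr p) (c 0) + ennreal (2 / cc * F0 * (1 - 0))
      + ennreal (G0\<^sup>2 / cc ^ 3) * (\<integral>\<^sup>+\<tau>. half_energy (c \<tau>) * indicator {0..1} \<tau> \<partial>lborel)"
    unfolding enstrophy_def G0_def
  proof (rule gradient_bound)
    show "cc * (cutoff N k)\<^sup>2 \<le> cutoff N k powr p * damp lam \<gamma> \<kappa> k" if N: "1 \<le> N" for N k
    proof (cases "k = 0")
      case False
      define n where "n = cutoff N k"
      have n: "1 \<le> n" "n \<le> norm (freq k)" using cutoff_bounds(3,5)[OF N] False by (auto simp: n_def)
      show ?thesis
      proof (cases "\<gamma> \<le> 1")
        case True
        have "lam * n \<le> lam * (norm (freq k) + 1)" using lam n by simp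
        also have "\<dots> \<le> damp lam \<gamma> \<kappa> k" using \<kappa> by (intro damp_ge) simp
        finally have "n * (lam * n) \<le> n * damp lam \<gamma> \<kappa> k" using n by (intro mult_left_mono) auto
        then show ?thesis using True n by (simp add: n_def[symmetric] cc_def p_def power2_eq_square mult_ac)
      next
        case False
        have "\<kappa> * n powr \<gamma> \<le> \<kappa> * norm (freq k) powr \<gamma>"
          using \<kappa> n \<gamma> by (intro mult_left_mono powr_mono2) auto
        also have "\<dots> \<le> damp lam \<gamma> \<kappa> k" using lam by (simp add: damp_def)
        finally have "n powr p * (\<kappa> * n powr \<gamma>) \<le> n powr p * damp lam \<gamma> \<kappa> k" by (rule mult_left_mono) simp
        moreover have "n powr p * (\<kappa> * n powr \<gamma>) = \<kappa> * n\<^sup>2"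
        proof -
          have "n powr p * n powr \<gamma> = n powr (p + \<gamma>)" by (rule powr_add[symmetric])
          also have "p + \<gamma> = 2" using False by (simp add: p_def)
          also have "n powr 2 = n\<^sup>2" using n by (simp add: powr_numeral)
          finally show ?thesis by (simp add: mult.left_commute)
        qed
        ultimately show ?thesis using False by (simp add: n_def[symmetric] cc_def)
      qed
    qed (simp add: cutoff_bounds(4)[OF N])
  qed (use p cc lam \<kappa> damp_nonneg F0_energy c_energy M0_nonneg in auto)
  also have "\<dots> < \<infinity>" using w0 half[of 1] by (simp add: ennreal_mult_less_top)
  finally show ?thesis using cc by (auto simp: ennreal_mult_less_top)
qed

text \<open>For t >= C0 the offset is absorbed by C0 + C1 t <= (1 + C1) t. After division by t only
  C1 is left, which does not depend on \<kappa>, so the prefactor \<kappa> survives.\<close>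

lemma mean_dissipation_le:
  assumes a: "0 \<le> a" and C0: "0 \<le> C0" and b: "0 < b" and le: "\<And>t. b \<le> t \<Longrightarrow> enstrophy a t \<le> ennreal (C0 + C1 * t)"
  shows "mean_dissipation a \<kappa> \<theta> \<le> ennreal (\<kappa> * ((2*pi)^3 * (1 + C1)))"
  unfolding mean_dissipation_def
proof (rule Limsup_bounded)
  show "\<forall>\<^sub>F t in at_top. ennreal (\<kappa> / t) * (\<integral>\<^sup>+ s\<in>{a..t}. gradient_L2_sq (\<theta> s) \<partial>lborel) \<le> ennreal (\<kappa> * ((2*pi)^3 * (1 + C1)))"
    using eventually_ge_at_top[of b] eventually_ge_at_top[of C0]
  proof eventually_elim
    case (elim t)
    have t: "0 < t" using elim b by simp
    have "ennreal (\<kappa> / t) * (\<integral>\<^sup>+ s\<in>{a..t}. gradient_L2_sq (\<theta> s) \<partial>lborel)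
       \<le> ennreal (\<kappa> / t) * (ennreal ((2*pi)^3) * ennreal (C0 + C1 * t))"
      by (intro mult_left_mono order_trans[OF gradient_le_enstrophy[OF a]] le elim) auto
    also have "\<dots> = ennreal (\<kappa> / t * ((2*pi)^3 * (C0 + C1 * t)))"
    proof -
      have nn: "0 \<le> \<kappa> / t" "0 \<le> (2*pi)^3" "0 \<le> C0 + C1 * t" using \<kappa> t C0 C1_nonneg by auto
      then show ?thesis by (simp only: ennreal_mult mult_nonneg_nonneg)
    qed
    also have "\<dots> \<le> ennreal (\<kappa> * ((2*pi)^3 * (1 + C1)))"
    proof (rule ennreal_leI)
      have "C0 + C1 * t \<le> t * (1 + C1)" using elim by (simp add: algebra_simps)
      then have "\<kappa> / t * ((2*pi)^3 * (C0 + C1 * t)) \<le> \<kappa> / t * ((2*pi)^3 * (t * (1 + C1)))"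
        using \<kappa> t by (intro mult_left_mono) auto
      also have "\<dots> = \<kappa> * ((2*pi)^3 * (1 + C1))" using t by simp
      finally show "\<kappa> / t * ((2*pi)^3 * (C0 + C1 * t)) \<le> \<kappa> * ((2*pi)^3 * (1 + C1))" .
    qed
    finally show ?case .
  qed
qed

lemma mean_dissipation_positive_time:
  assumes "0 < a" shows "mean_dissipation a \<kappa> \<theta> \<le> ennreal (\<kappa> * ((2*pi)^3 * (1 + C1)))"
proof -
  obtain C0 where "0 \<le> C0" "\<And>t. a \<le> t \<Longrightarrow> enstrophy a t \<le> ennreal (C0 + C1 * t)"
    using enstrophy_growth[OF assms] by blast
  then show ?thesis using assms by (intro mean_dissipation_le[of a C0 a]) auto
qed

text \<open>The interval {0..1} contributes a finite constant to the offset; from time 1 on the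
  growth rate is the same C1 as for positive starting times.\<close>

lemma mean_dissipation_initial_time:
  assumes "sobolev_sq (1 - max 1 \<gamma> / 2) \<theta>0 < \<infinity>"
  shows "mean_dissipation 0 \<kappa> \<theta> \<le> ennreal (\<kappa> * ((2*pi)^3 * (1 + C1)))"
proof -
  interpret coeff_solution "damp lam \<gamma> \<kappa>" "fourier_coeff S" "fourier_coeff \<theta>0" c by (rule c_solution)
  have [measurable]: "(\<lambda>\<tau>. wsq w (c \<tau>)) \<in> borel_measurable borel" for w by (rule wsq_measurable[OF cont])
  obtain C0 where C0: "0 \<le> C0" "\<And>t. 1 \<le> t \<Longrightarrow> enstrophy 1 t \<le> ennreal (C0 + C1 * t)"
    using enstrophy_growth[of 1] by auto
  define D where "D = enn2real (enstrophy 0 1)"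
  have D: "enstrophy 0 1 = ennreal D" "0 \<le> D" using enstrophy_initial[OF assms] by (auto simp: D_def less_top)
  have "enstrophy 0 t \<le> ennreal ((D + C0) + C1 * t)" if t: "1 \<le> t" for t
  proof -
    have "enstrophy 0 t \<le> (\<integral>\<^sup>+\<tau>. wsq (\<lambda>k. (norm (freq k))\<^sup>2) (c \<tau>) * indicator {0..1} \<tau> + wsq (\<lambda>k. (norm (freq k))\<^sup>2) (c \<tau>) * indicator {1..t} \<tau> \<partial>lborel)"
      unfolding enstrophy_def by (intro nn_integral_mono) (auto simp: indicator_def)
    also have "\<dots> = enstrophy 0 1 + enstrophy 1 t"
      unfolding enstrophy_def by (rule nn_integral_add) measurable
    also have "\<dots> \<le> ennreal D + ennreal (C0 + C1 * t)" using C0(2)[OF t] by (simp add: D add_left_mono)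
    also have "\<dots> = ennreal ((D + C0) + C1 * t)" using D C0 C1_nonneg t by (simp add: add.assoc flip: ennreal_plus)
    finally show ?thesis .
  qed
  then show ?thesis using D C0 by (intro mean_dissipation_le[of 0 "D + C0" 1]) auto
qed

end

lemma tendsto_of_linear_bound:
  fixes f :: "real \<Rightarrow> ennreal"
  assumes "\<And>\<kappa>. 0 < \<kappa> \<Longrightarrow> f \<kappa> \<le> ennreal (\<kappa> * C)"
  shows "(f \<longlongrightarrow> 0) (at_right 0)"
proof (rule tendsto_sandwich[OF always_eventually _ tendsto_const])
  show "\<forall>\<^sub>F \<kappa> in at_right 0. f \<kappa> \<le> ennreal (\<kappa> * C)"
    using eventually_at_right_less[of "0::real"] by eventually_elim (rule assms)
  have "((\<lambda>\<kappa>. \<kappa> * C) \<longlongrightarrow> 0 * C) (at_right 0)" by (intro tendsto_intros)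
  then have "((\<lambda>\<kappa>. ennreal (\<kappa> * C)) \<longlongrightarrow> ennreal (0 * C)) (at_right 0)" by (rule tendsto_ennrealI)
  then show "((\<lambda>\<kappa>. ennreal (\<kappa> * C)) \<longlongrightarrow> 0) (at_right 0)" by simp
qed simp

end

text \<open>In both cases the limit superior is at most \<kappa> times a constant that is fixed
  before the family of solutions is chosen.\<close>

theorem theorem7p2:
  fixes \<theta>0 S :: "real^3 \<Rightarrow> real" and lam \<gamma> :: real
  assumes "Linf_torus \<theta>0" and "Linf_torus S"
    and "zero_mean \<theta>0" and "zero_mean S" and "zero_vertical_mean \<theta>0"
    and "lam > 0" and "0 < \<gamma>" and "\<gamma> \<le> 2"
  shows "(\<forall>\<kappa>\<ge>0. \<exists>\<theta>. mg_solution lam \<gamma> \<kappa> S \<theta>0 \<theta> \<and>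
            (\<forall>\<eta>. mg_solution lam \<gamma> \<kappa> S \<theta>0 \<eta> \<longrightarrow>
               (\<forall>t\<ge>0. AE x in lebesgue_on torus3. \<eta> t x = \<theta> t x)))
       \<and> (\<forall>\<theta>. (\<forall>\<kappa>\<ge>0. mg_solution lam \<gamma> \<kappa> S \<theta>0 (\<theta> \<kappa>)) \<longrightarrow>
            (sobolev_sq (1 - max 1 \<gamma> / 2) \<theta>0 < \<infinity> \<longrightarrow>
               ((\<lambda>\<kappa>. mean_dissipation 0 \<kappa> (\<theta> \<kappa>)) \<longlongrightarrow> 0) (at_right 0))
          \<and> (\<forall>a>0. ((\<lambda>\<kappa>. mean_dissipation a \<kappa> (\<theta> \<kappa>)) \<longlongrightarrow> 0) (at_right 0)))"
proof -
  interpret mg_data \<theta>0 S lam \<gamma>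
    by standard (use assms in \<open>auto intro: Linf_torus_imp_L2\<close>)
  show ?thesis
  proof (intro conjI allI impI)
    show "\<exists>\<theta>. mg_solution lam \<gamma> \<kappa> S \<theta>0 \<theta> \<and>
            (\<forall>\<eta>. mg_solution lam \<gamma> \<kappa> S \<theta>0 \<eta> \<longrightarrow>
               (\<forall>t\<ge>0. AE x in lebesgue_on torus3. \<eta> t x = \<theta> t x))" if "0 \<le> \<kappa>" for \<kappa>
      by (rule existence_uniqueness[OF that])
    fix \<theta> assume sol: "\<forall>\<kappa>\<ge>0. mg_solution lam \<gamma> \<kappa> S \<theta>0 (\<theta> \<kappa>)"
    show "((\<lambda>\<kappa>. mean_dissipation 0 \<kappa> (\<theta> \<kappa>)) \<longlongrightarrow> 0) (at_right 0)"
      if "sobolev_sq (1 - max 1 \<gamma> / 2) \<theta>0 < \<infinity>"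
    proof (rule tendsto_of_linear_bound)
      fix \<kappa> :: real assume "0 < \<kappa>"
      then show "mean_dissipation 0 \<kappa> (\<theta> \<kappa>) \<le> ennreal (\<kappa> * ((2*pi)^3 * (1 + C1)))"
        using sol that by (intro mean_dissipation_initial_time) auto
    qed
    show "((\<lambda>\<kappa>. mean_dissipation a \<kappa> (\<theta> \<kappa>)) \<longlongrightarrow> 0) (at_right 0)" if "0 < a" for a
    proof (rule tendsto_of_linear_bound)
      fix \<kappa> :: real assume "0 < \<kappa>"
      then show "mean_dissipation a \<kappa> (\<theta> \<kappa>) \<le> ennreal (\<kappa> * ((2*pi)^3 * (1 + C1)))"
        using sol that by (intro mean_dissipation_positive_time) auto
    qed
  qed
qed

end
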